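(* Let $k$ be an algebraically closed field of characteristic zero. Let $\rho, s$ be positive integers, let $m,i_1,\dots,i_\rho,j_1,\dots,j_\rho$ be non-negative integers, and put $\mathbf m_1=(m,2^{i_1},1^{j_1})$ and $\mathbf m_k=(2^{i_k},1^{j_k})$ for $k=2,\dots,\rho$. Suppose that $$m\ \ge\ \min\Bigl(s+\sum_{k=1}^\rho i_k,\ 2s\Bigr).$$ Let $Z_1=Z_{K,\mathbf m_1}\subset\mathbb P^2_k$ be the cluster scheme of $(K,\mathbf m_1)$ with $K\in U_s$, let $Z_k=Z_{K_k,\mathbf m_k}$ $(k=2,\dots,\rho)$ be unibranched cluster schemes whose defining clusters $K_2,\dots,K_\rho$ have no satellite points, with $Z_1,\dots,Z_\rho$ supported at pairwise different points of $\mathbb P^2$, and let $Z=Z_1\cup Z_2\cup\dots\cup Z_\rho$. If the position of the points of the $\rho$ clusters $K,K_2,\dots,K_\rho$ is general, and $$3\sum_{k=1}^\rho i_k+\sum_{k=1}^\rho j_k\ \ge\ 2m+3,\qquad 4\sum_{k=1}^\rho j_k\ \ge\ m^2-4m-6,$$ then $Z$ has maximal rank, except in the cases (i) $m=2$, $\sum_k i_k=4$, $j_k=0$ for all $k$; (ii) $m=4$, $\sum_k i_k=6$, $j_k=0$ for all $k$.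
   Context: Maximal rank: a zero-dimensional closed subscheme $Z\subset\mathbb P^2$ has maximal rank in degree $d$ if the restriction map $H^0(\mathbb P^2,\mathcal O_{\mathbb P^2}(d))\to H^0(Z,\mathcal O_Z(d))$ has maximal rank (is injective or surjective); $Z$ has maximal rank if it has maximal rank in every degree $d$. Clusters: let $p$ be a smooth point of a surface $S$ over $k$. A unibranched cluster with origin $p$ is a sequence $K=(p_1=p,p_2,\dots,p_r)$ where, $\sigma_i:S_i\to S_{i-1}$ denoting the blowing-up of $p_i$ ($S_0=S$), each $p_i$ with $i>1$ is a point of the exceptional curve of $\sigma_{i-1}$. Put $S_K=S_r$ and $\pi_K:S_K\to S$ the composition; $E_i\subset S_K$ is the total transform of the exceptional curve of $\sigma_i$. For $j>i$, $p_j$ is proximate to $p_i$ if it lies on the exceptional curve of $\sigma_i$ (then $j=i+1$) or on its strict transform (when $j>i+1$). A point proximate to two points is a satellite; otherwise it is free. A system of multiplicities is a sequence of integers $\mathbf m=(m_1,\dots,m_r)$; the weighted cluster $(K,\mathbf m)$ defines the zero-dimensional scheme $Z_{K,\mathbf m}\subset S$ (unibranched cluster scheme) with ideal sheaf $(\pi_K)_*\mathcal O_{S_K}(-m_1E_1-\dots-m_rE_r)$. The notation $(m,2^i,1^j)$ means $m$, followed by $i$ entries $2$, then $j$ entries $1$, then zeros up to the number of points of the cluster (similarly $(2^i,1^j)$). Clusters are assumed to have at least as many points as there are nonzero entries of the system of multiplicities. $U_s$ denotes the set of unibranched clusters of $r\ge s$ points with origin at a fixed point $p\in\mathbb P^2$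 such that $p_i$ is proximate to $p_{i-1}$ for all $i>1$, and to $p_1$ for $1<i\le s$, with no other proximity relations (so for $s=1,2$ there are no satellites). General position: unibranched clusters of $r$ points of $S$ are parametrized by a smooth irreducible variety $\Gamma_r$ with a smooth family $F_r\to\Gamma_r$ whose fibre over $K$ is $S_K$: $\Gamma_1=S$ and $F_1$ is the blow-up of $S\times S$ along the diagonal (mapping to $\Gamma_1$ by the first projection); $\Gamma_{r+1}\subset F_r$ is the exceptional divisor of that last blow-up, and $F_{r+1}$ is the blow-up of $\Gamma_{r+1}\times_{\Gamma_r}F_r$ along the graph of the inclusion $\Gamma_{r+1}\hookrightarrow F_r$. Fixing the numbers of points, the tuples $(K,K_2,\dots,K_\rho)$ with $K\in U_s$, the $K_k$ ($k\ge2$) without satellites, and pairwise distinct origins form an irreducible variety (locally closed in the product of the corresponding $\Gamma_r$'s); "general position" means that the tuple belongs to a suitable nonempty Zariski-open subset of this variety. *)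

theory Defs
  imports
    "HOL-Library.FuncSet"
    "HOL-Computational_Algebra.Polynomial_Factorial"
begin

text \<open>
  Every surface in sight (the projective plane with coordinates \<open>X\<^sub>0, X\<^sub>1, X\<^sub>2\<close> and its iterated
  blow-ups) has the function field \<open>k(x,y)\<close>, where \<open>x = X\<^sub>1/X\<^sub>0\<close> and \<open>y = X\<^sub>2/X\<^sub>0\<close>. A closed point of
  such a surface is represented by its local ring, a subset of \<open>k(x,y)\<close>; the surfaces being
  separated, a point of a given surface is determined by its local ring.
\<close>

type_synonym 'a ratfun = "'a poly poly fract"
type_synonym 'a point = "'a ratfun set"

definition cnst :: "'a::idom \<Rightarrow> 'a ratfun" where
  "cnst c = to_fract [:[:c:]:]"

text \<open>The inner polynomial variable is \<open>x\<close>, the outer one is \<open>y\<close>.\<close>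

definition xx :: "'a::idom ratfun" where "xx = to_fract [:[:0, 1:]:]"
definition yy :: "'a::idom ratfun" where "yy = to_fract [:0, 1:]"

definition ev2 :: "'a::idom poly poly \<Rightarrow> 'a ratfun \<Rightarrow> 'a ratfun \<Rightarrow> 'a ratfun" where
  "ev2 F X Y = poly (map_poly (\<lambda>p. poly (map_poly cnst p) X) F) Y"

text \<open>The local ring at the origin of the affine plane with coordinate functions \<open>X, Y\<close>.\<close>

definition loc :: "'a::idom ratfun \<times> 'a ratfun \<Rightarrow> 'a point" where
  "loc XY = {ev2 F (fst XY) (snd XY) / ev2 G (fst XY) (snd XY) | F G. coeff (coeff G 0) 0 \<noteq> 0}"

definition maxid :: "'a::idom point \<Rightarrow> 'a ratfun set" where
  "maxid R = {f \<in> R. f = 0 \<or> inverse f \<notin> R}"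

text \<open>\<open>hcoord t\<close> is \<open>X\<^sub>t/X\<^sub>0\<close>, and \<open>aff t\<close> are the affine coordinates on the open set \<open>X\<^sub>t \<noteq> 0\<close>.\<close>

definition hcoord :: "nat \<Rightarrow> 'a::idom ratfun" where
  "hcoord t = (if t = 0 then 1 else if t = 1 then xx else yy)"

definition aff :: "nat \<Rightarrow> 'a::idom ratfun \<times> 'a ratfun" where
  "aff t = (if t = 0 then (xx, yy) else if t = 1 then (1 / xx, yy / xx) else (1 / yy, xx / yy))"

definition plane :: "'a::idom point set" where
  "plane = {loc (fst (aff t) - cnst a, snd (aff t) - cnst b) | t a b. t < 3}"

text \<open>
  A form \<open>F\<close> of degree \<open>d\<close> is represented by \<open>F/X\<^sub>0\<^sup>d = F(1,x,y)\<close>. Accordingly the stalk of \<open>\<O>(d)\<close>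
  at a point of \<open>X\<^sub>t \<noteq> 0\<close> is generated by \<open>(X\<^sub>t/X\<^sub>0)\<^sup>d\<close>; the condition that \<open>X\<^sub>u/X\<^sub>t\<close> be regular for
  \<open>u = 0, 1, 2\<close> says that the point lies in \<open>X\<^sub>t \<noteq> 0\<close>.
\<close>

definition global_sections :: "int \<Rightarrow> 'a::idom ratfun set" where
  "global_sections d =
     {to_fract P | P. \<forall>i j. coeff (coeff P j) i \<noteq> 0 \<longrightarrow> int i + int j \<le> d}"

definition twist_stalk :: "int \<Rightarrow> 'a::idom point \<Rightarrow> 'a ratfun set" where
  "twist_stalk d R =
     {f. \<exists>t<3. (\<forall>u<3. hcoord u / hcoord t \<in> R) \<and> f / (hcoord t powi d) \<in> R}"

text \<open>
  A zero-dimensional closed subscheme of the plane is represented by its ideal sheaf, i.e. by the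
  function sending a point to the stalk of the ideal sheaf there (the whole local ring outside the
  support). Then \<open>H\<^sup>0(Z, \<O>\<^sub>Z(d))\<close> is the product of the stalks \<open>\<O>(d)\<^sub>q / I\<^sub>q \<O>(d)\<^sub>q\<close> over the support.
  Since \<open>\<O>(d)\<^sub>q\<close> is free of rank one, \<open>I\<^sub>q \<O>(d)\<^sub>q\<close> consists of simple products.
\<close>

type_synonym 'a subsch = "'a point \<Rightarrow> 'a ratfun set"

definition supp :: "'a::idom subsch \<Rightarrow> 'a point set" where
  "supp Z = {q \<in> plane. Z q \<noteq> q}"

definition twist_coset :: "int \<Rightarrow> 'a::idom subsch \<Rightarrow> 'a point \<Rightarrow> 'a ratfun \<Rightarrow> 'a ratfun set" where
  "twist_coset d Z q f =
     {g \<in> twist_stalk d q. g - f \<in> {a * b | a b. a \<in> Z q \<and> b \<in> twist_stalk d q}}"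

definition scheme_sections :: "int \<Rightarrow> 'a::idom subsch \<Rightarrow> ('a point \<Rightarrow> 'a ratfun set) set" where
  "scheme_sections d Z = (\<Pi>\<^sub>E q\<in>supp Z. twist_coset d Z q ` twist_stalk d q)"

definition restriction :: "int \<Rightarrow> 'a::idom subsch \<Rightarrow> 'a ratfun \<Rightarrow> ('a point \<Rightarrow> 'a ratfun set)" where
  "restriction d Z f = (\<lambda>q\<in>supp Z. twist_coset d Z q f)"

definition max_rank_in_degree :: "int \<Rightarrow> 'a::idom subsch \<Rightarrow> bool" where
  "max_rank_in_degree d Z \<longleftrightarrow>
     inj_on (restriction d Z) (global_sections d) \<or>
     restriction d Z ` global_sections d = scheme_sections d Z"

definition max_rank :: "'a::idom subsch \<Rightarrow> bool" where
  "max_rank Z \<longleftrightarrow> (\<forall>d. max_rank_in_degree d Z)"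

text \<open>
  The points of the exceptional curve of the blow-up of \<open>R\<close>. The two affine charts of the blow-up
  have coordinates \<open>X, Y/X\<close> (exceptional curve \<open>X = 0\<close>) and \<open>X/Y, Y\<close> (exceptional curve \<open>Y = 0\<close>).
\<close>

definition exc_points :: "'a::idom point \<Rightarrow> 'a point set" where
  "exc_points R = {q. \<exists>X Y c. R = loc (X, Y) \<and>
     (q = loc (X, Y / X - cnst c) \<or> q = loc (X / Y - cnst c, Y))}"

text \<open>Clusters are indexed from \<open>0\<close>: the point \<open>p\<^sub>i\<close> is \<open>K ! (i - 1)\<close>.\<close>

definition clusters :: "nat \<Rightarrow> 'a::idom point list set" where
  "clusters r = {K. length K = r \<and> r \<ge> 1 \<and> K ! 0 \<in> plane \<and>
     (\<forall>i. Suc i < r \<longrightarrow> K ! Suc i \<in> exc_points (K ! i))}"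

text \<open>
  \<open>exc_ring R\<close> is the local ring of the generic point of the exceptional curve of the blow-up of
  \<open>R\<close>, that is, the valuation ring of the order function of the maximal ideal of \<open>R\<close>.
\<close>

primrec maxid_power :: "'a::idom point \<Rightarrow> nat \<Rightarrow> 'a ratfun set" where
  "maxid_power R 0 = R"
| "maxid_power R (Suc n) =
     {\<Sum>i<N. a i * b i | (N::nat) a b. \<forall>i<N. a i \<in> maxid R \<and> b i \<in> maxid_power R n}"

definition exc_ring :: "'a::idom point \<Rightarrow> 'a ratfun set" where
  "exc_ring R = {f / g | f g. f \<in> R \<and> g \<in> R \<and> g \<noteq> 0 \<and>
     (\<forall>n. g \<in> maxid_power R n \<longrightarrow> f \<in> maxid_power R n)}"

text \<open>
  A point of a surface lies on an irreducible curve iff its local ring is contained in the local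
  ring of the generic point of the curve; a curve and its strict transform have the same generic
  point.
\<close>

definition proximate :: "'a::idom point list \<Rightarrow> nat \<Rightarrow> nat \<Rightarrow> bool" where
  "proximate K j i \<longleftrightarrow> i < j \<and> j < length K \<and> K ! j \<subseteq> exc_ring (K ! i)"

definition satellite :: "'a::idom point list \<Rightarrow> nat \<Rightarrow> bool" where
  "satellite K j \<longleftrightarrow> (\<exists>i i'. i \<noteq> i' \<and> proximate K j i \<and> proximate K j i')"

definition satellite_free :: "'a::idom point list \<Rightarrow> bool" where
  "satellite_free K \<longleftrightarrow> (\<forall>j<length K. \<not> satellite K j)"

definition U_clusters :: "'a::idom point \<Rightarrow> nat \<Rightarrow> nat \<Rightarrow> 'a point list set" where
  "U_clusters p r s = {K \<in> clusters r. s \<le> r \<and> K ! 0 = p \<and>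
     (\<forall>j<r. \<forall>i<j. proximate K j i \<longleftrightarrow> j = Suc i \<or> (i = 0 \<and> j < s))}"

text \<open>
  The ideal sheaf of \<open>Z\<^bsub>K,m\<^esub>\<close>. The points of \<open>S\<^sub>K\<close> over the origin are the points of the exceptional
  curve of the blow-up of \<open>K ! i\<close>, other than \<open>K ! Suc i\<close>, for \<open>i < length K\<close>. At such a point \<open>q\<close>,
  the total transform \<open>E\<^sub>j\<close> has local equation \<open>e j\<close>, a generator of \<open>maxid (K ! j) \<cdot> q\<close>, if \<open>j \<le> i\<close>,
  and does not pass through \<open>q\<close> if \<open>j > i\<close>. The stalk of the direct image at the origin consists of
  the rational functions that are sections of \<open>\<O>(-\<Sum> m\<^sub>j E\<^sub>j)\<close> at all these points.
\<close>

definition exc_twist_stalk :: "'a::idom point list \<Rightarrow> int list \<Rightarrow> nat \<Rightarrow> 'a point \<Rightarrow> 'a ratfun set" where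
  "exc_twist_stalk K m i q = {f. \<exists>e.
     (\<forall>j\<le>i. e j \<in> maxid (K ! j) \<and> e j \<noteq> 0 \<and> (\<forall>h\<in>maxid (K ! j). h / e j \<in> q)) \<and>
     f / (\<Prod>j\<le>i. e j powi (m ! j)) \<in> q}"

definition cluster_scheme :: "'a::idom point list \<Rightarrow> int list \<Rightarrow> 'a subsch" where
  "cluster_scheme K m = (\<lambda>R. if R = K ! 0
     then {f. \<forall>i<length K. \<forall>q\<in>exc_points (K ! i).
            (Suc i < length K \<longrightarrow> q \<noteq> K ! Suc i) \<longrightarrow> f \<in> exc_twist_stalk K m i q}
     else R)"

definition pad :: "nat \<Rightarrow> int list \<Rightarrow> int list" where
  "pad r m = m @ replicate (r - length m) 0"

definition union_scheme :: "'i set \<Rightarrow> ('i \<Rightarrow> 'a::idom subsch) \<Rightarrow> 'a subsch" where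
  "union_scheme I Z = (\<lambda>R. \<Inter>k\<in>I. Z k R)"

text \<open>
  The variety \<open>\<Gamma>\<^sub>r\<close> is covered by affine spaces of dimension \<open>r + 1\<close>, one for each choice of an affine
  chart \<open>t\<close> of the plane and, at every blow-up, of one of the two affine charts of the blow-up. If
  \<open>(X,Y)\<close> are the coordinates, centred at \<open>p\<^sub>i\<close>, of a family of clusters, then \<open>\<Gamma>\<^bsub>i+1\<^esub>\<close>, the exceptional
  divisor of the blow-up along \<open>X = Y = 0\<close>, has over this family the two charts with additional
  coordinate \<open>Y/X\<close> respectively \<open>X/Y\<close>.
\<close>

primrec chart_params ::
  "nat \<Rightarrow> (nat \<Rightarrow> bool) \<Rightarrow> (nat \<Rightarrow> 'a::idom) \<Rightarrow> nat \<Rightarrow> 'a ratfun \<times> 'a ratfun" where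
  "chart_params t e c 0 = (fst (aff t) - cnst (c 0), snd (aff t) - cnst (c 1))"
| "chart_params t e c (Suc i) =
     (let (X, Y) = chart_params t e c i
      in if e i then (X, Y / X - cnst (c (i + 2))) else (X / Y - cnst (c (i + 2)), Y))"

definition chart_cluster ::
  "nat \<Rightarrow> nat \<Rightarrow> (nat \<Rightarrow> bool) \<Rightarrow> (nat \<Rightarrow> 'a::idom) \<Rightarrow> 'a point list" where
  "chart_cluster r t e c = map (\<lambda>i. loc (chart_params t e c i)) [0..<r]"

inductive_set polynomial_funs :: "'i set \<Rightarrow> (('i \<Rightarrow> 'a::comm_ring_1) \<Rightarrow> 'a) set" for I where
  const: "(\<lambda>_. a) \<in> polynomial_funs I"
| coord: "i \<in> I \<Longrightarrow> (\<lambda>c. c i) \<in> polynomial_funs I"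
| add: "\<lbrakk>P \<in> polynomial_funs I; Q \<in> polynomial_funs I\<rbrakk> \<Longrightarrow> (\<lambda>c. P c + Q c) \<in> polynomial_funs I"
| mult: "\<lbrakk>P \<in> polynomial_funs I; Q \<in> polynomial_funs I\<rbrakk> \<Longrightarrow> (\<lambda>c. P c * Q c) \<in> polynomial_funs I"

text \<open>
  Zariski-open subsets of a locally closed subset \<open>V\<close> of \<open>\<Gamma>\<^bsub>r 1\<^esub> \<times> \<dots> \<times> \<Gamma>\<^bsub>r \<rho>\<^esub>\<close> (with the subspace
  topology): those whose trace on each affine chart of the product is relatively Zariski open.
\<close>

definition zariski_open_in ::
  "nat \<Rightarrow> (nat \<Rightarrow> nat) \<Rightarrow> (nat \<Rightarrow> 'a::idom point list) set \<Rightarrow> (nat \<Rightarrow> 'a point list) set \<Rightarrow> bool" where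
  "zariski_open_in \<rho> r V W \<longleftrightarrow> W \<subseteq> V \<and>
     (\<forall>t e. (\<forall>k. t k < 3) \<longrightarrow>
       (\<exists>\<P> \<subseteq> polynomial_funs {(k, i). k \<in> {1..\<rho>} \<and> i \<le> r k}. \<forall>c.
         let K = (\<lambda>k\<in>{1..\<rho>}. chart_cluster (r k) (t k) (e k) (\<lambda>i. c (k, i)))
         in K \<in> V \<longrightarrow> (K \<in> W \<longleftrightarrow> (\<exists>P\<in>\<P>. P c \<noteq> 0))))"

definition cluster_tuples ::
  "'a::idom point \<Rightarrow> nat \<Rightarrow> nat \<Rightarrow> (nat \<Rightarrow> nat) \<Rightarrow> (nat \<Rightarrow> 'a point list) set" where
  "cluster_tuples p s \<rho> r = {K \<in> (\<Pi>\<^sub>E k\<in>{1..\<rho>}. clusters (r k)).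
     K 1 \<in> U_clusters p (r 1) s \<and> (\<forall>k\<in>{2..\<rho>}. satellite_free (K k)) \<and>
     inj_on (\<lambda>k. K k ! 0) {1..\<rho>}}"

definition mults :: "nat \<Rightarrow> (nat \<Rightarrow> nat) \<Rightarrow> (nat \<Rightarrow> nat) \<Rightarrow> nat \<Rightarrow> int list" where
  "mults m i j k = (if k = 1 then [int m] else []) @ replicate (i k) 2 @ replicate (j k) 1"

end

theory Submission
  imports Defs
begin

text \<open>
  Put \<open>I = \<Sum> i\<^sub>k\<close> and \<open>J = \<Sum> j\<^sub>k\<close>. Since \<open>h\<^sup>0(\<I>\<^sub>Z(n)) \<le> \<kappa>\<close> is an open condition, maximal rank follows from
  the expected value of \<open>h\<^sup>0\<close> in two consecutive degrees for one tuple of clusters.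

  In the coordinates \<open>u = x, v = y/x\<close> at the origin of \<open>K\<close>, a form of degree \<open>m + D\<close> with multiplicity
  at least \<open>m\<close> there is \<open>u\<^sup>m f\<close> with \<open>f = \<Sum>\<^bsub>e \<le> D\<^esub> u\<^sup>e g\<^sub>e(v)\<close> and \<open>deg g\<^sub>e \<le> m + e\<close>. Put all the clusters on an
  arc \<open>u = \<phi>(v)\<close>, with origins over distinct values \<open>v\<^sub>k\<close> of \<open>v\<close>; that \<open>K\<close> is in \<open>U\<^sub>s\<close> means that \<open>\<phi>\<close> has order
  \<open>max s 2 - 1\<close> at \<open>v\<^sub>1 = 0\<close>. Then \<open>f\<close> restricted to the arc is divisible by \<open>\<Prod> (v - v\<^sub>k)\<^bsup>2i\<^sub>k + j\<^sub>k\<^esup>\<close> and \<open>\<partial>f/\<partial>u\<close> by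
  \<open>\<Prod> (v - v\<^sub>k)\<^bsup>i\<^sub>k\<^esup>\<close>. Letting the \<open>v\<^sub>k\<close> collide, it suffices to find \<open>\<phi>\<close> for which divisibility by
  \<open>v\<^bsup>2I + J\<^esup>\<close> and \<open>v\<^sup>I\<close> forces \<open>f = 0\<close>, or leaves a space of solutions of the expected dimension; the
  arcs for the two degrees may differ, being members of the pencil they span. This is
  done by induction on \<open>D\<close>: for a suitable order of \<open>\<phi>\<close> the conditions force \<open>g\<^sub>0 = 0\<close>, and \<open>f\<close> is replaced by
  \<open>f/u\<close>. In the exceptional cases the excess is due to a double curve.
\<close>

section \<open>Linear systems depending on parameters\<close>

text \<open>The order \<open>c\<close> of the arc is dictated by a count. Passing from
  \<open>f\<close> to \<open>f/u\<close> lowers both orders of vanishing by \<open>c\<close> and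
  must cost exactly the \<open>m + 1\<close> coefficients of \<open>g_0\<close>, so
  \<open>2c = m + 1\<close>. Then the derivative condition gives \<open>v^c | f/u\<close> on the
  arc, hence \<open>v^(2c) | g_0\<close>, while \<open>deg g_0 <= m\<close>. For even
  \<open>m\<close> no \<open>c\<close> fits: one coefficient of \<open>g_0\<close> survives, and the
  arc of order \<open>m/2\<close> has to degenerate to one of order \<open>m/2 + 1\<close>. This
  parity obstacle is what singles out \<open>I = m + 2\<close>, \<open>J = 0\<close> in degree
  \<open>m + 2\<close>. The bound \<open>3I + J >= 2m + 3\<close> makes injectivity start in degree
  \<open>m + 1\<close>. The bound \<open>m >= min (s + I) (2s)\<close> makes the orders wanted by
  the induction reach the order imposed by \<open>U_s\<close>. The quadratic bound on
  \<open>J\<close> settles degree \<open>m + 1\<close> and leaves only \<open>m = 2, 4\<close> as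
  exceptions. Openness is proved by elimination over a ring of functions: a trivial kernel at one
  parameter persists wherever one of certain functions is nonzero. In one variable this means almost
  everywhere, which justifies all the degenerations.\<close>

lemma underdetermined_system:
  fixes L :: "'s \<Rightarrow> 'b \<Rightarrow> 'a::field"
  assumes "finite A" "finite B" "card A < card B"
  shows "\<exists>x. (\<exists>b\<in>B. x b \<noteq> 0) \<and> (\<forall>\<alpha>\<in>A. (\<Sum>b\<in>B. L \<alpha> b * x b) = 0)"
  using assms
proof (induction A arbitrary: B L rule: finite_induct)
  case empty
  then obtain b where "b \<in> B" by fastforce
  then show ?case by (auto intro!: exI[of _ "\<lambda>_. 1"])
next
  case (insert \<alpha>0 A)
  show ?case
  proof (cases "\<forall>b\<in>B. L \<alpha>0 b = 0")
    case True
    have "card A < card B" using insert.hyps insert.prems by simp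
    from insert.IH[OF insert.prems(1) this, of L] obtain x where
      x: "\<exists>b\<in>B. x b \<noteq> 0" "\<forall>\<alpha>\<in>A. (\<Sum>b\<in>B. L \<alpha> b * x b) = 0" by blast
    moreover have "(\<Sum>b\<in>B. L \<alpha>0 b * x b) = 0" using True by simp
    ultimately show ?thesis by (intro exI[of _ x]) blast
  next
    case False
    then obtain b0 where b0: "b0 \<in> B" "L \<alpha>0 b0 \<noteq> 0" by blast
    \<comment> \<open>Elimination of the unknown \<open>b0\<close> with the equation
      \<open>\<alpha>0\<close> as pivot, by cross-multiplication.\<close>
    define L' where "L' \<alpha> b = L \<alpha> b * L \<alpha>0 b0 - L \<alpha> b0 * L \<alpha>0 b" for \<alpha> b
    define B' where "B' = B - {b0}"
    have B: "B = insert b0 B'" "b0 \<notin> B'" "finite B'" using b0 insert.prems by (auto simp: B'_def)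
    have "card A < card B'" using insert B by simp
    from insert.IH[OF B(3) this, of L'] obtain x where
      x: "\<exists>b\<in>B'. x b \<noteq> 0" "\<And>\<alpha>. \<alpha> \<in> A \<Longrightarrow> (\<Sum>b\<in>B'. L' \<alpha> b * x b) = 0" by blast
    define x0 where "x0 = - (\<Sum>b\<in>B'. L \<alpha>0 b * x b) / L \<alpha>0 b0"
    define y where "y = x(b0 := x0)"
    have sy: "(\<Sum>b\<in>B. L \<alpha> b * y b) = L \<alpha> b0 * x0 + (\<Sum>b\<in>B'. L \<alpha> b * x b)" for \<alpha>
    proof -
      have "(\<Sum>b\<in>B'. L \<alpha> b * y b) = (\<Sum>b\<in>B'. L \<alpha> b * x b)"
        by (rule sum.cong) (use B in \<open>auto simp: y_def\<close>)
      then show ?thesis using B by (simp add: y_def)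
    qed
    have "(\<Sum>b\<in>B. L \<alpha>0 b * y b) = 0" using b0 by (simp add: sy x0_def)
    moreover have "(\<Sum>b\<in>B. L \<alpha> b * y b) = 0" if "\<alpha> \<in> A" for \<alpha>
    proof -
      have "0 = (\<Sum>b\<in>B'. L \<alpha>0 b0 * (L \<alpha> b * x b) - L \<alpha> b0 * (L \<alpha>0 b * x b))"
        using x(2)[OF that] by (simp add: L'_def algebra_simps)
      also have "\<dots> = L \<alpha>0 b0 * (\<Sum>b\<in>B'. L \<alpha> b * x b) - L \<alpha> b0 * (\<Sum>b\<in>B'. L \<alpha>0 b * x b)"
        by (simp add: sum_subtractf sum_distrib_left)
      also have "\<dots> = L \<alpha>0 b0 * (\<Sum>b\<in>B. L \<alpha> b * y b)"
        unfolding sy x0_def using b0(2) by (simp add: field_simps)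
      finally show ?thesis using b0 by simp
    qed
    moreover have "\<exists>b\<in>B. y b \<noteq> 0" using x(1) B by (auto simp: y_def)
    ultimately show ?thesis by blast
  qed
qed

text \<open>The right-hand side becomes the column of an additional unknown \<open>None\<close>,
  which makes the homogeneous system underdetermined. Injectivity forbids \<open>x None = 0\<close>,
  and dividing by \<open>x None\<close> solves the original system.\<close>

lemma square_system_surj:
  fixes L :: "'s \<Rightarrow> 'b \<Rightarrow> 'a::field"
  assumes "finite A" "finite B" "card A \<le> card B"
    and inj: "\<And>x. (\<And>\<alpha>. \<alpha> \<in> A \<Longrightarrow> (\<Sum>b\<in>B. L \<alpha> b * x b) = 0) \<Longrightarrow> \<forall>b\<in>B. x b = 0"
  shows "\<exists>x. \<forall>\<alpha>\<in>A. (\<Sum>b\<in>B. L \<alpha> b * x b) = z \<alpha>"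
proof -
  define B' where "B' = insert None (Some ` B)"
  have [simp]: "finite B'" "card B' = Suc (card B)" using assms(2) by (simp_all add: B'_def card_image)
  define L' where "L' \<alpha> b = (case b of None \<Rightarrow> - z \<alpha> | Some b \<Rightarrow> L \<alpha> b)" for \<alpha> b
  have s: "(\<Sum>b\<in>B'. L' \<alpha> b * x b) = (\<Sum>b\<in>B. L \<alpha> b * x (Some b)) - z \<alpha> * x None" for \<alpha> x
    using assms(2) by (simp add: B'_def sum.reindex L'_def)
  obtain x where x: "\<exists>b\<in>B'. x b \<noteq> 0" "\<And>\<alpha>. \<alpha> \<in> A \<Longrightarrow> (\<Sum>b\<in>B'. L' \<alpha> b * x b) = 0"
    using underdetermined_system[of A B' L'] assms by auto
  have x0: "x None \<noteq> 0"
  proof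
    assume "x None = 0"
    then have "\<forall>b\<in>B. x (Some b) = 0" using x(2) s by (intro inj) simp
    then show False using x(1) \<open>x None = 0\<close> by (auto simp: B'_def)
  qed
  have "(\<Sum>b\<in>B. L \<alpha> b * (x (Some b) / x None)) = z \<alpha>" if "\<alpha> \<in> A" for \<alpha>
  proof -
    have "(\<Sum>b\<in>B. L \<alpha> b * (x (Some b) / x None)) = (\<Sum>b\<in>B. L \<alpha> b * x (Some b)) / x None"
      by (simp add: sum_divide_distrib)
    then show ?thesis using x(2)[OF that] s x0 by simp
  qed
  then show ?thesis by (intro exI[of _ "\<lambda>b. x (Some b) / x None"]) blast
qed

text \<open>The parameter is the last argument of \<open>L\<close>, so that each coefficient
  \<open>L \<alpha> b\<close> is itself a function of the parameter and can be required to lie in a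
  ring of functions.\<close>

definition inj_system :: "('s \<Rightarrow> 'b \<Rightarrow> 't \<Rightarrow> 'a::field) \<Rightarrow> 's set \<Rightarrow> 'b set \<Rightarrow> 't \<Rightarrow> bool" where
  "inj_system L A B t \<longleftrightarrow>
     (\<forall>x. (\<forall>\<alpha>\<in>A. (\<Sum>b\<in>B. L \<alpha> b t * x b) = 0) \<longrightarrow> (\<forall>b\<in>B. x b = 0))"

text \<open>One step of elimination without division: the coefficients of the smaller system stay in
  every ring of functions that contains the old ones. Iterated, this takes the place of
  minors.\<close>

lemma inj_system_insert:
  assumes "finite B" "b0 \<notin> B"
  shows "inj_system L A (insert b0 B) t \<longleftrightarrow> (\<exists>\<alpha>0\<in>A. L \<alpha>0 b0 t \<noteq> 0 \<and>
    inj_system (\<lambda>\<alpha> b t. L \<alpha> b t * L \<alpha>0 b0 t - L \<alpha> b0 t * L \<alpha>0 b t) A B t)" (is "?l \<longleftrightarrow> ?r")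
proof
  assume ?r
  then obtain \<alpha>0 where a: "\<alpha>0 \<in> A" "L \<alpha>0 b0 t \<noteq> 0"
    and i: "inj_system (\<lambda>\<alpha> b t. L \<alpha> b t * L \<alpha>0 b0 t - L \<alpha> b0 t * L \<alpha>0 b t) A B t" by blast
  show ?l unfolding inj_system_def
  proof (intro allI impI)
    fix x assume x: "\<forall>\<alpha>\<in>A. (\<Sum>b\<in>insert b0 B. L \<alpha> b t * x b) = 0"
    then have e: "(\<Sum>b\<in>B. L \<alpha> b t * x b) = - L \<alpha> b0 t * x b0" if "\<alpha> \<in> A" for \<alpha>
      using that assms by (simp add: eq_neg_iff_add_eq_0 add.commute)
    have "(\<Sum>b\<in>B. (L \<alpha> b t * L \<alpha>0 b0 t - L \<alpha> b0 t * L \<alpha>0 b t) * x b) = 0" if "\<alpha> \<in> A" for \<alpha>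
    proof -
      have "(\<Sum>b\<in>B. (L \<alpha> b t * L \<alpha>0 b0 t - L \<alpha> b0 t * L \<alpha>0 b t) * x b) =
        L \<alpha>0 b0 t * (\<Sum>b\<in>B. L \<alpha> b t * x b) - L \<alpha> b0 t * (\<Sum>b\<in>B. L \<alpha>0 b t * x b)"
        by (simp add: sum_subtractf sum_distrib_left algebra_simps)
      then show ?thesis using e[OF that] e[OF a(1)] by simp
    qed
    then have *: "\<forall>b\<in>B. x b = 0" using i unfolding inj_system_def by blast
    then have "L \<alpha>0 b0 t * x b0 = 0" using e[OF a(1)] by simp
    with a * show "\<forall>b\<in>insert b0 B. x b = 0" by simp
  qed
next
  assume l: ?l
  have "\<exists>\<alpha>0\<in>A. L \<alpha>0 b0 t \<noteq> 0"
  proof (rule ccontr)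
    assume *: "\<not> ?thesis"
    have "(\<Sum>b\<in>insert b0 B. L \<alpha> b t * (if b = b0 then 1 else 0)) = 0" if "\<alpha> \<in> A" for \<alpha>
      using that * assms by (auto intro!: sum.neutral)
    with l[unfolded inj_system_def, rule_format, of "\<lambda>b. if b = b0 then 1 else 0" b0]
    show False by simp
  qed
  then obtain \<alpha>0 where a: "\<alpha>0 \<in> A" "L \<alpha>0 b0 t \<noteq> 0" by blast
  have "inj_system (\<lambda>\<alpha> b t. L \<alpha> b t * L \<alpha>0 b0 t - L \<alpha> b0 t * L \<alpha>0 b t) A B t"
    unfolding inj_system_def
  proof (intro allI impI)
    fix x assume x: "\<forall>\<alpha>\<in>A. (\<Sum>b\<in>B. (L \<alpha> b t * L \<alpha>0 b0 t - L \<alpha> b0 t * L \<alpha>0 b t) * x b) = 0"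
    define x0 where "x0 = - (\<Sum>b\<in>B. L \<alpha>0 b t * x b) / L \<alpha>0 b0 t"
    have "(\<Sum>b\<in>insert b0 B. L \<alpha> b t * (x(b0 := x0)) b) = 0" if "\<alpha> \<in> A" for \<alpha>
    proof -
      have "(\<Sum>b\<in>B. L \<alpha> b t * (x(b0 := x0)) b) = (\<Sum>b\<in>B. L \<alpha> b t * x b)"
        by (rule sum.cong) (use assms in auto)
      then have "L \<alpha>0 b0 t * (\<Sum>b\<in>insert b0 B. L \<alpha> b t * (x(b0 := x0)) b) =
         L \<alpha>0 b0 t * (\<Sum>b\<in>B. L \<alpha> b t * x b) - L \<alpha> b0 t * (\<Sum>b\<in>B. L \<alpha>0 b t * x b)"
        using a assms by (simp add: x0_def field_simps)
      also have "\<dots> = (\<Sum>b\<in>B. (L \<alpha> b t * L \<alpha>0 b0 t - L \<alpha> b0 t * L \<alpha>0 b t) * x b)"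
        by (simp add: sum_subtractf sum_distrib_left algebra_simps)
      finally show ?thesis using x that a by simp
    qed
    then have "\<forall>b\<in>insert b0 B. (x(b0 := x0)) b = 0" using l unfolding inj_system_def by blast
    then show "\<forall>b\<in>B. x b = 0" using assms by (metis fun_upd_other insertI2)
  qed
  with a show ?r by blast
qed

text \<open>Two instances matter: polynomials in one variable, where a nonzero element has finitely
  many zeros, and polynomial functions of the parameters of the clusters, which define the Zariski
  topology.\<close>

locale function_ring =
  fixes R :: "('t \<Rightarrow> 'a::field) set"
  assumes const: "\<And>a. (\<lambda>_. a) \<in> R"
    and add: "\<And>f g. f \<in> R \<Longrightarrow> g \<in> R \<Longrightarrow> (\<lambda>t. f t + g t) \<in> R"
    and mult: "\<And>f g. f \<in> R \<Longrightarrow> g \<in> R \<Longrightarrow> (\<lambda>t. f t * g t) \<in> R"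
begin

lemma diff: "f \<in> R \<Longrightarrow> g \<in> R \<Longrightarrow> (\<lambda>t. f t - g t) \<in> R"
  using add[of f "\<lambda>t. (-1) * g t"] mult[OF const[of "-1"], of g] by simp

lemma sum: "(\<And>i. i \<in> S \<Longrightarrow> f i \<in> R) \<Longrightarrow> (\<lambda>t. \<Sum>i\<in>S. f i t) \<in> R"
  by (induction S rule: infinite_finite_induct) (auto intro: const add)

text \<open>Semicontinuity of the rank, by induction on the unknowns: every choice of a pivot
  equation contributes the products of the pivot with the functions obtained for the eliminated
  system.\<close>

lemma inj_system_open:
  assumes "finite B" "\<And>\<alpha> b. \<alpha> \<in> A \<Longrightarrow> b \<in> B \<Longrightarrow> L \<alpha> b \<in> R"
  shows "\<exists>\<P>\<subseteq>R. \<forall>t. inj_system L A B t \<longleftrightarrow> (\<exists>P\<in>\<P>. P t \<noteq> 0)"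
  using assms
proof (induction B arbitrary: L rule: finite_induct)
  case empty
  then show ?case by (intro exI[of _ "{\<lambda>_. 1}"]) (auto simp: inj_system_def const)
next
  case (insert b0 B)
  define L' where "L' \<alpha>0 \<alpha> b t = L \<alpha> b t * L \<alpha>0 b0 t - L \<alpha> b0 t * L \<alpha>0 b t" for \<alpha>0 \<alpha> b t
  have "\<exists>\<P>\<subseteq>R. \<forall>t. inj_system (L' \<alpha>0) A B t \<longleftrightarrow> (\<exists>P\<in>\<P>. P t \<noteq> 0)" if "\<alpha>0 \<in> A" for \<alpha>0
  proof (rule insert.IH)
    fix \<alpha> b assume "\<alpha> \<in> A" "b \<in> B"
    then have "L \<alpha> b \<in> R" "L \<alpha> b0 \<in> R" "L \<alpha>0 b \<in> R" "L \<alpha>0 b0 \<in> R" using insert.prems that by auto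
    then show "L' \<alpha>0 \<alpha> b \<in> R" unfolding L'_def by (intro diff mult)
  qed
  then obtain \<P> where P: "\<And>\<alpha>0. \<alpha>0 \<in> A \<Longrightarrow> \<P> \<alpha>0 \<subseteq> R"
    "\<And>\<alpha>0 t. \<alpha>0 \<in> A \<Longrightarrow> inj_system (L' \<alpha>0) A B t \<longleftrightarrow> (\<exists>P\<in>\<P> \<alpha>0. P t \<noteq> 0)" by metis
  define \<Q> where "\<Q> = {\<lambda>t. L \<alpha>0 b0 t * P t | \<alpha>0 P. \<alpha>0 \<in> A \<and> P \<in> \<P> \<alpha>0}"
  have "\<Q> \<subseteq> R" using P(1) insert.prems by (auto simp: \<Q>_def intro!: mult)
  moreover have "inj_system L A (insert b0 B) t \<longleftrightarrow> (\<exists>P\<in>\<Q>. P t \<noteq> 0)" for t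
  proof -
    have "inj_system L A (insert b0 B) t \<longleftrightarrow> (\<exists>\<alpha>0\<in>A. L \<alpha>0 b0 t \<noteq> 0 \<and> inj_system (L' \<alpha>0) A B t)"
      unfolding L'_def by (rule inj_system_insert) (use insert.hyps in auto)
    also have "\<dots> \<longleftrightarrow> (\<exists>\<alpha>0\<in>A. L \<alpha>0 b0 t \<noteq> 0 \<and> (\<exists>P\<in>\<P> \<alpha>0. P t \<noteq> 0))" using P(2) by blast
    also have "\<dots> \<longleftrightarrow> (\<exists>P\<in>\<Q>. P t \<noteq> 0)" unfolding \<Q>_def by (auto, (metis mult_eq_0_iff)+)
    finally show ?thesis .
  qed
  ultimately show ?case by blast
qed

end

lemma function_ring_poly: "function_ring (range (poly :: 'a::field poly \<Rightarrow> _))"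
proof
  show "(\<lambda>_. a) \<in> range poly" for a :: 'a by (rule image_eqI[of _ _ "[:a:]"]) auto
  show "(\<lambda>t. f t + g t) \<in> range poly" "(\<lambda>t. f t * g t) \<in> range poly"
    if "f \<in> range poly" "g \<in> range poly" for f g :: "'a \<Rightarrow> 'a"
  proof -
    from that obtain p q where "f = poly p" "g = poly q" by auto
    then show "(\<lambda>t. f t + g t) \<in> range poly" "(\<lambda>t. f t * g t) \<in> range poly"
      by (simp_all add: image_iff fun_eq_iff) (metis poly_add, metis poly_mult)
  qed
qed

lemma function_ring_polynomial_funs:
  "function_ring (polynomial_funs I :: (('i \<Rightarrow> 'a::field) \<Rightarrow> 'a) set)"
  by standard (auto intro: polynomial_funs.intros)

text \<open>Carries a property of one degenerate parameter over to almost all parameters. Several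
  such properties then hold at a common parameter, the field being infinite where this is
  used.\<close>

lemma inj_system_cofinite:
  fixes L :: "'s \<Rightarrow> 'b \<Rightarrow> 'a \<Rightarrow> 'a::field"
  assumes "finite B" "\<And>\<alpha> b. \<alpha> \<in> A \<Longrightarrow> b \<in> B \<Longrightarrow> L \<alpha> b \<in> range poly" "inj_system L A B t0"
  shows "finite {t. \<not> inj_system L A B t}"
proof -
  interpret function_ring "range poly :: ('a \<Rightarrow> 'a) set" by (rule function_ring_poly)
  have "\<exists>\<P>\<subseteq>range poly. \<forall>t. inj_system L A B t \<longleftrightarrow> (\<exists>P\<in>\<P>. P t \<noteq> 0)"
    by (rule inj_system_open) (use assms in auto)
  then obtain \<P> where
    P: "\<P> \<subseteq> range poly" "\<And>t. inj_system L A B t \<longleftrightarrow> (\<exists>P\<in>\<P>. P t \<noteq> 0)" by blast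
  then obtain f where f: "f \<in> \<P>" "f t0 \<noteq> 0" using assms(3) by blast
  then obtain p where "f = poly p" using P(1) by blast
  with f have p: "poly p \<in> \<P>" "poly p t0 \<noteq> 0" by simp_all
  then have "finite {t. poly p t = 0}" by (intro poly_roots_finite) auto
  moreover have "{t. \<not> inj_system L A B t} \<subseteq> {t. poly p t = 0}" using P p by blast
  ultimately show ?thesis by (rule finite_subset[rotated])
qed

section \<open>Families of polynomials and linear systems for them\<close>

context function_ring
begin

definition poly_family :: "('t \<Rightarrow> 'a poly) \<Rightarrow> bool" where
  "poly_family F \<longleftrightarrow> (\<forall>n. (\<lambda>t. coeff (F t) n) \<in> R)"

lemma poly_family_const: "poly_family (\<lambda>_. p)"
  by (simp add: poly_family_def const)

lemma poly_family_add: "poly_family F \<Longrightarrow> poly_family G \<Longrightarrow> poly_family (\<lambda>t. F t + G t)"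
  by (simp add: poly_family_def add)

lemma poly_family_diff: "poly_family F \<Longrightarrow> poly_family G \<Longrightarrow> poly_family (\<lambda>t. F t - G t)"
  by (simp add: poly_family_def diff)

lemma poly_family_mult: "poly_family F \<Longrightarrow> poly_family G \<Longrightarrow> poly_family (\<lambda>t. F t * G t)"
  by (simp add: poly_family_def coeff_mult sum mult)

lemma poly_family_smult: "f \<in> R \<Longrightarrow> poly_family G \<Longrightarrow> poly_family (\<lambda>t. smult (f t) (G t))"
  by (simp add: poly_family_def mult)

lemma poly_family_prod:
  "(\<And>i. i \<in> S \<Longrightarrow> poly_family (F i)) \<Longrightarrow> poly_family (\<lambda>t. \<Prod>i\<in>S. F i t)"
  by (induction S rule: infinite_finite_induct) (auto intro: poly_family_const poly_family_mult)

lemma poly_family_power: "poly_family F \<Longrightarrow> poly_family (\<lambda>t. F t ^ n)"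
  by (induction n) (auto intro: poly_family_const poly_family_mult)

lemma poly_family_pCons: "f \<in> R \<Longrightarrow> poly_family F \<Longrightarrow> poly_family (\<lambda>t. pCons (f t) (F t))"
  unfolding poly_family_def
proof
  fix n assume "f \<in> R" "\<forall>n. (\<lambda>t. coeff (F t) n) \<in> R"
  then show "(\<lambda>t. coeff (pCons (f t) (F t)) n) \<in> R" by (cases n) auto
qed

end

lemma id_range_poly: "(\<lambda>t. t) \<in> range (poly :: 'a::field poly \<Rightarrow> _)"
  by (rule image_eqI[of _ _ "[:0,1:]"]) auto

text \<open>The unknowns are whole polynomials of bounded degree, so that a divisibility can be
  expressed by taking the quotient as one more unknown. In a pair \<open>(k, n)\<close> of
  \<open>T\<close>, \<open>k\<close> selects an equation between polynomials and \<open>n\<close>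
  one of its coefficients; \<open>T\<close> may be infinite.\<close>

definition poly_system ::
  "('k \<Rightarrow> 'e \<Rightarrow> 'a \<Rightarrow> 'a::field poly) \<Rightarrow> 'e set \<Rightarrow> ('e \<Rightarrow> nat) \<Rightarrow> ('k \<times> nat) set \<Rightarrow> 'a \<Rightarrow> bool" where
  "poly_system W E bd T t \<longleftrightarrow>
     (\<forall>p. (\<forall>e\<in>E. degree (p e) \<le> bd e) \<and> (\<forall>(k, n)\<in>T. coeff (\<Sum>e\<in>E. W k e t * p e) n = 0) \<longrightarrow>
       (\<forall>e\<in>E. p e = 0))"

lemma poly_system_cofinite:
  fixes W :: "'k \<Rightarrow> 'e \<Rightarrow> 'a \<Rightarrow> 'a::field poly"
  assumes "finite E" and W: "\<And>k e. function_ring.poly_family (range poly) (W k e)"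
    and t0: "poly_system W E bd T t0"
  shows "finite {t. \<not> poly_system W E bd T t}"
proof -
  interpret function_ring "range poly :: ('a \<Rightarrow> 'a) set" by (rule function_ring_poly)
  \<comment> \<open>One scalar unknown \<open>(e, i)\<close> for the coefficient of degree
    \<open>i\<close> in the unknown polynomial with index \<open>e\<close>.\<close>
  define B where "B = (SIGMA e:E. {..bd e})"
  define L where "L kn b t = coeff (W (fst kn) (fst b) t * monom 1 (snd b)) (snd kn)" for kn b t
  have fB: "finite B" using assms(1) by (auto simp: B_def)
  define P where "P x e = (\<Sum>i\<le>bd e. monom (x (e, i)) i)" for x :: "'e \<times> nat \<Rightarrow> 'a" and e
  have s: "(\<Sum>b\<in>B. L (k, n) b t * x b) = coeff (\<Sum>e\<in>E. W k e t * P x e) n" for k n t x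
  proof -
    have "(\<Sum>b\<in>B. L (k, n) b t * x b) = (\<Sum>e\<in>E. \<Sum>i\<le>bd e. L (k, n) (e, i) t * x (e, i))"
      unfolding B_def using assms(1) by (subst sum.Sigma) auto
    also have "\<dots> = (\<Sum>e\<in>E. \<Sum>i\<le>bd e. coeff (W k e t * monom (x (e, i)) i) n)"
    proof (intro sum.cong refl)
      fix e i
      have "monom (x (e, i)) i = smult (x (e, i)) (monom 1 i)" by (simp add: smult_monom)
      then show "L (k, n) (e, i) t * x (e, i) = coeff (W k e t * monom (x (e, i)) i) n"
        by (simp add: L_def mult.commute)
    qed
    also have "\<dots> = coeff (\<Sum>e\<in>E. W k e t * P x e) n"
      by (simp add: P_def sum_distrib_left coeff_sum)
    finally show ?thesis .
  qed
  have P: "degree (P x e) \<le> bd e" "coeff (P x e) i = (if i \<le> bd e then x (e, i) else 0)" for x e i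
  proof -
    show c: "coeff (P x e) i = (if i \<le> bd e then x (e, i) else 0)" for i
      by (simp add: P_def coeff_sum)
    show "degree (P x e) \<le> bd e" by (rule degree_le) (simp add: c)
  qed
  have "inj_system L T B t \<longleftrightarrow> poly_system W E bd T t" for t
  proof
    assume i: "inj_system L T B t"
    show "poly_system W E bd T t" unfolding poly_system_def
    proof (intro allI impI)
      fix p assume p: "(\<forall>e\<in>E. degree (p e) \<le> bd e) \<and> (\<forall>(k, n)\<in>T. coeff (\<Sum>e\<in>E. W k e t * p e) n = 0)"
      define x where "x b = coeff (p (fst b)) (snd b)" for b
      have Pp: "P x e = p e" if "e \<in> E" for e
        using p that by (intro poly_eqI) (auto simp: P x_def coeff_eq_0)
      have "(\<Sum>e\<in>E. W k e t * P x e) = (\<Sum>e\<in>E. W k e t * p e)" for k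
        by (rule sum.cong) (simp_all add: Pp)
      then have "\<forall>kn\<in>T. (\<Sum>b\<in>B. L kn b t * x b) = 0" using p s by auto
      with i have "\<forall>b\<in>B. x b = 0" unfolding inj_system_def by blast
      then have "P x e = 0" if "e \<in> E" for e
        using that by (intro poly_eqI) (auto simp: P B_def)
      then show "\<forall>e\<in>E. p e = 0" using Pp by simp
    qed
  next
    assume i: "poly_system W E bd T t"
    show "inj_system L T B t" unfolding inj_system_def
    proof (intro allI impI)
      fix x assume "\<forall>kn\<in>T. (\<Sum>b\<in>B. L kn b t * x b) = 0"
      then have "\<forall>(k, n)\<in>T. coeff (\<Sum>e\<in>E. W k e t * P x e) n = 0" using s by auto
      then have *: "\<forall>e\<in>E. P x e = 0" using i P(1) unfolding poly_system_def by blast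
      show "\<forall>b\<in>B. x b = 0"
      proof
        fix b assume "b \<in> B"
        then obtain e i where "b = (e, i)" "e \<in> E" "i \<le> bd e" by (auto simp: B_def)
        with * P(2)[of x e i] show "x b = 0" by simp
      qed
    qed
  qed
  moreover have "finite {t. \<not> inj_system L T B t}"
  proof (rule inj_system_cofinite[OF fB])
    show "L \<alpha> b \<in> range poly" for \<alpha> b
      using poly_family_mult[OF W poly_family_const, of "fst \<alpha>" "fst b" "monom 1 (snd b)"]
      unfolding L_def[abs_def] poly_family_def by blast
    show "inj_system L T B t0" using t0 calculation by blast
  qed
  ultimately show ?thesis by simp
qed

section \<open>Restriction to an arc\<close>

text \<open>For \<open>f = \<Sum> u\<^sup>e g\<^sub>e(v)\<close>, the restrictions of \<open>f\<close> and of \<open>\<partial>f/\<partial>u\<close> to the arc \<open>u = \<phi>(v)\<close>.\<close>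

definition arc_val :: "nat \<Rightarrow> 'a::field poly \<Rightarrow> (nat \<Rightarrow> 'a poly) \<Rightarrow> 'a poly" where
  "arc_val D \<phi> g = (\<Sum>e\<le>D. \<phi> ^ e * g e)"

definition arc_deriv :: "nat \<Rightarrow> 'a::field poly \<Rightarrow> (nat \<Rightarrow> 'a poly) \<Rightarrow> 'a poly" where
  "arc_deriv D \<phi> g = (\<Sum>e\<le>D. of_nat e * \<phi> ^ (e - 1) * g e)"

text \<open>This is \<open>f = g_0 + u h\<close> with \<open>h = f/u\<close>, restricted to the arc;
  the induction on \<open>D\<close> passes from \<open>f\<close> to \<open>h\<close>.\<close>

lemma arc_val_Suc: "arc_val (Suc D) \<phi> g = g 0 + \<phi> * arc_val D \<phi> (\<lambda>e. g (Suc e))"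
  by (simp add: arc_val_def sum.atMost_Suc_shift sum_distrib_left mult.assoc del: sum.atMost_Suc)

text \<open>Product rule for \<open>u h\<close>. As \<open>\<phi>\<close> vanishes at
  \<open>v = 0\<close>, a condition on the derivative of \<open>f\<close> becomes a condition on
  \<open>h\<close> itself up to the order of \<open>\<phi>\<close>.\<close>

lemma arc_deriv_Suc:
  "arc_deriv (Suc D) \<phi> g = arc_val D \<phi> (\<lambda>e. g (Suc e)) + \<phi> * arc_deriv D \<phi> (\<lambda>e. g (Suc e))"
proof -
  have "of_nat (Suc e) * \<phi> ^ e * g (Suc e) =
      \<phi> ^ e * g (Suc e) + \<phi> * (of_nat e * \<phi> ^ (e - 1) * g (Suc e))" for e
    by (cases e) (simp_all add: algebra_simps)
  then show ?thesis
    by (simp add: arc_val_def arc_deriv_def sum.atMost_Suc_shift sum_distrib_left sum.distrib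
        del: sum.atMost_Suc of_nat_Suc)
qed

text \<open>
  The functions \<open>f\<close> as above with \<open>deg g\<^sub>e \<le> m + e\<close> for \<open>e \<le> D\<close> are the quotients by \<open>u\<^sup>m\<close> of the
  polynomials of degree \<open>\<le> m + D\<close> with multiplicity \<open>\<ge> m\<close> at the origin of \<open>(x,y) = (u,uv)\<close>.
\<close>

definition determined ::
  "nat \<Rightarrow> nat \<Rightarrow> 'a::field poly \<Rightarrow> 'a poly \<Rightarrow> 'a poly \<Rightarrow> nat set \<Rightarrow> bool" where
  "determined m D \<phi> M M' N \<longleftrightarrow> (\<forall>g. (\<forall>e\<le>D. degree (g e) \<le> m + e) \<and>
     M dvd arc_val D \<phi> g \<and> M' dvd arc_deriv D \<phi> g \<and> (\<forall>n\<in>N. coeff (arc_val D \<phi> g) n = 0) \<longrightarrow>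
     (\<forall>e\<le>D. g e = 0))"

text \<open>Bounds the quotients by the two divisors in \<open>determined\<close>, so that these can
  serve as unknowns of bounded degree.\<close>

lemma degree_arc_val_le:
  assumes "\<forall>e\<le>D. degree (g e) \<le> m + e"
  shows "degree (arc_val D \<phi> g) \<le> D * degree \<phi> + m + D"
    and "degree (arc_deriv D \<phi> g) \<le> D * degree \<phi> + m + D"
proof -
  have *: "degree (\<phi> ^ k * g e) \<le> D * degree \<phi> + m + D" if "e \<le> D" "k \<le> D" for e k
  proof -
    have "degree (\<phi> ^ k * g e) \<le> degree (\<phi> ^ k) + degree (g e)" by (rule degree_mult_le)
    also have "degree (\<phi> ^ k) \<le> degree \<phi> * k" by (rule degree_power_le)
    also have "degree \<phi> * k \<le> D * degree \<phi>" using that by simp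
    finally show ?thesis using assms that by fastforce
  qed
  show "degree (arc_val D \<phi> g) \<le> D * degree \<phi> + m + D"
    unfolding arc_val_def by (rule degree_sum_le) (auto intro: *)
  have "degree (of_nat e * \<phi> ^ (e - 1) * g e) \<le> D * degree \<phi> + m + D" if "e \<le> D" for e
  proof -
    have "of_nat e * \<phi> ^ (e - 1) * g e = smult (of_nat e) (\<phi> ^ (e - 1) * g e)"
      by (simp add: of_nat_poly)
    also have "degree \<dots> \<le> degree (\<phi> ^ (e - 1) * g e)" by (rule degree_smult_le)
    also have "\<dots> \<le> D * degree \<phi> + m + D" using that by (intro *) auto
    finally show ?thesis .
  qed
  then show "degree (arc_deriv D \<phi> g) \<le> D * degree \<phi> + m + D"
    unfolding arc_deriv_def by (intro degree_sum_le) auto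
qed

lemma degree_cofactor_le:
  fixes p q r :: "'a::field poly"
  assumes "p = q * r" "p \<noteq> 0"
  shows "degree r \<le> degree p"
  using assms by (metis degree_mult_right_le mult.commute mult_zero_left)

text \<open>The uniform bound \<open>d\<close> makes the degrees allowed for the quotients
  independent of \<open>t\<close>. The divisors must be nonzero at \<open>t0\<close> in order that
  vanishing of \<open>g\<close> forces the quotients to vanish as well.\<close>

lemma determined_cofinite:
  fixes \<phi> M M' :: "'a::field \<Rightarrow> 'a poly"
  assumes fam: "function_ring.poly_family (range poly) \<phi>"
      "function_ring.poly_family (range poly) M" "function_ring.poly_family (range poly) M'"
    and deg: "\<And>t. degree (\<phi> t) \<le> d"
    and t0: "determined m D (\<phi> t0) (M t0) (M' t0) N" "M t0 \<noteq> 0" "M' t0 \<noteq> 0"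
  shows "finite {t. \<not> determined m D (\<phi> t) (M t) (M' t) N}"
proof -
  interpret function_ring "range poly :: ('a \<Rightarrow> 'a) set" by (rule function_ring_poly)
  define bd where "bd e = (if e \<le> D then m + e else D * d + m + D)" for e
  \<comment> \<open>The unknowns \<open>D + 1\<close> and \<open>D + 2\<close> are the quotients by
    \<open>M t\<close> and \<open>M' t\<close>. Row 0 says \<open>arc_val = M q\<close>, row 1 says
    \<open>arc_deriv = M' q'\<close>, and row 2 is \<open>arc_val\<close> again, to be read off at
    the coefficients in \<open>N\<close> only.\<close>
  define W where "W k e t = (if e \<le> D then if k = (1::nat) then of_nat e * \<phi> t ^ (e - 1) else \<phi> t ^ e
      else if k = 0 \<and> e = D + 1 then - M t else if k = 1 \<and> e = D + 2 then - M' t else 0)" for k e t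
  define T where "T = {0,1} \<times> UNIV \<union> {2::nat} \<times> N"
  have sW: "(\<Sum>e\<le>D+2. W k e t * p e) = (if k = 1 then arc_deriv D (\<phi> t) p else arc_val D (\<phi> t) p)
     + W k (D+1) t * p (D+1) + W k (D+2) t * p (D+2)" for k t p
    by (simp add: W_def arc_deriv_def arc_val_def)
  have fW: "poly_family (W k e)" for k e
  proof -
    have n: "poly_family (\<lambda>t. - F t)" if "poly_family F" for F
      using poly_family_diff[OF poly_family_const[of 0] that] by simp
    show ?thesis unfolding W_def[abs_def]
      by (cases "e \<le> D"; cases "k = 1"; cases "k = 0"; cases "e = D + 1"; cases "e = D + 2"; simp;
        intro poly_family_mult poly_family_power poly_family_const n fam)
  qed
  have "poly_system W {..D+2} bd T t0" unfolding poly_system_def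
  proof (intro allI impI)
    fix p assume p: "(\<forall>e\<in>{..D+2}. degree (p e) \<le> bd e) \<and>
      (\<forall>(k, n)\<in>T. coeff (\<Sum>e\<in>{..D+2}. W k e t0 * p e) n = 0)"
    then have z: "coeff (\<Sum>e\<le>D+2. W k e t0 * p e) n = 0" if "(k, n) \<in> T" for k n
      using that by blast
    have "(\<Sum>e\<le>D+2. W k e t0 * p e) = 0" if "k \<in> {0, 1}" for k
      by (rule poly_eqI, subst z) (use that in \<open>auto simp: T_def\<close>)
    from this[of 0] this[of 1]
    have "(\<Sum>e\<le>D+2. W 0 e t0 * p e) = 0" "(\<Sum>e\<le>D+2. W 1 e t0 * p e) = 0" by simp_all
    then have e: "arc_val D (\<phi> t0) p = M t0 * p (D+1)" "arc_deriv D (\<phi> t0) p = M' t0 * p (D+2)"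
      unfolding sW by (simp_all add: W_def)
    have "coeff (arc_val D (\<phi> t0) p) n = 0" if "n \<in> N" for n
      using z[of 2 n] that unfolding sW by (simp add: T_def W_def)
    moreover have "\<forall>e\<le>D. degree (p e) \<le> m + e"
    proof (intro allI impI)
      fix e assume "e \<le> D"
      then show "degree (p e) \<le> m + e" using bspec[OF conjunct1[OF p], of e] by (simp add: bd_def)
    qed
    ultimately have "\<forall>e\<le>D. p e = 0" using t0(1) e unfolding determined_def by simp
    moreover from this have "arc_val D (\<phi> t0) p = 0" "arc_deriv D (\<phi> t0) p = 0"
      by (simp_all add: arc_val_def arc_deriv_def)
    then have "p (D+1) = 0" "p (D+2) = 0" using e t0 by auto
    ultimately show "\<forall>e\<in>{..D+2}. p e = 0" by (auto simp: le_Suc_eq)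
  qed
  from poly_system_cofinite[OF _ fW this]
  have "finite {t. \<not> poly_system W {..D+2} bd T t}" by simp
  moreover have "determined m D (\<phi> t) (M t) (M' t) N" if "poly_system W {..D+2} bd T t" for t
    unfolding determined_def
  proof (intro allI impI, elim conjE)
    fix g e assume g: "\<forall>e\<le>D. degree (g e) \<le> m + e" "M t dvd arc_val D (\<phi> t) g"
      "M' t dvd arc_deriv D (\<phi> t) g" "\<forall>n\<in>N. coeff (arc_val D (\<phi> t) g) n = 0" and e: "e \<le> D"
    have dl: "D * degree (\<phi> t) + m + D \<le> D * d + m + D" using deg[of t] by simp
    have ex: "\<exists>q. h = k * q \<and> degree q \<le> D * d + m + D"
      if "k dvd h" "degree h \<le> D * degree (\<phi> t) + m + D" for h k :: "'a poly"
    proof (cases "h = 0")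
      case True then show ?thesis by (intro exI[of _ 0]) simp
    next
      case False
      from that obtain q where "h = k * q" by (elim dvdE)
      moreover from this have "degree q \<le> degree h" by (rule degree_cofactor_le[OF _ False])
      ultimately show ?thesis using that(2) dl by (intro exI[of _ q]) linarith
    qed
    obtain q where q: "arc_val D (\<phi> t) g = M t * q" "degree q \<le> D * d + m + D"
      using ex[OF g(2) degree_arc_val_le(1)[OF g(1)]] by blast
    obtain q' where q': "arc_deriv D (\<phi> t) g = M' t * q'" "degree q' \<le> D * d + m + D"
      using ex[OF g(3) degree_arc_val_le(2)[OF g(1)]] by blast
    define p where "p e = (if e \<le> D then g e else if e = D + 1 then q else q')" for e
    have a: "arc_val D (\<phi> t) p = arc_val D (\<phi> t) g" "arc_deriv D (\<phi> t) p = arc_deriv D (\<phi> t) g"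
      by (simp_all add: arc_val_def arc_deriv_def p_def)
    have "\<forall>e\<in>{..D+2}. degree (p e) \<le> bd e" using g q q' by (auto simp: p_def bd_def)
    moreover have "\<forall>(k, n)\<in>T. coeff (\<Sum>e\<in>{..D+2}. W k e t * p e) n = 0"
      unfolding sW a using q q' g(4) by (auto simp: T_def W_def p_def)
    ultimately have "p e = 0" using that e unfolding poly_system_def by auto
    then show "g e = 0" using e by (simp add: p_def)
  qed
  ultimately have "{t. \<not> determined m D (\<phi> t) (M t) (M' t) N} \<subseteq> {t. \<not> poly_system W {..D+2} bd T t}"
    by blast
  with \<open>finite {t. \<not> poly_system W {..D+2} bd T t}\<close> show ?thesis by (rule finite_subset[rotated])
qed

section \<open>Divisibility by powers of \<open>v\<close> and the order of an arc\<close>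

lemma monom_dvd_small_degree:
  fixes p :: "'a::field poly"
  assumes "monom 1 n dvd p" "degree p < n"
  shows "p = 0"
proof (rule poly_eqI)
  fix k show "coeff p k = coeff 0 k"
    using assms by (cases "k < n") (auto simp: monom_1_dvd_iff' coeff_eq_0)
qed

lemma monom_dvd_mono: "a \<le> b \<Longrightarrow> monom 1 b dvd p \<Longrightarrow> monom 1 a dvd (p :: 'a::field poly)"
  by (simp add: monom_1_dvd_iff')

lemma monom_dvd_unit_mult:
  fixes p q :: "'a::field poly"
  assumes "coeff q 0 \<noteq> 0"
  shows "monom 1 n dvd q * p \<longleftrightarrow> monom 1 n dvd p"
proof (cases "p = 0")
  case False
  have "q \<noteq> 0" using assms by auto
  moreover have "order 0 q = 0" using assms by (intro order_0I) (simp add: poly_0_coeff_0)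
  ultimately have "order 0 (q * p) = order 0 p" using False by (simp add: order_mult)
  then show ?thesis using False \<open>q \<noteq> 0\<close> by (simp add: monom_1_dvd_iff)
qed simp

definition has_ord :: "'a::field poly \<Rightarrow> nat \<Rightarrow> bool" where
  "has_ord \<phi> c \<longleftrightarrow> (\<forall>i<c. coeff \<phi> i = 0) \<and> coeff \<phi> c \<noteq> 0"

lemma has_ordE:
  assumes "has_ord \<phi> c"
  obtains \<psi> where "\<phi> = monom 1 c * \<psi>" "coeff \<psi> 0 \<noteq> 0"
proof -
  have "monom 1 c dvd \<phi>" using assms by (simp add: monom_1_dvd_iff' has_ord_def)
  then obtain \<psi> where p: "\<phi> = monom 1 c * \<psi>" by (elim dvdE)
  then have "coeff \<psi> 0 \<noteq> 0" using assms by (simp add: has_ord_def coeff_monom_mult)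
  with p show thesis by (rule that)
qed

lemma has_ord_monom: "has_ord (monom 1 c) c"
  by (simp add: has_ord_def)

text \<open>The cofactor of \<open>v^c\<close> in \<open>\<phi>\<close> is a unit at 0. Truncated
  subtraction covers the case \<open>n \<le> c\<close>, where both sides are true.\<close>

lemma has_ord_mult_dvd:
  assumes "has_ord \<phi> c"
  shows "monom 1 n dvd \<phi> * p \<longleftrightarrow> monom 1 (n - c) dvd p"
proof -
  obtain \<psi> where p: "\<phi> = monom 1 c * \<psi>" "coeff \<psi> 0 \<noteq> 0" using assms by (rule has_ordE)
  have *: "monom 1 k dvd monom 1 c * (\<psi> * p) \<longleftrightarrow> monom 1 (k - c) dvd \<psi> * p" for k
  proof (cases "k \<le> c")
    case True
    then have "monom 1 k dvd (monom 1 c :: 'a poly)" by (simp add: monom_1_dvd_iff')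
    then show ?thesis using True by (simp add: monom_0 one_pCons[symmetric])
  next
    case False
    then have "(monom 1 k :: 'a poly) = monom 1 c * monom 1 (k - c)" by (simp add: mult_monom)
    then show ?thesis by simp
  qed
  show ?thesis unfolding p(1) mult.assoc * by (rule monom_dvd_unit_mult[OF p(2)])
qed

section \<open>Arcs for which the conditions concentrated at \<open>v = 0\<close> determine
  \<open>f\<close>\<close>

abbreviation det0 where
  "det0 m D \<phi> a b \<equiv> determined m D \<phi> (monom 1 a) (monom 1 b) {}"

lemma det0_mono: "det0 m D \<phi> a b \<Longrightarrow> a \<le> a' \<Longrightarrow> b \<le> b' \<Longrightarrow> det0 m D \<phi> a' b'"
  unfolding determined_def using monom_dvd_mono by blast

lemma infinite_field_avoid: "finite S \<Longrightarrow> \<exists>t::'a::field_char_0. t \<notin> S"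
  by (rule ex_new_if_finite[OF infinite_UNIV_char_0])

text \<open>Adding \<open>t v^\<sigma>\<close> to an arc of order at least \<open>\<sigma>\<close>
  gives order exactly \<open>\<sigma>\<close> for all but one \<open>t\<close>, and by openness
  almost no \<open>t\<close> spoils the conclusion. So the induction may use whatever larger order
  suits it and adjust the order afterwards.\<close>

lemma det0_perturb:
  fixes \<phi> :: "'a::field_char_0 poly"
  assumes "det0 m D \<phi> a b" "\<forall>i<\<sigma>. coeff \<phi> i = 0"
  shows "\<exists>\<phi>'::'a poly. has_ord \<phi>' \<sigma> \<and> det0 m D \<phi>' a b"
proof -
  interpret function_ring "range poly :: ('a \<Rightarrow> 'a) set" by (rule function_ring_poly)
  define f where "f t = \<phi> + smult t (monom 1 \<sigma>)" for t
  have fin: "finite {t. \<not> det0 m D (f t) a b}"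
  proof (rule determined_cofinite[where ?t0.0 = 0 and \<phi> = f and M = "\<lambda>_. monom 1 a" and M' = "\<lambda>_. monom 1 b"])
    show "poly_family f" unfolding f_def
      by (intro poly_family_add poly_family_const poly_family_smult id_range_poly)
    show "degree (f t) \<le> max (degree \<phi>) \<sigma>" for t
      unfolding f_def by (intro degree_add_le order.trans[OF degree_smult_le]) (auto simp: degree_monom_eq)
    show "det0 m D (f 0) a b" using assms by (simp add: f_def)
  qed (use poly_family_const in auto)
  obtain t where "t \<notin> insert (- coeff \<phi> \<sigma>) {t. \<not> det0 m D (f t) a b}"
    using infinite_field_avoid fin by blast
  then have t: "t \<noteq> - coeff \<phi> \<sigma>" "det0 m D (f t) a b" by auto
  from t(1) have "coeff \<phi> \<sigma> + t \<noteq> 0" by (metis add_eq_0_iff)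
  then have "has_ord (f t) \<sigma>" using assms by (auto simp: has_ord_def f_def)
  with t(2) show ?thesis by blast
qed

text \<open>The number of coefficients of \<open>g_0, ..., g_D\<close>, that is, the dimension of
  the space of forms of degree \<open>m + D\<close> with multiplicity at least \<open>m\<close> at
  the origin.\<close>

definition bidim :: "nat \<Rightarrow> nat \<Rightarrow> nat" where "bidim m D = (\<Sum>e\<le>D. m + e + 1)"

lemma bidim_0 [simp]: "bidim m 0 = m + 1"
  by (simp add: bidim_def)

lemma bidim_Suc: "bidim m (Suc D) = m + 1 + bidim (Suc m) D"
  by (simp add: bidim_def sum.atMost_Suc_shift del: sum.atMost_Suc)

text \<open>
  One step of the Horace method with the exceptional curve \<open>u = 0\<close>: as soon as the conditions
  force \<open>g 0 = 0\<close>, one passes to \<open>f / u\<close>.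
\<close>

lemma det0_Suc:
  assumes det: "det0 (Suc m) D \<phi> a' b'"
    and step: "\<And>g. \<lbrakk>\<forall>e\<le>Suc D. degree (g e) \<le> m + e; monom 1 a dvd arc_val (Suc D) \<phi> g;
      monom 1 b dvd arc_deriv (Suc D) \<phi> g\<rbrakk> \<Longrightarrow> g 0 = 0 \<and>
      monom 1 a' dvd arc_val D \<phi> (\<lambda>e. g (Suc e)) \<and> monom 1 b' dvd arc_deriv D \<phi> (\<lambda>e. g (Suc e))"
  shows "det0 m (Suc D) \<phi> a b"
  unfolding determined_def
proof (intro allI impI, elim conjE)
  fix g e assume g: "\<forall>e\<le>Suc D. degree (g e) \<le> m + e" "monom 1 a dvd arc_val (Suc D) \<phi> g"
      "monom 1 b dvd arc_deriv (Suc D) \<phi> g" and e: "e \<le> Suc D"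
  have "degree (g (Suc e)) \<le> Suc m + e" if "e \<le> D" for e using g(1)[rule_format, of "Suc e"] that by simp
  moreover note s = step[OF g]
  ultimately have *: "\<forall>e\<le>D. g (Suc e) = 0"
    by (intro det[unfolded determined_def, THEN spec, THEN mp] conjI allI impI ballI) simp_all
  show "g e = 0"
  proof (cases e)
    case 0 then show ?thesis using s by simp
  next
    case (Suc e') then show ?thesis using * e by simp
  qed
qed

text \<open>Without double points an arc of order \<open>m + 1\<close> works: the part
  \<open>\<phi> h\<close> of \<open>f\<close> vanishes to order \<open>m + 1\<close>, so it cannot
  interfere with \<open>g_0\<close>, whose degree is at most \<open>m\<close>.\<close>

lemma curvilinear_det0:
  assumes "\<tau> \<le> m + 1"
  shows "\<exists>\<phi>::'a::field_char_0 poly. has_ord \<phi> \<tau> \<and> det0 m D \<phi> (bidim m D) 0"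
  using assms
proof (induction D arbitrary: m \<tau>)
  case 0
  have "det0 m 0 (monom 1 \<tau> :: 'a poly) (bidim m 0) 0"
    unfolding determined_def
  proof (intro allI impI, elim conjE)
    fix g :: "nat \<Rightarrow> 'a poly" and e :: nat
    assume g: "\<forall>e\<le>0. degree (g e) \<le> m + e" "monom 1 (bidim m 0) dvd arc_val 0 (monom 1 \<tau>) g" "e \<le> 0"
    have "monom 1 (m + 1) dvd g 0" "degree (g 0) < m + 1" using g(2) g(1)[rule_format, of 0]
      by (simp_all add: arc_val_def)
    then have "g 0 = 0" by (rule monom_dvd_small_degree)
    then show "g e = 0" using g(3) by simp
  qed
  with has_ord_monom show ?case by (intro exI conjI)
next
  case (Suc D)
  \<comment> \<open>The induction hypothesis at level \<open>m + 1\<close> allows orders up to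
    \<open>m + 2\<close>, so \<open>m + 1\<close> is available.\<close>
  have "\<exists>\<phi>::'a poly. has_ord \<phi> (m + 1) \<and> det0 (Suc m) D \<phi> (bidim (Suc m) D) 0"
    by (rule Suc.IH) simp
  then obtain \<phi> :: "'a poly" where
    p: "has_ord \<phi> (m + 1)" "det0 (Suc m) D \<phi> (bidim (Suc m) D) 0" by (elim exE conjE)
  have "det0 m (Suc D) \<phi> (bidim m (Suc D)) 0"
  proof (rule det0_Suc[OF p(2)])
    fix g assume g: "\<forall>e\<le>Suc D. degree (g e) \<le> m + e"
      "monom 1 (bidim m (Suc D)) dvd arc_val (Suc D) \<phi> g"
    have "monom 1 (m + 1) dvd g 0 + \<phi> * arc_val D \<phi> (\<lambda>e. g (Suc e))"
      using monom_dvd_mono[OF _ g(2), of "m + 1"] by (simp add: bidim_Suc arc_val_Suc)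
    moreover have "monom 1 (m + 1) dvd \<phi> * arc_val D \<phi> (\<lambda>e. g (Suc e))"
      by (simp add: has_ord_mult_dvd[OF p(1)] monom_0 one_pCons[symmetric])
    ultimately have "monom 1 (m + 1) dvd g 0" by (simp add: dvd_add_left_iff)
    then have g0: "g 0 = 0" by (rule monom_dvd_small_degree) (use g(1)[rule_format, of 0] in simp)
    then have "monom 1 (bidim (Suc m) D) dvd arc_val D \<phi> (\<lambda>e. g (Suc e))"
      using g(2) by (simp add: arc_val_Suc has_ord_mult_dvd[OF p(1)] bidim_Suc)
    then show "g 0 = 0 \<and> monom 1 (bidim (Suc m) D) dvd arc_val D \<phi> (\<lambda>e. g (Suc e)) \<and>
      monom 1 0 dvd arc_deriv D \<phi> (\<lambda>e. g (Suc e))" using g0 by (simp add: monom_0 one_pCons[symmetric])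
  qed
  then show ?case by (rule det0_perturb) (use p(1) Suc.prems in \<open>auto simp: has_ord_def\<close>)
qed

text \<open>All derivative conditions are spent at once. Since \<open>I \<le> c\<close>, they give
  \<open>v^I | f/u\<close>; with \<open>c + I = m + 1\<close> this kills \<open>g_0\<close>, and
  \<open>f/u\<close> is left with a curvilinear problem having the right number
  \<open>2I + J - c\<close> of conditions.\<close>

lemma few_double_points_det0:
  assumes "2 * I \<le> m + 1" "3 * I + J = bidim m (Suc D)"
  shows "\<exists>\<phi>::'a::field_char_0 poly. has_ord \<phi> (m + 1 - I) \<and> det0 m (Suc D) \<phi> (2 * I + J) I"
proof -
  define c where "c = m + 1 - I"
  have c: "I \<le> c" "I + c = m + 1" using assms by (auto simp: c_def)
  have "\<exists>\<phi>::'a poly. has_ord \<phi> c \<and> det0 (Suc m) D \<phi> (bidim (Suc m) D) 0"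
    by (rule curvilinear_det0) (use c in simp)
  then obtain \<phi> :: "'a poly" where p: "has_ord \<phi> c" "det0 (Suc m) D \<phi> (bidim (Suc m) D) 0"
    by (elim exE conjE)
  have N: "2 * I + J = bidim (Suc m) D + c" using assms c by (simp add: bidim_Suc)
  have "bidim (Suc m) D \<ge> 1" by (cases D) (auto simp: bidim_Suc)
  moreover have "bidim (Suc m) D \<ge> m + 2" by (cases D) (auto simp: bidim_Suc)
  ultimately have J: "m + 1 \<le> 2 * I + J" "I \<le> 2 * I + J - c" using N c assms by auto
  have "det0 m (Suc D) \<phi> (2 * I + J) I"
  proof (rule det0_Suc[OF p(2)])
    fix g assume g: "\<forall>e\<le>Suc D. degree (g e) \<le> m + e"
      "monom 1 (2 * I + J) dvd arc_val (Suc D) \<phi> g" "monom 1 I dvd arc_deriv (Suc D) \<phi> g"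
    let ?A = "arc_val D \<phi> (\<lambda>e. g (Suc e))"
    have triv: "monom 1 k dvd \<phi> * r" if "k \<le> c" for k r
      using that by (simp add: has_ord_mult_dvd[OF p(1)] monom_0 one_pCons[symmetric])
    have "monom 1 I dvd ?A" using g(3) triv c by (simp add: arc_deriv_Suc dvd_add_left_iff)
    moreover have "m + 1 - c = I" using c by simp
    ultimately have "monom 1 (m + 1) dvd \<phi> * ?A" by (simp only: has_ord_mult_dvd[OF p(1)])
    moreover have "monom 1 (m + 1) dvd g 0 + \<phi> * ?A"
      using monom_dvd_mono[OF J(1) g(2)] by (simp add: arc_val_Suc)
    ultimately have "monom 1 (m + 1) dvd g 0" by (simp add: dvd_add_left_iff)
    then have g0: "g 0 = 0" by (rule monom_dvd_small_degree) (use g(1)[rule_format, of 0] in simp)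
    then have "monom 1 (bidim (Suc m) D) dvd ?A"
      using g(2) by (simp add: arc_val_Suc has_ord_mult_dvd[OF p(1)] N)
    then show "g 0 = 0 \<and> monom 1 (bidim (Suc m) D) dvd ?A \<and>
      monom 1 0 dvd arc_deriv D \<phi> (\<lambda>e. g (Suc e))" using g0 by (simp add: monom_0 one_pCons[symmetric])
  qed
  with p(1) show ?thesis unfolding c_def by blast
qed

text \<open>For \<open>f = g_0 + u g_1\<close> the derivative is \<open>g_1\<close> itself, so
  \<open>v^I | g_1\<close>. The lower bound on \<open>\<tau>\<close> turns this into
  \<open>g_0 = 0\<close>; the upper bound leaves more than \<open>m + 1\<close> orders of vanishing
  for \<open>g_1\<close>.\<close>

lemma pencil_det0:
  assumes "I \<le> m + 1" "m + 1 \<le> \<tau> + I" "\<tau> + m + 2 \<le> 2 * I + J"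
  shows "det0 m 1 (monom 1 \<tau> :: 'a::field poly) (2 * I + J) I"
  unfolding determined_def
proof (intro allI impI, elim conjE)
  fix g :: "nat \<Rightarrow> 'a poly" and e :: nat
  assume g: "\<forall>e\<le>1. degree (g e) \<le> m + e" "monom 1 (2 * I + J) dvd arc_val 1 (monom 1 \<tau>) g"
    "monom 1 I dvd arc_deriv 1 (monom 1 \<tau>) g" and e: "e \<le> 1"
  note dv = has_ord_mult_dvd[OF has_ord_monom]
  have A: "monom 1 (2 * I + J) dvd g 0 + monom 1 \<tau> * g 1" using g(2) by (simp add: arc_val_def)
  have B: "monom 1 I dvd g 1" using g(3) by (simp add: arc_deriv_def)
  have "monom 1 (m + 1) dvd monom 1 \<tau> * g 1"
    unfolding dv by (rule monom_dvd_mono[OF _ B]) (use assms in auto)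
  moreover have "monom 1 (m + 1) dvd g 0 + monom 1 \<tau> * g 1"
    by (rule monom_dvd_mono[OF _ A]) (use assms in auto)
  ultimately have "monom 1 (m + 1) dvd g 0" by (simp add: dvd_add_left_iff)
  then have g0: "g 0 = 0" by (rule monom_dvd_small_degree) (use g(1)[rule_format, of 0] in simp)
  then have "monom 1 (2 * I + J - \<tau>) dvd g 1" using A by (simp add: dv)
  moreover have "degree (g 1) \<le> m + 1" using g(1)[rule_format, of 1] by simp
  moreover have "m + 1 < 2 * I + J - \<tau>" using assms by linarith
  ultimately have "g 1 = 0" by (intro monom_dvd_small_degree[of "2 * I + J - \<tau>"]) linarith+
  moreover have "e = 0 \<or> e = 1" using e by linarith
  ultimately show "g e = 0" using g0 by blast
qed

text \<open>\<open>geo_sum t y n\<close> is the sum of \<open>t^(n-1-l) y^l\<close> over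
  \<open>l < n\<close>, and \<open>geo_sum2\<close> has the additional factors \<open>l + 1\<close>.
  Homogeneity keeps them polynomial in \<open>t\<close>, also at \<open>t = 0\<close>.\<close>

primrec geo_sum :: "'a::comm_ring_1 \<Rightarrow> 'a \<Rightarrow> nat \<Rightarrow> 'a" where
  "geo_sum t y 0 = 0"
| "geo_sum t y (Suc n) = t * geo_sum t y n + y ^ n"

primrec geo_sum2 :: "'a::comm_ring_1 \<Rightarrow> 'a \<Rightarrow> nat \<Rightarrow> 'a" where
  "geo_sum2 t y 0 = 0"
| "geo_sum2 t y (Suc n) = t * geo_sum2 t y n + of_nat (Suc n) * y ^ n"

lemma geo_sum: "(t - y) * geo_sum t y n = t ^ n - y ^ n"
proof (induction n)
  case (Suc n)
  have "(t - y) * geo_sum t y (Suc n) = t * ((t - y) * geo_sum t y n) + (t - y) * y ^ n"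
    by (simp add: algebra_simps)
  then show ?case unfolding Suc.IH by (simp add: algebra_simps)
qed simp

lemma geo_sum2:
  "(t - y)\<^sup>2 * geo_sum2 t y n = t ^ Suc n - of_nat (Suc n) * t * y ^ n + of_nat n * y ^ Suc n"
proof (induction n)
  case (Suc n)
  have "(t - y)\<^sup>2 * geo_sum2 t y (Suc n) =
      t * ((t - y)\<^sup>2 * geo_sum2 t y n) + (t - y)\<^sup>2 * of_nat (Suc n) * y ^ n"
    by (simp add: algebra_simps)
  then show ?case unfolding Suc.IH by (simp add: algebra_simps power2_eq_square)
qed simp

text \<open>
  For \<open>m = 2c\<close> an arc of order \<open>c\<close> leaves one coefficient of \<open>g 0\<close> free. Letting the arc
  \<open>u = v\<^sup>c(t + v\<chi>)\<close> degenerate, \<open>t \<rightarrow> 0\<close>, this coefficient has to vanish to a high order in \<open>t\<close>, and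
  only the condition on the last coefficient of \<open>f/u\<close> is lost. The sums \<open>geo_sum\<close> and
  \<open>geo_sum2\<close> truncate \<open>1/(t + v\<chi>)\<close> and \<open>1/(t + v\<chi>)\<^sup>2\<close>, multiplied by a power of \<open>t\<close>.
\<close>

lemma det0_even_step:
  fixes \<phi> :: "'a::field_char_0 poly"
  assumes ord: "has_ord \<phi> (c + 1)" and m: "m = 2 * c" and K: "K = 2 * I' + J" "I' + J \<ge> 2"
    and det: "det0 (Suc m) D \<phi> (c + K - 1) I'"
  shows "\<exists>\<phi>'::'a poly. has_ord \<phi>' c \<and> det0 m (Suc D) \<phi>' (2 * c + K) (I' + c)"
proof -
  interpret function_ring "range poly :: ('a \<Rightarrow> 'a) set" by (rule function_ring_poly)
  obtain \<chi> where chi: "\<phi> = monom 1 (c + 1) * \<chi>" "coeff \<chi> 0 \<noteq> 0" using ord by (rule has_ordE)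
  define y where "y = - (monom 1 1 * \<chi>)"
  \<comment> \<open>The arc \<open>v^c (t + v \<chi>)\<close>: order \<open>c\<close> for
    \<open>t \<noteq> 0\<close>, while \<open>f 0 = \<phi>\<close> has order
    \<open>c + 1\<close>.\<close>
  define f where "f t = monom 1 c * ([:t:] - y)" for t
  define \<kappa> where "\<kappa> t = geo_sum [:t:] y K" for t
  \<comment> \<open>The factor \<open>[:t:] ^ (K - I' - 1)\<close> brings the power of
    \<open>t\<close> to \<open>t^K\<close>, the same as for \<open>\<kappa>\<close>; its exponent is
    positive because \<open>I' + J \<ge> 2\<close>, whence \<open>l 0 = 0\<close>.\<close>
  define l where "l t = [:t:] ^ (K - I' - 1) * geo_sum2 [:t:] y I'" for t
  have yk: "y ^ n = monom 1 n * (- \<chi>) ^ n" for n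
  proof -
    have "y = monom 1 1 * (- \<chi>)" by (simp add: y_def)
    then show ?thesis by (simp only: power_mult_distrib monom_power) simp
  qed
  have f0: "f 0 = \<phi>" by (simp add: f_def chi y_def mult_monom mult.assoc[symmetric])
  have K1: "K \<ge> 1" "K - I' - 1 > 0" using K by auto
  have fam_t: "poly_family (\<lambda>t. [:t:])"
    by (intro poly_family_pCons id_range_poly poly_family_const)
  have fam: "poly_family f" "poly_family \<kappa>" "poly_family l"
  proof -
    have g: "poly_family (\<lambda>t. geo_sum [:t:] y n)" for n
    proof (induction n)
      case (Suc n)
      then show ?case unfolding geo_sum.simps
        by (intro poly_family_add poly_family_mult poly_family_const fam_t)
    qed (simp add: poly_family_const)
    have g2: "poly_family (\<lambda>t. geo_sum2 [:t:] y n)" for n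
    proof (induction n)
      case (Suc n)
      then show ?case unfolding geo_sum2.simps
        by (intro poly_family_add poly_family_mult poly_family_const fam_t)
    qed (simp add: poly_family_const)
    show "poly_family f" "poly_family \<kappa>" "poly_family l"
      unfolding f_def[abs_def] \<kappa>_def[abs_def] l_def[abs_def]
      by (intro poly_family_mult poly_family_diff poly_family_power poly_family_const fam_t g g2)+
  qed
  \<comment> \<open>The unknown \<open>Suc D\<close> is the surviving coefficient of
    \<open>g 0\<close>, a constant according to \<open>bd\<close>; the others stand for
    \<open>t^K g (Suc e)\<close>. Rows 0 and 1 are the conditions on \<open>f/u\<close> and on its
    derivative, solved for these after multiplication by \<open>\<kappa> t\<close> and
    \<open>l t\<close>.\<close>
  define W where "W k e t = (if e \<le> D then if k = (1::nat) then of_nat e * f t ^ (e - 1) else f t ^ e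
      else if k = 0 then monom 1 c * \<kappa> t else - l t)" for k e t
  define bd where "bd e = (if e \<le> D then Suc m + e else 0)" for e
  define T where "T = {0} \<times> {..<c + K} \<union> {1::nat} \<times> {..<I'}"
  have sW: "(\<Sum>e\<le>Suc D. W k e t * p e) = (if k = 1 then arc_deriv D (f t) p else arc_val D (f t) p)
     + (if k = 0 then monom 1 c * \<kappa> t else - l t) * p (Suc D)" for k t p
    by (simp add: W_def arc_deriv_def arc_val_def)
  have fW: "poly_family (W k e)" for k e
  proof -
    have n: "poly_family (\<lambda>t. - F t)" if "poly_family F" for F
      using poly_family_diff[OF poly_family_const[of 0] that] by simp
    show ?thesis unfolding W_def[abs_def]
      by (cases "e \<le> D"; cases "k = 1"; cases "k = 0"; simp;
        intro poly_family_mult poly_family_power poly_family_const n fam)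
  qed
  have T: "(\<forall>(k, n)\<in>T. coeff (\<Sum>e\<le>Suc D. W k e t * p e) n = 0) \<longleftrightarrow>
    monom 1 (c + K) dvd arc_val D (f t) p + monom 1 c * \<kappa> t * p (Suc D) \<and>
    monom 1 I' dvd arc_deriv D (f t) p - l t * p (Suc D)" for t p
    unfolding sW T_def monom_1_dvd_iff' by (simp only: ball_Un) (simp add: Ball_def)
  \<comment> \<open>At \<open>t = 0\<close> the constant enters row 0 with order
    \<open>c + K - 1\<close> and row 1 not at all. So all conditions except the last one of row 0
    concern the other unknowns alone, which vanish by \<open>det\<close>; that last one then kills
    the constant.\<close>
  have "poly_system W {..Suc D} bd T 0" unfolding poly_system_def T
  proof (intro allI impI, elim conjE)
    fix p assume deg: "\<forall>e\<in>{..Suc D}. degree (p e) \<le> bd e"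
      and A: "monom 1 (c + K) dvd arc_val D (f 0) p + monom 1 c * \<kappa> 0 * p (Suc D)"
      and B: "monom 1 I' dvd arc_deriv D (f 0) p - l 0 * p (Suc D)"
    have l0: "l 0 = 0" using K1(2) by (simp add: l_def)
    obtain k where k: "K = Suc k" using K1(1) by (cases K) auto
    have k0: "monom 1 c * \<kappa> 0 = monom 1 (c + k) * (- \<chi>) ^ k"
      by (simp add: \<kappa>_def k yk mult_monom mult.assoc[symmetric])
    have "monom 1 (c + k) dvd arc_val D (f 0) p + monom 1 (c + k) * (- \<chi>) ^ k * p (Suc D)"
      using monom_dvd_mono[OF _ A, of "c + k"] k by (simp add: k0)
    then have A': "monom 1 (c + K - 1) dvd arc_val D (f 0) p"
      using k by (simp add: dvd_add_left_iff mult.assoc)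
    have "degree (p e) \<le> Suc m + e" if "e \<le> D" for e
      using deg[rule_format, of e] that by (simp add: bd_def)
    then have d: "\<forall>e\<le>D. degree (p e) \<le> Suc m + e" by blast
    have pe: "\<forall>e\<le>D. p e = 0"
      by (intro det[unfolded determined_def, THEN spec, THEN mp] conjI ballI d)
        (use A' B in \<open>simp_all add: f0 l0\<close>)
    then have "arc_val D (f 0) p = 0" by (simp add: arc_val_def)
    then have "monom 1 (c + k) * monom 1 1 dvd monom 1 (c + k) * ((- \<chi>) ^ k * p (Suc D))"
      using A by (simp add: k0 mult.assoc k mult_monom)
    then have "monom 1 1 dvd (- \<chi>) ^ k * p (Suc D)" by (subst (asm) dvd_mult_cancel_left) simp
    moreover have "coeff ((- \<chi>) ^ k) 0 \<noteq> 0" using chi(2) by (simp add: coeff_0_power)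
    ultimately have "monom 1 1 dvd p (Suc D)" by (blast dest: monom_dvd_unit_mult)
    moreover have "degree (p (Suc D)) < 1" using deg[rule_format, of "Suc D"] by (simp add: bd_def)
    ultimately have "p (Suc D) = 0" by (rule monom_dvd_small_degree)
    with pe show "\<forall>e\<in>{..Suc D}. p e = 0" by (metis atMost_iff le_Suc_eq)
  qed
  from poly_system_cofinite[OF _ fW this]
  have "finite {t. \<not> poly_system W {..Suc D} bd T t}" by simp
  then obtain t where "t \<notin> insert 0 {t. \<not> poly_system W {..Suc D} bd T t}"
    using infinite_field_avoid by (meson finite_insert)
  then have t: "t \<noteq> 0" and sys: "poly_system W {..Suc D} bd T t" by auto
  define \<psi> where "\<psi> = [:t:] - y"
  have psi0: "coeff \<psi> 0 \<noteq> 0" using t by (simp add: \<psi>_def y_def coeff_monom_mult)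
  have ft: "f t = monom 1 c * \<psi>" by (simp add: f_def \<psi>_def)
  have ordf: "has_ord (f t) c" using psi0 by (simp add: ft has_ord_def coeff_monom_mult)
  have yd: "monom 1 n dvd y ^ n" for n
    by (simp add: yk)
  have \<kappa>: "\<psi> * \<kappa> t = [:t:] ^ K - y ^ K" unfolding \<psi>_def \<kappa>_def by (rule geo_sum)
  obtain w where w: "\<psi>\<^sup>2 * l t = [:t:] ^ K + monom 1 I' * w"
  proof -
    obtain z where z: "y ^ I' = monom 1 I' * z" using yd[of I'] by (elim dvdE)
    have "\<psi>\<^sup>2 * l t = [:t:] ^ (K - I' - 1) * (\<psi>\<^sup>2 * geo_sum2 [:t:] y I')"
      by (simp add: l_def mult.left_commute)
    also have "\<psi>\<^sup>2 * geo_sum2 [:t:] y I' =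
        [:t:] ^ Suc I' + monom 1 I' * (z * (of_nat I' * y - of_nat (Suc I') * [:t:]))"
      unfolding \<psi>_def geo_sum2 power_Suc2[of y] z by (simp add: algebra_simps)
    also have "[:t:] ^ (K - I' - 1) * \<dots> = [:t:] ^ K +
        monom 1 I' * ([:t:] ^ (K - I' - 1) * (z * (of_nat I' * y - of_nat (Suc I') * [:t:])))"
    proof -
      have "[:t:] ^ (K - I' - 1) * [:t:] ^ Suc I' = [:t:] ^ K"
        using K1 by (simp only: power_add[symmetric]) simp
      then show ?thesis by (simp only: distrib_left mult.left_commute)
    qed
    finally show thesis by (rule that)
  qed
  have "det0 m (Suc D) (f t) (2 * c + K) (I' + c)" unfolding determined_def
  proof (intro allI impI, elim conjE)
    fix g e assume g: "\<forall>e\<le>Suc D. degree (g e) \<le> m + e"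
      "monom 1 (2 * c + K) dvd arc_val (Suc D) (f t) g"
      "monom 1 (I' + c) dvd arc_deriv (Suc D) (f t) g" and e: "e \<le> Suc D"
    define A where "A = arc_val D (f t) (\<lambda>e. g (Suc e))"
    define B where "B = arc_deriv D (f t) (\<lambda>e. g (Suc e))"
    have gA: "monom 1 (2 * c + K) dvd g 0 + monom 1 c * \<psi> * A"
      using g(2) by (simp only: arc_val_Suc A_def ft)
    have gB: "monom 1 (I' + c) dvd A + monom 1 c * \<psi> * B"
      using g(3) by (simp only: arc_deriv_Suc A_def B_def ft)
    have "monom 1 c dvd A + monom 1 c * (\<psi> * B)"
      using monom_dvd_mono[OF _ gB, of c] by (simp add: mult.assoc)
    then have cA: "monom 1 c dvd A" by (simp add: dvd_add_left_iff)
    have mm: "(monom 1 m :: 'a poly) = monom 1 c * monom 1 c" by (simp add: m mult_monom mult_2)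
    have "monom 1 m dvd monom 1 c * \<psi> * A"
    proof -
      obtain A' where "A = monom 1 c * A'" using cA by (elim dvdE)
      then have "monom 1 c * \<psi> * A = monom 1 m * (\<psi> * A')"
        by (simp add: mm mult_ac)
      then show ?thesis by (metis dvd_triv_left)
    qed
    moreover have "monom 1 m dvd g 0 + monom 1 c * \<psi> * A"
      by (rule monom_dvd_mono[OF _ gA]) (simp add: m)
    ultimately have "monom 1 m dvd g 0" by (simp add: dvd_add_left_iff)
    \<comment> \<open>Only \<open>v^m | g 0\<close> is forced, one order short of
      \<open>g 0 = 0\<close>: the constant \<open>q\<close> is the free coefficient.\<close>
    then obtain q where q: "g 0 = monom 1 m * q" by (elim dvdE)
    have "degree q \<le> 0"
    proof (cases "q = 0")
      case False
      then have "degree (g 0) = m + degree q" by (simp add: q degree_mult_eq degree_monom_eq)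
      then show ?thesis using g(1)[rule_format, of 0] by simp
    qed simp
    have gq: "g 0 + monom 1 c * \<psi> * A = monom 1 c * (monom 1 c * q + \<psi> * A)"
      by (simp add: q mm algebra_simps)
    have "monom 1 (2 * c + K) = monom 1 c * (monom 1 (c + K) :: 'a poly)"
      by (simp add: mult_monom mult_2 add.assoc)
    then have "monom 1 c * monom 1 (c + K) dvd monom 1 c * (monom 1 c * q + \<psi> * A)"
      using gA by (simp only: gq)
    then have d1: "monom 1 (c + K) dvd monom 1 c * q + \<psi> * A"
      by (subst (asm) dvd_mult_cancel_left) simp
    \<comment> \<open>Multiply \<open>d1\<close> by \<open>\<kappa> t\<close>. The error term
      \<open>A y^K\<close> is harmless because \<open>v^c\<close> divides \<open>A\<close> and
      \<open>v^K\<close> divides \<open>y^K\<close>.\<close>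
    have d3: "monom 1 (c + K) dvd [:t:] ^ K * A + monom 1 c * \<kappa> t * q"
    proof -
      have "[:t:] ^ K * A + monom 1 c * \<kappa> t * q =
          (\<psi> * \<kappa> t + y ^ K) * A + monom 1 c * \<kappa> t * q" by (simp add: \<kappa>)
      also have "\<dots> = \<kappa> t * (monom 1 c * q + \<psi> * A) + A * y ^ K" by (simp add: algebra_simps)
      finally show ?thesis
        using d1 mult_dvd_mono[OF cA yd[of K]] by (simp add: mult_monom dvd_add)
    qed
    have d4: "monom 1 I' dvd [:t:] ^ K * B - l t * q"
    proof -
      \<comment> \<open>This combination of the two conditions eliminates \<open>A\<close>; after
        division by \<open>v^c\<close> and multiplication by \<open>l t\<close> it becomes
        \<open>d4\<close>.\<close>
      have "monom 1 (I' + c) dvd \<psi> * (A + monom 1 c * \<psi> * B) - (monom 1 c * q + \<psi> * A)"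
        using gB monom_dvd_mono[OF _ d1, of "I' + c"] K by (intro dvd_diff) (simp_all add: dvd_mult)
      also have "\<dots> = monom 1 c * (\<psi>\<^sup>2 * B - q)" by (simp add: algebra_simps power2_eq_square)
      finally have "monom 1 c * monom 1 I' dvd monom 1 c * (\<psi>\<^sup>2 * B - q)"
        by (simp add: mult_monom add.commute)
      then have d2: "monom 1 I' dvd \<psi>\<^sup>2 * B - q" by (subst (asm) dvd_mult_cancel_left) simp
      have "[:t:] ^ K * B - l t * q = (\<psi>\<^sup>2 * l t - monom 1 I' * w) * B - l t * q"
        by (simp add: w)
      also have "\<dots> = l t * (\<psi>\<^sup>2 * B - q) - monom 1 I' * (w * B)" by (simp add: algebra_simps)
      finally show ?thesis using d2 by (simp add: dvd_diff)
    qed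
    define p where "p e = (if e \<le> D then [:t:] ^ K * g (Suc e) else q)" for e
    have pA: "arc_val D (f t) p = [:t:] ^ K * A" "arc_deriv D (f t) p = [:t:] ^ K * B"
      by (simp_all add: arc_val_def arc_deriv_def A_def B_def p_def sum_distrib_left mult_ac)
    have pq: "p (Suc D) = q" by (simp add: p_def)
    have "degree (p e) \<le> bd e" if "e \<in> {..Suc D}" for e
    proof (cases "e \<le> D")
      case True
      have "degree ([:t:] ^ K * g (Suc e)) = degree (g (Suc e))"
        using t by (simp add: poly_const_pow)
      then show ?thesis using g(1)[rule_format, of "Suc e"] True by (simp add: p_def bd_def)
    next
      case False
      then show ?thesis using \<open>degree q \<le> 0\<close> by (simp add: p_def bd_def)
    qed
    moreover have "\<forall>(k, n)\<in>T. coeff (\<Sum>e\<in>{..Suc D}. W k e t * p e) n = 0"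
      unfolding T pA pq using d3 d4 by blast
    ultimately have p: "\<forall>e\<in>{..Suc D}. p e = 0"
      by (intro sys[unfolded poly_system_def, THEN spec, THEN mp]) blast
    have p': "p e = 0" if "e \<le> Suc D" for e using p that by blast
    show "g e = 0"
    proof (cases e)
      case 0
      then show ?thesis using p'[of "Suc D"] pq by (simp add: q)
    next
      case (Suc e')
      then have "p e' = 0" "e' \<le> D" using p' e by auto
      then show ?thesis using t Suc by (simp add: p_def)
    qed
  qed
  with ordf show ?thesis by (intro exI[of _ "f t"] conjI)
qed

text \<open>Odd and even steps alternate as \<open>m\<close> grows by one. An odd \<open>m\<close>
  and \<open>m + 1\<close> want the same order, an even \<open>m\<close> wants one less than
  \<open>m + 1\<close> does, which is the case for the degeneration. The extra hypotheses are what
  the base case \<open>D = 0\<close> needs; traced back through an even step to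
  \<open>D = 1\<close>, they read \<open>I \<le> m + 1\<close>.\<close>

lemma double_points_det0:
  assumes "m \<ge> 1" "3 * I + J = bidim m (Suc D)"
    and "D = 0 \<Longrightarrow> I + (m + 1) div 2 \<le> m + 1" "D = 1 \<Longrightarrow> even m \<Longrightarrow> I \<le> m + 1"
  shows "\<exists>\<phi>::'a::field_char_0 poly. has_ord \<phi> ((m + 1) div 2) \<and> det0 m (Suc D) \<phi> (2 * I + J) I"
  using assms
proof (induction D arbitrary: m I J)
  case 0
  have m: "3 * I + J = 2 * m + 3" using "0.prems"(2) by (simp add: bidim_Suc)
  \<comment> \<open>As \<open>3I + J = 2m + 3\<close>, the two bounds on the order in
    \<open>pencil_det0\<close> coincide and leave \<open>m + 1 - I\<close> only.\<close>
  have "det0 m (Suc 0) (monom 1 (m + 1 - I) :: 'a poly) (2 * I + J) I"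
    unfolding One_nat_def[symmetric] by (rule pencil_det0) (use m "0.prems"(3)[OF refl] in linarith)+
  then show ?case by (rule det0_perturb) (use "0.prems"(3) in auto)
next
  case (Suc D)
  have dim: "3 * I + J = m + 1 + bidim (Suc m) (Suc D)" using Suc.prems(2) by (simp only: bidim_Suc)
  have dim1: "D = 0 \<Longrightarrow> bidim (Suc m) (Suc D) = 2 * m + 5"
    "D = 1 \<Longrightarrow> bidim (Suc m) (Suc D) = 3 * m + 9" by (simp_all add: bidim_Suc)
  show ?case
  proof (cases "2 * I \<le> m + 1")
    case True
    have "\<exists>\<phi>::'a poly. has_ord \<phi> (m + 1 - I) \<and> det0 m (Suc (Suc D)) \<phi> (2 * I + J) I"
      by (rule few_double_points_det0[OF True Suc.prems(2)])
    then obtain \<phi> :: "'a poly" where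
      p: "has_ord \<phi> (m + 1 - I)" "det0 m (Suc (Suc D)) \<phi> (2 * I + J) I" by (elim exE conjE)
    have "\<forall>i<(m + 1) div 2. coeff \<phi> i = 0" using p(1) True by (simp add: has_ord_def)
    with p(2) show ?thesis by (rule det0_perturb)
  next
    case I: False
    define c where "c = (m + 1) div 2"
    show ?thesis
    proof (cases "even m")
      case False
      then have c: "2 * c = m + 1" "(Suc m + 1) div 2 = c" "c \<ge> 1" by (auto simp: c_def elim!: oddE)
      \<comment> \<open>The double points on \<open>u = 0\<close> trade \<open>c\<close> pairs of
        orders: \<open>I\<close> drops by \<open>c\<close>, and \<open>J\<close> grows by
        \<open>c\<close> so that \<open>2I + J\<close> drops by \<open>c\<close> as well. The total
        falls by \<open>2c = m + 1\<close>.\<close>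
      have IJ: "3 * (I - c) + (J + c) = bidim (Suc m) (Suc D)" using dim c I by linarith
      have "\<exists>\<phi>::'a poly. has_ord \<phi> c \<and> det0 (Suc m) (Suc D) \<phi> (2 * (I - c) + (J + c)) (I - c)"
      proof (rule Suc.IH[of "Suc m" "I - c" "J + c", unfolded c(2), OF _ IJ])
        show "I - c + c \<le> Suc m + 1" if "D = 0"
          using dim dim1(1)[OF that] I c by linarith
        show "I - c \<le> Suc m + 1" if "D = 1"
          using dim dim1(2)[OF that] I c by linarith
      qed simp
      then obtain \<phi> :: "'a poly" where
        p: "has_ord \<phi> c" "det0 (Suc m) (Suc D) \<phi> (2 * (I - c) + (J + c)) (I - c)" by (elim exE conjE)
      have "det0 m (Suc (Suc D)) \<phi> (2 * I + J) I"
      proof (rule det0_Suc[OF p(2)])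
        fix g assume g: "\<forall>e\<le>Suc (Suc D). degree (g e) \<le> m + e"
          "monom 1 (2 * I + J) dvd arc_val (Suc (Suc D)) \<phi> g"
          "monom 1 I dvd arc_deriv (Suc (Suc D)) \<phi> g"
        let ?A = "arc_val (Suc D) \<phi> (\<lambda>e. g (Suc e))" and ?B = "arc_deriv (Suc D) \<phi> (\<lambda>e. g (Suc e))"
        have A: "monom 1 (2 * I + J) dvd g 0 + \<phi> * ?A" using g(2) by (simp only: arc_val_Suc)
        have B: "monom 1 I dvd ?A + \<phi> * ?B" using g(3) by (simp only: arc_deriv_Suc)
        have "monom 1 c dvd ?A + \<phi> * ?B" using monom_dvd_mono[OF _ B, of c] c I by simp
        moreover have "monom 1 c dvd \<phi> * ?B"
          by (simp add: has_ord_mult_dvd[OF p(1)] monom_0 one_pCons[symmetric])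
        ultimately have "monom 1 c dvd ?A" by (simp add: dvd_add_left_iff)
        moreover have "m + 1 - c = c" using c by simp
        ultimately have "monom 1 (m + 1) dvd \<phi> * ?A" by (simp only: has_ord_mult_dvd[OF p(1)])
        moreover have "monom 1 (m + 1) dvd g 0 + \<phi> * ?A"
          using monom_dvd_mono[OF _ A, of "m + 1"] I by simp
        ultimately have "monom 1 (m + 1) dvd g 0" by (simp add: dvd_add_left_iff)
        then have g0: "g 0 = 0" by (rule monom_dvd_small_degree) (use g(1)[rule_format, of 0] in simp)
        have e: "2 * (I - c) + (J + c) = 2 * I + J - c" using c I by linarith
        have A': "monom 1 (2 * (I - c) + (J + c)) dvd ?A"
          using A unfolding e by (simp only: g0 add_0_left has_ord_mult_dvd[OF p(1)])
        have "monom 1 I dvd ?A" by (rule monom_dvd_mono[OF _ A']) (use c I in linarith)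
        then have "monom 1 I dvd \<phi> * ?B" using B by (simp add: dvd_add_right_iff)
        then have "monom 1 (I - c) dvd ?B" by (simp only: has_ord_mult_dvd[OF p(1)])
        with g0 A' show "g 0 = 0 \<and> monom 1 (2 * (I - c) + (J + c)) dvd ?A \<and> monom 1 (I - c) dvd ?B"
          by blast
      qed
      with p(1) show ?thesis unfolding c_def by (intro exI conjI)
    next
      case True
      then have c: "2 * c = m" "(Suc m + 1) div 2 = c + 1" "c \<ge> 1"
        using Suc.prems(1) by (auto simp: c_def elim!: evenE)
      have b: "bidim (Suc m) (Suc D) \<ge> 2 * m + 5" by (cases D) (simp_all add: bidim_Suc)
      \<comment> \<open>Here \<open>2c = m\<close>, so one further condition has to go for the total
        to fall by \<open>m + 1\<close>; it is the one lost in
        \<open>det0_even_step\<close>.\<close>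
      have IJ: "3 * (I - c) + (J + c - 1) = bidim (Suc m) (Suc D)" using dim c I by linarith
      have "\<exists>\<phi>::'a poly. has_ord \<phi> (c + 1) \<and>
        det0 (Suc m) (Suc D) \<phi> (2 * (I - c) + (J + c - 1)) (I - c)"
      proof (rule Suc.IH[of "Suc m" "I - c" "J + c - 1", unfolded c(2), OF _ IJ])
        show "I - c + (c + 1) \<le> Suc m + 1" if "D = 0"
          using Suc.prems(4) True that I c by simp
        show "I - c \<le> Suc m + 1" if "even (Suc m)" using True that by simp
      qed simp
      then obtain \<phi> :: "'a poly" where
        p: "has_ord \<phi> (c + 1)" "det0 (Suc m) (Suc D) \<phi> (2 * (I - c) + (J + c - 1)) (I - c)"
        by (elim exE conjE)
      have e: "2 * (I - c) + (J + c - 1) = c + (2 * (I - c) + J) - 1"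
        "2 * I + J = 2 * c + (2 * (I - c) + J)" "I = I - c + c" using c I by linarith+
      have "\<exists>\<phi>'::'a poly. has_ord \<phi>' c \<and>
          det0 m (Suc (Suc D)) \<phi>' (2 * c + (2 * (I - c) + J)) (I - c + c)"
      proof (rule det0_even_step[OF p(1) _ refl])
        show "m = 2 * c" using c by simp
        show "2 \<le> I - c + J" using dim b c I by linarith
        show "det0 (Suc m) (Suc D) \<phi> (c + (2 * (I - c) + J) - 1) (I - c)" using p(2) by (simp only: e(1))
      qed
      then show ?thesis using e c_def by metis
    qed
  qed
qed

text \<open>Collects the two constructions, with arcs of order \<open>(m + 1) div 2\<close> and
  \<open>m + 1 - I\<close>, and lowers the order to the prescribed \<open>\<sigma>\<close>.\<close>

lemma arc_exact:
  assumes "m \<ge> 1" "3 * I + J = bidim m (Suc D)"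
    and "\<sigma> \<le> (m + 1) div 2 \<and> (D = 0 \<longrightarrow> I + (m + 1) div 2 \<le> m + 1) \<and> (D = 1 \<and> even m \<longrightarrow> I \<le> m + 1) \<or>
      2 * I \<le> m + 1 \<and> \<sigma> \<le> m + 1 - I"
  shows "\<exists>\<phi>::'a::field_char_0 poly. has_ord \<phi> \<sigma> \<and> det0 m (Suc D) \<phi> (2 * I + J) I"
proof -
  have "\<exists>c\<ge>\<sigma>. \<exists>\<phi>::'a poly. has_ord \<phi> c \<and> det0 m (Suc D) \<phi> (2 * I + J) I"
    using assms(3)
  proof
    assume a: "\<sigma> \<le> (m + 1) div 2 \<and> (D = 0 \<longrightarrow> I + (m + 1) div 2 \<le> m + 1) \<and> (D = 1 \<and> even m \<longrightarrow> I \<le> m + 1)"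
    have "\<exists>\<phi>::'a poly. has_ord \<phi> ((m + 1) div 2) \<and> det0 m (Suc D) \<phi> (2 * I + J) I"
      by (rule double_points_det0[OF assms(1,2)]) (use a in blast)+
    with a show ?thesis by (intro exI[of _ "(m + 1) div 2"] conjI) simp_all
  next
    assume a: "2 * I \<le> m + 1 \<and> \<sigma> \<le> m + 1 - I"
    then have "\<exists>\<phi>::'a poly. has_ord \<phi> (m + 1 - I) \<and> det0 m (Suc D) \<phi> (2 * I + J) I"
      by (intro few_double_points_det0[OF _ assms(2)]) simp
    with a show ?thesis by (intro exI[of _ "m + 1 - I"] conjI) simp_all
  qed
  then obtain c and \<phi> :: "'a poly" where c: "c \<ge> \<sigma>" "has_ord \<phi> c" "det0 m (Suc D) \<phi> (2 * I + J) I"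
    by (elim exE conjE)
  then have "\<forall>i<\<sigma>. coeff \<phi> i = 0" by (simp add: has_ord_def)
  with c(3) show ?thesis by (rule det0_perturb)
qed

text \<open>If there are too many conditions, some are dropped until the system is square; if there
  are too few, orders of vanishing along the arc are added. \<open>max s 2 - 1\<close> is the order
  that \<open>U_s\<close> prescribes, the values \<open>s = 1\<close> and \<open>s = 2\<close>
  describing the same clusters.\<close>

lemma arc_inj_surj:
  fixes s m I J :: nat
  assumes s: "s \<ge> 1" and m: "m \<ge> min (s + I) (2 * s)" and N: "3 * I + J \<ge> 2 * m + 3"
    and J: "4 * int J \<ge> int m ^ 2 - 4 * int m - 6"
    and exc: "\<not> (D = 1 \<and> even m \<and> I = m + 2 \<and> J = 0)"
  shows arc_inj: "bidim m (Suc D) \<le> 3 * I + J \<Longrightarrow>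
      \<exists>\<phi>::'a::field_char_0 poly. has_ord \<phi> (max s 2 - 1) \<and> det0 m (Suc D) \<phi> (2 * I + J) I"
    and arc_surj: "D \<ge> 1 \<Longrightarrow> 3 * I + J \<le> bidim m (Suc D) \<Longrightarrow>
      \<exists>\<phi>::'a::field_char_0 poly. has_ord \<phi> (max s 2 - 1) \<and>
        det0 m (Suc D) \<phi> (2 * I + (bidim m (Suc D) - 3 * I)) I"
proof -
  define \<sigma> where "\<sigma> = max s 2 - 1"
  have m1: "m \<ge> 1" using m s by auto
  \<comment> \<open>The available arcs have order \<open>(m + 1) div 2\<close>, or
    \<open>m + 1 - I\<close> if \<open>2 * I \<le> m + 1\<close>; the hypothesis on \<open>m\<close>
    makes one of them reach \<open>\<sigma>\<close>.\<close>
  have XY: "\<sigma> \<le> (m + 1) div 2 \<or> 2 * I \<le> m + 1 \<and> \<sigma> \<le> m + 1 - I"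
    using m s m1 unfolding \<sigma>_def by (auto simp: min_def max_def split: if_splits)
  show "\<exists>\<phi>::'a poly. has_ord \<phi> (max s 2 - 1) \<and>
      det0 m (Suc D) \<phi> (2 * I + (bidim m (Suc D) - 3 * I)) I"
    if D: "D \<ge> 1" and le: "3 * I + J \<le> bidim m (Suc D)"
  proof -
    have "D = 1 \<Longrightarrow> bidim m (Suc D) = 3 * m + 6" by (simp add: bidim_Suc)
    then have "D = 1 \<and> even m \<longrightarrow> I \<le> m + 1" using le exc by auto
    then show ?thesis unfolding \<sigma>_def[symmetric] using XY D m1 le by (intro arc_exact) auto
  qed
  show "\<exists>\<phi>::'a poly. has_ord \<phi> (max s 2 - 1) \<and> det0 m (Suc D) \<phi> (2 * I + J) I"
    if ge: "bidim m (Suc D) \<le> 3 * I + J"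
  proof (cases D)
    case 0
    show ?thesis
    proof (cases "I \<le> m + 1")
      case True
      \<comment> \<open>An order \<open>\<sigma>\<close> larger than \<open>m + 1 - I\<close> is
        tolerable as long as enough conditions are left for \<open>g 1\<close>.\<close>
      have \<sigma>: "\<sigma> \<le> m + 1 - I \<or> \<sigma> + m + 2 \<le> 2 * I + J"
      proof (cases "s = 1 \<or> m < 2 * s")
        case True
        then show ?thesis using m N \<open>I \<le> m + 1\<close> m1 by (auto simp: \<sigma>_def min_def max_def split: if_splits)
      next
        case False
        then have s2: "s \<ge> 2" "m \<ge> 2 * s" "\<sigma> = s - 1" using s by (auto simp: \<sigma>_def)
        obtain q where q: "q = (int m)\<^sup>2" by simp
        \<comment> \<open>With \<open>m^2 \<ge> 6m - 9\<close> the quadratic bound on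
          \<open>J\<close> becomes \<open>4J \<ge> 2m - 15\<close>, which is enough for
          \<open>3 * \<sigma> \<le> m + 2 + J\<close> when \<open>2s \<le> m\<close>.\<close>
        have q6: "q - 6 * int m + 9 \<ge> 0"
        proof -
          have "q - 6 * int m + 9 = (int m - 3)\<^sup>2" by (simp add: q power2_eq_square algebra_simps)
          then show ?thesis by simp
        qed
        have "4 * int J \<ge> q - 4 * int m - 6" using J q by simp
        moreover have "int \<sigma> = int s - 1" "2 * int s \<le> int m" using s2 by auto
        ultimately have "3 * int \<sigma> \<le> int m + 2 + int J" using q6 by linarith
        then have "3 * \<sigma> \<le> m + 2 + J" by linarith
        then show ?thesis using True by linarith
      qed
      define \<tau> where "\<tau> = max \<sigma> (m + 1 - I)"
      have "det0 m (Suc D) (monom 1 \<tau> :: 'a poly) (2 * I + J) I"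
        unfolding 0 One_nat_def[symmetric] by (rule pencil_det0) (use True N \<sigma> in \<open>auto simp: \<tau>_def\<close>)
      then show ?thesis unfolding \<sigma>_def[symmetric]
        by (rule det0_perturb) (auto simp: \<tau>_def)
    next
      case False
      have "det0 m (Suc D) (monom 1 \<sigma> :: 'a poly) (2 * I + J) I" unfolding determined_def
      proof (intro allI impI, elim conjE)
        fix g :: "nat \<Rightarrow> 'a poly" and e :: nat
        assume g: "\<forall>e\<le>Suc D. degree (g e) \<le> m + e" "monom 1 (2 * I + J) dvd arc_val (Suc D) (monom 1 \<sigma>) g"
          "monom 1 I dvd arc_deriv (Suc D) (monom 1 \<sigma>) g" and e: "e \<le> Suc D"
        have "monom 1 I dvd g 1" using g(3) by (simp add: 0 arc_deriv_def)
        then have g1: "g 1 = 0" by (rule monom_dvd_small_degree) (use g(1)[rule_format, of 1] False in simp)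
        then have "monom 1 (2 * I + J) dvd g 0" using g(2) by (simp add: 0 arc_val_def)
        then have g0: "g 0 = 0" by (rule monom_dvd_small_degree) (use g(1)[rule_format, of 0] False in simp)
        have "e = 0 \<or> e = 1" using e 0 by linarith
        then show "g e = 0" using g0 g1 by blast
      qed
      then show ?thesis unfolding \<sigma>_def[symmetric] using has_ord_monom by (intro exI conjI)
    qed
  next
    case (Suc D')
    define b where "b = bidim m (Suc D)"
    have b1: "D = 1 \<Longrightarrow> b = 3 * m + 6" by (simp add: b_def bidim_Suc)
    \<comment> \<open>As many double points as fit into \<open>b\<close> conditions; simple orders
      fill the remainder. For \<open>D = 1\<close> and even \<open>m\<close> one stays below
      \<open>m + 2\<close>, where the induction fails; this costs one order of vanishing on the arc
      more, which is available outside the exceptional case.\<close>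
    define I' where "I' = (if D = 1 \<and> even m then min I (min (b div 3) (m + 1)) else min I (b div 3))"
    have I': "I' \<le> I" "3 * I' \<le> b" "D = 1 \<and> even m \<longrightarrow> I' \<le> m + 1"
      by (auto simp: I'_def min_def)
    have "\<exists>\<phi>::'a poly. has_ord \<phi> \<sigma> \<and> det0 m (Suc D) \<phi> (2 * I' + (b - 3 * I')) I'"
    proof (rule arc_exact[OF m1])
      show "3 * I' + (b - 3 * I') = bidim m (Suc D)" using I' b_def by simp
      show "\<sigma> \<le> (m + 1) div 2 \<and> (D = 0 \<longrightarrow> I' + (m + 1) div 2 \<le> m + 1) \<and> (D = 1 \<and> even m \<longrightarrow> I' \<le> m + 1) \<or>
        2 * I' \<le> m + 1 \<and> \<sigma> \<le> m + 1 - I'"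
        using XY I' Suc by auto
    qed
    moreover have "2 * I' + (b - 3 * I') \<le> 2 * I + J"
    proof (cases "I' = I")
      case True then show ?thesis using ge b_def I' by linarith
    next
      case False
      show ?thesis
      proof (cases "D = 1 \<and> even m \<and> m + 1 < b div 3")
        case True
        then have "b = 3 * m + 6" "I' = m + 1" "I \<ge> m + 2" using b1 False by (auto simp: I'_def)
        then show ?thesis using exc ge True unfolding b_def[symmetric] by auto
      next
        case f: False
        then have "I' = b div 3" "I \<ge> b div 3 + 1" using False by (auto simp: I'_def min_def split: if_splits)
        then show ?thesis by linarith
      qed
    qed
    ultimately show ?thesis unfolding \<sigma>_def[symmetric] using det0_mono I'(1) by meson
  qed
qed

section \<open>From one multiple point to several points on a common arc\<close>

lemma prod_linear_degree:
  "finite S \<Longrightarrow> (\<Prod>k\<in>S. [:0, 1:] ^ n k) = monom (1::'a::field) (\<Sum>k\<in>S. n k)"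
  by (simp add: power_sum monom_altdef)

text \<open>The condition \<open>poly \<phi> (v k) \<noteq> 0\<close> keeps the origins of the other
  clusters off the exceptional curve \<open>u = 0\<close>, so that they are points of the plane
  different from the origin of the first cluster.\<close>

lemma arc_family:
  fixes \<phi>1 \<phi>2 :: "'a::field_char_0 poly" and i j :: "nat \<Rightarrow> nat" and \<rho> :: nat
  defines "I \<equiv> \<Sum>k=1..\<rho>. i k" and "J \<equiv> \<Sum>k=1..\<rho>. j k"
  assumes ord: "has_ord \<phi>1 \<sigma>" "has_ord \<phi>2 \<sigma>"
    and det: "determined m D1 \<phi>1 (monom 1 (2 * I + J)) (monom 1 I) N1"
      "determined m D2 \<phi>2 (monom 1 (2 * I + J)) (monom 1 I) N2"
  shows "\<exists>(\<phi>::'a poly) v. has_ord \<phi> \<sigma> \<and> v 1 = 0 \<and> inj_on v {1..\<rho>} \<and> (\<forall>k\<in>{2..\<rho>}. poly \<phi> (v k) \<noteq> 0) \<and>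
    (\<forall>(D, N)\<in>{(D1, N1), (D2, N2)}. determined m D \<phi> (\<Prod>k=1..\<rho>. [:- v k, 1:] ^ (2 * i k + j k))
       (\<Prod>k=1..\<rho>. [:- v k, 1:] ^ i k) N)"
proof -
  interpret function_ring "range poly :: ('a \<Rightarrow> 'a) set" by (rule function_ring_poly)
  define f where "f t = \<phi>1 + smult t (\<phi>2 - \<phi>1)" for t
  have ff: "poly_family f" unfolding f_def[abs_def]
    by (intro poly_family_add poly_family_const poly_family_smult id_range_poly)
  have fd: "degree (f t) \<le> max (degree \<phi>1) (degree \<phi>2)" for t
    unfolding f_def
    by (intro degree_add_le order.trans[OF degree_smult_le] degree_diff_le) auto
  have fin1: "finite {t. \<not> determined m D1 (f t) (monom 1 (2 * I + J)) (monom 1 I) N1}"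
    by (rule determined_cofinite[OF ff poly_family_const poly_family_const fd, where ?t0.0 = 0])
      (use det in \<open>simp_all add: f_def\<close>)
  have fin2: "finite {t. \<not> determined m D2 (f t) (monom 1 (2 * I + J)) (monom 1 I) N2}"
    by (rule determined_cofinite[OF ff poly_family_const poly_family_const fd, where ?t0.0 = 1])
      (use det in \<open>simp_all add: f_def\<close>)
  \<comment> \<open>\<open>poly p t\<close> is the coefficient of \<open>v^\<sigma>\<close> in
    \<open>f t\<close>, nonzero at \<open>t = 0\<close> and at \<open>t = 1\<close>.\<close>
  define p where "p = [:coeff \<phi>1 \<sigma>, coeff \<phi>2 \<sigma> - coeff \<phi>1 \<sigma>:]"
  have "finite {t. poly p t = 0}" using ord by (intro poly_roots_finite) (auto simp: p_def has_ord_def)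
  then obtain t where t: "poly p t \<noteq> 0" "determined m D1 (f t) (monom 1 (2 * I + J)) (monom 1 I) N1"
     "determined m D2 (f t) (monom 1 (2 * I + J)) (monom 1 I) N2"
    using infinite_field_avoid[of "{t. poly p t = 0} \<union> ({t. \<not> determined m D1 (f t) (monom 1 (2 * I + J)) (monom 1 I) N1} \<union>
      {t. \<not> determined m D2 (f t) (monom 1 (2 * I + J)) (monom 1 I) N2})"] fin1 fin2 by auto
  define \<phi> where "\<phi> = f t"
  have ordp: "has_ord \<phi> \<sigma>"
    using t(1) ord by (simp add: has_ord_def \<phi>_def f_def p_def algebra_simps)
  \<comment> \<open>Distinct numbers in characteristic zero, with \<open>a 1 = 0\<close>: the points
    \<open>\<tau> * a k\<close> collide at \<open>\<tau> = 0\<close> and the first one never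
    moves.\<close>
  define a :: "nat \<Rightarrow> 'a" where "a k = of_nat (k - 1)" for k
  define M where "M w \<tau> = (\<Prod>k=1..\<rho>. [:- (\<tau> * a k), 1:] ^ w k)" for w :: "nat \<Rightarrow> nat" and \<tau>
  have fM: "poly_family (M w)" for w
  proof -
    have "(\<lambda>\<tau>. - (\<tau> * a k)) \<in> range poly" for k
      by (rule image_eqI[of _ _ "[:0, - a k:]"]) (auto simp: fun_eq_iff)
    then show ?thesis unfolding M_def[abs_def]
      by (intro poly_family_prod poly_family_power poly_family_pCons poly_family_const)
  qed
  have M0: "M (\<lambda>k. 2 * i k + j k) 0 = monom 1 (2 * I + J)" "M i 0 = monom 1 I"
    by (simp_all add: M_def prod_linear_degree I_def J_def sum.distrib sum_distrib_left)
  have fin4: "finite {\<tau>. \<not> determined m D \<phi> (M (\<lambda>k. 2 * i k + j k) \<tau>) (M i \<tau>) N}"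
    if "determined m D \<phi> (monom 1 (2 * I + J)) (monom 1 I) N" for D N
    by (rule determined_cofinite[OF poly_family_const fM fM order.refl, where ?t0.0 = 0])
      (use that M0 in simp_all)
  have "\<phi> \<noteq> 0" using ordp by (auto simp: has_ord_def)
  have fin3: "finite (\<Union>k\<in>{2..\<rho>}. {\<tau>. poly \<phi> (\<tau> * a k) = 0})"
  proof (intro finite_UN_I finite_atLeastAtMost)
    fix k assume "k \<in> {2..\<rho>}"
    then have "a k \<noteq> 0" by (auto simp: a_def)
    then have "{\<tau>. poly \<phi> (\<tau> * a k) = 0} \<subseteq> (\<lambda>x. x / a k) ` {x. poly \<phi> x = 0}"
      by (auto simp: image_iff intro!: exI[of _ "_ * a k"])
    then show "finite {\<tau>. poly \<phi> (\<tau> * a k) = 0}"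
      using poly_roots_finite[OF \<open>\<phi> \<noteq> 0\<close>] by (meson finite_imageI finite_subset)
  qed
  obtain \<tau> where \<tau>: "\<tau> \<noteq> 0" "determined m D1 \<phi> (M (\<lambda>k. 2 * i k + j k) \<tau>) (M i \<tau>) N1"
    "determined m D2 \<phi> (M (\<lambda>k. 2 * i k + j k) \<tau>) (M i \<tau>) N2" "\<forall>k\<in>{2..\<rho>}. poly \<phi> (\<tau> * a k) \<noteq> 0"
    using infinite_field_avoid[of "insert 0 ({\<tau>. \<not> determined m D1 \<phi> (M (\<lambda>k. 2 * i k + j k) \<tau>) (M i \<tau>) N1} \<union>
      {\<tau>. \<not> determined m D2 \<phi> (M (\<lambda>k. 2 * i k + j k) \<tau>) (M i \<tau>) N2} \<union>
      (\<Union>k\<in>{2..\<rho>}. {\<tau>. poly \<phi> (\<tau> * a k) = 0}))"] fin4[of D1 N1] fin4[of D2 N2] fin3 t(2,3)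
    by (auto simp: \<phi>_def)
  have "inj_on (\<lambda>k. \<tau> * a k) {1..\<rho>}" using \<tau>(1) by (auto simp: inj_on_def a_def)
  moreover have "\<tau> * a 1 = 0" by (simp add: a_def)
  moreover have "\<forall>(D, N)\<in>{(D1, N1), (D2, N2)}. determined m D \<phi>
      (\<Prod>k=1..\<rho>. [:- (\<tau> * a k), 1:] ^ (2 * i k + j k)) (\<Prod>k=1..\<rho>. [:- (\<tau> * a k), 1:] ^ i k) N"
    using \<tau>(2,3) unfolding M_def by blast
  ultimately show ?thesis using \<tau>(4) ordp
    by (intro exI[of _ \<phi>] exI[of _ "\<lambda>k. \<tau> * a k"] conjI)
qed

section \<open>Polynomials in two variables\<close>

definition is_hom :: "('b::comm_ring_1 \<Rightarrow> 'c::comm_ring_1) \<Rightarrow> bool" where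
  "is_hom h \<longleftrightarrow> h 0 = 0 \<and> h 1 = 1 \<and> (\<forall>a b. h (a + b) = h a + h b) \<and> (\<forall>a b. h (a * b) = h a * h b)"

lemma is_homD:
  assumes "is_hom h"
  shows is_hom_0: "h 0 = 0" and is_hom_1: "h 1 = 1" and is_hom_add: "h (a + b) = h a + h b"
    and is_hom_mult: "h (a * b) = h a * h b" and is_hom_power: "h (a ^ n) = h a ^ n"
    and is_hom_sum: "h (sum f S) = (\<Sum>x\<in>S. h (f x))"
    and is_hom_diff: "h (a - b) = h a - h b" and is_hom_uminus: "h (- a) = - h a"
proof -
  show *: "h 0 = 0" "h 1 = 1" "h (a + b) = h a + h b" "h (a * b) = h a * h b" for a b
    using assms by (auto simp: is_hom_def)
  show "h (a ^ n) = h a ^ n" by (induction n) (simp_all add: *)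
  show "h (sum f S) = (\<Sum>x\<in>S. h (f x))" by (induction S rule: infinite_finite_induct) (simp_all add: *)
  show u: "h (- a) = - h a" for a using *(3)[of a "- a"] by (simp add: * eq_neg_iff_add_eq_0 add.commute)
  show "h (a - b) = h a - h b" using *(3)[of a "- b"] u by simp
qed

lemma is_hom_poly_map:
  assumes "is_hom h"
  shows "is_hom (\<lambda>p. poly (map_poly h p) X)"
proof -
  note h = is_homD[OF assms]
  have "map_poly h (p + q) = map_poly h p + map_poly h q" for p q
    by (rule poly_eqI) (simp add: coeff_map_poly h)
  moreover have "map_poly h (p * q) = map_poly h p * map_poly h q" for p q
    by (rule poly_eqI) (simp add: coeff_map_poly coeff_mult h)
  moreover have "map_poly h 1 = 1" by (simp add: map_poly_1 h)
  ultimately show ?thesis by (simp add: is_hom_def)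
qed

lemma is_hom_comp: "is_hom h \<Longrightarrow> is_hom k \<Longrightarrow> is_hom (\<lambda>x. h (k x))"
  by (simp add: is_hom_def)

text \<open>A common form of three evaluations, distinguished by the map \<open>c\<close> on
  constants: in the function field (\<open>ev2\<close>), in bivariate polynomials
  (\<open>bsub\<close>) and along a parametrised curve (\<open>pev\<close>).\<close>

definition bev :: "('a::comm_ring_1 \<Rightarrow> 'b::comm_ring_1) \<Rightarrow> 'a poly poly \<Rightarrow> 'b \<Rightarrow> 'b \<Rightarrow> 'b" where
  "bev c F X Y = poly (map_poly (\<lambda>p. poly (map_poly c p) X) F) Y"

abbreviation (input) cst :: "'a::zero \<Rightarrow> 'a poly poly" where "cst a \<equiv> [:[:a:]:]"
abbreviation (input) px :: "'a::comm_ring_1 poly poly" where "px \<equiv> [:[:0, 1:]:]"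
abbreviation (input) py :: "'a::comm_ring_1 poly poly" where "py \<equiv> [:0, 1:]"

lemma is_hom_bev: "is_hom c \<Longrightarrow> is_hom (\<lambda>F. bev c F X Y)"
  unfolding bev_def by (intro is_hom_poly_map)

lemma bev_gens:
  assumes "is_hom c"
  shows "bev c (cst a) X Y = c a" "bev c px X Y = X" "bev c py X Y = Y"
  using assms by (simp_all add: bev_def map_poly_pCons is_homD)

lemma bipoly_decomp: "\<exists>A B. F = cst (coeff (coeff F 0) 0) + px * A + py * B"
proof -
  obtain p Q where F: "F = pCons p Q" by (cases F)
  obtain a q where p: "p = pCons a q" by (cases p)
  have "F = cst a + px * [:q:] + py * Q" unfolding F p by simp
  moreover have c: "coeff (coeff F 0) 0 = a" by (simp add: F p)
  ultimately show ?thesis unfolding c by blast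
qed

text \<open>Constants and the two variables generate the ring; identities between evaluations and
  substitutions are checked on these generators.\<close>

lemma bipoly_hom_eqI:
  assumes "is_hom h" "is_hom k" "\<And>a. h (cst a) = k (cst a)" "h px = k px" "h py = k py"
  shows "h F = k F"
proof (induction F)
  case 0
  then show ?case using assms by (simp add: is_homD)
next
  case (pCons p F)
  have "h [:p:] = k [:p:]"
  proof (induction p)
    case 0
    then show ?case using assms by (simp add: is_homD)
  next
    case (pCons a p)
    have "[:pCons a p:] = cst a + px * [:p:]" by simp
    then show ?case using assms pCons.IH by (simp only: is_homD[OF assms(1)] is_homD[OF assms(2)])
  qed
  moreover have "pCons p F = [:p:] + py * F" by simp
  ultimately show ?case using assms pCons.IH by (simp only: is_homD[OF assms(1)] is_homD[OF assms(2)])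
qed

definition bsub :: "'a::comm_ring_1 poly poly \<Rightarrow> 'a poly poly \<Rightarrow> 'a poly poly \<Rightarrow> 'a poly poly" where
  "bsub F A B = bev (\<lambda>a. cst a) F A B"

lemma is_hom_cst: "is_hom (\<lambda>a::'a::comm_ring_1. cst a)"
  by (simp add: is_hom_def one_pCons)

lemma is_hom_bsub: "is_hom (\<lambda>F. bsub F A B)"
  unfolding bsub_def by (rule is_hom_bev[OF is_hom_cst])

lemma bsub_gens: "bsub (cst a) A B = cst a" "bsub px A B = A" "bsub py A B = B"
  unfolding bsub_def by (rule bev_gens[OF is_hom_cst])+

lemma bev_bsub: "is_hom c \<Longrightarrow> bev c (bsub F A B) X Y = bev c F (bev c A X Y) (bev c B X Y)"
  by (rule bipoly_hom_eqI[of "\<lambda>F. bev c (bsub F A B) X Y"])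
    (simp_all add: is_hom_bev is_hom_comp[OF is_hom_bev is_hom_bsub] bsub_gens bev_gens)

lemma bsub_bsub: "bsub (bsub F A B) A' B' = bsub F (bsub A A' B') (bsub B A' B')"
  unfolding bsub_def[of _ A' B'] bsub_def[of F "bev _ _ _ _"] by (rule bev_bsub[OF is_hom_cst])

lemma bsub_id: "bsub F px py = F"
  by (rule bipoly_hom_eqI[OF is_hom_bsub]) (simp_all add: bsub_gens is_hom_def)

section \<open>Evaluation in the function field and algebraic independence\<close>

lemma is_hom_cnst: "is_hom (cnst :: 'a::idom \<Rightarrow> _)"
  by (simp add: is_hom_def cnst_def one_pCons[symmetric] flip: to_fract_add to_fract_mult)

lemma inj_cnst: "cnst a = cnst b \<longleftrightarrow> a = b"
  by (simp add: cnst_def)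

lemma ev2_bev: "ev2 F X Y = bev cnst F X Y"
  by (simp add: ev2_def bev_def)

lemmas ev2_hom = is_homD[OF is_hom_bev[OF is_hom_cnst], folded ev2_bev]
lemmas ev2_gens = bev_gens[OF is_hom_cnst, folded ev2_bev]
lemmas ev2_bsub = bev_bsub[OF is_hom_cnst, folded ev2_bev]

lemma ev2_xx_yy: "ev2 F xx yy = to_fract F"
  unfolding ev2_bev
  by (rule bipoly_hom_eqI[OF is_hom_bev[OF is_hom_cnst]])
    (simp_all add: bev_gens[OF is_hom_cnst] xx_def yy_def is_hom_def, simp add: cnst_def)

text \<open>Algebraic independence over the ground field. It allows an identity between rational
  functions to be read as an identity between polynomials, where coefficients can be
  compared.\<close>

definition indep :: "'a::idom ratfun \<Rightarrow> 'a ratfun \<Rightarrow> bool" where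
  "indep X Y \<longleftrightarrow> (\<forall>F. ev2 F X Y = 0 \<longrightarrow> F = 0)"

lemma indep_eq_iff: "indep X Y \<Longrightarrow> ev2 F X Y = ev2 G X Y \<longleftrightarrow> F = G"
  by (metis ev2_hom(7) eq_iff_diff_eq_0 indep_def)

lemma indep_nonzero: "indep X Y \<Longrightarrow> ev2 F X Y = 0 \<longleftrightarrow> F = 0"
  using indep_eq_iff[of X Y F 0] by (simp add: ev2_hom)

lemma indep_xx_yy: "indep xx yy"
  by (simp add: indep_def ev2_xx_yy)

lemma indep_coords_nonzero:
  assumes "indep X Y" shows "X \<noteq> 0" "Y \<noteq> 0"
  using indep_nonzero[OF assms, of px] indep_nonzero[OF assms, of py] by (simp_all add: ev2_gens)

text \<open>A substitution with a left inverse is injective on polynomials, so it takes independent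
  coordinates to independent ones.\<close>

lemma indep_bsub:
  assumes "indep X Y" "\<And>F. bsub (bsub F A B) A' B' = F"
  shows "indep (ev2 A X Y) (ev2 B X Y)"
  unfolding indep_def
proof (intro allI impI)
  fix F assume "ev2 F (ev2 A X Y) (ev2 B X Y) = 0"
  then have "bsub F A B = 0" using assms(1) by (simp add: ev2_bsub[symmetric] indep_nonzero)
  then have "bsub (bsub F A B) A' B' = 0" by (simp add: is_homD[OF is_hom_bsub])
  then show "F = 0" by (simp add: assms(2))
qed

lemma indep_translate:
  assumes "indep X Y" shows "indep (X - cnst a) (Y - cnst b)"
proof -
  have "bsub (bsub F (px - cst a) (py - cst b)) (px + cst a) (py + cst b) = F" for F :: "'a poly poly"
    by (simp only: bsub_bsub is_homD[OF is_hom_bsub] bsub_gens add_diff_cancel_right' bsub_id)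
  from indep_bsub[OF assms this] show ?thesis by (simp only: ev2_hom ev2_gens)
qed

lemma indep_swap: "indep X Y \<Longrightarrow> indep Y X"
  using indep_bsub[of X Y py px py px] by (simp only: bsub_bsub bsub_gens bsub_id ev2_gens)

text \<open>The exponent of \<open>x\<close>, the inner variable, comes first.\<close>

definition bcoeff :: "'a::zero poly poly \<Rightarrow> nat \<Rightarrow> nat \<Rightarrow> 'a" where
  "bcoeff F i j = coeff (coeff F j) i"

lemma bipoly_eqI: "(\<And>i j. bcoeff F i j = bcoeff G i j) \<Longrightarrow> F = G"
  by (simp add: bcoeff_def poly_eq_iff)

lemma bcoeff_simps [simp]:
  "bcoeff 0 i j = 0" "bcoeff (F + G) i j = bcoeff F i j + bcoeff G i j"
  "bcoeff (F - G) i j = bcoeff F i j - bcoeff (G :: 'a::comm_ring_1 poly poly) i j"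
  for F G :: "'a::comm_ring_1 poly poly"
  by (simp_all add: bcoeff_def)

lemma bcoeff_sum: "bcoeff (sum f S) i j = (\<Sum>x\<in>S. bcoeff (f x) i j)"
  by (simp add: bcoeff_def coeff_sum)

lemma bmonom_eq: "cst (a::'a::comm_ring_1) * px ^ i * py ^ j = monom (monom a i) j"
proof -
  have x: "px ^ i = [:monom (1::'a) i:]" by (induction i) (simp_all add: one_pCons monom_Suc monom_0)
  have y: "py ^ j = monom (1::'a poly) j" by (simp add: monom_altdef)
  show ?thesis unfolding x y by (simp add: smult_monom)
qed

lemma bcoeff_monom: "bcoeff (monom (monom a i) j) i' j' = (if i' = i \<and> j' = j then a else 0)"
  by (simp add: bcoeff_def)

lemma bcoeff_cst: "bcoeff (cst a) i j = (if i = 0 \<and> j = 0 then a else 0)"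
  by (simp add: bcoeff_def coeff_pCons split: nat.split)

lemma bcoeff_mult: "bcoeff (F * G) a b = (\<Sum>j\<le>b. \<Sum>i\<le>a. bcoeff F i j * bcoeff G (a - i) (b - j))"
  by (simp add: bcoeff_def coeff_mult coeff_sum)

lemma bcoeff_0_0_mult: "bcoeff (F * G) 0 0 = bcoeff F 0 0 * bcoeff G 0 0"
  by (simp add: bcoeff_mult)

lemma bcoeff_finite: "\<exists>N. \<forall>i j. bcoeff F i j \<noteq> 0 \<longrightarrow> i \<le> N \<and> j \<le> N"
proof -
  define N where "N = degree F + (\<Sum>j\<le>degree F. degree (coeff F j))"
  have "i \<le> N \<and> j \<le> N" if "bcoeff F i j \<noteq> 0" for i j
  proof -
    have "j \<le> degree F" using that by (metis bcoeff_def coeff_0 le_degree)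
    moreover have "i \<le> degree (coeff F j)" using that by (simp add: bcoeff_def le_degree)
    moreover have "degree (coeff F j) \<le> (\<Sum>j\<le>degree F. degree (coeff F j))"
      by (rule member_le_sum) (use \<open>j \<le> degree F\<close> in auto)
    ultimately show ?thesis by (simp add: N_def)
  qed
  then show ?thesis by blast
qed

lemma bipoly_as_sum:
  assumes "\<And>i j. bcoeff F i j \<noteq> 0 \<Longrightarrow> (i, j) \<in> S" "finite S"
  shows "F = (\<Sum>(i, j)\<in>S. cst (bcoeff F i j) * px ^ i * py ^ j)"
proof (rule bipoly_eqI)
  fix a b
  have "bcoeff (\<Sum>(i, j)\<in>S. cst (bcoeff F i j) * px ^ i * py ^ j) a b =
      (\<Sum>s\<in>S. if s = (a, b) then bcoeff F a b else 0)"
    unfolding bcoeff_sum bmonom_eq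
    by (rule sum.cong) (auto simp: bcoeff_monom split: if_splits)
  also have "\<dots> = bcoeff F a b" using assms by auto
  finally show "bcoeff F a b = bcoeff (\<Sum>(i, j)\<in>S. cst (bcoeff F i j) * px ^ i * py ^ j) a b" by simp
qed

lemma bipoly_sumE:
  obtains S where "finite S" "\<And>i j. bcoeff F i j \<noteq> 0 \<longleftrightarrow> (i, j) \<in> S"
    "F = (\<Sum>(i, j)\<in>S. cst (bcoeff F i j) * px ^ i * py ^ j)"
proof -
  obtain N where N: "\<And>i j. bcoeff F i j \<noteq> 0 \<Longrightarrow> i \<le> N \<and> j \<le> N" using bcoeff_finite[of F] by blast
  define S where "S = {(i, j). bcoeff F i j \<noteq> 0}"
  have "S \<subseteq> {..N} \<times> {..N}" using N by (auto simp: S_def)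
  then have S: "finite S" by (rule finite_subset) simp
  have i: "bcoeff F i j \<noteq> 0 \<longleftrightarrow> (i, j) \<in> S" for i j by (simp add: S_def)
  have "F = (\<Sum>(i, j)\<in>S. cst (bcoeff F i j) * px ^ i * py ^ j)"
    by (rule bipoly_as_sum[OF _ S]) (simp add: i)
  with S i show thesis by (rule that)
qed

definition ordge :: "nat \<Rightarrow> 'a::zero poly poly \<Rightarrow> bool" where
  "ordge n F \<longleftrightarrow> (\<forall>i j. i + j < n \<longrightarrow> bcoeff F i j = 0)"

lemma px_power_dvd_iff: "px ^ n dvd F \<longleftrightarrow> (\<forall>i j. i < n \<longrightarrow> bcoeff F i j = 0)"
  for F :: "'a::idom poly poly"
proof -
  have "px ^ n = [:monom (1::'a) n:]" by (induction n) (simp_all add: one_pCons monom_Suc monom_0)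
  then show ?thesis by (auto simp: const_poly_dvd_iff monom_1_dvd_iff' bcoeff_def)
qed

lemma py_power_dvd_iff: "py ^ n dvd F \<longleftrightarrow> (\<forall>i j. j < n \<longrightarrow> bcoeff F i j = 0)"
  for F :: "'a::idom poly poly"
proof -
  have "py ^ n = monom (1::'a poly) n" by (simp add: monom_altdef)
  then have "py ^ n dvd F \<longleftrightarrow> (\<forall>j<n. coeff F j = 0)" by (simp only: monom_1_dvd_iff')
  moreover have "coeff F j = 0 \<longleftrightarrow> (\<forall>i. bcoeff F i j = 0)" for j
    unfolding bcoeff_def by (simp add: poly_eq_iff)
  ultimately show ?thesis by blast
qed

lemma bcoeff_swap: "bcoeff (bsub F py px) i j = bcoeff F j i"
proof -
  obtain S where S: "finite S" "\<And>i j. bcoeff F i j \<noteq> 0 \<longleftrightarrow> (i, j) \<in> S"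
    "F = (\<Sum>(i, j)\<in>S. cst (bcoeff F i j) * px ^ i * py ^ j)" by (rule bipoly_sumE[where F = F]) (rule that)
  have "bsub F py px = (\<Sum>(i, j)\<in>S. cst (bcoeff F i j) * px ^ j * py ^ i)"
    by (subst S(3)) (simp add: is_homD[OF is_hom_bsub] bsub_gens case_prod_unfold mult_ac del: mult_pCons_left mult_pCons_right)
  also have "bcoeff \<dots> i j = (\<Sum>s\<in>S. if s = (j, i) then bcoeff F j i else 0)"
    unfolding bmonom_eq bcoeff_sum by (rule sum.cong) (auto simp: bcoeff_monom split: if_splits)
  also have "\<dots> = bcoeff F j i" using S by auto
  finally show ?thesis .
qed

text \<open>The monomial \<open>x^i y^j\<close> becomes \<open>x^(i+j) y^j\<close>, so no two
  monomials are ever merged.\<close>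

lemma bcoeff_blow: "bcoeff (bsub F px (px * py)) a b = (if b \<le> a then bcoeff F (a - b) b else 0)"
proof -
  obtain S where S: "finite S" "\<And>i j. bcoeff F i j \<noteq> 0 \<longleftrightarrow> (i, j) \<in> S"
    "F = (\<Sum>(i, j)\<in>S. cst (bcoeff F i j) * px ^ i * py ^ j)" by (rule bipoly_sumE[where F = F]) (rule that)
  have "bsub F px (px * py) = (\<Sum>(i, j)\<in>S. cst (bcoeff F i j) * px ^ (i + j) * py ^ j)"
    by (subst S(3)) (simp add: is_homD[OF is_hom_bsub] bsub_gens case_prod_unfold mult_ac power_add
        power_mult_distrib del: mult_pCons_left mult_pCons_right)
  also have "bcoeff \<dots> a b = (\<Sum>s\<in>S. if b \<le> a \<and> s = (a - b, b) then bcoeff F (a - b) b else 0)"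
    unfolding bmonom_eq bcoeff_sum by (rule sum.cong) (auto simp: bcoeff_monom split: if_splits)
  also have "\<dots> = (if b \<le> a then bcoeff F (a - b) b else 0)" using S by auto
  finally show ?thesis .
qed

section \<open>Virtual transforms along a cluster\<close>

definition exc_coord :: "bool \<Rightarrow> 'a::comm_ring_1 poly poly" where
  "exc_coord e = (if e then px else py)"

text \<open>The total transform of a polynomial in a chart of the blow-up, recentred at the point
  with parameter \<open>\<gamma>\<close>. It is dual to \<open>chart_next\<close>, which changes the
  coordinates instead.\<close>

definition chart_sub :: "bool \<Rightarrow> 'a::comm_ring_1 \<Rightarrow> 'a poly poly \<Rightarrow> 'a poly poly" where
  "chart_sub e \<gamma> F = (if e then bsub F px (px * (py + cst \<gamma>)) else bsub F (py * (px + cst \<gamma>)) py)"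

definition chart_next :: "bool \<Rightarrow> 'a::idom \<Rightarrow> 'a ratfun \<times> 'a ratfun \<Rightarrow> 'a ratfun \<times> 'a ratfun" where
  "chart_next e \<gamma> XY = (if e then (fst XY, snd XY / fst XY - cnst \<gamma>) else (fst XY / snd XY - cnst \<gamma>, snd XY))"

lemma is_hom_chart_sub: "is_hom (chart_sub e \<gamma>)"
  unfolding chart_sub_def[abs_def] by (cases e) (simp_all add: is_hom_bsub)

lemma chart_sub_cst: "chart_sub e \<gamma> (cst a) = cst a"
  by (simp add: chart_sub_def bsub_gens)

lemma ev2_chart_sub:
  assumes "fst XY \<noteq> 0" "snd XY \<noteq> 0"
  shows "ev2 (chart_sub e \<gamma> F) (fst (chart_next e \<gamma> XY)) (snd (chart_next e \<gamma> XY)) = ev2 F (fst XY) (snd XY)"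
  using assms by (simp add: chart_sub_def chart_next_def ev2_bsub ev2_hom ev2_gens
      del: mult_pCons_left mult_pCons_right add_pCons)

lemma chart_sub_False: "chart_sub False \<gamma> F = bsub (chart_sub True \<gamma> (bsub F py px)) py px"
  unfolding chart_sub_def if_True if_False
  by (simp only: bsub_bsub bsub_gens is_homD[OF is_hom_bsub])

text \<open>The multiplicity of a curve at a point is the order of its total transform along the
  exceptional curve. By \<open>bcoeff_blow\<close> the exponent of the exceptional equation records
  the degree \<open>i + j\<close>; recentring at \<open>\<gamma>\<close> is an automorphism that
  fixes this equation.\<close>

lemma exc_coord_power_dvd_chart_sub:
  fixes F :: "'a::idom poly poly"
  shows "exc_coord e ^ n dvd chart_sub e \<gamma> F \<longleftrightarrow> ordge n F"
proof -
  have dvd: "px ^ n dvd bsub G px (py + cst \<gamma>)" if "px ^ n dvd G" for G \<gamma>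
  proof -
    obtain H where "G = px ^ n * H" using \<open>px ^ n dvd G\<close> by (elim dvdE)
    then have "bsub G px (py + cst \<gamma>) = px ^ n * bsub H px (py + cst \<gamma>)"
      by (simp only: is_homD[OF is_hom_bsub] bsub_gens)
    then show ?thesis by (metis dvd_triv_left)
  qed
  have T: "px ^ n dvd chart_sub True \<gamma> F \<longleftrightarrow> ordge n F" for F
  proof -
    have e: "chart_sub True \<gamma> F = bsub (bsub F px (px * py)) px (py + cst \<gamma>)"
      unfolding chart_sub_def if_True by (simp only: bsub_bsub bsub_gens is_homD[OF is_hom_bsub])
    have "bsub (chart_sub True \<gamma> F) px (py + cst (- \<gamma>)) = bsub F px (px * py)"
    proof -
      have "py + cst (- \<gamma>) + cst \<gamma> = py" by simp
      then show ?thesis unfolding e by (simp only: bsub_bsub bsub_gens is_homD[OF is_hom_bsub])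
    qed
    then have "px ^ n dvd chart_sub True \<gamma> F \<longleftrightarrow> px ^ n dvd bsub F px (px * py)"
      using dvd[of "bsub F px (px * py)" \<gamma>] dvd[of "chart_sub True \<gamma> F" "- \<gamma>"] e by metis
    also have "\<dots> \<longleftrightarrow> ordge n F" unfolding px_power_dvd_iff bcoeff_blow ordge_def
    proof (intro iffI allI impI)
      fix i j assume a: "\<forall>a b. a < n \<longrightarrow> (if b \<le> a then bcoeff F (a - b) b else 0) = 0" "i + j < n"
      from a(1)[rule_format, of "i + j" j] a(2) show "bcoeff F i j = 0" by simp
    qed auto
    finally show ?thesis .
  qed
  show ?thesis
  proof (cases e)
    case True
    with T show ?thesis by (simp add: exc_coord_def)
  next
    case False
    have "py ^ n dvd chart_sub False \<gamma> F \<longleftrightarrow> px ^ n dvd chart_sub True \<gamma> (bsub F py px)"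
      unfolding chart_sub_False py_power_dvd_iff px_power_dvd_iff bcoeff_swap by blast
    also have "\<dots> \<longleftrightarrow> ordge n F" unfolding T ordge_def bcoeff_swap by (metis add.commute)
    finally show ?thesis using False by (simp add: exc_coord_def)
  qed
qed

text \<open>In a relation \<open>F(X, Y/X) = 0\<close> the denominators are cleared by a power of
  \<open>X\<close>, which keeps different monomials different.\<close>

lemma indep_chart_next:
  assumes "indep X Y" "chart_next e \<gamma> (X, Y) = (X', Y')"
  shows "indep X' Y'"
proof -
  have *: "indep X (Y / X)" if XY: "indep X Y" for X Y :: "'a ratfun"
    unfolding indep_def
  proof (intro allI impI)
    fix F assume F: "ev2 F X (Y / X) = 0"
    obtain S where S: "finite S" "\<And>i j. bcoeff F i j \<noteq> 0 \<longleftrightarrow> (i, j) \<in> S"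
      "F = (\<Sum>(i, j)\<in>S. cst (bcoeff F i j) * px ^ i * py ^ j)" by (rule bipoly_sumE[where F = F]) (rule that)
    \<comment> \<open>A crude bound for all exponents of \<open>Y/X\<close>; any larger number would
      do.\<close>
    define N where "N = (\<Sum>s\<in>S. snd s)"
    have N: "j \<le> N" if "(i, j) \<in> S" for i j
      unfolding N_def using member_le_sum[OF that, of snd] S(1) by simp
    define G where "G = (\<Sum>(i, j)\<in>S. cst (bcoeff F i j) * px ^ (i + N - j) * py ^ j)"
    have X: "X \<noteq> 0" using indep_coords_nonzero[OF XY] by simp
    have "ev2 G X Y = (\<Sum>(i, j)\<in>S. cnst (bcoeff F i j) * X ^ (i + N - j) * Y ^ j)"
      unfolding G_def by (simp only: ev2_hom ev2_gens case_prod_unfold)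
    also have "\<dots> = (\<Sum>(i, j)\<in>S. X ^ N * (cnst (bcoeff F i j) * X ^ i * (Y / X) ^ j))"
    proof (intro sum.cong refl)
      fix s assume "s \<in> S"
      obtain i j where s: "s = (i, j)" by (cases s)
      have "X ^ (i + N - j) * X ^ j = X ^ N * X ^ i"
        using N[of i j] \<open>s \<in> S\<close> s by (simp add: power_add[symmetric] add.commute)
      then have "X ^ (i + N - j) * Y ^ j = X ^ N * (X ^ i * (Y / X) ^ j)"
        using X by (simp add: power_divide field_simps)
      then show "(case s of (i, j) \<Rightarrow> cnst (bcoeff F i j) * X ^ (i + N - j) * Y ^ j) =
          (case s of (i, j) \<Rightarrow> X ^ N * (cnst (bcoeff F i j) * X ^ i * (Y / X) ^ j))"
        by (simp add: s mult_ac)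
    qed
    also have "\<dots> = X ^ N * ev2 F X (Y / X)"
      unfolding arg_cong[OF S(3), of "\<lambda>G. ev2 G X (Y / X)"]
      by (simp only: ev2_hom ev2_gens case_prod_unfold sum_distrib_left)
    finally have "G = 0" using F XY by (simp add: indep_nonzero)
    have "bcoeff F a b = 0" for a b
    proof (cases "(a, b) \<in> S")
      case True
      have "bcoeff G (a + N - b) b = (\<Sum>s\<in>S. if s = (a, b) then bcoeff F a b else 0)"
        unfolding G_def bmonom_eq bcoeff_sum
      proof (intro sum.cong refl)
        fix s assume "s \<in> S"
        obtain i j where s: "s = (i, j)" by (cases s)
        have "i + N - j = a + N - b \<and> j = b \<longleftrightarrow> s = (a, b)"
          using N[of i j] N[OF True] \<open>s \<in> S\<close> s by auto
        then show "bcoeff (case s of (i, j) \<Rightarrow> monom (monom (bcoeff F i j) (i + N - j)) j) (a + N - b) b =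
            (if s = (a, b) then bcoeff F a b else 0)" by (auto simp: s bcoeff_monom)
      qed
      then show ?thesis using True S(1) \<open>G = 0\<close> by simp
    qed (use S in blast)
    then show "F = 0" by (intro bipoly_eqI) simp
  qed
  show ?thesis
  proof (cases e)
    case True
    then show ?thesis using indep_translate[OF *[OF assms(1)], of 0 \<gamma>] assms(2)
      by (auto simp: chart_next_def is_homD[OF is_hom_cnst])
  next
    case False
    then show ?thesis
      using indep_swap[OF indep_translate[OF *[OF indep_swap[OF assms(1)]], of 0 \<gamma>]] assms(2)
      by (auto simp: chart_next_def is_homD[OF is_hom_cnst])
  qed
qed

text \<open>The virtual transform with respect to the multiplicity \<open>m\<close>, in a chart of the blow-up.\<close>

definition virt :: "bool \<Rightarrow> 'a::comm_ring_1 \<Rightarrow> nat \<Rightarrow> 'a poly poly \<Rightarrow> 'a poly poly" where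
  "virt e \<gamma> m F = (if e then map_poly (poly_shift m) (chart_sub e \<gamma> F) else poly_shift m (chart_sub e \<gamma> F))"

lemma bcoeff_virt: "bcoeff (virt e \<gamma> m F) a b =
    (if e then bcoeff (chart_sub e \<gamma> F) (a + m) b else bcoeff (chart_sub e \<gamma> F) a (b + m))"
  by (simp add: virt_def bcoeff_def coeff_map_poly coeff_poly_shift add.commute)

lemma bcoeff_px_power_mult: "bcoeff (px ^ n * F) a b = (if a < n then 0 else bcoeff F (a - n) b)"
  for F :: "'a::comm_ring_1 poly poly"
proof -
  have x: "px ^ n = [:monom (1::'a) n:]" by (induction n) (simp_all add: one_pCons monom_Suc monom_0)
  show ?thesis unfolding x by (simp add: bcoeff_def coeff_monom_mult)
qed

lemma bcoeff_py_power_mult: "bcoeff (py ^ n * F) a b = (if b < n then 0 else bcoeff F a (b - n))"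
  for F :: "'a::comm_ring_1 poly poly"
proof -
  have y: "py ^ n = monom (1::'a poly) n" by (simp add: monom_altdef)
  show ?thesis unfolding y by (simp add: bcoeff_def coeff_monom_mult)
qed

lemma chart_sub_eq_virt:
  fixes F :: "'a::idom poly poly"
  assumes "ordge m F"
  shows "chart_sub e \<gamma> F = exc_coord e ^ m * virt e \<gamma> m F"
proof -
  have "exc_coord e ^ m dvd chart_sub e \<gamma> F" using assms by (simp add: exc_coord_power_dvd_chart_sub)
  then obtain H where H: "chart_sub e \<gamma> F = exc_coord e ^ m * H" by (elim dvdE)
  have "virt e \<gamma> m F = H"
    by (rule bipoly_eqI, unfold bcoeff_virt H exc_coord_def)
      (simp add: bcoeff_px_power_mult bcoeff_py_power_mult)
  with H show ?thesis by simp
qed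

lemma bcoeff_cst_mult: "bcoeff (cst a * F) i j = a * bcoeff F i j"
  by (simp add: bcoeff_def)

lemma virt_add: "virt e \<gamma> m (F + G) = virt e \<gamma> m F + virt e \<gamma> m G"
  by (rule bipoly_eqI) (simp add: bcoeff_virt is_homD[OF is_hom_chart_sub])

lemma virt_cst_mult: "virt e \<gamma> m (cst a * F) = cst a * virt e \<gamma> m F"
  by (rule bipoly_eqI)
    (simp only: bcoeff_virt is_homD[OF is_hom_chart_sub] chart_sub_cst bcoeff_cst_mult, simp)

text \<open>Because \<open>virt\<close> just drops the low coefficients when the division is not
  exact, every stage is defined for all \<open>F\<close> and linear in \<open>F\<close>. Hence the
  conditions in \<open>passes\<close> are linear. The shift \<open>i + 2\<close> leaves the
  parameters 0 and 1 to the origin, as in \<open>chart_params\<close>.\<close>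

primrec vstage :: "(nat \<Rightarrow> bool) \<Rightarrow> (nat \<Rightarrow> 'a::comm_ring_1) \<Rightarrow> (nat \<Rightarrow> nat) \<Rightarrow> 'a poly poly \<Rightarrow> nat \<Rightarrow> 'a poly poly" where
  "vstage e c \<mu> F 0 = F"
| "vstage e c \<mu> F (Suc i) = virt (e i) (c (i + 2)) (\<mu> i) (vstage e c \<mu> F i)"

definition passes :: "nat \<Rightarrow> (nat \<Rightarrow> bool) \<Rightarrow> (nat \<Rightarrow> 'a::comm_ring_1) \<Rightarrow> (nat \<Rightarrow> nat) \<Rightarrow> 'a poly poly \<Rightarrow> bool" where
  "passes r e c \<mu> F \<longleftrightarrow> (\<forall>i<r. ordge (\<mu> i) (vstage e c \<mu> F i))"

lemma vstage_add: "vstage e c \<mu> (F + G) i = vstage e c \<mu> F i + vstage e c \<mu> G i"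
  by (induction i) (simp_all add: virt_add)

lemma vstage_cst_mult: "vstage e c \<mu> (cst a * F) i = cst a * vstage e c \<mu> F i"
  by (induction i) (simp_all only: vstage.simps virt_cst_mult)

lemma vstage_0: "vstage e c \<mu> 0 i = 0"
  using vstage_cst_mult[of e c \<mu> 0 0 i] by simp

lemma vstage_sum: "vstage e c \<mu> (sum f S) i = (\<Sum>x\<in>S. vstage e c \<mu> (f x) i)"
  by (induction S rule: infinite_finite_induct) (simp_all add: vstage_0 vstage_add)

lemma vstage_diff: "vstage e c \<mu> (F - G) i = vstage e c \<mu> F i - vstage e c \<mu> G i"
  by (metis add_diff_cancel_right' diff_add_cancel vstage_add)

lemma passes_add: "passes r e c \<mu> F \<Longrightarrow> passes r e c \<mu> G \<Longrightarrow> passes r e c \<mu> (F + G)"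
  by (simp add: passes_def vstage_add ordge_def)

lemma ordge_virt:
  fixes F :: "'a::idom poly poly"
  assumes "ordge L F"
  shows "ordge (L - m) (virt e \<gamma> m F)"
proof -
  have "exc_coord e ^ L dvd chart_sub e \<gamma> F" using assms by (simp add: exc_coord_power_dvd_chart_sub)
  then show ?thesis
    by (auto simp: exc_coord_def px_power_dvd_iff py_power_dvd_iff ordge_def bcoeff_virt split: if_splits)
qed

text \<open>Each virtual transform loses at most \<open>\<mu> i\<close> of the order, so a
  sufficiently high power of the maximal ideal lies in the ideal of the cluster. This permits
  working with polynomials in place of germs.\<close>

lemma passes_high_order:
  fixes F :: "'a::idom poly poly"
  assumes "ordge (\<Sum>i<r. \<mu> i) F"
  shows "passes r e c \<mu> F"
proof -
  have "i \<le> r \<Longrightarrow> ordge (\<Sum>l=i..<r. \<mu> l) (vstage e c \<mu> F i)" for i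
  proof (induction i)
    case 0
    then show ?case using assms by (simp add: atLeast0LessThan)
  next
    case (Suc i)
    have "(\<Sum>l=i..<r. \<mu> l) - \<mu> i = (\<Sum>l=Suc i..<r. \<mu> l)"
      using Suc.prems by (simp add: sum.atLeast_Suc_lessThan)
    then show ?case using ordge_virt[OF Suc.IH, of "\<mu> i" "e i" "c (i + 2)"] Suc.prems by simp
  qed
  moreover have "i < r \<Longrightarrow> \<mu> i \<le> (\<Sum>l=i..<r. \<mu> l)" for i
    by (rule member_le_sum) auto
  ultimately show ?thesis unfolding passes_def ordge_def by (meson less_imp_le less_le_trans)
qed

text \<open>Like \<open>chart_params\<close>, but from arbitrary initial coordinates: for clusters
  on an arc these are \<open>x - U\<close> and \<open>y/x - V\<close>, which are not affine
  coordinates of the plane.\<close>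

primrec gen_params :: "'a::idom ratfun \<times> 'a ratfun \<Rightarrow> (nat \<Rightarrow> bool) \<Rightarrow> (nat \<Rightarrow> 'a) \<Rightarrow> nat \<Rightarrow> 'a ratfun \<times> 'a ratfun" where
  "gen_params XY e c 0 = XY"
| "gen_params XY e c (Suc i) = chart_next (e i) (c (i + 2)) (gen_params XY e c i)"

lemma chart_params_eq:
  "chart_params t e c i = gen_params (fst (aff t) - cnst (c 0), snd (aff t) - cnst (c 1)) e c i"
  by (induction i) (simp_all add: chart_next_def case_prod_unfold Let_def)

definition gen_cluster :: "nat \<Rightarrow> 'a::idom ratfun \<times> 'a ratfun \<Rightarrow> (nat \<Rightarrow> bool) \<Rightarrow> (nat \<Rightarrow> 'a) \<Rightarrow> 'a point list" where
  "gen_cluster r XY e c = map (\<lambda>i. loc (gen_params XY e c i)) [0..<r]"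

lemma chart_cluster_eq:
  "chart_cluster r t e c = gen_cluster r (fst (aff t) - cnst (c 0), snd (aff t) - cnst (c 1)) e c"
  by (simp add: chart_cluster_def gen_cluster_def chart_params_eq)

abbreviation indep2 :: "'a::idom ratfun \<times> 'a ratfun \<Rightarrow> bool" where
  "indep2 XY \<equiv> indep (fst XY) (snd XY)"

lemma indep_gen_params: "indep2 XY \<Longrightarrow> indep2 (gen_params XY e c i)"
  by (induction i) (simp, metis gen_params.simps(2) indep_chart_next prod.collapse)

abbreviation ev2p :: "'a::idom poly poly \<Rightarrow> 'a ratfun \<times> 'a ratfun \<Rightarrow> 'a ratfun" where
  "ev2p F XY \<equiv> ev2 F (fst XY) (snd XY)"

lemma ev2_chart_sub':
  "indep2 XY \<Longrightarrow> ev2p (chart_sub e \<gamma> F) (chart_next e \<gamma> XY) = ev2p F XY"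
  using ev2_chart_sub[OF indep_coords_nonzero] by blast

text \<open>A local equation, at the point with index \<open>Suc i\<close>, of the exceptional curve of the blow-up of the point with index \<open>i\<close>.\<close>

definition exc_eq :: "'a::idom ratfun \<times> 'a ratfun \<Rightarrow> (nat \<Rightarrow> bool) \<Rightarrow> (nat \<Rightarrow> 'a) \<Rightarrow> nat \<Rightarrow> 'a ratfun" where
  "exc_eq XY e c i = ev2p (exc_coord (e i)) (gen_params XY e c i)"

lemma exc_eq_next: "exc_eq XY e c i = ev2p (exc_coord (e i)) (gen_params XY e c (Suc i))"
  by (simp add: exc_eq_def exc_coord_def chart_next_def ev2_gens)

text \<open>Each passed stage splits off the corresponding power of its exceptional equation from
  the total transform.\<close>

lemma ev2_vstage:
  assumes "indep2 XY" "passes i e c \<mu> F"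
  shows "ev2p F XY = (\<Prod>l<i. exc_eq XY e c l ^ \<mu> l) * ev2p (vstage e c \<mu> F i) (gen_params XY e c i)"
  using assms(2)
proof (induction i)
  case 0
  then show ?case by simp
next
  case (Suc i)
  then have IH: "ev2p F XY = (\<Prod>l<i. exc_eq XY e c l ^ \<mu> l) * ev2p (vstage e c \<mu> F i) (gen_params XY e c i)"
    and o: "ordge (\<mu> i) (vstage e c \<mu> F i)" by (simp_all add: passes_def)
  have "ev2p (vstage e c \<mu> F i) (gen_params XY e c i) =
      ev2p (chart_sub (e i) (c (i + 2)) (vstage e c \<mu> F i)) (gen_params XY e c (Suc i))"
    using ev2_chart_sub'[OF indep_gen_params[OF assms(1)]] by simp
  also have "\<dots> = exc_eq XY e c i ^ \<mu> i * ev2p (vstage e c \<mu> F (Suc i)) (gen_params XY e c (Suc i))"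
    unfolding chart_sub_eq_virt[OF o] exc_eq_next by (simp only: ev2_hom vstage.simps)
  finally show ?case using IH by simp
qed

section \<open>Local rings\<close>

lemma loc_iff: "f \<in> loc XY \<longleftrightarrow> (\<exists>F G. f = ev2p F XY / ev2p G XY \<and> bcoeff G 0 0 \<noteq> 0)"
  unfolding loc_def bcoeff_def by blast

lemma locI: "bcoeff G 0 0 \<noteq> 0 \<Longrightarrow> ev2p F XY / ev2p G XY \<in> loc XY"
  unfolding loc_iff by blast

lemma bcoeff_1: "bcoeff 1 0 0 = (1::'a::comm_ring_1)"
  by (simp add: bcoeff_def)

lemma loc_ev2: "ev2p F XY \<in> loc XY"
  using locI[of 1 F XY] by (simp add: bcoeff_1 ev2_hom)

lemma loc_cnst: "cnst a \<in> loc XY"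
  using loc_ev2[of "cst a" XY] by (simp add: ev2_gens)

lemma loc_0: "0 \<in> loc XY" and loc_1: "1 \<in> loc XY"
  using loc_cnst[of 0 XY] loc_cnst[of 1 XY] by (simp_all add: is_homD[OF is_hom_cnst])

lemma loc_coords: "fst XY \<in> loc XY" "snd XY \<in> loc XY"
  using loc_ev2[of px XY] loc_ev2[of py XY] by (simp_all add: ev2_gens)

lemma loc_mult: "f \<in> loc XY \<Longrightarrow> g \<in> loc XY \<Longrightarrow> f * g \<in> loc XY"
proof -
  assume "f \<in> loc XY" "g \<in> loc XY"
  then obtain F G F' G' where "f = ev2p F XY / ev2p G XY" "g = ev2p F' XY / ev2p G' XY"
    "bcoeff G 0 0 \<noteq> 0" "bcoeff G' 0 0 \<noteq> 0" unfolding loc_iff by blast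
  then show ?thesis using locI[of "G * G'" "F * F'" XY] by (simp add: bcoeff_0_0_mult ev2_hom)
qed

lemma loc_add: "f \<in> loc XY \<Longrightarrow> g \<in> loc XY \<Longrightarrow> f + g \<in> loc XY"
proof -
  assume fg: "f \<in> loc XY" "g \<in> loc XY"
  then obtain F G F' G' where h: "f = ev2p F XY / ev2p G XY" "g = ev2p F' XY / ev2p G' XY"
    "bcoeff G 0 0 \<noteq> 0" "bcoeff G' 0 0 \<noteq> 0" unfolding loc_iff by blast
  show ?thesis
  proof (cases "ev2p G XY = 0 \<or> ev2p G' XY = 0")
    case True
    then show ?thesis using h fg by auto
  next
    case False
    then have "f + g = ev2p (F * G' + F' * G) XY / ev2p (G * G') XY"
      by (simp add: h ev2_hom add_frac_eq)
    then show ?thesis using h locI[of "G * G'" "F * G' + F' * G" XY] by (simp add: bcoeff_0_0_mult)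
  qed
qed

lemma loc_power: "f \<in> loc XY \<Longrightarrow> f ^ n \<in> loc XY"
  by (induction n) (auto intro: loc_1 loc_mult)

lemma loc_sum: "(\<And>x. x \<in> S \<Longrightarrow> f x \<in> loc XY) \<Longrightarrow> sum f S \<in> loc XY"
  by (induction S rule: infinite_finite_induct) (auto intro: loc_0 loc_add)

lemma loc_prod: "(\<And>x. x \<in> S \<Longrightarrow> f x \<in> loc XY) \<Longrightarrow> prod f S \<in> loc XY"
  by (induction S rule: infinite_finite_induct) (auto intro: loc_1 loc_mult)

lemma loc_diff: "f \<in> loc XY \<Longrightarrow> g \<in> loc XY \<Longrightarrow> f - g \<in> loc XY"
  using loc_add[of f XY "cnst (-1) * g"] loc_mult[OF loc_cnst, of g XY "-1"]
  by (simp add: is_homD[OF is_hom_cnst])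

lemma ev2_monomial_sum:
  assumes "finite S" "\<And>i j. bcoeff F i j \<noteq> 0 \<Longrightarrow> (i, j) \<in> S"
  shows "ev2 F X Y = (\<Sum>(i, j)\<in>S. cnst (bcoeff F i j) * X ^ i * Y ^ j)"
proof -
  have F: "F = (\<Sum>(i, j)\<in>S. cst (bcoeff F i j) * px ^ i * py ^ j)"
    by (rule bipoly_as_sum) (use assms in auto)
  show ?thesis unfolding arg_cong[OF F, of "\<lambda>G. ev2 G X Y"]
    by (simp only: ev2_hom ev2_gens case_prod_unfold)
qed

text \<open>Every monomial of \<open>F\<close> has at least \<open>n\<close> factors among
  \<open>X\<close> and \<open>Y\<close>, and each of them can absorb one factor
  \<open>1/Z\<close>.\<close>

lemma ordge_quotient_mem:
  assumes "ordge n F" "X \<in> loc q" "Y \<in> loc q" "X / Z \<in> loc q" "Y / Z \<in> loc q"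
  shows "ev2 F X Y / Z ^ n \<in> loc q"
proof -
  obtain S where S: "finite S" "\<And>i j. bcoeff F i j \<noteq> 0 \<longleftrightarrow> (i, j) \<in> S"
    "F = (\<Sum>(i, j)\<in>S. cst (bcoeff F i j) * px ^ i * py ^ j)" by (rule bipoly_sumE[where F = F]) (rule that)
  have "ev2 F X Y / Z ^ n = (\<Sum>(i, j)\<in>S. cnst (bcoeff F i j) * X ^ i * Y ^ j / Z ^ n)"
    using ev2_monomial_sum[of S F X Y] S by (simp add: sum_divide_distrib case_prod_unfold)
  also have "\<dots> \<in> loc q"
  proof (rule loc_sum)
    fix s assume "s \<in> S"
    obtain i j where s: "s = (i, j)" by (cases s)
    then have "\<not> i + j < n" using assms(1) \<open>s \<in> S\<close> S(2) by (auto simp: ordge_def)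
    \<comment> \<open>Of the \<open>n\<close> denominators, \<open>a\<close> go to the powers of
      \<open>X\<close> and the other \<open>n - a\<close> to those of \<open>Y\<close>.\<close>
    define a where "a = min i n"
    have a: "a \<le> i" "n - a \<le> j" "a \<le> n" using \<open>\<not> i + j < n\<close> by (auto simp: a_def)
    have "X ^ i = X ^ a * X ^ (i - a)" "Y ^ j = Y ^ (n - a) * Y ^ (j - (n - a))" "Z ^ n = Z ^ a * Z ^ (n - a)"
      using a by (simp_all only: power_add[symmetric] le_add_diff_inverse)
    then have "cnst (bcoeff F i j) * X ^ i * Y ^ j / Z ^ n =
        cnst (bcoeff F i j) * (X / Z) ^ a * (Y / Z) ^ (n - a) * X ^ (i - a) * Y ^ (j - (n - a))"
      by (simp only: power_divide) simp
    then show "(case s of (i, j) \<Rightarrow> cnst (bcoeff F i j) * X ^ i * Y ^ j / Z ^ n) \<in> loc q"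
      using assms by (simp only: s case_prod_conv) (intro loc_mult loc_power loc_cnst; assumption)
  qed
  finally show ?thesis .
qed

lemma maxid_iff:
  assumes "indep2 XY"
  shows "f \<in> maxid (loc XY) \<longleftrightarrow> (\<exists>F G. f = ev2p F XY / ev2p G XY \<and> bcoeff G 0 0 \<noteq> 0 \<and> bcoeff F 0 0 = 0)"
proof
  assume "f \<in> maxid (loc XY)"
  then have f: "f \<in> loc XY" "f = 0 \<or> inverse f \<notin> loc XY" by (auto simp: maxid_def)
  then obtain F G where F: "f = ev2p F XY / ev2p G XY" "bcoeff G 0 0 \<noteq> 0" unfolding loc_iff by blast
  have "bcoeff F 0 0 = 0"
  proof (rule ccontr)
    assume n: "bcoeff F 0 0 \<noteq> 0"
    then have "inverse f \<in> loc XY" using locI[of F G XY] F by simp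
    moreover have "F \<noteq> 0" "G \<noteq> 0" using n F by auto
    then have "f \<noteq> 0" using F assms by (simp add: indep_nonzero)
    ultimately show False using f by blast
  qed
  with F show "\<exists>F G. f = ev2p F XY / ev2p G XY \<and> bcoeff G 0 0 \<noteq> 0 \<and> bcoeff F 0 0 = 0" by blast
next
  assume "\<exists>F G. f = ev2p F XY / ev2p G XY \<and> bcoeff G 0 0 \<noteq> 0 \<and> bcoeff F 0 0 = 0"
  then obtain F G where F: "f = ev2p F XY / ev2p G XY" "bcoeff G 0 0 \<noteq> 0" "bcoeff F 0 0 = 0" by blast
  have "inverse f \<notin> loc XY" if "f \<noteq> 0"
  proof
    assume "inverse f \<in> loc XY"
    then obtain F' G' where F': "inverse f = ev2p F' XY / ev2p G' XY" "bcoeff G' 0 0 \<noteq> 0"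
      unfolding loc_iff by blast
    have "G' \<noteq> 0" "G \<noteq> 0" using F' F by auto
    then have nz: "ev2p G' XY \<noteq> 0" "ev2p G XY \<noteq> 0" using assms by (simp_all add: indep_nonzero)
    have "f * inverse f = 1" using that by simp
    then have "ev2p F XY * ev2p F' XY = ev2p G XY * ev2p G' XY"
      unfolding F'(1) unfolding F(1) using nz by (simp add: field_simps)
    then have "F * F' = G * G'" using indep_eq_iff[OF assms, of "F * F'" "G * G'"] by (simp add: ev2_hom)
    then have "bcoeff (F * F') 0 0 = bcoeff (G * G') 0 0" by simp
    then show False using F F' by (simp add: bcoeff_0_0_mult)
  qed
  moreover have "f \<in> loc XY" using F locI by blast
  ultimately show "f \<in> maxid (loc XY)" by (auto simp: maxid_def)
qed

lemma maxid_ev2: "indep2 XY \<Longrightarrow> bcoeff F 0 0 = 0 \<Longrightarrow> ev2p F XY \<in> maxid (loc XY)"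
  unfolding maxid_iff by (intro exI[of _ F] exI[of _ 1]) (simp add: ev2_hom bcoeff_1)

lemma maxid_coords:
  assumes "indep2 XY" shows "fst XY \<in> maxid (loc XY)" "snd XY \<in> maxid (loc XY)"
  using maxid_ev2[OF assms, of px] maxid_ev2[OF assms, of py] by (simp_all add: ev2_gens bcoeff_def)

lemma maxid_mult:
  assumes "indep2 XY" "f \<in> maxid (loc XY)" "g \<in> loc XY" shows "f * g \<in> maxid (loc XY)"
proof -
  obtain F G F' G' where "f = ev2p F XY / ev2p G XY" "g = ev2p F' XY / ev2p G' XY"
    "bcoeff G 0 0 \<noteq> 0" "bcoeff G' 0 0 \<noteq> 0" "bcoeff F 0 0 = 0"
    using assms unfolding loc_iff maxid_iff[OF assms(1)] by blast
  then show ?thesis unfolding maxid_iff[OF assms(1)]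
    by (intro exI[of _ "F * F'"] exI[of _ "G * G'"]) (simp add: ev2_hom bcoeff_0_0_mult)
qed

lemma maxid_add:
  assumes "indep2 XY" "f \<in> maxid (loc XY)" "g \<in> maxid (loc XY)" shows "f + g \<in> maxid (loc XY)"
proof -
  obtain F G F' G' where h: "f = ev2p F XY / ev2p G XY" "g = ev2p F' XY / ev2p G' XY"
    "bcoeff G 0 0 \<noteq> 0" "bcoeff G' 0 0 \<noteq> 0" "bcoeff F 0 0 = 0" "bcoeff F' 0 0 = 0"
    using assms unfolding maxid_iff[OF assms(1)] by blast
  then have "G \<noteq> 0" "G' \<noteq> 0" by auto
  then have "f + g = ev2p (F * G' + F' * G) XY / ev2p (G * G') XY"
    using assms(1) by (simp add: h ev2_hom add_frac_eq indep_nonzero)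
  then show ?thesis unfolding maxid_iff[OF assms(1)] using h
    by (intro exI[of _ "F * G' + F' * G"] exI[of _ "G * G'"]) (simp add: bcoeff_0_0_mult)
qed

lemma loc_inverse_unit:
  assumes "f \<in> loc XY" "f \<notin> maxid (loc XY)" shows "inverse f \<in> loc XY"
  using assms by (auto simp: maxid_def)

lemma cnst_not_maxid:
  fixes a :: "'a::field"
  assumes "a \<noteq> 0" shows "cnst a \<notin> maxid (loc XY)"
proof -
  have "inverse (cnst a) = cnst (inverse a)"
    using assms is_homD(4)[OF is_hom_cnst, of a "inverse a"]
    by (intro inverse_unique) (simp add: is_homD[OF is_hom_cnst])
  moreover have "cnst a \<noteq> 0" using assms inj_cnst[of a 0] by (simp add: is_homD[OF is_hom_cnst])
  ultimately show ?thesis using loc_cnst[of "inverse a" XY] by (auto simp: maxid_def)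
qed

lemma ev2_mod_maxid:
  assumes "indep2 XY" "X \<in> maxid (loc XY)" "Y \<in> maxid (loc XY)"
  shows "ev2 F X Y - cnst (bcoeff F 0 0) \<in> maxid (loc XY)" "ev2 F X Y \<in> loc XY"
proof -
  have l: "X \<in> loc XY" "Y \<in> loc XY" using assms by (auto simp: maxid_def)
  have *: "ev2 F X Y \<in> loc XY" for F
  proof -
    obtain S where S: "finite S" "\<And>i j. bcoeff F i j \<noteq> 0 \<longleftrightarrow> (i, j) \<in> S"
      "F = (\<Sum>(i, j)\<in>S. cst (bcoeff F i j) * px ^ i * py ^ j)" by (rule bipoly_sumE[where F = F]) (rule that)
    have "ev2 F X Y = (\<Sum>(i, j)\<in>S. cnst (bcoeff F i j) * X ^ i * Y ^ j)"
      by (rule ev2_monomial_sum) (use S in auto)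
    also have "\<dots> \<in> loc XY" using l by (auto intro!: loc_sum loc_mult loc_power loc_cnst)
    finally show ?thesis .
  qed
  show "ev2 F X Y \<in> loc XY" by (rule *)
  obtain A B where F: "F = cst (bcoeff F 0 0) + px * A + py * B"
    using bipoly_decomp[of F] unfolding bcoeff_def by blast
  have "ev2 F X Y = cnst (bcoeff F 0 0) + X * ev2 A X Y + Y * ev2 B X Y"
    unfolding arg_cong[OF F, of "\<lambda>G. ev2 G X Y"] by (simp only: ev2_hom ev2_gens)
  then have "ev2 F X Y - cnst (bcoeff F 0 0) = X * ev2 A X Y + Y * ev2 B X Y" by simp
  then show "ev2 F X Y - cnst (bcoeff F 0 0) \<in> maxid (loc XY)"
    using assms * by (auto intro: maxid_add maxid_mult)
qed

text \<open>The denominator \<open>G(X, Y)\<close> has the residue \<open>G(0, 0)\<close>, so it is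
  a unit of the larger ring.\<close>

lemma loc_subset:
  fixes XY :: "'a::field ratfun \<times> 'a ratfun"
  assumes "indep2 XY" "X \<in> maxid (loc XY)" "Y \<in> maxid (loc XY)"
  shows "loc (X, Y) \<subseteq> loc XY"
proof
  fix f assume "f \<in> loc (X, Y)"
  then obtain F G where f: "f = ev2 F X Y / ev2 G X Y" "bcoeff G 0 0 \<noteq> 0" unfolding loc_iff by auto
  have "ev2 G X Y \<notin> maxid (loc XY)"
  proof
    assume "ev2 G X Y \<in> maxid (loc XY)"
    then have "ev2 G X Y + (ev2 G X Y - cnst (bcoeff G 0 0)) * (- 1) \<in> maxid (loc XY)"
      using assms ev2_mod_maxid(1)[OF assms, of G] loc_cnst[of "-1" XY]
      by (intro maxid_add maxid_mult) (simp_all add: is_homD[OF is_hom_cnst])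
    then have "cnst (bcoeff G 0 0) \<in> maxid (loc XY)" by simp
    then show False using cnst_not_maxid[OF f(2)] by blast
  qed
  then have "inverse (ev2 G X Y) \<in> loc XY" by (intro loc_inverse_unit ev2_mod_maxid(2)[OF assms])
  then show "f \<in> loc XY" using loc_mult[OF ev2_mod_maxid(2)[OF assms, of F]] f
    by (simp add: divide_inverse)
qed

lemma maxid_mono:
  fixes XY :: "'a::field ratfun \<times> 'a ratfun"
  assumes "indep2 XY" "X \<in> maxid (loc XY)" "Y \<in> maxid (loc XY)" "indep X Y"
  shows "maxid (loc (X, Y)) \<subseteq> maxid (loc XY)"
proof
  fix f assume "f \<in> maxid (loc (X, Y))"
  then obtain F G where f: "f = ev2 F X Y / ev2 G X Y" "bcoeff G 0 0 \<noteq> 0" "bcoeff F 0 0 = 0"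
    using maxid_iff[of "(X, Y)"] assms(4) by auto
  have "ev2 F X Y \<in> maxid (loc XY)" using ev2_mod_maxid(1)[OF assms(1-3), of F] f
    by (simp add: is_homD[OF is_hom_cnst])
  moreover have "1 / ev2 G X Y \<in> loc (X, Y)" using locI[of G 1 "(X, Y)"] f by (simp add: ev2_hom)
  then have "1 / ev2 G X Y \<in> loc XY" using loc_subset[OF assms(1-3)] by blast
  ultimately show "f \<in> maxid (loc XY)" using maxid_mult[OF assms(1)] f by fastforce
qed

text \<open>A point of the exceptional curve dominates the point blown up, and there the maximal
  ideal becomes principal, generated by the exceptional equation.\<close>

lemma loc_chart_next:
  fixes XY :: "'a::field ratfun \<times> 'a ratfun"
  assumes "indep2 XY"
  shows "loc XY \<subseteq> loc (chart_next e \<gamma> XY)" "maxid (loc XY) \<subseteq> maxid (loc (chart_next e \<gamma> XY))"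
    "h \<in> maxid (loc XY) \<Longrightarrow> h / ev2p (exc_coord e) XY \<in> loc (chart_next e \<gamma> XY)"
proof -
  let ?N = "chart_next e \<gamma> XY"
  have i: "indep2 ?N" using indep_chart_next[of "fst XY" "snd XY" e \<gamma>] assms by simp
  have nz: "fst XY \<noteq> 0" "snd XY \<noteq> 0" using indep_coords_nonzero[OF assms] by auto
  have E: "ev2p (exc_coord e) ?N = ev2p (exc_coord e) XY" "ev2p (exc_coord e) XY \<noteq> 0"
    using nz by (simp_all add: exc_coord_def chart_next_def ev2_gens)
  have q: "fst XY / ev2p (exc_coord e) XY \<in> loc ?N" "snd XY / ev2p (exc_coord e) XY \<in> loc ?N"
  proof -
    have "fst XY / ev2p (exc_coord e) XY = (if e then 1 else fst ?N + cnst \<gamma>)"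
      "snd XY / ev2p (exc_coord e) XY = (if e then snd ?N + cnst \<gamma> else 1)"
      using nz by (simp_all add: exc_coord_def chart_next_def ev2_gens)
    then show "fst XY / ev2p (exc_coord e) XY \<in> loc ?N" "snd XY / ev2p (exc_coord e) XY \<in> loc ?N"
      by (simp_all add: loc_1 loc_add loc_coords loc_cnst)
  qed
  have Em: "ev2p (exc_coord e) ?N \<in> maxid (loc ?N)"
    using maxid_coords[OF i] by (cases e) (simp_all add: exc_coord_def ev2_gens)
  have m: "fst XY \<in> maxid (loc ?N)" "snd XY \<in> maxid (loc ?N)"
    using maxid_mult[OF i Em q(1)] maxid_mult[OF i Em q(2)] E by simp_all
  show s: "loc XY \<subseteq> loc ?N" using loc_subset[OF i m] by simp
  show "maxid (loc XY) \<subseteq> maxid (loc ?N)" using maxid_mono[OF i m assms] by simp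
  assume "h \<in> maxid (loc XY)"
  then obtain F G where h: "h = ev2p F XY / ev2p G XY" "bcoeff G 0 0 \<noteq> 0" "bcoeff F 0 0 = 0"
    unfolding maxid_iff[OF assms] by blast
  have "ev2p F XY / ev2p (exc_coord e) XY ^ 1 \<in> loc ?N"
    by (rule ordge_quotient_mem) (use h m q in \<open>auto simp: ordge_def maxid_def\<close>)
  moreover have "1 / ev2p G XY \<in> loc ?N" using locI[of G 1 XY] h s by (auto simp: ev2_hom)
  ultimately show "h / ev2p (exc_coord e) XY \<in> loc ?N" using loc_mult h by fastforce
qed

text \<open>Setting \<open>x = 0\<close> is a homomorphism onto polynomials in \<open>y\<close>,
  which form a domain.\<close>

lemma px_dvd_mult_iff: "px dvd F * G \<longleftrightarrow> px dvd F \<or> px dvd G"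
  for F G :: "'a::idom poly poly"
proof -
  define z where "z F = map_poly (\<lambda>p. coeff p 0) F" for F :: "'a poly poly"
  have c: "coeff (z F) j = bcoeff F 0 j" for F j by (simp add: z_def coeff_map_poly bcoeff_def)
  have "z (F * G) = z F * z G" by (rule poly_eqI) (simp add: c coeff_mult bcoeff_mult)
  moreover have "px dvd F \<longleftrightarrow> z F = 0" for F
    using px_power_dvd_iff[of 1 F] by (simp add: poly_eq_iff c)
  ultimately show ?thesis by simp
qed

lemma px_power_dvd_multD:
  fixes G :: "'a::idom poly poly"
  assumes "px ^ n dvd G * B" "\<not> px dvd B"
  shows "px ^ n dvd G"
  using assms(1)
proof (induction n arbitrary: G)
  case (Suc n)
  have "px dvd G * B" using Suc.prems by (metis dvd_trans dvd_triv_left power_Suc)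
  then obtain G' where G': "G = px * G'" using assms(2) px_dvd_mult_iff by (metis dvdE)
  have "px * px ^ n dvd px * (G' * B)" using Suc.prems by (simp only: G' power_Suc mult.assoc)
  then have "px ^ n dvd G' * B" by (subst (asm) dvd_mult_cancel_left) simp
  then have "px ^ n dvd G'" by (rule Suc.IH)
  then show ?case unfolding G' power_Suc by (rule mult_dvd_mono[OF dvd_refl])
qed simp

lemma not_px_dvd: "bcoeff B 0 j \<noteq> 0 \<Longrightarrow> \<not> px dvd B" for B :: "'a::idom poly poly"
  using px_power_dvd_iff[of 1 B] by auto

lemma loc_swap: "loc (X, Y) = loc (Y, X)"
proof -
  have "loc (X, Y) \<subseteq> loc (Y, X)" for X Y :: "'a ratfun"
  proof
    fix f assume "f \<in> loc (X, Y)"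
    then obtain F G where f: "f = ev2 F X Y / ev2 G X Y" "bcoeff G 0 0 \<noteq> 0" unfolding loc_iff by auto
    have "ev2 (bsub F py px) Y X = ev2 F X Y" for F by (simp only: ev2_bsub ev2_gens)
    then show "f \<in> loc (Y, X)"
      using f locI[of "bsub G py px" "bsub F py px" "(Y, X)"] by (simp add: bcoeff_swap)
  qed
  then show ?thesis by blast
qed

text \<open>
  Other coordinates at the same point are not assumed to be algebraically independent, but they
  generate the maximal ideal because the local ring is neither a field nor a discrete valuation ring.
\<close>

lemma other_coord_maxid:
  assumes "indep2 XY" "loc XY = loc (X', Y')"
  shows "X' \<in> maxid (loc XY)"
proof -
  have "inverse X' \<notin> loc XY" if "X' \<noteq> 0"
  proof
    assume "inverse X' \<in> loc XY"
    then obtain F G where F: "inverse X' = ev2 F X' Y' / ev2 G X' Y'" "bcoeff G 0 0 \<noteq> 0"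
      unfolding assms(2) loc_iff by auto
    have "ev2 G X' Y' \<noteq> 0" using F that by auto
    then have "ev2 G X' Y' = X' * ev2 F X' Y'" using F(1) that by (simp add: field_simps)
    then have P: "ev2 (G - px * F) X' Y' = 0" by (simp only: ev2_hom ev2_gens) simp
    have P0: "bcoeff (G - px * F) 0 0 \<noteq> 0" using F(2) unfolding bcoeff_simps bcoeff_0_0_mult
      by (simp add: bcoeff_def)
    have "fst XY \<in> loc (X', Y')" using loc_coords(1)[of XY] assms(2) by simp
    then obtain A B where A: "fst XY = ev2 A X' Y' / ev2 B X' Y'" "bcoeff B 0 0 \<noteq> 0"
      unfolding loc_iff by auto
    \<comment> \<open>\<open>G - px * F\<close> is a relation between \<open>X'\<close> and
      \<open>Y'\<close> with nonzero constant term. Added to a numerator without constant term, it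
      makes the fraction invertible without changing its value, so the coordinate
      \<open>fst XY\<close> would be a unit.\<close>
    define A' where "A' = (if bcoeff A 0 0 = 0 then A + (G - px * F) else A)"
    have "bcoeff A' 0 0 \<noteq> 0" "ev2 A' X' Y' = ev2 A X' Y'"
      unfolding A'_def using P P0 by (simp_all add: ev2_hom(3) del: mult_pCons_left)
    then have "inverse (fst XY) \<in> loc XY" unfolding assms(2) using A locI[of A' B "(X', Y')"] by simp
    then show False using maxid_coords(1)[OF assms(1)] indep_coords_nonzero(1)[OF assms(1)]
      by (simp add: maxid_def)
  qed
  then show ?thesis using loc_coords(1)[of "(X', Y')"] assms(2) by (auto simp: maxid_def)
qed

lemma other_coords_repr:
  assumes "loc XY = loc (X', Y')" "h \<in> maxid (loc XY)"
  shows "\<exists>F G. h = ev2 F X' Y' / ev2 G X' Y' \<and> bcoeff G 0 0 \<noteq> 0 \<and> bcoeff F 0 0 = 0"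
proof -
  have "h \<in> loc (X', Y')" "h = 0 \<or> inverse h \<notin> loc XY" using assms by (auto simp: maxid_def)
  then obtain F G where F: "h = ev2 F X' Y' / ev2 G X' Y'" "bcoeff G 0 0 \<noteq> 0" unfolding loc_iff by auto
  show ?thesis
  proof (cases "h = 0")
    case True
    then show ?thesis by (intro exI[of _ 0] exI[of _ 1]) (simp add: ev2_hom bcoeff_1)
  next
    case False
    have "bcoeff F 0 0 = 0"
    proof (rule ccontr)
      assume "bcoeff F 0 0 \<noteq> 0"
      then have "inverse h \<in> loc XY" unfolding assms(1) using locI[of F G "(X', Y')"] F by simp
      then show False using assms(2) False by (simp add: maxid_def)
    qed
    with F show ?thesis by blast
  qed
qed

text \<open>If \<open>X'\<close> were zero, \<open>Y'\<close> would generate the maximal ideal, and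
  the two given coordinates would be multiples of one function; their linear parts would then be
  proportional.\<close>

lemma other_coord_nonzero:
  assumes "indep2 XY" "loc XY = loc (X', Y')"
  shows "X' \<noteq> 0"
proof
  assume X': "X' = 0"
  have *: "\<exists>a\<in>loc XY. h = Y' * a" if h: "h \<in> maxid (loc XY)" for h
  proof -
    obtain F G where F: "h = ev2 F X' Y' / ev2 G X' Y'" "bcoeff G 0 0 \<noteq> 0" "bcoeff F 0 0 = 0"
      using other_coords_repr[OF assms(2) h] by blast
    obtain A B where "F = cst (bcoeff F 0 0) + px * A + py * B"
      using bipoly_decomp[of F] unfolding bcoeff_def by blast
    then have "ev2 F X' Y' = ev2 (cst 0 + px * A + py * B) X' Y'" using F(3) by simp
    then have "h = Y' * (ev2 B X' Y' / ev2 G X' Y')"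
      unfolding F(1) by (simp only: ev2_hom ev2_gens X' is_homD[OF is_hom_cnst]) simp
    moreover have "ev2 B X' Y' / ev2 G X' Y' \<in> loc XY" unfolding assms(2) using locI[of G B "(X', Y')"] F by simp
    ultimately show ?thesis by blast
  qed
  obtain a where a: "a \<in> loc XY" "fst XY = Y' * a" using *[OF maxid_coords(1)[OF assms(1)]] by blast
  obtain b where b: "b \<in> loc XY" "snd XY = Y' * b" using *[OF maxid_coords(2)[OF assms(1)]] by blast
  have "Y' \<in> maxid (loc XY)" by (rule other_coord_maxid[OF assms(1) trans[OF assms(2) loc_swap]])
  then obtain C D where C: "Y' = ev2p C XY / ev2p D XY" "bcoeff D 0 0 \<noteq> 0" "bcoeff C 0 0 = 0"
    unfolding maxid_iff[OF assms(1)] by blast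
  obtain A B where A: "a = ev2p A XY / ev2p B XY" "bcoeff B 0 0 \<noteq> 0" using a unfolding loc_iff by blast
  obtain A' B' where A': "b = ev2p A' XY / ev2p B' XY" "bcoeff B' 0 0 \<noteq> 0" using b unfolding loc_iff by blast
  have "D \<noteq> 0" "B \<noteq> 0" "B' \<noteq> 0" using C A A' by auto
  then have nz: "ev2p D XY \<noteq> 0" "ev2p B XY \<noteq> 0" "ev2p B' XY \<noteq> 0" using assms(1) by (simp_all add: indep_nonzero)
  have "ev2p (px * (D * B)) XY = ev2p (C * A) XY" "ev2p (py * (D * B')) XY = ev2p (C * A') XY"
    using a(2) b(2) nz unfolding C(1) A(1) A'(1) ev2_hom ev2_gens by (simp_all add: field_simps)
  then have e: "px * (D * B) = C * A" "py * (D * B') = C * A'"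
    using indep_eq_iff[OF assms(1)] by blast+
  have px1: "bcoeff (px ^ 1 * F) 1 0 = bcoeff F 0 0" "bcoeff (py ^ 1 * F) 1 0 = 0"
    "bcoeff (py ^ 1 * F) 0 1 = bcoeff F 0 0" for F :: "'a poly poly"
    unfolding bcoeff_px_power_mult bcoeff_py_power_mult by simp_all
  \<comment> \<open>\<open>C\<close> has no constant term, so the linear part of a product with
    \<open>C\<close> is that of \<open>C\<close> times a constant.\<close>
  have m10: "bcoeff (C * F) 1 0 = bcoeff C 1 0 * bcoeff F 0 0" "bcoeff (C * F) 0 1 = bcoeff C 0 1 * bcoeff F 0 0" for F
    using C(3) by (simp_all add: bcoeff_mult)
  have "bcoeff D 0 0 * bcoeff B 0 0 = bcoeff C 1 0 * bcoeff A 0 0"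
    using arg_cong[OF e(1), of "\<lambda>F. bcoeff F 1 0"] px1(1)[of "D * B"] m10(1)[of A]
    by (simp only: power_one_right bcoeff_0_0_mult)
  then have "bcoeff C 1 0 \<noteq> 0" using C(2) A(2) by auto
  moreover have "0 = bcoeff C 1 0 * bcoeff A' 0 0"
    using arg_cong[OF e(2), of "\<lambda>F. bcoeff F 1 0"] px1(2)[of "D * B'"] m10(1)[of A']
    by (simp only: power_one_right)
  ultimately have "bcoeff A' 0 0 = 0" by simp
  moreover have "bcoeff D 0 0 * bcoeff B' 0 0 = bcoeff C 0 1 * bcoeff A' 0 0"
    using arg_cong[OF e(2), of "\<lambda>F. bcoeff F 0 1"] px1(3)[of "D * B'"] m10(2)[of A']
    by (simp only: power_one_right bcoeff_0_0_mult)
  ultimately show False using C(2) A'(2) by simp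
qed

lemma bcoeff_chart_sub_0: "bcoeff (chart_sub e \<gamma> F) 0 0 = bcoeff F 0 0"
  for F :: "'a::comm_ring_1 poly poly"
proof -
  obtain A B where F: "F = cst (bcoeff F 0 0) + px * A + py * B"
    using bipoly_decomp[of F] unfolding bcoeff_def by blast
  have g: "bcoeff (chart_sub e \<gamma> px) 0 0 = 0" "bcoeff (chart_sub e \<gamma> py) 0 0 = 0"
    unfolding chart_sub_def bsub_gens by (cases e; simp add: bcoeff_def)+
  have "bcoeff (chart_sub e \<gamma> (cst (bcoeff F 0 0) + px * A + py * B)) 0 0 = bcoeff F 0 0"
    unfolding is_homD[OF is_hom_chart_sub] chart_sub_cst bcoeff_simps bcoeff_0_0_mult g
    by (simp add: bcoeff_cst)
  then show ?thesis using F by simp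
qed

text \<open>\<open>E\<close> is a local equation of the exceptional curve at \<open>q\<close>. The
  points are given by arbitrary coordinates at the centre; both charts reduce to the first by
  exchanging these.\<close>

lemma exc_points_chart:
  assumes "indep2 XY" "q \<in> exc_points (loc XY)"
  shows "\<exists>E N. E \<in> maxid (loc XY) \<and> E \<noteq> 0 \<and> q = loc N \<and> loc XY \<subseteq> q \<and> (\<forall>h\<in>maxid (loc XY). h / E \<in> q)"
proof -
  have *: "X' \<in> maxid (loc XY) \<and> X' \<noteq> 0 \<and> loc XY \<subseteq> q \<and> (\<forall>h\<in>maxid (loc XY). h / X' \<in> q)"
    if R: "loc XY = loc (X', Y')" and q: "q = loc (X', Y' / X' - cnst c)" for X' Y' c
  proof -
    have R': "loc XY = loc (Y', X')" using R loc_swap by metis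
    have nz: "X' \<noteq> 0" "Y' \<noteq> 0"
      using other_coord_nonzero[OF assms(1) R] other_coord_nonzero[OF assms(1) R'] by auto
    let ?N = "(X', Y' / X' - cnst c)"
    have ev: "ev2 F X' Y' = ev2p (chart_sub True c F) ?N" for F
      using ev2_chart_sub[of "(X', Y')" True c F] nz by (simp add: chart_next_def)
    have sub: "loc XY \<subseteq> loc ?N"
    proof
      fix f assume "f \<in> loc XY"
      then obtain F G where f: "f = ev2 F X' Y' / ev2 G X' Y'" "bcoeff G 0 0 \<noteq> 0"
        unfolding R loc_iff by auto
      then show "f \<in> loc ?N" unfolding f(1) ev by (intro locI) (simp add: bcoeff_chart_sub_0)
    qed
    have yx: "Y' / X' \<in> loc ?N"
      using loc_add[OF loc_coords(2)[of ?N] loc_cnst[of c]] by simp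
    have "h / X' \<in> loc ?N" if h: "h \<in> maxid (loc XY)" for h
    proof -
      obtain F G where F: "h = ev2 F X' Y' / ev2 G X' Y'" "bcoeff G 0 0 \<noteq> 0" "bcoeff F 0 0 = 0"
        using other_coords_repr[OF R h] by blast
      have "ev2 F X' Y' / X' ^ 1 \<in> loc ?N"
      proof (rule ordge_quotient_mem)
        show "ordge 1 F" using F by (simp add: ordge_def)
        show "X' \<in> loc ?N" "Y' \<in> loc ?N" using sub R loc_coords[of "(X', Y')"] by auto
        show "X' / X' \<in> loc ?N" "Y' / X' \<in> loc ?N" using nz yx by (simp_all add: loc_1)
      qed
      moreover have "1 / ev2 G X' Y' \<in> loc ?N"
        using locI[of G 1 "(X', Y')"] F sub R by (auto simp: ev2_hom)
      ultimately have "ev2 F X' Y' / X' ^ 1 * (1 / ev2 G X' Y') \<in> loc ?N" by (rule loc_mult)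
      then show ?thesis by (simp add: F(1) mult.commute)
    qed
    then show ?thesis using nz sub other_coord_maxid[OF assms(1) R] q by simp
  qed
  obtain X' Y' c where R: "loc XY = loc (X', Y')"
    and q: "q = loc (X', Y' / X' - cnst c) \<or> q = loc (X' / Y' - cnst c, Y')"
    using assms(2) unfolding exc_points_def by blast
  from q show ?thesis
  proof
    assume q: "q = loc (X', Y' / X' - cnst c)"
    show ?thesis using *[OF R q] q by blast
  next
    assume q: "q = loc (X' / Y' - cnst c, Y')"
    then have q': "q = loc (Y', X' / Y' - cnst c)" by (simp only: loc_swap)
    show ?thesis using *[OF trans[OF R loc_swap] q'] q' by blast
  qed
qed

section \<open>Stalks of a cluster scheme in terms of virtual transforms\<close>

lemma loc_gen_params_mono:
  assumes "indep2 (XY :: 'a::field ratfun \<times> 'a ratfun)" "j \<le> k"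
  shows "loc (gen_params XY e c j) \<subseteq> loc (gen_params XY e c k)"
  using assms(2)
proof (induction rule: dec_induct)
  case (step n)
  then show ?case using loc_chart_next(1)[OF indep_gen_params[OF assms(1)]] by fastforce
qed simp

lemma exc_eq_props:
  assumes "indep2 (XY :: 'a::field ratfun \<times> 'a ratfun)"
  shows "exc_eq XY e c j \<in> maxid (loc (gen_params XY e c j))" "exc_eq XY e c j \<noteq> 0"
    "h \<in> maxid (loc (gen_params XY e c j)) \<Longrightarrow> j < i \<Longrightarrow> h / exc_eq XY e c j \<in> loc (gen_params XY e c i)"
proof -
  note i = indep_gen_params[OF assms, of e c j]
  show "exc_eq XY e c j \<in> maxid (loc (gen_params XY e c j))"
    using maxid_coords[OF i] by (cases "e j") (simp_all add: exc_eq_def exc_coord_def ev2_gens)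
  show "exc_eq XY e c j \<noteq> 0"
    using indep_coords_nonzero[OF i] by (cases "e j") (simp_all add: exc_eq_def exc_coord_def ev2_gens)
  assume "h \<in> maxid (loc (gen_params XY e c j))" "j < i"
  then have "h / exc_eq XY e c j \<in> loc (gen_params XY e c (Suc j))"
    using loc_chart_next(3)[OF i] by (simp add: exc_eq_def)
  then show "h / exc_eq XY e c j \<in> loc (gen_params XY e c i)"
    using loc_gen_params_mono[OF assms, of "Suc j" i] \<open>j < i\<close> by auto
qed

text \<open>Otherwise the nonzero constant \<open>\<gamma> - \<gamma>'\<close>, a difference of two
  coordinates vanishing at the point, would lie in a maximal ideal. It provides a point of the
  exceptional curve that is not the next point of the cluster.\<close>

lemma loc_chart_next_inj:
  fixes XY :: "'a::field ratfun \<times> 'a ratfun"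
  assumes "indep2 XY" "loc (chart_next True \<gamma> XY) = loc (chart_next True \<gamma>' XY)"
  shows "\<gamma> = \<gamma>'"
proof (rule ccontr)
  assume ne: "\<gamma> \<noteq> \<gamma>'"
  have i: "indep2 (chart_next True \<gamma> XY)" for \<gamma>
    using indep_chart_next[of "fst XY" "snd XY" True \<gamma>] assms by simp
  have "snd (chart_next True \<gamma>' XY) - snd (chart_next True \<gamma> XY) = cnst (\<gamma> - \<gamma>')"
    by (simp add: chart_next_def is_homD[OF is_hom_cnst])
  moreover have "snd (chart_next True \<gamma>' XY) + snd (chart_next True \<gamma> XY) * cnst (- 1) \<in> maxid (loc (chart_next True \<gamma> XY))"
    using maxid_coords(2)[OF i[of \<gamma>]] maxid_coords(2)[OF i[of \<gamma>']] assms(2)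
    by (intro maxid_add[OF i] maxid_mult[OF i] loc_cnst) simp_all
  ultimately have "cnst (\<gamma> - \<gamma>') \<in> maxid (loc (chart_next True \<gamma> XY))"
    by (simp add: is_homD[OF is_hom_cnst])
  then show False using cnst_not_maxid[of "\<gamma> - \<gamma>'"] ne by simp
qed

lemma prod_atMost_split: "(\<Prod>j\<le>i. f j) = (\<Prod>j<i. f j) * (f i :: 'b::comm_monoid_mult)" for i :: nat
  by (simp add: lessThan_Suc_atMost[symmetric])

text \<open>The bridge from the sheaf definition to linear conditions. In one direction the
  factorisation \<open>ev2_vstage\<close> applies at every point of the exceptional curves. In the
  other, a single point of each curve suffices, because the order along a curve can be tested at any
  of its points.\<close>

theorem cluster_scheme_iff_passes:
  fixes XY :: "'a::field ratfun \<times> 'a ratfun" and M :: "int list"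
  assumes ind: "indep2 XY" and r: "r \<ge> 1" and M: "\<And>i. i < r \<Longrightarrow> M ! i = int (\<mu> i)" and G: "bcoeff G 0 0 \<noteq> 0"
  shows "ev2p F XY / ev2p G XY \<in> cluster_scheme (gen_cluster r XY e c) M (loc XY) \<longleftrightarrow> passes r e c \<mu> F"
proof -
  let ?P = "gen_params XY e c" and ?K = "gen_cluster r XY e c" and ?f = "ev2p F XY / ev2p G XY"
  have K: "?K ! i = loc (?P i)" if "i < r" for i using that by (simp add: gen_cluster_def)
  have K0: "loc XY = ?K ! 0" using K[of 0] r by simp
  have lenK: "length ?K = r" by (simp add: gen_cluster_def)
  have cs: "?f \<in> cluster_scheme ?K M (loc XY) \<longleftrightarrow> (\<forall>i<r. \<forall>q\<in>exc_points (loc (?P i)).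
      (Suc i < r \<longrightarrow> q \<noteq> ?K ! Suc i) \<longrightarrow> ?f \<in> exc_twist_stalk ?K M i q)"
    unfolding cluster_scheme_def if_P[OF K0] lenK using K by simp
  note indP = indep_gen_params[OF ind, of e c]
  have G1: "1 / ev2p G XY \<in> loc XY" using locI[of G 1 XY] G by (simp add: ev2_hom)
  have "G \<noteq> 0" using G by auto
  then have Gnz: "ev2p G XY \<noteq> 0" using ind by (simp add: indep_nonzero)
  have val: "?f = (\<Prod>l<i. exc_eq XY e c l ^ \<mu> l) * (ev2p (vstage e c \<mu> F i) (?P i) * (1 / ev2p G XY))"
    if "passes i e c \<mu> F" for i using ev2_vstage[OF ind that] by simp
  have Enz: "(\<Prod>l<i. exc_eq XY e c l ^ \<mu> l) \<noteq> 0" for i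
    using exc_eq_props(2)[OF ind] by simp
  have canc: "a * (w * g) / (a * x) = w / x * g" if "a \<noteq> 0" for a w g x :: "'a ratfun"
    using that by simp
  show ?thesis
  proof
    assume p: "passes r e c \<mu> F"
    show "?f \<in> cluster_scheme ?K M (loc XY)" unfolding cs
    proof (intro allI ballI impI)
      fix i q assume i: "i < r" and q: "q \<in> exc_points (loc (?P i))"
      obtain E N where E: "E \<in> maxid (loc (?P i))" "E \<noteq> 0" "q = loc N" "loc (?P i) \<subseteq> q"
        "\<And>h. h \<in> maxid (loc (?P i)) \<Longrightarrow> h / E \<in> q" using exc_points_chart[OF indP q] by blast
      define e' where "e' j = (if j < i then exc_eq XY e c j else E)" for j
      have "e' j \<in> maxid (?K ! j) \<and> e' j \<noteq> 0 \<and> (\<forall>h\<in>maxid (?K ! j). h / e' j \<in> q)" if "j \<le> i" for j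
      proof (cases "j < i")
        case True
        then have "h / exc_eq XY e c j \<in> q" if "h \<in> maxid (loc (?P j))" for h
          using exc_eq_props(3)[OF ind that True] E(4) by blast
        then show ?thesis using True i exc_eq_props(1,2)[OF ind] by (simp add: e'_def K)
      next
        case False
        then show ?thesis using that i E by (simp add: e'_def K)
      qed
      moreover have "?f / (\<Prod>j\<le>i. e' j powi (M ! j)) \<in> q"
      proof -
        have p': "passes i e c \<mu> F" "ordge (\<mu> i) (vstage e c \<mu> F i)" using p i by (auto simp: passes_def)
        have "(\<Prod>j\<le>i. e' j powi (M ! j)) = (\<Prod>j\<le>i. e' j ^ \<mu> j)"
          by (rule prod.cong) (use i M in \<open>auto simp: power_int_of_nat\<close>)
        also have "\<dots> = (\<Prod>l<i. exc_eq XY e c l ^ \<mu> l) * E ^ \<mu> i"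
          unfolding prod_atMost_split by (simp add: e'_def)
        finally have "?f / (\<Prod>j\<le>i. e' j powi (M ! j)) =
            ev2p (vstage e c \<mu> F i) (?P i) / E ^ \<mu> i * (1 / ev2p G XY)"
          by (simp only: val[OF p'(1)] canc[OF Enz])
        moreover have "ev2p (vstage e c \<mu> F i) (?P i) / E ^ \<mu> i \<in> q" unfolding E(3)
          by (rule ordge_quotient_mem[OF p'(2)])
            (use E maxid_coords[OF indP] loc_coords[of "?P i"] in auto)
        moreover have "1 / ev2p G XY \<in> q" using G1 loc_gen_params_mono[OF ind, of 0 i e c] E(4) by auto
        ultimately show ?thesis unfolding E(3) by (simp only: loc_mult)
      qed
      ultimately show "?f \<in> exc_twist_stalk ?K M i q" unfolding exc_twist_stalk_def by blast
    qed
  next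
    assume f: "?f \<in> cluster_scheme ?K M (loc XY)"
    have "i < r \<Longrightarrow> ordge (\<mu> i) (vstage e c \<mu> F i)" for i
    proof (induction i rule: less_induct)
      case (less i)
      then have p: "passes i e c \<mu> F" by (simp add: passes_def)
      \<comment> \<open>At most one of the values 0 and 1 gives the next point of the
        cluster.\<close>
      obtain \<gamma> where \<gamma>: "Suc i < r \<longrightarrow> loc (chart_next True \<gamma> (?P i)) \<noteq> ?K ! Suc i"
        using loc_chart_next_inj[OF indP, of 0 i 1] by (metis zero_neq_one)
      define N where "N = chart_next True \<gamma> (?P i)"
      define q where "q = loc N"
      have "loc (?P i) = loc (fst (?P i), snd (?P i))" by simp
      then have "q \<in> exc_points (loc (?P i))"
        unfolding exc_points_def q_def N_def chart_next_def if_True by blast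
      then have "?f \<in> exc_twist_stalk ?K M i q" using f \<gamma> less.prems unfolding cs q_def N_def by blast
      then obtain e' where e': "\<And>j. j \<le> i \<Longrightarrow> e' j \<in> maxid (?K ! j) \<and> e' j \<noteq> 0"
        "?f / (\<Prod>j\<le>i. e' j powi (M ! j)) \<in> q" unfolding exc_twist_stalk_def by blast
      have sub: "loc (?P i) \<subseteq> q" unfolding q_def N_def by (rule loc_chart_next(1)[OF indP])
      define E where "E j = (if j < i then exc_eq XY e c j else ev2p px (?P i))" for j
      have Enz': "E j \<noteq> 0" for j using exc_eq_props(2)[OF ind] indep_coords_nonzero[OF indP]
        by (simp add: E_def ev2_gens)
      \<comment> \<open>Whatever local equations \<open>e'\<close> are chosen, they are multiples of
        the standard ones \<open>E\<close>; so \<open>f\<close> is divisible by the standard product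
        as well.\<close>
      have eE: "e' j / E j \<in> q" if "j \<le> i" for j
      proof (cases "j < i")
        case True
        then show ?thesis using exc_eq_props(3)[OF ind _ True] e'(1)[OF that] sub less.prems K[of j]
          by (auto simp: E_def)
      next
        case False
        then have "j = i" using that by simp
        have "e' i / ev2p (exc_coord True) (?P i) \<in> loc (chart_next True \<gamma> (?P i))"
          by (rule loc_chart_next(3)[OF indP]) (use e'(1)[of i] less.prems K[of i] in simp)
        then show ?thesis using \<open>j = i\<close> by (simp add: E_def q_def N_def exc_coord_def)
      qed
      have "(\<Prod>j\<le>i. e' j powi (M ! j)) = (\<Prod>j\<le>i. e' j ^ \<mu> j)"
        by (rule prod.cong) (use less.prems M in \<open>auto simp: power_int_of_nat\<close>)
      then have "?f / (\<Prod>j\<le>i. e' j ^ \<mu> j) \<in> q" using e'(2) by simp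
      moreover have "(\<Prod>j\<le>i. (e' j / E j) ^ \<mu> j) \<in> q"
        using eE unfolding q_def by (intro loc_prod loc_power) simp
      ultimately have "?f / (\<Prod>j\<le>i. e' j ^ \<mu> j) * (\<Prod>j\<le>i. (e' j / E j) ^ \<mu> j) \<in> q"
        unfolding q_def by (rule loc_mult)
      moreover have "(\<Prod>j\<le>i. e' j ^ \<mu> j) \<noteq> 0" using e'(1) by simp
      ultimately have "?f / (\<Prod>j\<le>i. E j ^ \<mu> j) \<in> q" by (simp add: power_divide prod_dividef)
      moreover have "?f / (\<Prod>j\<le>i. E j ^ \<mu> j) =
          ev2p (vstage e c \<mu> F i) (?P i) / ev2p px (?P i) ^ \<mu> i * (1 / ev2p G XY)"
      proof -
        have "(\<Prod>j\<le>i. E j ^ \<mu> j) = (\<Prod>l<i. exc_eq XY e c l ^ \<mu> l) * ev2p px (?P i) ^ \<mu> i"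
          unfolding prod_atMost_split by (simp add: E_def)
        then show ?thesis by (simp only: val[OF p] canc[OF Enz])
      qed
      \<comment> \<open>Multiplying by the denominator of the germ returns to its polynomial
        numerator.\<close>
      moreover have "ev2p G XY \<in> q" using loc_ev2[of G XY] loc_gen_params_mono[OF ind, of 0 i e c] sub by auto
      ultimately have "ev2p (vstage e c \<mu> F i) (?P i) / ev2p px (?P i) ^ \<mu> i * (1 / ev2p G XY) * ev2p G XY \<in> q"
        unfolding q_def by (simp only: loc_mult)
      then have "ev2p (vstage e c \<mu> F i) (?P i) / ev2p px (?P i) ^ \<mu> i \<in> q" using Gnz by simp
      then obtain A B where A: "ev2p (vstage e c \<mu> F i) (?P i) / ev2p px (?P i) ^ \<mu> i = ev2p A N / ev2p B N"
        "bcoeff B 0 0 \<noteq> 0" unfolding q_def loc_iff by blast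
      have indN: "indep2 N" unfolding N_def
        using indep_chart_next[of "fst (?P i)" "snd (?P i)" True \<gamma>] indP by simp
      have "B \<noteq> 0" using A by auto
      then have Bnz: "ev2p B N \<noteq> 0" using indN by (simp add: indep_nonzero)
      have pxN: "ev2p px (?P i) = ev2p px N" "ev2p px (?P i) \<noteq> 0"
        using indep_coords_nonzero[OF indP] by (simp_all add: ev2_gens N_def chart_next_def)
      have "ev2p (vstage e c \<mu> F i) (?P i) = ev2p (chart_sub True \<gamma> (vstage e c \<mu> F i)) N"
        unfolding N_def using ev2_chart_sub'[OF indP] by simp
      then have "ev2p (chart_sub True \<gamma> (vstage e c \<mu> F i) * B) N = ev2p (px ^ \<mu> i * A) N"
        using A(1) Bnz pxN unfolding ev2_hom by (simp add: field_simps)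
      then have "chart_sub True \<gamma> (vstage e c \<mu> F i) * B = px ^ \<mu> i * A"
        using indep_eq_iff[OF indN] by blast
      then have "px ^ \<mu> i dvd chart_sub True \<gamma> (vstage e c \<mu> F i) * B" by (metis dvd_triv_left)
      then have "px ^ \<mu> i dvd chart_sub True \<gamma> (vstage e c \<mu> F i)"
        using not_px_dvd[OF A(2)] by (rule px_power_dvd_multD)
      then show ?case
        using exc_coord_power_dvd_chart_sub[of True "\<mu> i" \<gamma> "vstage e c \<mu> F i"]
        unfolding exc_coord_def if_True by blast
    qed
    then show "passes r e c \<mu> F" by (simp add: passes_def)
  qed
qed

lemma ordge_mult:
  fixes F G :: "'a::idom poly poly"
  assumes "ordge m F" "ordge n G" shows "ordge (m + n) (F * G)"
proof -
  have "exc_coord True ^ m * exc_coord True ^ n dvd chart_sub True 0 F * chart_sub True 0 G"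
    using assms by (intro mult_dvd_mono) (simp_all add: exc_coord_power_dvd_chart_sub)
  then show ?thesis
    by (simp only: power_add[symmetric] is_homD(4)[OF is_hom_chart_sub, symmetric] exc_coord_power_dvd_chart_sub)
qed

lemma ordge_power: "ordge 1 F \<Longrightarrow> ordge n (F ^ n)" for F :: "'a::idom poly poly"
proof (induction n)
  case (Suc n)
  then show ?case using ordge_mult[of 1 F n "F ^ n"] by simp
qed (simp add: ordge_def)

lemma ordge_0_mult: "ordge m F \<Longrightarrow> ordge m (F * G)" for F :: "'a::idom poly poly"
  using ordge_mult[of m F 0 G] by (simp add: ordge_def)

text \<open>Geometric series: \<open>H = h (1 - U)\<close> with a constant \<open>h\<close> and with
  \<open>U\<close> vanishing at the origin.\<close>

lemma truncated_inverse:
  fixes H :: "'a::field poly poly"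
  assumes "bcoeff H 0 0 \<noteq> 0"
  shows "\<exists>W. ordge L (H * W - 1)"
proof -
  define h where "h = bcoeff H 0 0"
  define U where "U = 1 - cst (inverse h) * H"
  have "bcoeff U 0 0 = 0"
    using assms unfolding U_def bcoeff_simps bcoeff_cst_mult by (simp add: h_def bcoeff_def)
  then have U: "ordge L (U ^ L)" by (intro ordge_power) (simp add: ordge_def)
  define W where "W = cst (inverse h) * (\<Sum>l<L. U ^ l)"
  have "H * W = (1 - U) * (\<Sum>l<L. U ^ l)" unfolding W_def U_def by (simp only: mult_ac) simp
  also have "\<dots> = 1 - U ^ L" by (simp add: one_diff_power_eq)
  finally have "H * W - 1 = 0 - U ^ L" by simp
  then have "ordge L (H * W - 1)" using U by (simp add: ordge_def bcoeff_def)
  then show ?thesis by blast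
qed

lemma cluster_scheme_mult:
  fixes XY :: "'a::field ratfun \<times> 'a ratfun"
  assumes ind: "indep2 XY" and r: "r \<ge> 1"
    and f: "f \<in> cluster_scheme (gen_cluster r XY e c) M (loc XY)" and g: "g \<in> loc XY"
  shows "f * g \<in> cluster_scheme (gen_cluster r XY e c) M (loc XY)"
proof -
  let ?K = "gen_cluster r XY e c"
  have K: "?K ! i = loc (gen_params XY e c i)" if "i < r" for i using that by (simp add: gen_cluster_def)
  have K0: "loc XY = ?K ! 0" using K[of 0] r by simp
  have lenK: "length ?K = r" by (simp add: gen_cluster_def)
  have cs: "x \<in> cluster_scheme ?K M (loc XY) \<longleftrightarrow> (\<forall>i<r. \<forall>q\<in>exc_points (loc (gen_params XY e c i)).
      (Suc i < r \<longrightarrow> q \<noteq> ?K ! Suc i) \<longrightarrow> x \<in> exc_twist_stalk ?K M i q)" for x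
    unfolding cluster_scheme_def if_P[OF K0] lenK using K by simp
  show ?thesis unfolding cs
  proof (intro allI ballI impI)
    fix i q assume i: "i < r" and q: "q \<in> exc_points (loc (gen_params XY e c i))"
      "Suc i < r \<longrightarrow> q \<noteq> ?K ! Suc i"
    then have "f \<in> exc_twist_stalk ?K M i q" using f unfolding cs by blast
    then obtain e' where e': "\<forall>j\<le>i. e' j \<in> maxid (?K ! j) \<and> e' j \<noteq> 0 \<and> (\<forall>h\<in>maxid (?K ! j). h / e' j \<in> q)"
      "f / (\<Prod>j\<le>i. e' j powi (M ! j)) \<in> q" unfolding exc_twist_stalk_def by blast
    obtain N where N: "q = loc N" "loc (gen_params XY e c i) \<subseteq> q"
      using exc_points_chart[OF indep_gen_params[OF ind] q(1)] by blast
    have "g \<in> q" using g N loc_gen_params_mono[OF ind, of 0 i e c] by auto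
    then have "f / (\<Prod>j\<le>i. e' j powi (M ! j)) * g \<in> q" using e'(2) unfolding N(1) by (simp only: loc_mult)
    then have "f * g / (\<Prod>j\<le>i. e' j powi (M ! j)) \<in> q" by simp
    with e'(1) show "f * g \<in> exc_twist_stalk ?K M i q" unfolding exc_twist_stalk_def by blast
  qed
qed

text \<open>The conditions of the earlier stages make this awkward to follow directly. It is read
  off from the ideal property of the stalk, in the coordinates \<open>xx\<close>, \<open>yy\<close>;
  any independent pair would do.\<close>

lemma passes_mult:
  fixes F :: "'a::field poly poly"
  assumes "r \<ge> 1" "passes r e c \<mu> F"
  shows "passes r e c \<mu> (F * G)"
proof -
  define XY where "XY = (xx :: 'a ratfun, yy :: 'a ratfun)"
  define M where "M = map (\<lambda>i. int (\<mu> i)) [0..<r]"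
  have ind: "indep2 XY" by (simp add: XY_def indep_xx_yy)
  have iff: "ev2p F XY / ev2p 1 XY \<in> cluster_scheme (gen_cluster r XY e c) M (loc XY) \<longleftrightarrow> passes r e c \<mu> F" for F
    by (rule cluster_scheme_iff_passes[OF ind assms(1)]) (simp_all add: M_def bcoeff_1)
  have "ev2p F XY / ev2p 1 XY * ev2p G XY \<in> cluster_scheme (gen_cluster r XY e c) M (loc XY)"
    by (rule cluster_scheme_mult[OF ind assms(1)]) (use iff assms(2) loc_ev2 in blast)+
  then show ?thesis using iff[of "F * G"] by (simp add: ev2_hom)
qed

lemma passes_diff: "passes r e c \<mu> F \<Longrightarrow> passes r e c \<mu> G \<Longrightarrow> passes r e c \<mu> (F - G)"
  by (simp add: passes_def vstage_diff ordge_def)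

lemma virt_square:
  fixes F :: "'a::idom poly poly"
  assumes "ordge m F"
  shows "virt e \<gamma> (2 * m) (F * F) = virt e \<gamma> m F * virt e \<gamma> m F"
proof -
  have p: "exc_coord e ^ (2 * m) = exc_coord e ^ m * (exc_coord e ^ m :: 'a poly poly)"
    by (simp add: mult_2 power_add)
  have o: "ordge (2 * m) (F * F)" using ordge_mult[OF assms assms] by (simp add: mult_2)
  have "exc_coord e ^ (2 * m) * virt e \<gamma> (2 * m) (F * F) = chart_sub e \<gamma> F * chart_sub e \<gamma> F"
    unfolding chart_sub_eq_virt[OF o, symmetric] by (simp only: is_homD[OF is_hom_chart_sub])
  also have "\<dots> = exc_coord e ^ (2 * m) * (virt e \<gamma> m F * virt e \<gamma> m F)"
    unfolding chart_sub_eq_virt[OF assms] p by (simp only: mult_ac)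
  finally show ?thesis by (simp add: exc_coord_def split: if_splits)
qed

lemma passes_square:
  fixes F :: "'a::idom poly poly"
  assumes "passes r e c \<nu> F"
  shows "passes r e c (\<lambda>i. 2 * \<nu> i) (F * F)"
proof -
  have "i \<le> r \<Longrightarrow> vstage e c (\<lambda>i. 2 * \<nu> i) (F * F) i = vstage e c \<nu> F i * vstage e c \<nu> F i" for i
    by (induction i) (use assms in \<open>simp_all add: passes_def virt_square\<close>)
  then show ?thesis using assms ordge_mult unfolding passes_def by (metis less_imp_le mult_2)
qed

section \<open>Forms of degree \<open>n\<close> and their expressions in local coordinates\<close>

definition tri :: "nat \<Rightarrow> (nat \<times> nat) set" where "tri n = {(i, j). i + j \<le> n}"

lemma finite_tri [simp]: "finite (tri n)"
proof -
  have "tri n \<subseteq> {..n} \<times> {..n}" by (auto simp: tri_def)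
  then show ?thesis by (rule finite_subset) simp
qed

lemma card_tri: "2 * card (tri n) = (n + 1) * (n + 2)"
proof -
  have "tri n = (SIGMA i:{..n}. {..n - i})" by (auto simp: tri_def)
  then have "card (tri n) = (\<Sum>i\<le>n. n - i + 1)" by simp
  also have "\<dots> = (\<Sum>i\<le>n. i + 1)"
    by (rule sum.reindex_bij_witness[of _ "\<lambda>i. n - i" "\<lambda>i. n - i"]) auto
  also have "2 * \<dots> = (n + 1) * (n + 2)" by (induction n) auto
  finally show ?thesis .
qed

text \<open>\<open>fmon t n (i,j)\<close> is the monomial \<open>X\<^sub>1\<^sup>i X\<^sub>2\<^sup>j X\<^sub>0\<^bsup>n-i-j\<^esup>\<close> in the affine coordinates on \<open>X\<^sub>t \<noteq> 0\<close>.\<close>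

definition fmon :: "nat \<Rightarrow> nat \<Rightarrow> nat \<times> nat \<Rightarrow> 'a::comm_ring_1 poly poly" where
  "fmon t n s = (if t = 0 then px ^ fst s * py ^ snd s
     else if t = 1 then px ^ (n - fst s - snd s) * py ^ snd s
     else px ^ (n - fst s - snd s) * py ^ fst s)"

lemma fmon_0: "fmon 0 n s = px ^ fst s * py ^ snd s"
  unfolding fmon_def by (simp only: refl if_True)

definition form :: "nat \<Rightarrow> nat \<Rightarrow> (nat \<times> nat \<Rightarrow> 'a::comm_ring_1) \<Rightarrow> 'a poly poly" where
  "form t n a = (\<Sum>s\<in>tri n. cst (a s) * fmon t n s)"

definition gsec :: "nat \<Rightarrow> (nat \<times> nat \<Rightarrow> 'a::idom) \<Rightarrow> 'a ratfun" where
  "gsec n a = to_fract (form 0 n a)"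

lemma xx_yy_nonzero [simp]: "xx \<noteq> (0 :: 'a::idom ratfun)" "yy \<noteq> (0 :: 'a ratfun)"
  using indep_coords_nonzero[OF indep_xx_yy] by auto

lemma hcoord_nonzero [simp]: "hcoord t \<noteq> (0 :: 'a::idom ratfun)"
  by (simp add: hcoord_def)

lemma less3_cases: "t < 3 \<Longrightarrow> t = 0 \<or> t = 1 \<or> t = (2::nat)"
  by linarith

lemma gsec_div_hcoord:
  fixes a :: "nat \<times> nat \<Rightarrow> 'a::idom"
  assumes "t < 3"
  shows "gsec n a / hcoord t ^ n = ev2p (form t n a) (aff t)"
proof -
  have g: "gsec n a = (\<Sum>s\<in>tri n. cnst (a s) * xx ^ fst s * yy ^ snd s)"
    unfolding gsec_def ev2_xx_yy[symmetric] form_def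
    by (simp only: ev2_hom ev2_gens fmon_0 mult.assoc)
  have f: "ev2p (form t n a) (aff t) = (\<Sum>s\<in>tri n. cnst (a s) * ev2p (fmon t n s) (aff t))"
    unfolding form_def by (simp only: ev2_hom ev2_gens)
  have "xx ^ i * yy ^ j / hcoord t ^ n = ev2p (fmon t n (i, j)) (aff t :: 'a ratfun \<times> _)"
    if "i + j \<le> n" for i j
  proof -
    have x: "xx ^ n = (xx :: 'a ratfun) ^ i * (xx ^ j * xx ^ (n - i - j))" "yy ^ n = (yy :: 'a ratfun) ^ i * (yy ^ j * yy ^ (n - i - j))"
      using that by (simp_all add: power_add[symmetric])
    show ?thesis using less3_cases[OF assms]
    proof (elim disjE)
      assume t: "t = 0"
      show ?thesis by (simp add: t hcoord_def aff_def fmon_def ev2_hom ev2_gens)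
    next
      assume t: "t = 1"
      have "ev2p (fmon t n (i, j)) (aff t) = (1 / xx :: 'a ratfun) ^ (n - i - j) * (yy / xx) ^ j"
        by (simp add: t aff_def fmon_def ev2_hom ev2_gens del: One_nat_def)
      then show ?thesis unfolding t by (simp add: hcoord_def x(1) power_divide mult.commute)
    next
      assume t: "t = 2"
      have "ev2p (fmon t n (i, j)) (aff t) = (1 / yy :: 'a ratfun) ^ (n - i - j) * (xx / yy) ^ i"
        by (simp add: t aff_def fmon_def ev2_hom ev2_gens)
      then show ?thesis unfolding t by (simp add: hcoord_def x(2) power_divide mult.commute)
    qed
  qed
  then show ?thesis unfolding f g sum_divide_distrib
    by (intro sum.cong refl) (auto simp: tri_def mult.assoc times_divide_eq_right[symmetric]
        simp del: times_divide_eq_right)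
qed

lemma bcoeff_form_0: "bcoeff (form 0 n a) i j = (if (i, j) \<in> tri n then a (i, j) else 0)"
proof -
  have "form 0 n a = (\<Sum>s\<in>tri n. cst (a s) * px ^ fst s * py ^ snd s)"
    unfolding form_def fmon_0 by (simp only: mult.assoc)
  also have "bcoeff \<dots> i j = (\<Sum>s\<in>tri n. if s = (i, j) then a (i, j) else 0)"
    unfolding bmonom_eq bcoeff_sum by (rule sum.cong) (auto simp: bcoeff_monom prod_eq_iff)
  finally show ?thesis by simp
qed

lemma gsec_eq_0_iff: "gsec n a = 0 \<longleftrightarrow> (\<forall>s\<in>tri n. a s = 0)"
proof -
  have "gsec n a = 0 \<longleftrightarrow> form 0 n a = 0" by (simp add: gsec_def)
  also have "\<dots> \<longleftrightarrow> (\<forall>i j. bcoeff (form 0 n a) i j = 0)" by (metis bipoly_eqI bcoeff_simps(1))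
  also have "\<dots> \<longleftrightarrow> (\<forall>s\<in>tri n. a s = 0)" unfolding bcoeff_form_0 by auto
  finally show ?thesis .
qed

lemma global_sections_iff: "f \<in> global_sections (int n) \<longleftrightarrow> (\<exists>P. f = to_fract P \<and> (\<forall>i j. bcoeff P i j \<noteq> 0 \<longrightarrow> i + j \<le> n))"
  unfolding global_sections_def bcoeff_def by (auto simp flip: of_nat_add)

lemma gsec_in_global_sections: "gsec n a \<in> global_sections (int n)"
  unfolding global_sections_iff gsec_def
  by (intro exI[of _ "form 0 n a"]) (auto simp: bcoeff_form_0 tri_def split: if_splits)

lemma global_sectionsE:
  assumes "f \<in> global_sections (int n)"
  obtains a where "f = gsec n a"
proof -
  from assms obtain P where P: "f = to_fract P" "\<And>i j. bcoeff P i j \<noteq> 0 \<Longrightarrow> i + j \<le> n"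
    unfolding global_sections_iff by blast
  have "P = form 0 n (\<lambda>(i, j). bcoeff P i j)"
    by (rule bipoly_eqI) (use P(2) in \<open>auto simp: bcoeff_form_0 tri_def\<close>)
  then show thesis using P(1) that[of "\<lambda>(i, j). bcoeff P i j"] by (simp add: gsec_def)
qed

lemma global_sections_mult:
  assumes "f \<in> global_sections (int n)" "g \<in> global_sections (int n')"
  shows "f * g \<in> global_sections (int (n + n'))"
proof -
  obtain P Q where P: "f = to_fract P" "\<And>i j. bcoeff P i j \<noteq> 0 \<Longrightarrow> i + j \<le> n"
    and Q: "g = to_fract Q" "\<And>i j. bcoeff Q i j \<noteq> 0 \<Longrightarrow> i + j \<le> n'"
    using assms unfolding global_sections_iff by blast
  have "i + j \<le> n + n'" if "bcoeff (P * Q) i j \<noteq> 0" for i j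
  proof (rule ccontr)
    assume n: "\<not> i + j \<le> n + n'"
    have "bcoeff P a b * bcoeff Q (i - a) (j - b) = 0" if "a \<le> i" "b \<le> j" for a b
    proof (rule ccontr)
      assume "bcoeff P a b * bcoeff Q (i - a) (j - b) \<noteq> 0"
      then have "a + b \<le> n" "i - a + (j - b) \<le> n'" using P(2) Q(2) by auto
      then show False using n that by linarith
    qed
    then have "bcoeff (P * Q) i j = 0" unfolding bcoeff_mult by (intro sum.neutral ballI) simp
    with that show False by simp
  qed
  then show ?thesis unfolding global_sections_iff P(1) Q(1) by (intro exI[of _ "P * Q"]) simp
qed

lemma global_sections_mono: "n \<le> n' \<Longrightarrow> f \<in> global_sections (int n) \<Longrightarrow> f \<in> global_sections (int n')"
  unfolding global_sections_iff by (elim exE conjE, rule exI, rule conjI, assumption) (blast intro: le_trans)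

lemma global_sections_diff:
  assumes "f \<in> global_sections (int n)" "g \<in> global_sections (int n)"
  shows "f - g \<in> global_sections (int n)"
proof -
  obtain P Q where P: "f = to_fract P" "\<And>i j. bcoeff P i j \<noteq> 0 \<Longrightarrow> i + j \<le> n"
    and Q: "g = to_fract Q" "\<And>i j. bcoeff Q i j \<noteq> 0 \<Longrightarrow> i + j \<le> n"
    using assms unfolding global_sections_iff by blast
  have "f - g = to_fract (P - Q)" by (simp add: P(1) Q(1))
  moreover have "i + j \<le> n" if "bcoeff (P - Q) i j \<noteq> 0" for i j
    using that P(2)[of i j] Q(2)[of i j] by (cases "bcoeff P i j = 0") auto
  ultimately show ?thesis unfolding global_sections_iff by blast
qed

text \<open>Points with coordinates in which the affine coordinates of the chart \<open>t\<close> are polynomials.\<close>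

definition coords_at :: "nat \<Rightarrow> 'a::idom poly poly \<Rightarrow> 'a poly poly \<Rightarrow> 'a ratfun \<times> 'a ratfun \<Rightarrow> bool" where
  "coords_at t A B XY \<longleftrightarrow> t < 3 \<and> indep2 XY \<and> aff t = (ev2p A XY, ev2p B XY)"

lemma hcoord_quot:
  assumes "t < 3" "u < 3"
  shows "hcoord u / hcoord t \<in> {1, fst (aff t), snd (aff t)}"
  using less3_cases[OF assms(1)] less3_cases[OF assms(2)] by (auto simp: hcoord_def aff_def)

lemma hcoord_quot_loc:
  assumes "coords_at t A B XY" "u < 3"
  shows "hcoord u / hcoord t \<in> loc XY"
proof -
  have "t < 3" "{1, fst (aff t), snd (aff t)} \<subseteq> loc XY"
    using assms(1) loc_ev2[of _ XY] loc_1[of XY] by (auto simp: coords_at_def)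
  then show ?thesis using hcoord_quot[of t u] assms(2) by blast
qed

text \<open>The quotient of two homogeneous coordinates that are nonzero at a point is a unit there,
  so the choice of \<open>t\<close> in \<open>twist_stalk\<close> is immaterial.\<close>

lemma twist_stalk_iff:
  fixes XY :: "'a::field ratfun \<times> 'a ratfun"
  assumes "coords_at t A B XY"
  shows "f \<in> twist_stalk d (loc XY) \<longleftrightarrow> f / (hcoord t powi d) \<in> loc XY"
proof
  assume "f / (hcoord t powi d) \<in> loc XY"
  then show "f \<in> twist_stalk d (loc XY)" unfolding twist_stalk_def
    using hcoord_quot_loc[OF assms] assms by (auto simp: coords_at_def)
next
  assume "f \<in> twist_stalk d (loc XY)"
  then obtain t' where t': "t' < 3" "\<And>u. u < 3 \<Longrightarrow> hcoord u / hcoord t' \<in> loc XY"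
    "f / (hcoord t' powi d) \<in> loc XY" unfolding twist_stalk_def by blast
  have "hcoord t / hcoord t' \<in> loc XY" "hcoord t' / hcoord t \<in> loc XY"
    using t' hcoord_quot_loc[OF assms] assms by (auto simp: coords_at_def)
  then have "(hcoord t' / hcoord t) powi d \<in> loc XY"
  proof (cases "d \<ge> 0")
    case True
    then have "(hcoord t' / hcoord t :: 'a ratfun) powi d = (hcoord t' / hcoord t) ^ nat d" by (simp add: power_int_def)
    then show ?thesis using \<open>hcoord t' / hcoord t \<in> loc XY\<close> by (simp only: loc_power)
  next
    case False
    then have "(hcoord t' / hcoord t :: 'a ratfun) powi d = (hcoord t / hcoord t') ^ nat (- d)"
      by (simp add: power_int_def inverse_divide flip: power_inverse)
    then show ?thesis using \<open>hcoord t / hcoord t' \<in> loc XY\<close> by (simp only: loc_power)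
  qed
  then have "f / (hcoord t' powi d) * (hcoord t' / hcoord t) powi d \<in> loc XY"
    using t'(3) by (simp only: loc_mult)
  also have "f / (hcoord t' powi d) * (hcoord t' / hcoord t) powi d = f / (hcoord t powi d)"
    by (simp add: power_int_divide_distrib)
  finally show "f / (hcoord t powi d) \<in> loc XY" .
qed

lemma gsec_div_coords:
  assumes "coords_at t A B XY"
  shows "gsec n a / (hcoord t powi int n) = ev2p (bsub (form t n a) A B) XY"
  using gsec_div_hcoord[of t n a] assms by (simp add: coords_at_def ev2_bsub)

section \<open>The rank of a union of cluster schemes\<close>

text \<open>The stalk at \<open>q\<close> of the twisted ideal sheaf of \<open>Z\<close>.\<close>

definition kernel_at :: "int \<Rightarrow> 'a::idom subsch \<Rightarrow> 'a point \<Rightarrow> 'a ratfun set" where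
  "kernel_at d Z q = {a * b | a b. a \<in> Z q \<and> b \<in> twist_stalk d q}"

text \<open>That is, \<open>h\<^sup>0(\<I>\<^sub>Z(n)) \<le> \<kappa>\<close>, stated so that it visibly is an open condition on \<open>Z\<close>.\<close>

definition rank_cond :: "'a::idom point set \<Rightarrow> 'a subsch \<Rightarrow> nat \<Rightarrow> nat \<Rightarrow> bool" where
  "rank_cond Q Z n \<kappa> \<longleftrightarrow> (\<exists>l::nat \<Rightarrow> nat \<times> nat \<Rightarrow> 'a. \<forall>a.
     (\<forall>q\<in>Q. gsec n a \<in> kernel_at (int n) Z q) \<and> (\<forall>i<\<kappa>. (\<Sum>s\<in>tri n. l i s * a s) = 0) \<longrightarrow>
     (\<forall>s\<in>tri n. a s = 0))"

definition cluster_loc_poly ::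
  "(nat \<Rightarrow> nat) \<Rightarrow> (nat \<Rightarrow> 'a::comm_ring_1 poly poly) \<Rightarrow> (nat \<Rightarrow> 'a poly poly) \<Rightarrow>
    nat \<Rightarrow> nat \<Rightarrow> (nat \<times> nat \<Rightarrow> 'a) \<Rightarrow> 'a poly poly" where
  "cluster_loc_poly t A B k n a = bsub (form (t k) n a) (A k) (B k)"

text \<open>One index \<open>(k, i, a, b)\<close> for the vanishing of the coefficient of
  \<open>x^a y^b\<close> in the \<open>i\<close>-th virtual transform at the \<open>k\<close>-th
  cluster; each point thus contributes \<open>\<mu> (\<mu> + 1) / 2\<close> conditions.\<close>

definition cluster_conds :: "nat \<Rightarrow> (nat \<Rightarrow> nat) \<Rightarrow> (nat \<Rightarrow> nat \<Rightarrow> nat) \<Rightarrow> (nat \<times> nat \<times> nat \<times> nat) set" where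
  "cluster_conds \<rho> r \<mu> = (SIGMA k:{1..\<rho>}. SIGMA i:{..<r k}. {(a, b). a + b < \<mu> k i})"

definition cluster_cond_val ::
  "(nat \<Rightarrow> nat \<Rightarrow> bool) \<Rightarrow> (nat \<Rightarrow> nat \<Rightarrow> 'a::comm_ring_1) \<Rightarrow> (nat \<Rightarrow> nat \<Rightarrow> nat) \<Rightarrow>
    nat \<times> nat \<times> nat \<times> nat \<Rightarrow> 'a poly poly \<Rightarrow> 'a" where
  "cluster_cond_val e c \<mu> = (\<lambda>(k, i, a, b) F. bcoeff (vstage (e k) (c k) (\<mu> k) F i) a b)"

definition cluster_cond_mat ::
  "(nat \<Rightarrow> nat) \<Rightarrow> (nat \<Rightarrow> 'a::comm_ring_1 poly poly) \<Rightarrow> (nat \<Rightarrow> 'a poly poly) \<Rightarrow>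
    (nat \<Rightarrow> nat \<Rightarrow> bool) \<Rightarrow> (nat \<Rightarrow> nat \<Rightarrow> 'a) \<Rightarrow> (nat \<Rightarrow> nat \<Rightarrow> nat) \<Rightarrow>
    nat \<Rightarrow> nat \<times> nat \<times> nat \<times> nat \<Rightarrow> nat \<times> nat \<Rightarrow> 'a" where
  "cluster_cond_mat t A B e c \<mu> n \<phi> s =
     cluster_cond_val e c \<mu> \<phi> (bsub (fmon (t (fst \<phi>)) n s) (A (fst \<phi>)) (B (fst \<phi>)))"

text \<open>General enough for two situations: tuples from affine charts of the parameter variety,
  and the special tuple on an arc, where the affine coordinates are polynomials in the blown-up
  coordinates \<open>x - U\<close> and \<open>y/x - V\<close>.\<close>

locale cluster_data =
  fixes \<rho> :: nat and r t :: "nat \<Rightarrow> nat" and A B :: "nat \<Rightarrow> 'a::field_char_0 poly poly"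
    and XY :: "nat \<Rightarrow> 'a ratfun \<times> 'a ratfun" and e :: "nat \<Rightarrow> nat \<Rightarrow> bool" and c :: "nat \<Rightarrow> nat \<Rightarrow> 'a"
    and \<mu> :: "nat \<Rightarrow> nat \<Rightarrow> nat" and M :: "nat \<Rightarrow> int list" and K :: "nat \<Rightarrow> 'a point list"
  assumes rho: "\<rho> \<ge> 1"
    and K: "k \<in> {1..\<rho>} \<Longrightarrow> K k = gen_cluster (r k) (XY k) (e k) (c k)"
    and coords: "k \<in> {1..\<rho>} \<Longrightarrow> coords_at (t k) (A k) (B k) (XY k)"
    and r: "k \<in> {1..\<rho>} \<Longrightarrow> r k \<ge> 1"
    and M: "k \<in> {1..\<rho>} \<Longrightarrow> i < r k \<Longrightarrow> M k ! i = int (\<mu> k i)"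
    and plane: "k \<in> {1..\<rho>} \<Longrightarrow> K k ! 0 \<in> plane"
    and inj: "inj_on (\<lambda>k. K k ! 0) {1..\<rho>}"
begin

definition Z :: "'a subsch" where "Z = union_scheme {1..\<rho>} (\<lambda>k. cluster_scheme (K k) (M k))"

lemma K0: "k \<in> {1..\<rho>} \<Longrightarrow> K k ! 0 = loc (XY k)"
  using K r[of k] by (simp add: gen_cluster_def)

lemma ind: "k \<in> {1..\<rho>} \<Longrightarrow> indep2 (XY k)"
  using coords by (simp add: coords_at_def)

text \<open>The origins being distinct, the other cluster schemes impose nothing at this
  point.\<close>

lemma Z_iff:
  assumes "k \<in> {1..\<rho>}" "x \<in> loc (XY k)"
  shows "x \<in> Z (loc (XY k)) \<longleftrightarrow> x \<in> cluster_scheme (K k) (M k) (loc (XY k))"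
proof -
  have "x \<in> cluster_scheme (K k') (M k') (loc (XY k))" if "k' \<in> {1..\<rho>}" "k' \<noteq> k" for k'
  proof -
    have "loc (XY k) \<noteq> K k' ! 0" using inj that assms(1) K0 by (metis inj_onD)
    then show ?thesis using assms(2) by (simp add: cluster_scheme_def)
  qed
  then show ?thesis using assms(1) unfolding Z_def union_scheme_def by blast
qed

lemma Z_passes:
  assumes "k \<in> {1..\<rho>}" "bcoeff G 0 0 \<noteq> 0"
  shows "ev2p F (XY k) / ev2p G (XY k) \<in> Z (loc (XY k)) \<longleftrightarrow> passes (r k) (e k) (c k) (\<mu> k) F"
  unfolding Z_iff[OF assms(1) locI[OF assms(2)]] K[OF assms(1)]
  by (rule cluster_scheme_iff_passes[OF ind[OF assms(1)] r[OF assms(1)] M[OF assms(1)] assms(2)])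

lemma Z_passes1:
  assumes "k \<in> {1..\<rho>}"
  shows "ev2p F (XY k) \<in> Z (loc (XY k)) \<longleftrightarrow> passes (r k) (e k) (c k) (\<mu> k) F"
  using Z_passes[OF assms, of 1 F] by (simp add: bcoeff_1 ev2_hom)

lemma Z_mult:
  assumes k: "k \<in> {1..\<rho>}" and x: "x \<in> Z (loc (XY k))" and y: "y \<in> loc (XY k)"
  shows "x * y \<in> Z (loc (XY k))"
proof -
  have "x * y \<in> cluster_scheme (K k') (M k') (loc (XY k))" if k': "k' \<in> {1..\<rho>}" for k'
  proof (cases "k' = k")
    case True
    have "x \<in> cluster_scheme (K k) (M k) (loc (XY k))" using x k unfolding Z_def union_scheme_def by blast
    then show ?thesis unfolding True K[OF k] by (rule cluster_scheme_mult[OF ind[OF k] r[OF k] _ y])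
  next
    case False
    have "loc (XY k) \<noteq> K k' ! 0" using inj k' k False K0 by (metis inj_onD)
    moreover have "x \<in> cluster_scheme (K k') (M k') (loc (XY k))"
      using x k' unfolding Z_def union_scheme_def by blast
    ultimately show ?thesis using y by (simp add: cluster_scheme_def loc_mult)
  qed
  then show ?thesis unfolding Z_def union_scheme_def by blast
qed

lemma Z_diff:
  assumes k: "k \<in> {1..\<rho>}" and x: "x \<in> Z (loc (XY k))" "x \<in> loc (XY k)"
    and y: "y \<in> Z (loc (XY k))" "y \<in> loc (XY k)"
  shows "x - y \<in> Z (loc (XY k))"
proof -
  obtain F G where F: "x = ev2p F (XY k) / ev2p G (XY k)" "bcoeff G 0 0 \<noteq> 0" using x(2) unfolding loc_iff by blast
  obtain F' G' where F': "y = ev2p F' (XY k) / ev2p G' (XY k)" "bcoeff G' 0 0 \<noteq> 0" using y(2) unfolding loc_iff by blast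
  have p: "passes (r k) (e k) (c k) (\<mu> k) F" "passes (r k) (e k) (c k) (\<mu> k) F'"
    using x(1) y(1) unfolding F(1) F'(1) Z_passes[OF k F(2)] Z_passes[OF k F'(2)] by blast+
  have "G \<noteq> 0" "G' \<noteq> 0" using F F' by auto
  then have "ev2p G (XY k) \<noteq> 0" "ev2p G' (XY k) \<noteq> 0" using ind[OF k] by (simp_all add: indep_nonzero)
  then have "x - y = ev2p (F * G' - F' * G) (XY k) / ev2p (G * G') (XY k)"
    by (simp add: F(1) F'(1) ev2_hom diff_frac_eq)
  moreover have "passes (r k) (e k) (c k) (\<mu> k) (F * G' - F' * G)"
    using p by (intro passes_diff passes_mult r[OF k])
  moreover have "bcoeff (G * G') 0 0 \<noteq> 0" using F F' by (simp add: bcoeff_0_0_mult)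
  ultimately show ?thesis using Z_passes[OF k] by simp
qed

lemma Z_0: "k \<in> {1..\<rho>} \<Longrightarrow> 0 \<in> Z (loc (XY k))"
  using Z_passes1[of k 0] by (simp add: passes_def vstage_0 ordge_def ev2_hom)

abbreviation h where "h k d \<equiv> hcoord (t k) powi d"

lemma stalk: "k \<in> {1..\<rho>} \<Longrightarrow> f \<in> twist_stalk d (loc (XY k)) \<longleftrightarrow> f / h k d \<in> loc (XY k)"
  by (rule twist_stalk_iff[OF coords])

lemma kernel_at_iff:
  assumes k: "k \<in> {1..\<rho>}"
  shows "f \<in> kernel_at d Z (loc (XY k)) \<longleftrightarrow> f / h k d \<in> Z (loc (XY k))"
proof
  assume "f \<in> kernel_at d Z (loc (XY k))"
  then obtain a b where "f = a * b" "a \<in> Z (loc (XY k))" "b / h k d \<in> loc (XY k)"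
    unfolding kernel_at_def using stalk[OF k] by blast
  then show "f / h k d \<in> Z (loc (XY k))" using Z_mult[OF k, of a "b / h k d"] by simp
next
  assume "f / h k d \<in> Z (loc (XY k))"
  moreover have "f = f / h k d * h k d" by simp
  moreover have "h k d \<in> twist_stalk d (loc (XY k))" unfolding stalk[OF k] by (simp add: loc_1)
  ultimately show "f \<in> kernel_at d Z (loc (XY k))" unfolding kernel_at_def by blast
qed

lemma twist_coset_iff:
  assumes k: "k \<in> {1..\<rho>}"
  shows "g \<in> twist_coset d Z (loc (XY k)) f \<longleftrightarrow> g / h k d \<in> loc (XY k) \<and> (g - f) / h k d \<in> Z (loc (XY k))"
  using kernel_at_iff[OF k, of "g - f" d] stalk[OF k, of g d]
  unfolding twist_coset_def kernel_at_def by blast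

lemma twist_coset_eq_iff:
  assumes k: "k \<in> {1..\<rho>}" and f: "f \<in> twist_stalk d (loc (XY k))" and g: "g \<in> twist_stalk d (loc (XY k))"
  shows "twist_coset d Z (loc (XY k)) f = twist_coset d Z (loc (XY k)) g \<longleftrightarrow> (f - g) / h k d \<in> Z (loc (XY k))"
proof
  assume "twist_coset d Z (loc (XY k)) f = twist_coset d Z (loc (XY k)) g"
  moreover have "f \<in> twist_coset d Z (loc (XY k)) f"
    unfolding twist_coset_iff[OF k] using f stalk[OF k] Z_0[OF k] by simp
  ultimately show "(f - g) / h k d \<in> Z (loc (XY k))" using twist_coset_iff[OF k] by blast
next
  assume fg: "(f - g) / h k d \<in> Z (loc (XY k))"
  have F: "f / h k d \<in> loc (XY k)" "g / h k d \<in> loc (XY k)" using f g stalk[OF k] by blast+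
  then have fg': "(f - g) / h k d \<in> loc (XY k)" using loc_diff by (simp add: diff_divide_distrib)
  have neg: "(g - f) / h k d \<in> Z (loc (XY k))"
    using Z_diff[OF k Z_0[OF k] loc_0 fg fg'] by (simp add: diff_divide_distrib)
  have "x \<in> twist_coset d Z (loc (XY k)) g \<longleftrightarrow> x \<in> twist_coset d Z (loc (XY k)) f" for x
  proof (cases "x / h k d \<in> loc (XY k)")
    case True
    have l: "(x - f) / h k d \<in> loc (XY k)" "(x - g) / h k d \<in> loc (XY k)" "(g - f) / h k d \<in> loc (XY k)"
      using True F loc_diff by (simp_all add: diff_divide_distrib)
    have "(x - f) / h k d - (g - f) / h k d = (x - g) / h k d" "(x - g) / h k d - (f - g) / h k d = (x - f) / h k d"
      by (simp_all add: diff_divide_distrib)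
    then show ?thesis using Z_diff[OF k _ l(1) neg l(3)] Z_diff[OF k _ l(2) fg fg'] True
      unfolding twist_coset_iff[OF k] by auto
  qed (simp add: twist_coset_iff[OF k])
  then show "twist_coset d Z (loc (XY k)) f = twist_coset d Z (loc (XY k)) g" by blast
qed

lemma supp_Z: "supp Z \<subseteq> (\<lambda>k. loc (XY k)) ` {1..\<rho>}"
proof
  fix q assume "q \<in> supp Z"
  then have q: "Z q \<noteq> q" by (simp add: supp_def)
  show "q \<in> (\<lambda>k. loc (XY k)) ` {1..\<rho>}"
  proof (rule ccontr)
    assume n: "q \<notin> (\<lambda>k. loc (XY k)) ` {1..\<rho>}"
    then have "cluster_scheme (K k) (M k) q = q" if "k \<in> {1..\<rho>}" for k
      using that K0[OF that] by (auto simp: cluster_scheme_def)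
    moreover have "{1..\<rho>} \<noteq> {}" using rho by simp
    ultimately have "Z q = q" unfolding Z_def union_scheme_def by auto
    with q show False by simp
  qed
qed

lemma Z_not_supp: "k \<in> {1..\<rho>} \<Longrightarrow> loc (XY k) \<notin> supp Z \<Longrightarrow> Z (loc (XY k)) = loc (XY k)"
  using plane K0 by (auto simp: supp_def)

lemma global_stalk:
  assumes k: "k \<in> {1..\<rho>}" and f: "f \<in> global_sections (int n)"
  shows "f \<in> twist_stalk (int n) (loc (XY k))"
proof -
  obtain a where a: "f = gsec n a" using f by (rule global_sectionsE)
  show ?thesis unfolding stalk[OF k] a gsec_div_coords[OF coords[OF k]] by (rule loc_ev2)
qed

lemma inv_h_loc: "k \<in> {1..\<rho>} \<Longrightarrow> 1 / hcoord (t k) \<in> loc (XY k)"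
  using hcoord_quot_loc[OF coords, of k 0] by (simp add: hcoord_def)

abbreviation loc_poly where "loc_poly \<equiv> cluster_loc_poly t A B"

lemmas loc_poly_def = cluster_loc_poly_def

lemma gsec_loc: "k \<in> {1..\<rho>} \<Longrightarrow> gsec n a / h k (int n) = ev2p (loc_poly k n a) (XY k)"
  unfolding loc_poly_def by (rule gsec_div_coords[OF coords])

abbreviation passes_at where "passes_at k F \<equiv> passes (r k) (e k) (c k) (\<mu> k) F"

lemma gsec_kernel_iff:
  assumes k: "k \<in> {1..\<rho>}"
  shows "gsec n a \<in> kernel_at (int n) Z (K k ! 0) \<longleftrightarrow> passes_at k (loc_poly k n a)"
  unfolding K0[OF k] kernel_at_iff[OF k] gsec_loc[OF k] by (rule Z_passes1[OF k])

abbreviation conds where "conds \<equiv> cluster_conds \<rho> r \<mu>"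
abbreviation cond_val where "cond_val \<equiv> cluster_cond_val e c \<mu>"

lemmas conds_def = cluster_conds_def
lemmas cond_val_def = cluster_cond_val_def

lemma passes_iff_conds:
  "k \<in> {1..\<rho>} \<Longrightarrow> passes_at k F \<longleftrightarrow> (\<forall>s. (k, s) \<in> conds \<longrightarrow> cond_val (k, s) F = 0)"
  unfolding passes_def ordge_def conds_def cond_val_def by auto

lemma card_strict_tri: "2 * card {(a, b). a + b < (m::nat)} = m * (m + 1)" and
  finite_strict_tri: "finite {(a, b). a + b < (m::nat)}"
proof -
  have "{(a, b). a + b < m} = (if m = 0 then {} else tri (m - 1))" by (auto simp: tri_def)
  then show "2 * card {(a, b). a + b < m} = m * (m + 1)" "finite {(a, b). a + b < m}"
    using card_tri[of "m - 1"] by (cases m; simp)+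
qed

lemma finite_conds: "finite conds"
  unfolding conds_def by (intro finite_SigmaI finite_strict_tri) auto

lemma card_conds: "2 * card conds = (\<Sum>k=1..\<rho>. \<Sum>i<r k. \<mu> k i * (\<mu> k i + 1))"
  unfolding conds_def
  by (simp add: finite_strict_tri sum_distrib_left card_strict_tri finite_SigmaI)

abbreviation cond_mat where "cond_mat \<equiv> cluster_cond_mat t A B e c \<mu>"

lemmas cond_mat_def = cluster_cond_mat_def

lemma cond_val_loc_poly: "cond_val \<phi> (loc_poly (fst \<phi>) n a) = (\<Sum>s\<in>tri n. cond_mat n \<phi> s * a s)"
proof -
  obtain k i x y where p: "\<phi> = (k, i, x, y)" by (cases \<phi>)
  have "loc_poly k n a = (\<Sum>s\<in>tri n. cst (a s) * bsub (fmon (t k) n s) (A k) (B k))"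
    unfolding loc_poly_def form_def by (simp only: is_homD[OF is_hom_bsub] bsub_gens)
  then show ?thesis unfolding p cond_mat_def cond_val_def fst_conv split_conv
    by (simp only: vstage_sum vstage_cst_mult bcoeff_sum bcoeff_cst_mult mult.commute)
qed

lemma kernel_iff_mat:
  "(\<forall>k\<in>{1..\<rho>}. gsec n a \<in> kernel_at (int n) Z (K k ! 0)) \<longleftrightarrow>
    (\<forall>\<phi>\<in>conds. (\<Sum>s\<in>tri n. cond_mat n \<phi> s * a s) = 0)"
proof -
  have "(\<forall>k\<in>{1..\<rho>}. gsec n a \<in> kernel_at (int n) Z (K k ! 0)) \<longleftrightarrow>
      (\<forall>k\<in>{1..\<rho>}. \<forall>s. (k, s) \<in> conds \<longrightarrow> cond_val (k, s) (loc_poly k n a) = 0)"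
    using gsec_kernel_iff passes_iff_conds by blast
  also have "\<dots> \<longleftrightarrow> (\<forall>\<phi>\<in>conds. cond_val \<phi> (loc_poly (fst \<phi>) n a) = 0)"
    unfolding conds_def by force
  finally show ?thesis unfolding cond_val_loc_poly .
qed

abbreviation rank_condition where
  "rank_condition n \<kappa> \<equiv> rank_cond ((\<lambda>k. K k ! 0) ` {1..\<rho>}) Z n \<kappa>"

lemma rank_condition_iff:
  "rank_condition n \<kappa> \<longleftrightarrow> (\<exists>l. \<forall>a. (\<forall>\<phi>\<in>conds. (\<Sum>s\<in>tri n. cond_mat n \<phi> s * a s) = 0) \<and>
     (\<forall>i<\<kappa>. (\<Sum>s\<in>tri n. l i s * a s) = 0) \<longrightarrow> (\<forall>s\<in>tri n. a s = 0))"
  unfolding rank_cond_def using kernel_iff_mat by simp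

lemma max_rank_inj:
  assumes "rank_condition n 0" "d \<le> int n"
  shows "inj_on (restriction d Z) (global_sections d)"
proof (cases "d < 0")
  case True
  have "f = 0" if "f \<in> global_sections d" for f :: "'a ratfun"
  proof -
    obtain P where P: "f = to_fract P" "\<forall>i j. coeff (coeff P j) i \<noteq> 0 \<longrightarrow> int i + int j \<le> d"
      using \<open>f \<in> global_sections d\<close> unfolding global_sections_def by blast
    have "bcoeff P i j = 0" for i j
    proof (rule ccontr)
      assume "bcoeff P i j \<noteq> 0"
      then have "int i + int j \<le> d" using P(2) by (simp add: bcoeff_def)
      then show False using True by linarith
    qed
    then have "P = 0" by (intro bipoly_eqI) simp
    then show ?thesis using P by simp
  qed
  then show ?thesis by (intro inj_onI) metis
next
  case False
  then obtain m where d: "d = int m" "m \<le> n" using assms(2) by (metis int_nat_eq linorder_not_less nat_int nat_le_iff)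
  show ?thesis
  proof (rule inj_onI)
    fix f g assume f: "f \<in> global_sections d" and g: "g \<in> global_sections d"
      and eq: "restriction d Z f = restriction d Z g"
    obtain a where a: "f - g = gsec n a"
      using global_sectionsE[OF global_sections_mono[OF d(2)]] global_sections_diff f g d(1) by metis
    have "gsec n a \<in> kernel_at (int n) Z (K k ! 0)" if k: "k \<in> {1..\<rho>}" for k
    proof -
      have sf: "f \<in> twist_stalk d (loc (XY k))" "g \<in> twist_stalk d (loc (XY k))"
        using global_stalk[OF k] f g d(1) by auto
      have fg: "(f - g) / h k d \<in> Z (loc (XY k))"
      proof (cases "loc (XY k) \<in> supp Z")
        case True
        then have "twist_coset d Z (loc (XY k)) f = twist_coset d Z (loc (XY k)) g"
          using fun_cong[OF eq, of "loc (XY k)"] by (simp add: restriction_def)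
        then show ?thesis using twist_coset_eq_iff[OF k sf] by simp
      next
        case False
        have "(f - g) / h k d \<in> loc (XY k)"
          using sf stalk[OF k] loc_diff by (simp add: diff_divide_distrib)
        then show ?thesis using Z_not_supp[OF k False] by simp
      qed
      \<comment> \<open>A section of degree \<open>m\<close> is multiplied by
        \<open>X_0^(n-m)\<close>; as sections are divided by powers of \<open>X_0\<close>, the
        rational function stays the same and only the local trivialisation changes.\<close>
      have "(f - g) / h k d * (1 / hcoord (t k)) ^ (n - m) \<in> Z (loc (XY k))"
        by (rule Z_mult[OF k fg loc_power[OF inv_h_loc[OF k]]])
      moreover have "(f - g) / h k d * (1 / hcoord (t k)) ^ (n - m) = gsec n a / h k (int n)"
      proof -
        have "hcoord (t k) ^ n = hcoord (t k) ^ m * (hcoord (t k) ^ (n - m) :: 'a ratfun)"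
          using d(2) by (simp add: power_add[symmetric])
        then show ?thesis by (simp add: a d(1) power_divide)
      qed
      ultimately show ?thesis by (simp add: kernel_at_iff[OF k] K0[OF k])
    qed
    then have "\<forall>s\<in>tri n. a s = 0" using assms(1) unfolding rank_cond_def by blast
    then have "gsec n a = 0" by (simp only: gsec_eq_0_iff)
    then show "f = g" using a by simp
  qed
qed

end

text \<open>If a kernel element involved \<open>b0\<close>, the other columns would be too few to
  span, so a nonzero combination \<open>w\<close> of the rows kills them; applied to the kernel
  element it kills the column \<open>b0\<close> too, which contradicts surjectivity.\<close>

lemma surj_square_system_inj:
  fixes L :: "'s \<Rightarrow> 'b \<Rightarrow> 'a::field"
  assumes fin: "finite A" "finite B" and card: "card B \<le> card A"
    and surj: "\<And>z. \<exists>x. \<forall>\<alpha>\<in>A. (\<Sum>b\<in>B. L \<alpha> b * x b) = z \<alpha>"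
    and x: "\<And>\<alpha>. \<alpha> \<in> A \<Longrightarrow> (\<Sum>b\<in>B. L \<alpha> b * x b) = 0"
  shows "\<forall>b\<in>B. x b = 0"
proof (rule ccontr)
  assume "\<not> ?thesis"
  then obtain b0 where b0: "b0 \<in> B" "x b0 \<noteq> 0" by blast
  define B' where "B' = B - {b0}"
  have "card B' < card B" unfolding B'_def by (rule card_Diff1_less) (use fin b0 in auto)
  then have "card B' < card A" using card by linarith
  from underdetermined_system[OF _ fin(1) this, of "\<lambda>b \<alpha>. L \<alpha> b"] obtain w where
    w: "\<exists>\<alpha>\<in>A. w \<alpha> \<noteq> 0" "\<And>b. b \<in> B' \<Longrightarrow> (\<Sum>\<alpha>\<in>A. L \<alpha> b * w \<alpha>) = 0" using fin by (auto simp: B'_def)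
  have col: "(\<Sum>\<alpha>\<in>A. w \<alpha> * (\<Sum>b\<in>B. L \<alpha> b * y b)) = (\<Sum>\<alpha>\<in>A. L \<alpha> b0 * w \<alpha>) * y b0" for y
  proof -
    have "(\<Sum>\<alpha>\<in>A. w \<alpha> * (\<Sum>b\<in>B. L \<alpha> b * y b)) = (\<Sum>\<alpha>\<in>A. \<Sum>b\<in>B. L \<alpha> b * w \<alpha> * y b)"
      by (simp add: sum_distrib_left mult_ac)
    also have "\<dots> = (\<Sum>b\<in>B. (\<Sum>\<alpha>\<in>A. L \<alpha> b * w \<alpha>) * y b)"
      by (subst sum.swap) (simp add: sum_distrib_right)
    also have "\<dots> = (\<Sum>\<alpha>\<in>A. L \<alpha> b0 * w \<alpha>) * y b0"
      using w(2) fin b0 by (simp add: sum.remove[of B b0] B'_def)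
    finally show ?thesis .
  qed
  have "(\<Sum>\<alpha>\<in>A. L \<alpha> b0 * w \<alpha>) * x b0 = 0" unfolding col[symmetric] using x by simp
  then have z: "(\<Sum>\<alpha>\<in>A. L \<alpha> b0 * w \<alpha>) = 0" using b0 by simp
  obtain \<alpha>0 where a0: "\<alpha>0 \<in> A" "w \<alpha>0 \<noteq> 0" using w by blast
  obtain y where y: "\<And>\<alpha>. \<alpha> \<in> A \<Longrightarrow> (\<Sum>b\<in>B. L \<alpha> b * y b) = (if \<alpha> = \<alpha>0 then 1 else 0)"
    using surj[of "\<lambda>\<alpha>. if \<alpha> = \<alpha>0 then 1 else 0"] by blast
  have "(\<Sum>\<alpha>\<in>A. w \<alpha> * (\<Sum>b\<in>B. L \<alpha> b * y b)) = (\<Sum>\<alpha>\<in>A. if \<alpha> = \<alpha>0 then w \<alpha>0 else 0)"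
    by (rule sum.cong) (simp_all add: y)
  also have "\<dots> = w \<alpha>0" using fin a0 by simp
  finally show False using col[of y] z a0 by simp
qed

context cluster_data
begin

text \<open>Together with the \<open>\<kappa>\<close> auxiliary linear forms the conditions have
  trivial kernel. Since they are no more numerous than the monomials, all right-hand sides are
  attained.\<close>

lemma conds_surj:
  assumes "rank_condition n \<kappa>" "\<kappa> + card conds \<le> card (tri n)"
  shows "\<exists>a. \<forall>\<phi>\<in>conds. cond_val \<phi> (loc_poly (fst \<phi>) n a) = z \<phi>"
proof -
  obtain l where l: "\<And>a. \<lbrakk>\<forall>\<phi>\<in>conds. (\<Sum>s\<in>tri n. cond_mat n \<phi> s * a s) = 0;
    \<forall>i<\<kappa>. (\<Sum>s\<in>tri n. l i s * a s) = 0\<rbrakk> \<Longrightarrow> \<forall>s\<in>tri n. a s = 0"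
    using assms(1) unfolding rank_condition_iff by blast
  define L where "L \<phi> s = (case \<phi> of Inl \<phi> \<Rightarrow> cond_mat n \<phi> s | Inr i \<Rightarrow> l i s)" for \<phi> s
  have "\<exists>x. \<forall>\<alpha>\<in>conds <+> {..<\<kappa>}. (\<Sum>b\<in>tri n. L \<alpha> b * x b) = (case \<alpha> of Inl \<phi> \<Rightarrow> z \<phi> | Inr _ \<Rightarrow> 0)"
  proof (rule square_system_surj)
    show "card (conds <+> {..<\<kappa>}) \<le> card (tri n)" using assms(2) finite_conds by (simp add: card_Plus)
    show "\<forall>s\<in>tri n. x s = 0" if x: "\<And>\<alpha>. \<alpha> \<in> conds <+> {..<\<kappa>} \<Longrightarrow> (\<Sum>b\<in>tri n. L \<alpha> b * x b) = 0" for x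
    proof (rule l)
      show "\<forall>\<phi>\<in>conds. (\<Sum>s\<in>tri n. cond_mat n \<phi> s * x s) = 0"
        using x[OF InlI] by (simp add: L_def)
      show "\<forall>i<\<kappa>. (\<Sum>s\<in>tri n. l i s * x s) = 0"
        using x[OF InrI] by (simp add: L_def)
    qed
  qed (use finite_conds in simp_all)
  then obtain x where x: "\<And>\<alpha>. \<alpha> \<in> conds <+> {..<\<kappa>} \<Longrightarrow>
    (\<Sum>b\<in>tri n. L \<alpha> b * x b) = (case \<alpha> of Inl \<phi> \<Rightarrow> z \<phi> | Inr _ \<Rightarrow> 0)" by blast
  have "cond_val \<phi> (loc_poly (fst \<phi>) n x) = z \<phi>" if "\<phi> \<in> conds" for \<phi>
    unfolding cond_val_loc_poly using x[OF InlI[OF that]] by (simp add: L_def)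
  then show ?thesis by blast
qed

lemma cond_val_diff: "cond_val \<phi> (F - G) = cond_val \<phi> F - cond_val \<phi> G"
  by (simp add: cond_val_def vstage_diff split: prod.split)

text \<open>A germ \<open>F/G\<close> may be replaced by the polynomial \<open>F W\<close>, where
  \<open>W\<close> inverts \<open>G\<close> up to an order at which every function passes through
  the cluster.\<close>

lemma sections_surj:
  assumes "rank_condition n \<kappa>" "\<kappa> + card conds \<le> card (tri n)"
    and x: "\<And>k. k \<in> {1..\<rho>} \<Longrightarrow> x k \<in> loc (XY k)"
  shows "\<exists>a. \<forall>k\<in>{1..\<rho>}. gsec n a / h k (int n) - x k \<in> Z (loc (XY k))"
proof -
  have "\<exists>F G. x k = ev2p F (XY k) / ev2p G (XY k) \<and> bcoeff G 0 0 \<noteq> 0" if "k \<in> {1..\<rho>}" for k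
    using x[OF that] unfolding loc_iff .
  then obtain F G where FG: "\<And>k. k \<in> {1..\<rho>} \<Longrightarrow> x k = ev2p (F k) (XY k) / ev2p (G k) (XY k) \<and> bcoeff (G k) 0 0 \<noteq> 0"
    by metis
  have "\<exists>W. ordge (\<Sum>i<r k. \<mu> k i) (G k * W - 1)" if "k \<in> {1..\<rho>}" for k
    using FG[OF that] truncated_inverse by blast
  then obtain W where W: "\<And>k. k \<in> {1..\<rho>} \<Longrightarrow> ordge (\<Sum>i<r k. \<mu> k i) (G k * W k - 1)" by metis
  obtain a where a: "\<And>\<phi>. \<phi> \<in> conds \<Longrightarrow>
      cond_val \<phi> (loc_poly (fst \<phi>) n a) = cond_val \<phi> (F (fst \<phi>) * W (fst \<phi>))"
    using conds_surj[OF assms(1,2), of "\<lambda>\<phi>. cond_val \<phi> (F (fst \<phi>) * W (fst \<phi>))"] by blast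
  have "gsec n a / h k (int n) - x k \<in> Z (loc (XY k))" if k: "k \<in> {1..\<rho>}" for k
  proof -
    define P where "P = loc_poly k n a"
    have "passes_at k (P - F k * W k)" unfolding passes_iff_conds[OF k]
      using a by (auto simp: P_def cond_val_diff)
    then have "passes_at k ((P - F k * W k) * G k)" by (rule passes_mult[OF r[OF k]])
    moreover have "passes_at k (F k * (G k * W k - 1))"
      by (rule passes_high_order) (use ordge_0_mult[OF W[OF k], of "F k"] in \<open>simp add: mult.commute\<close>)
    ultimately have "passes_at k ((P - F k * W k) * G k + F k * (G k * W k - 1))" by (rule passes_add)
    moreover have "(P - F k * W k) * G k + F k * (G k * W k - 1) = P * G k - F k"
      by (simp add: algebra_simps)
    ultimately have p: "passes_at k (P * G k - F k)" by simp
    have G0: "bcoeff (G k) 0 0 \<noteq> 0" using FG[OF k] by blast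
    then have "G k \<noteq> 0" by auto
    then have "ev2p (G k) (XY k) \<noteq> 0" using ind[OF k] by (simp add: indep_nonzero)
    then have "gsec n a / h k (int n) - x k = ev2p (P * G k - F k) (XY k) / ev2p (G k) (XY k)"
      unfolding gsec_loc[OF k] using FG[OF k] by (simp add: P_def ev2_hom field_simps)
    then show ?thesis using Z_passes[OF k G0] p by simp
  qed
  then show ?thesis by blast
qed

lemma is_hom_bcoeff_0: "is_hom (\<lambda>F :: 'a poly poly. bcoeff F 0 0)"
  by (simp add: is_hom_def bcoeff_0_0_mult bcoeff_1)

text \<open>A line missing the support: its powers compare sections of different degrees without
  changing the conditions at the clusters.\<close>

lemma nonvanishing_linear_form:
  "\<exists>\<Lambda>. \<Lambda> \<in> global_sections (int 1) \<and> \<Lambda> \<noteq> 0 \<and>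
     (\<forall>k\<in>{1..\<rho>}. \<Lambda> / hcoord (t k) \<in> loc (XY k) \<and> hcoord (t k) / \<Lambda> \<in> loc (XY k))"
proof -
  \<comment> \<open>The forms \<open>X_0 + s X_1 + s^2 X_2\<close>. At each point the value is a
    nonzero polynomial in \<open>s\<close>, since the homogeneous coordinate used to normalise
    equals 1.\<close>
  define a :: "'a \<Rightarrow> nat \<times> nat \<Rightarrow> 'a" where "a s = (\<lambda>ij. if ij = (0,0) then 1 else if ij = (1,0) then s else s ^ 2)" for s
  define p where "p k = (if t k = 0 then [:1, bcoeff (A k) 0 0, bcoeff (B k) 0 0:]
    else if t k = 1 then [:bcoeff (A k) 0 0, 1, bcoeff (B k) 0 0:]
    else [:bcoeff (A k) 0 0, bcoeff (B k) 0 0, 1:])" for k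
  have tri1: "tri 1 = {(0,0), (1,0), (0,1)}" by (auto simp: tri_def)
  have val: "bcoeff (loc_poly k 1 (a s)) 0 0 = poly (p k) s" if "k \<in> {1..\<rho>}" for k s
  proof -
    note h0 = is_homD[OF is_hom_bcoeff_0]
    have m: "bcoeff (bsub (fmon (t k) 1 ij) (A k) (B k)) 0 0 =
      (if t k = 0 then bcoeff (A k) 0 0 ^ fst ij * bcoeff (B k) 0 0 ^ snd ij
       else if t k = 1 then bcoeff (A k) 0 0 ^ (1 - fst ij - snd ij) * bcoeff (B k) 0 0 ^ snd ij
       else bcoeff (A k) 0 0 ^ (1 - fst ij - snd ij) * bcoeff (B k) 0 0 ^ fst ij)" for ij
      unfolding fmon_def by (cases "t k = 0"; cases "t k = 1")
        (simp_all only: if_True if_False is_homD[OF is_hom_bsub] bsub_gens h0 simp_thms)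
    have "bcoeff (loc_poly k 1 (a s)) 0 0 =
        (\<Sum>ij\<in>tri 1. a s ij * bcoeff (bsub (fmon (t k) 1 ij) (A k) (B k)) 0 0)"
      unfolding loc_poly_def form_def
      by (simp only: is_homD[OF is_hom_bsub] bsub_gens bcoeff_sum bcoeff_cst_mult)
    then show ?thesis unfolding m tri1 by (simp add: a_def p_def power2_eq_square algebra_simps)
  qed
  have fin: "finite (\<Union>k\<in>{1..\<rho>}. {s. poly (p k) s = 0})"
    by (intro finite_UN_I poly_roots_finite) (auto simp: p_def)
  obtain s where "s \<notin> (\<Union>k\<in>{1..\<rho>}. {s. poly (p k) s = 0})" using infinite_field_avoid[OF fin] by blast
  then have s: "poly (p k) s \<noteq> 0" if "k \<in> {1..\<rho>}" for k using that by blast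
  define \<Lambda> where "\<Lambda> = gsec 1 (a s)"
  have e: "\<Lambda> / hcoord (t k) = ev2p (loc_poly k 1 (a s)) (XY k)" if "k \<in> {1..\<rho>}" for k
    using gsec_loc[OF that, of 1 "a s"] by (simp add: \<Lambda>_def)
  have "\<Lambda> / hcoord (t k) \<in> loc (XY k)" "hcoord (t k) / \<Lambda> \<in> loc (XY k)" if k: "k \<in> {1..\<rho>}" for k
  proof -
    show "\<Lambda> / hcoord (t k) \<in> loc (XY k)" unfolding e[OF k] by (rule loc_ev2)
    have "1 / ev2p (loc_poly k 1 (a s)) (XY k) \<in> loc (XY k)"
      using locI[of "loc_poly k 1 (a s)" 1 "XY k"] val[OF k] s[OF k] by (simp add: ev2_hom)
    then show "hcoord (t k) / \<Lambda> \<in> loc (XY k)" unfolding e[OF k, symmetric] by simp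
  qed
  moreover have "\<Lambda> \<noteq> 0" unfolding \<Lambda>_def gsec_eq_0_iff tri1 by (simp add: a_def)
  moreover have "\<Lambda> \<in> global_sections (int 1)" unfolding \<Lambda>_def by (rule gsec_in_global_sections)
  ultimately show ?thesis by blast
qed

lemma max_rank_surj:
  assumes rank: "rank_condition n \<kappa>" "\<kappa> + card conds \<le> card (tri n)" and d: "int n \<le> d"
  shows "restriction d Z ` global_sections d = scheme_sections d Z"
proof
  obtain d' where d': "d = int (n + d')" using d by (metis nat_le_iff_add nat_int zero_le_imp_eq_int of_nat_0_le_iff order.trans of_nat_le_iff)
  show "restriction d Z ` global_sections d \<subseteq> scheme_sections d Z"
  proof (intro image_subsetI)
    fix f :: "'a ratfun" assume f: "f \<in> global_sections d"
    have "f \<in> twist_stalk d q" if "q \<in> supp Z" for q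
      using supp_Z that global_stalk f d' by blast
    then show "restriction d Z f \<in> scheme_sections d Z"
      unfolding restriction_def scheme_sections_def by (intro restrict_PiE_iff[THEN iffD2] ballI imageI)
  qed
  show "scheme_sections d Z \<subseteq> restriction d Z ` global_sections d"
  proof
    fix \<sigma> assume s: "\<sigma> \<in> scheme_sections d Z"
    then have "\<forall>q\<in>supp Z. \<exists>f\<in>twist_stalk d q. \<sigma> q = twist_coset d Z q f"
      unfolding scheme_sections_def by (auto simp: PiE_iff)
    then obtain g where g: "\<And>q. q \<in> supp Z \<Longrightarrow> g q \<in> twist_stalk d q \<and> \<sigma> q = twist_coset d Z q (g q)"
      by metis
    obtain \<Lambda> where L: "\<Lambda> \<in> global_sections (int 1)" "\<Lambda> \<noteq> 0"
      "\<And>k. k \<in> {1..\<rho>} \<Longrightarrow> \<Lambda> / hcoord (t k) \<in> loc (XY k)" "\<And>k. k \<in> {1..\<rho>} \<Longrightarrow> hcoord (t k) / \<Lambda> \<in> loc (XY k)"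
      using nonvanishing_linear_form by blast
    define g' where "g' k = (if loc (XY k) \<in> supp Z then g (loc (XY k)) else 0)" for k
    have g': "g' k / h k d \<in> loc (XY k)" if "k \<in> {1..\<rho>}" for k
      using g[of "loc (XY k)"] stalk[OF that, of _ d] by (auto simp: g'_def loc_0)
    \<comment> \<open>The prescribed germ is divided by \<open>\<Lambda>^d'\<close> to bring it to
      degree \<open>n\<close>; the section found there is multiplied by the same power.\<close>
    define x where "x k = g' k / h k d * (hcoord (t k) / \<Lambda>) ^ d'" for k
    have "x k \<in> loc (XY k)" if "k \<in> {1..\<rho>}" for k
      unfolding x_def by (intro loc_mult loc_power g' L that)
    from sections_surj[OF rank, of x, OF this] obtain a where
      a: "\<And>k. k \<in> {1..\<rho>} \<Longrightarrow> gsec n a / h k (int n) - x k \<in> Z (loc (XY k))" by blast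
    define f where "f = gsec n a * \<Lambda> ^ d'"
    have "\<Lambda> ^ i \<in> global_sections (int i)" for i
    proof (induction i)
      case 0
      have "gsec 0 (\<lambda>_. 1) = (1 :: 'a ratfun)"
        by (simp add: gsec_def form_def tri_def fmon_def one_pCons[symmetric])
      then show ?case using gsec_in_global_sections[of 0 "\<lambda>_. 1 :: 'a"] by simp
    next
      case (Suc i)
      then show ?case using global_sections_mult[OF L(1) Suc.IH] by simp
    qed
    then have f: "f \<in> global_sections d" unfolding f_def d'
      by (intro global_sections_mult gsec_in_global_sections)
    have fZ: "(f - g' k) / h k d \<in> Z (loc (XY k))" if k: "k \<in> {1..\<rho>}" for k
    proof -
      have "(gsec n a / h k (int n) - x k) * (\<Lambda> / hcoord (t k)) ^ d' \<in> Z (loc (XY k))"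
        by (rule Z_mult[OF k a[OF k] loc_power[OF L(3)[OF k]]])
      moreover have "(gsec n a / h k (int n) - x k) * (\<Lambda> / hcoord (t k)) ^ d' = (f - g' k) / h k d"
      proof -
        have "x k * (\<Lambda> / hcoord (t k)) ^ d' = g' k / h k d"
          using L(2) by (simp add: x_def power_divide)
        moreover have "gsec n a / h k (int n) * (\<Lambda> / hcoord (t k)) ^ d' = f / h k d"
        proof -
          have "h k (int (n + d')) = hcoord (t k) ^ n * (hcoord (t k) ^ d' :: 'a ratfun)"
            by (simp only: power_int_of_nat power_add)
          then show ?thesis unfolding d' f_def by (simp add: power_divide)
        qed
        ultimately show ?thesis by (simp only: left_diff_distrib diff_divide_distrib)
      qed
      ultimately show ?thesis by simp
    qed
    have "restriction d Z f = \<sigma>"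
    proof
      fix q
      show "restriction d Z f q = \<sigma> q"
      proof (cases "q \<in> supp Z")
        case True
        then obtain k where k: "k \<in> {1..\<rho>}" "q = loc (XY k)" using supp_Z by blast
        have "g' k = g q" using True k by (simp add: g'_def)
        have "f \<in> twist_stalk d q" using global_stalk[OF k(1)] f d' k(2) by blast
        then have "twist_coset d Z q f = twist_coset d Z q (g q)"
          using twist_coset_eq_iff[OF k(1)] fZ[OF k(1)] g[OF True] \<open>g' k = g q\<close> unfolding k(2) by metis
        then show ?thesis using True g[OF True] by (simp add: restriction_def)
      next
        case False
        then show ?thesis using s by (auto simp: restriction_def scheme_sections_def PiE_iff extensional_def)
      qed
    qed
    then show "\<sigma> \<in> restriction d Z ` global_sections d" using f by blast
  qed
qed

lemma max_rank_if:
  assumes "rank_condition n 0" "rank_condition (Suc n) \<kappa>" "\<kappa> + card conds \<le> card (tri (Suc n))"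
  shows "max_rank Z"
  unfolding max_rank_def max_rank_in_degree_def
proof
  fix d :: int
  show "inj_on (restriction d Z) (global_sections d) \<or> restriction d Z ` global_sections d = scheme_sections d Z"
  proof (cases "d \<le> int n")
    case True
    then show ?thesis using max_rank_inj[OF assms(1)] by blast
  next
    case False
    then show ?thesis using max_rank_surj[OF assms(2,3), of d] by simp
  qed
qed

section \<open>Dimension counts and failure of maximal rank\<close>

lemma nonzero_form_exists:
  assumes "card conds < card (tri n)"
  shows "\<exists>a. (\<exists>s\<in>tri n. a s \<noteq> 0) \<and> (\<forall>k\<in>{1..\<rho>}. passes_at k (loc_poly k n a))"
proof -
  from underdetermined_system[OF finite_conds finite_tri assms, of "cond_mat n"] obtain a where
    a: "\<exists>s\<in>tri n. a s \<noteq> 0" "\<forall>\<phi>\<in>conds. (\<Sum>s\<in>tri n. cond_mat n \<phi> s * a s) = 0" by blast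
  then have "\<forall>k\<in>{1..\<rho>}. passes_at k (loc_poly k n a)"
    using kernel_iff_mat[of n a] gsec_kernel_iff by blast
  with a show ?thesis by blast
qed

text \<open>The larger degree \<open>n'\<close> shows that the conditions are independent as
  functionals on germs. Surjectivity in degree \<open>n\<close> would thus solve a system with at
  least as many equations as unknowns for all right-hand sides and exclude the solution
  \<open>a\<close>.\<close>

lemma not_max_rank_in_degree:
  assumes rank: "rank_condition n' \<kappa>" "\<kappa> + card conds \<le> card (tri n')" and n: "card (tri n) \<le> card conds"
    and a: "\<exists>s\<in>tri n. a s \<noteq> 0" "\<And>k. k \<in> {1..\<rho>} \<Longrightarrow> passes_at k (loc_poly k n a)"
  shows "\<not> max_rank_in_degree (int n) Z"
proof
  assume "max_rank_in_degree (int n) Z"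
  then consider "inj_on (restriction (int n) Z) (global_sections (int n))"
    | "restriction (int n) Z ` global_sections (int n) = scheme_sections (int n) Z"
    unfolding max_rank_in_degree_def by blast
  then show False
  proof cases
    case 1
    have "gsec 0 (\<lambda>_. 0) = (0 :: 'a ratfun)" by (simp add: gsec_eq_0_iff)
    then have 0: "0 \<in> (global_sections (int n) :: 'a ratfun set)"
      using global_sections_mono[of 0 n "0 :: 'a ratfun"] gsec_in_global_sections[of 0 "\<lambda>_. 0 :: 'a"] by simp
    have "restriction (int n) Z (gsec n a) = restriction (int n) Z 0"
    proof
      fix q
      show "restriction (int n) Z (gsec n a) q = restriction (int n) Z 0 q"
      proof (cases "q \<in> supp Z")
        case True
        then obtain k where k: "k \<in> {1..\<rho>}" "q = loc (XY k)" using supp_Z by blast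
        have "(gsec n a - 0) / h k (int n) \<in> Z (loc (XY k))"
          using gsec_kernel_iff[OF k(1)] a(2)[OF k(1)] kernel_at_iff[OF k(1)] K0[OF k(1)] by simp
        then have "twist_coset (int n) Z q (gsec n a) = twist_coset (int n) Z q 0"
          unfolding k(2) using twist_coset_eq_iff[OF k(1)] global_stalk[OF k(1)] gsec_in_global_sections 0 by blast
        then show ?thesis by (simp add: restriction_def)
      qed (simp add: restriction_def)
    qed
    then have "gsec n a = 0" using 1 gsec_in_global_sections 0 by (auto dest: inj_onD)
    then show False using a(1) by (simp add: gsec_eq_0_iff)
  next
    case 2
    have "\<forall>s\<in>tri n. a s = 0"
    proof (rule surj_square_system_inj[OF finite_conds finite_tri n])
      fix \<phi> assume p: "\<phi> \<in> conds"
      obtain k s where ks: "\<phi> = (k, s)" by (cases \<phi>)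
      then have "k \<in> {1..\<rho>}" using p by (auto simp: conds_def)
      then show "(\<Sum>b\<in>tri n. cond_mat n \<phi> b * a b) = 0"
        using a(2)[of k] p passes_iff_conds[of k "loc_poly k n a"]
        unfolding ks cond_val_loc_poly[symmetric] fst_conv by blast
    next
      fix z
      obtain b where b: "\<And>\<phi>. \<phi> \<in> conds \<Longrightarrow> cond_val \<phi> (loc_poly (fst \<phi>) n' b) = z \<phi>"
        using conds_surj[OF rank, of z] by blast
      \<comment> \<open>The local trivialisation carries the germs of a form of degree
        \<open>n'\<close> with prescribed conditions over to degree \<open>n\<close>.\<close>
      define f where "f k = ev2p (loc_poly k n' b) (XY k) * h k (int n)" for k
      have fs: "f k \<in> twist_stalk (int n) (loc (XY k))" if "k \<in> {1..\<rho>}" for k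
        unfolding stalk[OF that] f_def using loc_ev2[of "loc_poly k n' b" "XY k"] by simp
      have injXY: "inj_on (\<lambda>k. loc (XY k)) {1..\<rho>}"
        by (rule inj_on_cong[THEN iffD1, OF _ inj]) (rule K0)
      define \<sigma> where "\<sigma> = (\<lambda>q\<in>supp Z. twist_coset (int n) Z q (f (the_inv_into {1..\<rho>} (\<lambda>k. loc (XY k)) q)))"
      have inv: "the_inv_into {1..\<rho>} (\<lambda>k. loc (XY k)) (loc (XY k)) = k" if "k \<in> {1..\<rho>}" for k
        by (rule the_inv_into_f_f[OF injXY that])
      have "\<sigma> \<in> scheme_sections (int n) Z"
        unfolding scheme_sections_def \<sigma>_def
      proof (intro restrict_PiE_iff[THEN iffD2] ballI imageI)
        fix q assume "q \<in> supp Z"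
        then obtain k where k: "k \<in> {1..\<rho>}" "q = loc (XY k)" using supp_Z by blast
        show "f (the_inv_into {1..\<rho>} (\<lambda>k. loc (XY k)) q) \<in> twist_stalk (int n) q"
          unfolding k(2) inv[OF k(1)] by (rule fs[OF k(1)])
      qed
      then have "\<sigma> \<in> restriction (int n) Z ` global_sections (int n)" by (simp only: 2)
      then obtain g where g: "g \<in> global_sections (int n)" "\<sigma> = restriction (int n) Z g"
        by (rule imageE) (rule that)
      note g = g(1) g(2)[symmetric]
      obtain a' where a': "g = gsec n a'" using g(1) by (rule global_sectionsE)
      have "passes_at k (loc_poly k n a' - loc_poly k n' b)" if k: "k \<in> {1..\<rho>}" for k
      proof -
        have l: "(g - f k) / h k (int n) = ev2p (loc_poly k n a' - loc_poly k n' b) (XY k)"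
          unfolding diff_divide_distrib a' gsec_loc[OF k] by (simp add: f_def ev2_hom)
        have "(g - f k) / h k (int n) \<in> Z (loc (XY k))"
        proof (cases "loc (XY k) \<in> supp Z")
          case True
          then have "twist_coset (int n) Z (loc (XY k)) g = twist_coset (int n) Z (loc (XY k)) (f k)"
            using fun_cong[OF g(2), of "loc (XY k)"] inv[OF k] by (simp add: restriction_def \<sigma>_def)
          then show ?thesis using twist_coset_eq_iff[OF k global_stalk[OF k g(1)] fs[OF k]] by simp
        next
          case False
          then show ?thesis unfolding Z_not_supp[OF k False] l by (intro loc_ev2)
        qed
        then show ?thesis unfolding l Z_passes1[OF k] .
      qed
      then have "cond_val \<phi> (loc_poly (fst \<phi>) n a') = z \<phi>" if "\<phi> \<in> conds" for \<phi>
      proof -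
        obtain k s where ks: "\<phi> = (k, s)" by (cases \<phi>)
        then have "k \<in> {1..\<rho>}" using that by (auto simp: conds_def)
        then have "cond_val \<phi> (loc_poly k n a' - loc_poly k n' b) = 0"
          using \<open>\<And>k. k \<in> {1..\<rho>} \<Longrightarrow> passes_at k (loc_poly k n a' - loc_poly k n' b)\<close> that
          using passes_iff_conds[of k] unfolding ks by blast
        then show ?thesis using b[OF that] by (simp add: ks cond_val_diff)
      qed
      then show "\<exists>x. \<forall>\<phi>\<in>conds. (\<Sum>s\<in>tri n. cond_mat n \<phi> s * x s) = z \<phi>"
        unfolding cond_val_loc_poly by blast
    qed
    then show False using a(1) by blast
  qed
qed

text \<open>The square of a form with the multiplicities \<open>\<nu> k\<close> has the doubled
  multiplicities: a curve counted twice.\<close>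

lemma square_of_section:
  assumes "\<And>k. k \<in> {1..\<rho>} \<Longrightarrow> passes (r k) (e k) (c k) (\<nu> k) (loc_poly k n b)" "\<exists>s\<in>tri n. b s \<noteq> 0"
    and "\<And>k. k \<in> {1..\<rho>} \<Longrightarrow> \<mu> k = (\<lambda>i. 2 * \<nu> k i)"
  shows "\<exists>a. (\<exists>s\<in>tri (2 * n). a s \<noteq> 0) \<and> (\<forall>k\<in>{1..\<rho>}. passes_at k (loc_poly k (2 * n) a))"
proof -
  have "gsec n b * gsec n b \<in> global_sections (int (n + n))"
    by (intro global_sections_mult gsec_in_global_sections)
  then obtain a where a: "gsec n b * gsec n b = gsec (n + n) a" by (rule global_sectionsE)
  have "gsec n b \<noteq> 0" using assms(2) by (simp add: gsec_eq_0_iff)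
  then have "gsec (n + n) a \<noteq> 0" using a by (metis mult_eq_0_iff)
  then have "\<exists>s\<in>tri (2 * n). a s \<noteq> 0" by (simp add: gsec_eq_0_iff mult_2)
  moreover have "passes_at k (loc_poly k (2 * n) a)" if k: "k \<in> {1..\<rho>}" for k
  proof -
    have "ev2p (loc_poly k (n + n) a) (XY k) = gsec (n + n) a / h k (int (n + n))"
      using gsec_loc[OF k, of "n + n" a] by simp
    also have "\<dots> = gsec n b / h k (int n) * (gsec n b / h k (int n))"
      unfolding a[symmetric] power_int_of_nat power_add by simp
    also have "\<dots> = ev2p (loc_poly k n b * loc_poly k n b) (XY k)"
      unfolding gsec_loc[OF k] by (simp only: ev2_hom)
    finally have "loc_poly k (n + n) a = loc_poly k n b * loc_poly k n b"
      using indep_eq_iff[OF ind[OF k]] by blast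
    then show ?thesis using passes_square[OF assms(1)[OF k]] assms(3)[OF k] by (simp add: mult_2)
  qed
  ultimately show ?thesis by blast
qed

end

section \<open>Openness of the rank condition\<close>

lemma indep_inverse:
  assumes "indep X Y" shows "indep (1 / X) Y"
  unfolding indep_def
proof (intro allI impI)
  fix F assume F: "ev2 F (1 / X) Y = 0"
  obtain S where S: "finite S" "\<And>i j. bcoeff F i j \<noteq> 0 \<longleftrightarrow> (i, j) \<in> S"
    "F = (\<Sum>(i, j)\<in>S. cst (bcoeff F i j) * px ^ i * py ^ j)" by (rule bipoly_sumE[where F = F]) (rule that)
  define N where "N = (\<Sum>s\<in>S. fst s)"
  have N: "i \<le> N" if "(i, j) \<in> S" for i j
    unfolding N_def using member_le_sum[OF that, of fst] S(1) by simp
  define G where "G = (\<Sum>(i, j)\<in>S. cst (bcoeff F i j) * px ^ (N - i) * py ^ j)"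
  have X: "X \<noteq> 0" using indep_coords_nonzero[OF assms] by simp
  have "ev2 G X Y = (\<Sum>(i, j)\<in>S. cnst (bcoeff F i j) * X ^ (N - i) * Y ^ j)"
    unfolding G_def by (simp only: ev2_hom ev2_gens case_prod_unfold)
  also have "\<dots> = (\<Sum>(i, j)\<in>S. X ^ N * (cnst (bcoeff F i j) * (1 / X) ^ i * Y ^ j))"
  proof (intro sum.cong refl)
    fix s assume "s \<in> S"
    obtain i j where s: "s = (i, j)" by (cases s)
    have "X ^ N = X ^ (N - i) * X ^ i"
      using N[of i j] \<open>s \<in> S\<close> s by (simp add: power_add[symmetric])
    then show "(case s of (i, j) \<Rightarrow> cnst (bcoeff F i j) * X ^ (N - i) * Y ^ j) =
        (case s of (i, j) \<Rightarrow> X ^ N * (cnst (bcoeff F i j) * (1 / X) ^ i * Y ^ j))"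
      using X by (simp add: s power_divide)
  qed
  also have "\<dots> = X ^ N * ev2 F (1 / X) Y"
    unfolding arg_cong[OF S(3), of "\<lambda>G. ev2 G (1 / X) Y"]
    by (simp only: ev2_hom ev2_gens case_prod_unfold sum_distrib_left)
  finally have "G = 0" using F assms by (simp add: indep_nonzero)
  have "bcoeff F a b = 0" for a b
  proof (cases "(a, b) \<in> S")
    case True
    have "bcoeff G (N - a) b = (\<Sum>s\<in>S. if s = (a, b) then bcoeff F a b else 0)"
      unfolding G_def bmonom_eq bcoeff_sum
    proof (intro sum.cong refl)
      fix s assume "s \<in> S"
      obtain i j where s: "s = (i, j)" by (cases s)
      have "N - i = N - a \<and> j = b \<longleftrightarrow> s = (a, b)"
        using N[of i j] N[OF True] \<open>s \<in> S\<close> s by auto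
      then show "bcoeff (case s of (i, j) \<Rightarrow> monom (monom (bcoeff F i j) (N - i)) j) (N - a) b =
          (if s = (a, b) then bcoeff F a b else 0)" by (auto simp: s bcoeff_monom)
    qed
    then show ?thesis using True S(1) \<open>G = 0\<close> by simp
  qed (use S in blast)
  then show "F = 0" by (intro bipoly_eqI) simp
qed

lemma indep_aff: "indep2 (aff t :: 'a::idom ratfun \<times> 'a ratfun)"
proof -
  have *: "indep (1 / X) (Y / X)" if "indep X Y" for X Y :: "'a ratfun"
    by (rule indep_inverse, rule indep_chart_next[OF that, of True 0])
      (simp add: chart_next_def is_homD[OF is_hom_cnst])
  show ?thesis using indep_xx_yy[where ?'a = 'a] *[OF indep_xx_yy] *[OF indep_swap[OF indep_xx_yy]]
    by (simp add: aff_def)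
qed

section \<open>Families of bivariate polynomials\<close>

context function_ring
begin

text \<open>The degree bound is uniform in the parameter, so that a substitution is a sum over a
  fixed finite set of exponents.\<close>

definition bipoly_family :: "('t \<Rightarrow> 'a poly poly) \<Rightarrow> bool" where
  "bipoly_family F \<longleftrightarrow> (\<exists>N. \<forall>t i j. bcoeff (F t) i j \<noteq> 0 \<longrightarrow> i \<le> N \<and> j \<le> N) \<and>
     (\<forall>i j. (\<lambda>t. bcoeff (F t) i j) \<in> R)"

lemma bipoly_family_const: "bipoly_family (\<lambda>_. F)"
  using bcoeff_finite[of F] by (simp add: bipoly_family_def const)

lemma bipoly_family_cst: "f \<in> R \<Longrightarrow> bipoly_family (\<lambda>t. cst (f t))"
  unfolding bipoly_family_def bcoeff_cst
proof (intro conjI allI)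
  fix i j assume "f \<in> R"
  then show "(\<lambda>t. if i = 0 \<and> j = 0 then f t else 0) \<in> R" by (cases "i = 0 \<and> j = 0") (auto intro: const)
qed auto

lemma bipoly_family_add:
  assumes "bipoly_family F" "bipoly_family G" shows "bipoly_family (\<lambda>t. F t + G t)"
proof -
  obtain N N' where N: "\<And>t i j. bcoeff (F t) i j \<noteq> 0 \<Longrightarrow> i \<le> N \<and> j \<le> N"
    "\<And>t i j. bcoeff (G t) i j \<noteq> 0 \<Longrightarrow> i \<le> N' \<and> j \<le> N'" using assms unfolding bipoly_family_def by blast
  have "i \<le> N + N' \<and> j \<le> N + N'" if "bcoeff (F t + G t) i j \<noteq> 0" for t i j
  proof (cases "bcoeff (F t) i j = 0")
    case True
    then show ?thesis using that N(2)[of t i j] by simp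
  qed (use N(1)[of t i j] in simp)
  moreover have "(\<lambda>t. bcoeff (F t + G t) i j) \<in> R" for i j
    using assms by (simp add: bipoly_family_def add)
  ultimately show ?thesis unfolding bipoly_family_def by blast
qed

lemma bipoly_family_mult:
  assumes "bipoly_family F" "bipoly_family G" shows "bipoly_family (\<lambda>t. F t * G t)"
proof -
  obtain N N' where N: "\<And>t i j. bcoeff (F t) i j \<noteq> 0 \<Longrightarrow> i \<le> N \<and> j \<le> N"
    "\<And>t i j. bcoeff (G t) i j \<noteq> 0 \<Longrightarrow> i \<le> N' \<and> j \<le> N'" using assms unfolding bipoly_family_def by blast
  have "i \<le> N + N' \<and> j \<le> N + N'" if "bcoeff (F t * G t) i j \<noteq> 0" for t i j
  proof (rule ccontr)
    assume n: "\<not> ?thesis"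
    have "bcoeff (F t) a b * bcoeff (G t) (i - a) (j - b) = 0" if "a \<le> i" "b \<le> j" for a b
    proof (rule ccontr)
      assume "bcoeff (F t) a b * bcoeff (G t) (i - a) (j - b) \<noteq> 0"
      then have "a \<le> N" "b \<le> N" "i - a \<le> N'" "j - b \<le> N'" using N(1)[of t a b] N(2)[of t "i - a" "j - b"] by auto
      then show False using n that by linarith
    qed
    then have "bcoeff (F t * G t) i j = 0" unfolding bcoeff_mult by (intro sum.neutral ballI) simp
    with that show False by simp
  qed
  moreover have "(\<lambda>t. bcoeff (F t * G t) i j) \<in> R" for i j
    unfolding bcoeff_mult using assms by (intro sum mult) (auto simp: bipoly_family_def)
  ultimately show ?thesis unfolding bipoly_family_def by blast
qed

lemma bipoly_family_power: "bipoly_family F \<Longrightarrow> bipoly_family (\<lambda>t. F t ^ n)"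
  by (induction n) (auto intro: bipoly_family_const bipoly_family_mult)

lemma bipoly_family_sum:
  "(\<And>s. s \<in> S \<Longrightarrow> bipoly_family (F s)) \<Longrightarrow> bipoly_family (\<lambda>t. \<Sum>s\<in>S. F s t)"
  by (induction S rule: infinite_finite_induct) (auto intro: bipoly_family_const bipoly_family_add)

lemma bipoly_family_bsub:
  assumes "bipoly_family F" "bipoly_family A" "bipoly_family B"
  shows "bipoly_family (\<lambda>t. bsub (F t) (A t) (B t))"
proof -
  obtain N where N: "\<And>t i j. bcoeff (F t) i j \<noteq> 0 \<Longrightarrow> i \<le> N \<and> j \<le> N"
    using assms(1) unfolding bipoly_family_def by blast
  have "bsub (F t) (A t) (B t) =
      (\<Sum>s\<in>{..N} \<times> {..N}. cst (bcoeff (F t) (fst s) (snd s)) * A t ^ fst s * B t ^ snd s)" for t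
  proof -
    have F: "F t = (\<Sum>(i, j)\<in>{..N} \<times> {..N}. cst (bcoeff (F t) i j) * px ^ i * py ^ j)"
      by (rule bipoly_as_sum) (use N in auto)
    show ?thesis unfolding arg_cong[OF F, of "\<lambda>G. bsub G (A t) (B t)"]
      by (simp only: is_homD[OF is_hom_bsub] bsub_gens case_prod_unfold)
  qed
  moreover have "bipoly_family (\<lambda>t. \<Sum>s\<in>{..N} \<times> {..N}. cst (bcoeff (F t) (fst s) (snd s)) * A t ^ fst s * B t ^ snd s)"
    using assms by (intro bipoly_family_sum bipoly_family_mult bipoly_family_power bipoly_family_cst)
      (auto simp: bipoly_family_def)
  ultimately show ?thesis by simp
qed

lemma bipoly_family_virt:
  assumes "bipoly_family F" "\<gamma> \<in> R"
  shows "bipoly_family (\<lambda>t. virt e (\<gamma> t) m (F t))"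
proof -
  have "bipoly_family (\<lambda>t. chart_sub e (\<gamma> t) (F t))"
    unfolding chart_sub_def using assms
    by (cases e; simp only: if_True if_False;
      intro bipoly_family_bsub bipoly_family_mult bipoly_family_add bipoly_family_cst bipoly_family_const)
  then obtain N where N: "\<And>t i j. bcoeff (chart_sub e (\<gamma> t) (F t)) i j \<noteq> 0 \<Longrightarrow> i \<le> N \<and> j \<le> N"
    and R: "\<And>i j. (\<lambda>t. bcoeff (chart_sub e (\<gamma> t) (F t)) i j) \<in> R" unfolding bipoly_family_def by blast
  show ?thesis unfolding bipoly_family_def
  proof (intro conjI allI exI[of _ N] impI)
    fix t i j assume "bcoeff (virt e (\<gamma> t) m (F t)) i j \<noteq> 0"
    then show "i \<le> N" "j \<le> N" using N[of t "i + m" j] N[of t i "j + m"]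
      by (auto simp: bcoeff_virt split: if_splits)
  next
    fix i j show "(\<lambda>t. bcoeff (virt e (\<gamma> t) m (F t)) i j) \<in> R"
      unfolding bcoeff_virt using R by (cases e) simp_all
  qed
qed

lemma bipoly_family_vstage:
  assumes "bipoly_family F" "\<And>l. l < i \<Longrightarrow> (\<lambda>t. c t (l + 2)) \<in> R"
  shows "bipoly_family (\<lambda>t. vstage e (c t) \<mu> (F t) i)"
  using assms(2)
proof (induction i)
  case (Suc i)
  then show ?case by (auto intro!: bipoly_family_virt)
qed (simp add: assms(1))

end

text \<open>Built into the open set, it supplies the coordinates needed for
  \<open>cluster_data\<close>. All tuples from affine charts satisfy it, so the traces of the open
  set on the charts are not affected.\<close>

definition poly_coord_tuple :: "nat \<Rightarrow> (nat \<Rightarrow> nat) \<Rightarrow> (nat \<Rightarrow> 'a::idom point list) \<Rightarrow> bool" where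
  "poly_coord_tuple \<rho> r K \<longleftrightarrow> (\<exists>t A B XY e c. \<forall>k\<in>{1..\<rho>}.
     coords_at (t k) (A k) (B k) (XY k) \<and> K k = gen_cluster (r k) (XY k) (e k) (c k))"

lemma cluster_dataI:
  assumes "\<rho> \<ge> 1" "\<And>k. k \<in> {1..\<rho>} \<Longrightarrow> r k \<ge> 1" "K \<in> cluster_tuples p s \<rho> r"
    and "\<And>k i. k \<in> {1..\<rho>} \<Longrightarrow> i < r k \<Longrightarrow> M k ! i = int (\<mu> k i)"
    and "\<And>k. k \<in> {1..\<rho>} \<Longrightarrow> coords_at (t k) (A k) (B k) (XY k)"
    and "\<And>k. k \<in> {1..\<rho>} \<Longrightarrow> K k = gen_cluster (r k) (XY k) (e k) (c k)"
  shows "cluster_data \<rho> r t A B XY e c \<mu> M K"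
  using assms by unfold_locales (auto simp: cluster_tuples_def clusters_def PiE_iff)

lemma coords_at_translate:
  assumes "t < 3"
  shows "coords_at t (px + cst a) (py + cst b) (fst (aff t) - cnst a, snd (aff t) - cnst b)"
  using assms indep_translate[OF indep_aff]
  by (simp add: coords_at_def ev2_hom ev2_gens del: add_pCons)

text \<open>For fixed auxiliary forms the rank condition is the injectivity of a system with
  polynomial coefficients. Letting the forms vary means a union of open sets; requiring two rank
  conditions means an intersection, described by products.\<close>

theorem zariski_open_rank:
  fixes r :: "nat \<Rightarrow> nat" and p :: "'a::field_char_0 point" and s n \<kappa> n' \<kappa>' :: nat
  assumes rho: "\<rho> \<ge> 1" and r: "\<And>k. k \<in> {1..\<rho>} \<Longrightarrow> r k \<ge> 1"
    and M: "\<And>k i. k \<in> {1..\<rho>} \<Longrightarrow> i < r k \<Longrightarrow> M k ! i = int (\<mu> k i)"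
  defines "V \<equiv> cluster_tuples p s \<rho> r"
  defines "rk \<equiv> \<lambda>K n \<kappa>. rank_cond ((\<lambda>k. K k ! 0) ` {1..\<rho>})
    (union_scheme {1..\<rho>} (\<lambda>k. cluster_scheme (K k) (M k))) n \<kappa>"
  shows "zariski_open_in \<rho> r V {K \<in> V. poly_coord_tuple \<rho> r K \<and> rk K n \<kappa> \<and> rk K n' \<kappa>'}"
  unfolding zariski_open_in_def
proof (intro conjI allI impI)
  fix t :: "nat \<Rightarrow> nat" and e :: "nat \<Rightarrow> nat \<Rightarrow> bool"
  assume t: "\<forall>k. t k < 3"
  define I where "I = {(k, i). k \<in> {1..\<rho>} \<and> i \<le> r k}"
  interpret function_ring "polynomial_funs I :: ((nat \<times> nat \<Rightarrow> 'a) \<Rightarrow> 'a) set"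
    by (rule function_ring_polynomial_funs)
  define Kc where "Kc c = (\<lambda>k\<in>{1..\<rho>}. chart_cluster (r k) (t k) (e k) (\<lambda>i. c (k, i)))" for c :: "nat \<times> nat \<Rightarrow> 'a"
  define A where "A c k = px + cst (c (k, 0))" for c :: "nat \<times> nat \<Rightarrow> 'a" and k :: nat
  define B where "B c k = py + cst (c (k, 1))" for c :: "nat \<times> nat \<Rightarrow> 'a" and k :: nat
  define XY where "XY c k = (fst (aff (t k)) - cnst (c (k, 0)), snd (aff (t k)) - cnst (c (k, 1)))"
    for c :: "nat \<times> nat \<Rightarrow> 'a" and k
  have co: "coords_at (t k) (A c k) (B c k) (XY c k)" for c k
    unfolding A_def B_def XY_def by (rule coords_at_translate) (use t in simp)
  have Kg: "Kc c k = gen_cluster (r k) (XY c k) (e k) (\<lambda>i. c (k, i))" if "k \<in> {1..\<rho>}" for c k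
    using that by (simp add: Kc_def chart_cluster_eq XY_def)
  have data: "cluster_data \<rho> r t (A c) (B c) (XY c) e (\<lambda>k i. c (k, i)) \<mu> M (Kc c)" if "Kc c \<in> V" for c
    by (rule cluster_dataI[OF rho r _ M co Kg]) (use that in \<open>simp_all add: V_def\<close>)
  define cm where "cm n \<phi> s c = cluster_cond_mat t (A c) (B c) e (\<lambda>k i. c (k, i)) \<mu> n \<phi> s"
    for n \<phi> s and c :: "nat \<times> nat \<Rightarrow> 'a"
  define CS where "CS = cluster_conds \<rho> r \<mu>"
  have "\<exists>\<P>\<subseteq>polynomial_funs I. \<forall>c. Kc c \<in> V \<longrightarrow> (rk (Kc c) n \<kappa> \<longleftrightarrow> (\<exists>P\<in>\<P>. P c \<noteq> 0))" for n \<kappa>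
  proof -
    \<comment> \<open>The rows are the cluster conditions, depending on the parameters, and the
      constant rows of the \<open>\<kappa>\<close> auxiliary forms.\<close>
    define L where "L l \<phi> s c = (case \<phi> of Inl \<phi> \<Rightarrow> cm n \<phi> s c | Inr i \<Rightarrow> l i s)"
      for l :: "nat \<Rightarrow> nat \<times> nat \<Rightarrow> 'a" and \<phi> s and c :: "nat \<times> nat \<Rightarrow> 'a"
    have "\<exists>\<P>\<subseteq>polynomial_funs I. \<forall>c. inj_system (L l) (CS <+> {..<\<kappa>}) (tri n) c \<longleftrightarrow> (\<exists>P\<in>\<P>. P c \<noteq> 0)" for l
    proof (rule inj_system_open)
      fix \<phi> s assume "\<phi> \<in> CS <+> {..<\<kappa>}" "s \<in> tri n"
      then show "L l \<phi> s \<in> polynomial_funs I"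
      proof (elim PlusE)
        fix i assume "\<phi> = Inr i"
        then show ?thesis by (simp add: L_def[abs_def] const)
      next
        fix \<psi> assume phi: "\<phi> = Inl \<psi>" and psi: "\<psi> \<in> CS"
        obtain k i a b where ks: "\<psi> = (k, i, a, b)" by (cases \<psi>)
        have k: "k \<in> {1..\<rho>}" "i < r k" using psi by (auto simp: CS_def ks cluster_conds_def)
        have cR: "(\<lambda>c. c (k, l)) \<in> polynomial_funs I" if "l \<le> r k" for l
          by (rule polynomial_funs.coord) (use that k in \<open>simp add: I_def\<close>)
        have "bipoly_family (\<lambda>c. bsub (fmon (t k) n s) (A c k) (B c k))"
          unfolding A_def B_def using k
          by (intro bipoly_family_bsub bipoly_family_add bipoly_family_const bipoly_family_cst cR) auto
        then have "bipoly_family (\<lambda>c. vstage (e k) (\<lambda>i. c (k, i)) (\<mu> k) (bsub (fmon (t k) n s) (A c k) (B c k)) i)"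
          by (rule bipoly_family_vstage) (use k in \<open>intro cR, simp\<close>)
        then show ?thesis unfolding bipoly_family_def L_def[abs_def] phi
          by (simp add: cm_def[abs_def] ks cluster_cond_mat_def cluster_cond_val_def)
      qed
    qed simp
    then have "\<forall>l. \<exists>\<P>. \<P> \<subseteq> polynomial_funs I \<and>
        (\<forall>c. inj_system (L l) (CS <+> {..<\<kappa>}) (tri n) c \<longleftrightarrow> (\<exists>P\<in>\<P>. P c \<noteq> 0))" by blast
    then obtain \<P> where "\<forall>l. \<P> l \<subseteq> polynomial_funs I \<and>
        (\<forall>c. inj_system (L l) (CS <+> {..<\<kappa>}) (tri n) c \<longleftrightarrow> (\<exists>P\<in>\<P> l. P c \<noteq> 0))" by (rule choice[THEN exE])
    then have P: "\<And>l. \<P> l \<subseteq> polynomial_funs I"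
      "\<And>l c. inj_system (L l) (CS <+> {..<\<kappa>}) (tri n) c \<longleftrightarrow> (\<exists>P\<in>\<P> l. P c \<noteq> 0)" by blast+
    have "rk (Kc c) n \<kappa> \<longleftrightarrow> (\<exists>P\<in>(\<Union>l. \<P> l). P c \<noteq> 0)" if V: "Kc c \<in> V" for c
    proof -
      interpret cluster_data \<rho> r t "A c" "B c" "XY c" e "\<lambda>k i. c (k, i)" \<mu> M "Kc c" by (rule data[OF V])
      have ball: "(\<forall>\<alpha>\<in>CS <+> {..<\<kappa>}. Q \<alpha>) \<longleftrightarrow> (\<forall>\<phi>\<in>CS. Q (Inl \<phi>)) \<and> (\<forall>i<\<kappa>. Q (Inr i))" for Q
        by (auto simp: Plus_def)
      have "rk (Kc c) n \<kappa> \<longleftrightarrow> (\<exists>l. inj_system (L l) (CS <+> {..<\<kappa>}) (tri n) c)"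
        unfolding rk_def Z_def[symmetric] rank_condition_iff inj_system_def ball
        by (simp add: L_def cm_def CS_def)
      then show ?thesis using P(2) by blast
    qed
    then show ?thesis using P(1) by (intro exI[of _ "\<Union>l. \<P> l"]) blast
  qed
  note open_rk = this
  obtain \<P> where P: "\<P> \<subseteq> polynomial_funs I" "\<And>c. Kc c \<in> V \<Longrightarrow> rk (Kc c) n \<kappa> \<longleftrightarrow> (\<exists>P\<in>\<P>. P c \<noteq> 0)"
    using open_rk[of n \<kappa>] by blast
  obtain \<Q> where Q: "\<Q> \<subseteq> polynomial_funs I" "\<And>c. Kc c \<in> V \<Longrightarrow> rk (Kc c) n' \<kappa>' \<longleftrightarrow> (\<exists>P\<in>\<Q>. P c \<noteq> 0)"
    using open_rk[of n' \<kappa>'] by blast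
  define \<S> where "\<S> = {\<lambda>c. P c * Q c | P Q. P \<in> \<P> \<and> Q \<in> \<Q>}"
  have "\<S> \<subseteq> polynomial_funs I" using P(1) Q(1) by (auto simp: \<S>_def intro!: mult)
  moreover have "Kc c \<in> {K \<in> V. poly_coord_tuple \<rho> r K \<and> rk K n \<kappa> \<and> rk K n' \<kappa>'} \<longleftrightarrow> (\<exists>P\<in>\<S>. P c \<noteq> 0)"
    if V: "Kc c \<in> V" for c
  proof -
    have "poly_coord_tuple \<rho> r (Kc c)" unfolding poly_coord_tuple_def
      by (rule exI[of _ t], rule exI[of _ "A c"], rule exI[of _ "B c"], rule exI[of _ "XY c"],
          rule exI[of _ e], rule exI[of _ "\<lambda>k i. c (k, i)"]) (use co Kg in blast)
    then have "Kc c \<in> {K \<in> V. poly_coord_tuple \<rho> r K \<and> rk K n \<kappa> \<and> rk K n' \<kappa>'} \<longleftrightarrow>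
        (\<exists>P\<in>\<P>. P c \<noteq> 0) \<and> (\<exists>Q\<in>\<Q>. Q c \<noteq> 0)" using V P(2)[OF V] Q(2)[OF V] by simp
    also have "\<dots> \<longleftrightarrow> (\<exists>P\<in>\<S>. P c \<noteq> 0)"
    proof
      assume "(\<exists>P\<in>\<P>. P c \<noteq> 0) \<and> (\<exists>Q\<in>\<Q>. Q c \<noteq> 0)"
      then obtain P Q where "P \<in> \<P>" "Q \<in> \<Q>" "P c \<noteq> 0" "Q c \<noteq> 0" by blast
      then show "\<exists>P\<in>\<S>. P c \<noteq> 0" by (intro bexI[of _ "\<lambda>c. P c * Q c"]) (auto simp: \<S>_def)
    qed (auto simp: \<S>_def)
    finally show ?thesis .
  qed
  ultimately show "\<exists>\<P>\<subseteq>polynomial_funs {(k, i). k \<in> {1..\<rho>} \<and> i \<le> r k}. \<forall>c.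
         let K = (\<lambda>k\<in>{1..\<rho>}. chart_cluster (r k) (t k) (e k) (\<lambda>i. c (k, i)))
         in K \<in> V \<longrightarrow> (K \<in> {K \<in> V. poly_coord_tuple \<rho> r K \<and> rk K n \<kappa> \<and> rk K n' \<kappa>'} \<longleftrightarrow> (\<exists>P\<in>\<P>. P c \<noteq> 0))"
    unfolding I_def[symmetric] Kc_def[symmetric] Let_def by blast
qed auto

section \<open>Proximity\<close>

lemma bipoly_induct [case_names cst px py add mult]:
  fixes P :: "'a::comm_ring_1 poly poly \<Rightarrow> bool"
  assumes "\<And>a. P (cst a)" "P px" "P py" "\<And>F G. P F \<Longrightarrow> P G \<Longrightarrow> P (F + G)" "\<And>F G. P F \<Longrightarrow> P G \<Longrightarrow> P (F * G)"
  shows "P F"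
proof (induction F)
  case 0
  show ?case using assms(1)[of 0] by simp
next
  case (pCons p F)
  have "P [:p:]"
  proof (induction p)
    case 0
    show ?case using assms(1)[of 0] by simp
  next
    case (pCons a p)
    have "[:pCons a p:] = cst a + px * [:p:]" by simp
    then show ?case using assms pCons.IH by metis
  qed
  moreover have "pCons p F = [:p:] + py * F" by simp
  ultimately show ?case using assms pCons.IH by metis
qed

lemma chart_sub_exc_coord: "chart_sub e \<gamma> (exc_coord e) = exc_coord e"
  by (cases e) (simp_all add: chart_sub_def exc_coord_def bsub_gens)

text \<open>Away from the exceptional curve the blow-up is an isomorphism: up to a power of the
  exceptional equation every polynomial in the new coordinates comes from below. Allowing all large
  exponents makes the property additive.\<close>

lemma chart_sub_lift:
  "\<exists>L0. \<forall>L\<ge>L0. \<exists>F'. chart_sub e \<gamma> F' = exc_coord e ^ L * F"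
proof (induction F rule: bipoly_induct)
  case (cst a)
  have "chart_sub e \<gamma> (exc_coord e ^ L * cst a) = exc_coord e ^ L * cst a" for L
    by (simp only: is_homD[OF is_hom_chart_sub] chart_sub_exc_coord chart_sub_cst)
  then show ?case by blast
next
  case px
  have "\<exists>F'. chart_sub e \<gamma> F' = exc_coord e ^ L * px" if "L \<ge> 1" for L
  proof -
    obtain k where L: "L = Suc k" using \<open>L \<ge> 1\<close> by (cases L) auto
    \<comment> \<open>In this chart the new \<open>x\<close> is \<open>X/Y - \<gamma>\<close>, so
      \<open>y\<close> times it is pulled back from \<open>X - \<gamma> Y\<close>.\<close>
    have "chart_sub False \<gamma> (px - cst \<gamma> * py) = py * px"
      unfolding chart_sub_def if_False by (simp only: is_homD[OF is_hom_bsub] bsub_gens) (simp add: algebra_simps)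
    then have "chart_sub e \<gamma> (if e then px * px else px - cst \<gamma> * py) = exc_coord e * px"
      using chart_sub_exc_coord[of True \<gamma>]
      by (cases e) (simp_all only: exc_coord_def if_True if_False is_homD[OF is_hom_chart_sub])
    then have "chart_sub e \<gamma> (exc_coord e ^ k * (if e then px * px else px - cst \<gamma> * py)) = exc_coord e ^ L * px"
      by (simp only: is_homD[OF is_hom_chart_sub] chart_sub_exc_coord L power_Suc2 mult.assoc)
    then show ?thesis by blast
  qed
  then show ?case by blast
next
  case py
  have "\<exists>F'. chart_sub e \<gamma> F' = exc_coord e ^ L * py" if "L \<ge> 1" for L
  proof -
    obtain k where L: "L = Suc k" using \<open>L \<ge> 1\<close> by (cases L) auto
    have "chart_sub True \<gamma> (py - cst \<gamma> * px) = px * py"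
      unfolding chart_sub_def if_True by (simp only: is_homD[OF is_hom_bsub] bsub_gens) (simp add: algebra_simps)
    then have "chart_sub e \<gamma> (if e then py - cst \<gamma> * px else py * py) = exc_coord e * py"
      using chart_sub_exc_coord[of False \<gamma>]
      by (cases e) (simp_all only: exc_coord_def if_True if_False is_homD[OF is_hom_chart_sub])
    then have "chart_sub e \<gamma> (exc_coord e ^ k * (if e then py - cst \<gamma> * px else py * py)) = exc_coord e ^ L * py"
      by (simp only: is_homD[OF is_hom_chart_sub] chart_sub_exc_coord L power_Suc2 mult.assoc)
    then show ?thesis by blast
  qed
  then show ?case by blast
next
  case (add F G)
  then obtain L1 L2 where L: "\<And>L. L \<ge> L1 \<Longrightarrow> \<exists>F'. chart_sub e \<gamma> F' = exc_coord e ^ L * F"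
    "\<And>L. L \<ge> L2 \<Longrightarrow> \<exists>F'. chart_sub e \<gamma> F' = exc_coord e ^ L * G" by blast
  have "\<exists>F'. chart_sub e \<gamma> F' = exc_coord e ^ L * (F + G)" if "L \<ge> L1 + L2" for L
  proof -
    obtain F' G' where "chart_sub e \<gamma> F' = exc_coord e ^ L * F" "chart_sub e \<gamma> G' = exc_coord e ^ L * G"
      using L(1)[of L] L(2)[of L] \<open>L \<ge> L1 + L2\<close> by auto
    then have "chart_sub e \<gamma> (F' + G') = exc_coord e ^ L * (F + G)"
      by (simp only: is_homD[OF is_hom_chart_sub] distrib_left)
    then show ?thesis by blast
  qed
  then show ?case by blast
next
  case (mult F G)
  then obtain L1 L2 where L: "\<And>L. L \<ge> L1 \<Longrightarrow> \<exists>F'. chart_sub e \<gamma> F' = exc_coord e ^ L * F"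
    "\<And>L. L \<ge> L2 \<Longrightarrow> \<exists>F'. chart_sub e \<gamma> F' = exc_coord e ^ L * G" by blast
  have "\<exists>F'. chart_sub e \<gamma> F' = exc_coord e ^ L * (F * G)" if "L \<ge> L1 + L2" for L
  proof -
    have l: "L1 \<le> L - L2" using that by linarith
    obtain F' G' where "chart_sub e \<gamma> F' = exc_coord e ^ (L - L2) * F" "chart_sub e \<gamma> G' = exc_coord e ^ L2 * G"
      using L(1)[OF l] L(2)[OF order.refl] by auto
    then have "chart_sub e \<gamma> (F' * G') = (exc_coord e ^ (L - L2) * exc_coord e ^ L2) * (F * G)"
      by (simp only: is_homD[OF is_hom_chart_sub] mult_ac)
    also have "exc_coord e ^ (L - L2) * exc_coord e ^ L2 = (exc_coord e ^ L :: 'a poly poly)"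
      using that by (simp add: power_add[symmetric])
    finally show ?thesis by blast
  qed
  then show ?case by blast
qed

section \<open>Orders of vanishing along exceptional curves\<close>

lemma prime_elem_exc_coord: "prime_elem (exc_coord e :: 'a::idom poly poly)"
proof -
  have px: "prime_elem (px :: 'a poly poly)"
    unfolding prime_elem_def using px_dvd_mult_iff[where ?'a = 'a]
    by (auto simp: is_unit_const_poly_iff is_unit_poly_iff)
  have swap: "py dvd F \<longleftrightarrow> px dvd bsub F py px" for F :: "'a poly poly"
    using py_power_dvd_iff[of 1 F] px_power_dvd_iff[of 1 "bsub F py px"] by (simp add: bcoeff_swap)
  have "prime_elem (py :: 'a poly poly)"
    unfolding prime_elem_def using px_dvd_mult_iff[where ?'a = 'a]
    by (auto simp: swap is_homD[OF is_hom_bsub] is_unit_poly_iff simp del: mult_pCons_left)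
  with px show ?thesis by (simp add: exc_coord_def)
qed

text \<open>The order is a valuation, because the exceptional equation is prime in the chart of the
  blow-up.\<close>

lemma ordge_mult_exact:
  fixes F G :: "'a::field poly poly"
  assumes "\<not> ordge (Suc m) F" "\<not> ordge (Suc n) G"
  shows "\<not> ordge (Suc (m + n)) (F * G)"
proof
  assume "ordge (Suc (m + n)) (F * G)"
  then have "exc_coord True ^ Suc (m + n) dvd chart_sub True 0 F * chart_sub True 0 G"
    unfolding exc_coord_power_dvd_chart_sub[of True _ 0, symmetric] is_homD(4)[OF is_hom_chart_sub] .
  then have "exc_coord True ^ Suc m dvd chart_sub True 0 F \<or> exc_coord True ^ Suc n dvd chart_sub True 0 G"
    by (rule prime_elem_power_dvd_cases[OF _ _ prime_elem_exc_coord]) simp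
  then show False using assms by (simp only: exc_coord_power_dvd_chart_sub simp_thms)
qed

lemma ordge_unit_mult:
  fixes F G :: "'a::field poly poly"
  assumes "bcoeff G 0 0 \<noteq> 0"
  shows "ordge n (F * G) \<longleftrightarrow> ordge n F"
proof
  assume o: "ordge n (F * G)"
  show "ordge n F"
  proof (cases n)
    case 0 then show ?thesis by (simp add: ordge_def)
  next
    case (Suc m)
    have "\<not> ordge (Suc 0) G" using assms by (auto simp: ordge_def)
    then show ?thesis using o ordge_mult_exact[of m F 0 G] Suc by auto
  qed
qed (rule ordge_0_mult)

lemma maxid_power_iff:
  fixes XY :: "'a::field ratfun \<times> 'a ratfun"
  assumes ind: "indep2 XY"
  shows "f \<in> maxid_power (loc XY) n \<longleftrightarrow> (\<exists>F G. f = ev2p F XY / ev2p G XY \<and> bcoeff G 0 0 \<noteq> 0 \<and> ordge n F)"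
proof (induction n arbitrary: f)
  case 0
  show ?case by (simp add: loc_iff ordge_def)
next
  case (Suc n)
  define S where "S = {f. \<exists>F G. f = ev2p F XY / ev2p G XY \<and> bcoeff G 0 0 \<noteq> 0 \<and> ordge (Suc n) F}"
  have S0: "0 \<in> S" unfolding S_def
    by (intro CollectI exI[of _ 0] exI[of _ 1]) (simp add: ev2_hom bcoeff_1 ordge_def)
  have Sadd: "f + g \<in> S" if fg: "f \<in> S" "g \<in> S" for f g
  proof -
    obtain F G F' G' where h: "f = ev2p F XY / ev2p G XY" "g = ev2p F' XY / ev2p G' XY"
      "bcoeff G 0 0 \<noteq> 0" "bcoeff G' 0 0 \<noteq> 0" "ordge (Suc n) F" "ordge (Suc n) F'"
      using fg unfolding S_def by blast
    then have "G \<noteq> 0" "G' \<noteq> 0" by auto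
    then have "f + g = ev2p (F * G' + F' * G) XY / ev2p (G * G') XY"
      using ind by (simp add: h ev2_hom add_frac_eq indep_nonzero)
    moreover have "ordge (Suc n) (F * G' + F' * G)"
      using ordge_0_mult[OF h(5), of G'] ordge_0_mult[OF h(6), of G] by (simp add: ordge_def)
    ultimately show ?thesis unfolding S_def using h
      by (intro CollectI exI[of _ "F * G' + F' * G"] exI[of _ "G * G'"]) (simp add: bcoeff_0_0_mult)
  qed
  have Ssum: "(\<Sum>i<N. h i) \<in> S" if "\<And>i. i < N \<Longrightarrow> h i \<in> S" for N :: nat and h
    using that by (induction N) (auto intro: S0 Sadd)
  have "f \<in> maxid_power (loc XY) (Suc n) \<longleftrightarrow> f \<in> S"
  proof
    assume "f \<in> maxid_power (loc XY) (Suc n)"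
    then obtain N a b where f: "f = (\<Sum>i<(N::nat). a i * b i)"
      "\<And>i. i < N \<Longrightarrow> a i \<in> maxid (loc XY) \<and> b i \<in> maxid_power (loc XY) n" by auto
    have "a i * b i \<in> S" if i: "i < N" for i
    proof -
      obtain F G F' G' where h: "a i = ev2p F XY / ev2p G XY" "b i = ev2p F' XY / ev2p G' XY"
        "bcoeff G 0 0 \<noteq> 0" "bcoeff G' 0 0 \<noteq> 0" "bcoeff F 0 0 = 0" "ordge n F'"
        using f(2)[OF i] unfolding maxid_iff[OF ind] Suc.IH by blast
      have "ordge 1 F" using h(5) by (simp add: ordge_def)
      then have "ordge (Suc n) (F * F')" using ordge_mult[of 1 F n F'] h(6) by simp
      then show ?thesis unfolding S_def using h
        by (intro CollectI exI[of _ "F * F'"] exI[of _ "G * G'"]) (simp add: ev2_hom bcoeff_0_0_mult)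
    qed
    then show "f \<in> S" unfolding f(1) by (rule Ssum)
  next
    assume "f \<in> S"
    then obtain F G where F: "f = ev2p F XY / ev2p G XY" "bcoeff G 0 0 \<noteq> 0" "ordge (Suc n) F"
      unfolding S_def by blast
    obtain p Q where FQ: "F = pCons p Q" by (cases F)
    obtain z q where pq: "p = pCons z q" by (cases p)
    have z: "z = 0" using F(3)[unfolded ordge_def, rule_format, of 0 0] by (simp add: bcoeff_def FQ pq)
    have Fd: "F = px * [:q:] + py * Q" by (simp add: FQ pq z)
    have oA: "ordge n [:q:]" unfolding ordge_def
    proof (intro allI impI)
      fix i j assume "i + j < n"
      moreover have "bcoeff F (Suc i) 0 = coeff q i" by (simp add: FQ pq bcoeff_def)
      ultimately show "bcoeff [:q:] i j = 0" using F(3)[unfolded ordge_def, rule_format, of "Suc i" 0]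
        by (cases j) (simp_all add: bcoeff_def)
    qed
    have oB: "ordge n Q" unfolding ordge_def
    proof (intro allI impI)
      fix i j assume "i + j < n"
      then show "bcoeff Q i j = 0" using F(3)[unfolded ordge_def, rule_format, of i "Suc j"]
        by (simp add: FQ bcoeff_def)
    qed
    define a where "a i = (if i = (0::nat) then fst XY else snd XY)" for i
    define b where "b i = (if i = (0::nat) then ev2p [:q:] XY / ev2p G XY else ev2p Q XY / ev2p G XY)" for i
    have "ev2p F XY = fst XY * ev2p [:q:] XY + snd XY * ev2p Q XY"
      unfolding Fd by (simp only: ev2_hom ev2_gens)
    then have "f = (\<Sum>i<2. a i * b i)"
      unfolding F(1) by (simp add: numeral_2_eq_2 a_def b_def add_divide_distrib)
    moreover have "\<forall>i<2. a i \<in> maxid (loc XY) \<and> b i \<in> maxid_power (loc XY) n"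
      unfolding Suc.IH a_def b_def using maxid_coords[OF ind] oA oB F(2) by auto
    ultimately show "f \<in> maxid_power (loc XY) (Suc n)" by auto
  qed
  then show ?case by (simp only: S_def mem_Collect_eq)
qed

lemma exc_ring_iff:
  fixes XY :: "'a::field ratfun \<times> 'a ratfun"
  assumes ind: "indep2 XY"
  shows "f \<in> exc_ring (loc XY) \<longleftrightarrow>
    (\<exists>F G. f = ev2p F XY / ev2p G XY \<and> G \<noteq> 0 \<and> (\<forall>n. ordge n G \<longrightarrow> ordge n F))"
proof
  have mp: "ev2p F XY / ev2p G XY \<in> maxid_power (loc XY) n \<longleftrightarrow> ordge n F" if G: "bcoeff G 0 0 \<noteq> 0" for F G n
  proof
    assume "ev2p F XY / ev2p G XY \<in> maxid_power (loc XY) n"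
    then obtain F' G' where F': "ev2p F XY / ev2p G XY = ev2p F' XY / ev2p G' XY" "bcoeff G' 0 0 \<noteq> 0" "ordge n F'"
      unfolding maxid_power_iff[OF ind] by blast
    have "G \<noteq> 0" "G' \<noteq> 0" using G F' by auto
    then have "ev2p (F * G') XY = ev2p (F' * G) XY" using F'(1) ind by (simp add: ev2_hom frac_eq_eq indep_nonzero)
    then have "F * G' = F' * G" using indep_eq_iff[OF ind] by blast
    then show "ordge n F" using F' ordge_unit_mult[of G' n F] ordge_0_mult[of n F' G] by simp
  qed (use G maxid_power_iff[OF ind] in blast)
  {
    assume "f \<in> exc_ring (loc XY)"
    then obtain f' g' where f: "f = f' / g'" "f' \<in> loc XY" "g' \<in> loc XY" "g' \<noteq> 0"
      "\<And>n. g' \<in> maxid_power (loc XY) n \<Longrightarrow> f' \<in> maxid_power (loc XY) n" unfolding exc_ring_def by blast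
    obtain F G where F: "f' = ev2p F XY / ev2p G XY" "bcoeff G 0 0 \<noteq> 0" using f(2) unfolding loc_iff by blast
    obtain F' G' where F': "g' = ev2p F' XY / ev2p G' XY" "bcoeff G' 0 0 \<noteq> 0" using f(3) unfolding loc_iff by blast
    have imp: "ordge n F' \<Longrightarrow> ordge n F" for n using f(5)[of n] unfolding F(1) F'(1) mp[OF F(2)] mp[OF F'(2)] .
    have "F' \<noteq> 0" using f(4) F' by (auto simp: ev2_hom)
    moreover have "G \<noteq> 0" "G' \<noteq> 0" using F F' by auto
    ultimately have "f = ev2p (F * G') XY / ev2p (F' * G) XY" "F' * G \<noteq> 0"
      using ind by (simp_all add: f(1) F(1) F'(1) ev2_hom indep_nonzero)
    moreover have "ordge n (F' * G) \<Longrightarrow> ordge n (F * G')" for n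
      unfolding ordge_unit_mult[OF F(2)] ordge_unit_mult[OF F'(2)] by (rule imp)
    ultimately show "\<exists>F G. f = ev2p F XY / ev2p G XY \<and> G \<noteq> 0 \<and> (\<forall>n. ordge n G \<longrightarrow> ordge n F)" by blast
  }
  assume "\<exists>F G. f = ev2p F XY / ev2p G XY \<and> G \<noteq> 0 \<and> (\<forall>n. ordge n G \<longrightarrow> ordge n F)"
  then obtain F G where F: "f = ev2p F XY / ev2p G XY" "G \<noteq> 0" "\<And>n. ordge n G \<Longrightarrow> ordge n F" by blast
  have "ev2p F XY \<in> maxid_power (loc XY) n \<longleftrightarrow> ordge n F" for F n
    using mp[of 1 F n] by (simp add: bcoeff_1 ev2_hom)
  moreover have "ev2p G XY \<noteq> 0" using F(2) ind by (simp add: indep_nonzero)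
  ultimately show "f \<in> exc_ring (loc XY)" unfolding exc_ring_def
    by (intro CollectI exI[of _ "ev2p F XY"] exI[of _ "ev2p G XY"] conjI F(1) loc_ev2) (simp_all add: F(3))
qed

text \<open>The same valuation read on the blow-up, as the order along the exceptional curve;
  \<open>chart_sub_lift\<close> brings fractions in the new coordinates back to the old
  ones.\<close>

lemma exc_ring_chart_iff:
  fixes XY :: "'a::field ratfun \<times> 'a ratfun"
  assumes ind: "indep2 XY"
  shows "f \<in> exc_ring (loc XY) \<longleftrightarrow> (\<exists>F G. f = ev2p F (chart_next e \<gamma> XY) / ev2p G (chart_next e \<gamma> XY) \<and> G \<noteq> 0 \<and>
     (\<forall>n. exc_coord e ^ n dvd G \<longrightarrow> exc_coord e ^ n dvd F))"
proof
  let ?N = "chart_next e \<gamma> XY"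
  have indN: "indep2 ?N" using indep_chart_next[of "fst XY" "snd XY" e \<gamma>] ind by simp
  note ev = ev2_chart_sub'[OF ind, of e \<gamma>]
  {
    assume "f \<in> exc_ring (loc XY)"
    then obtain F G where F: "f = ev2p F XY / ev2p G XY" "G \<noteq> 0" "\<And>n. ordge n G \<Longrightarrow> ordge n F"
      unfolding exc_ring_iff[OF ind] by blast
    have "ev2p (chart_sub e \<gamma> G) ?N \<noteq> 0" unfolding ev using F(2) ind by (simp add: indep_nonzero)
    then have "chart_sub e \<gamma> G \<noteq> 0" by (auto simp: ev2_hom)
    moreover have "f = ev2p (chart_sub e \<gamma> F) ?N / ev2p (chart_sub e \<gamma> G) ?N" unfolding ev by (rule F(1))
    moreover have "\<forall>n. exc_coord e ^ n dvd chart_sub e \<gamma> G \<longrightarrow> exc_coord e ^ n dvd chart_sub e \<gamma> F"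
      unfolding exc_coord_power_dvd_chart_sub using F(3) by blast
    ultimately show "\<exists>F G. f = ev2p F ?N / ev2p G ?N \<and> G \<noteq> 0 \<and> (\<forall>n. exc_coord e ^ n dvd G \<longrightarrow> exc_coord e ^ n dvd F)"
      by blast
  }
  assume "\<exists>F G. f = ev2p F ?N / ev2p G ?N \<and> G \<noteq> 0 \<and> (\<forall>n. exc_coord e ^ n dvd G \<longrightarrow> exc_coord e ^ n dvd F)"
  then obtain F G where F: "f = ev2p F ?N / ev2p G ?N" "G \<noteq> 0" "\<And>n. exc_coord e ^ n dvd G \<Longrightarrow> exc_coord e ^ n dvd F" by blast
  obtain L1 where L1: "\<And>L. L \<ge> L1 \<Longrightarrow> \<exists>F'. chart_sub e \<gamma> F' = exc_coord e ^ L * F" using chart_sub_lift by blast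
  obtain L2 where L2: "\<And>L. L \<ge> L2 \<Longrightarrow> \<exists>F'. chart_sub e \<gamma> F' = exc_coord e ^ L * G" using chart_sub_lift by blast
  define L where "L = L1 + L2"
  obtain F' where F': "chart_sub e \<gamma> F' = exc_coord e ^ L * F" using L1[of L] by (auto simp: L_def)
  obtain G' where G': "chart_sub e \<gamma> G' = exc_coord e ^ L * G" using L2[of L] by (auto simp: L_def)
  have Enz: "ev2p (exc_coord e) ?N \<noteq> 0" "(exc_coord e :: 'a poly poly) \<noteq> 0"
    using indN prime_elem_exc_coord[of e, where ?'a = 'a] by (auto simp: indep_nonzero prime_elem_def)
  have "ev2p F' XY = ev2p (exc_coord e) ?N ^ L * ev2p F ?N" "ev2p G' XY = ev2p (exc_coord e) ?N ^ L * ev2p G ?N"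
    unfolding ev[symmetric] F' G' by (simp_all only: ev2_hom)
  then have "f = ev2p F' XY / ev2p G' XY" using F(1) Enz by simp
  moreover have "G' \<noteq> 0"
  proof
    assume "G' = 0"
    then have "exc_coord e ^ L * G = 0" using G' by (simp add: is_homD[OF is_hom_chart_sub])
    then show False using F(2) Enz by simp
  qed
  moreover have "ordge n F'" if "ordge n G'" for n
  proof (cases "n \<le> L")
    case True
    then have "exc_coord e ^ n dvd (exc_coord e ^ L :: 'a poly poly)" by (rule le_imp_power_dvd)
    then have "exc_coord e ^ n dvd chart_sub e \<gamma> F'" unfolding F' by (rule dvd_mult2)
    then show ?thesis by (simp only: exc_coord_power_dvd_chart_sub)
  next
    case False
    then obtain k where n: "n = L + k" using le_Suc_ex by (metis nat_le_linear)
    have "exc_coord e ^ n dvd chart_sub e \<gamma> G'" using that by (simp only: exc_coord_power_dvd_chart_sub)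
    then have "exc_coord e ^ k dvd G" unfolding G' n power_add using Enz by simp
    then have "exc_coord e ^ n dvd chart_sub e \<gamma> F'" unfolding F' n power_add using F(3) Enz by simp
    then show ?thesis by (simp only: exc_coord_power_dvd_chart_sub)
  qed
  ultimately show "f \<in> exc_ring (loc XY)" unfolding exc_ring_iff[OF ind] by blast
qed

lemma exc_ringI:
  fixes XY :: "'a::field ratfun \<times> 'a ratfun"
  assumes "indep2 XY" "f = ev2p F (chart_next e \<gamma> XY) / ev2p G (chart_next e \<gamma> XY)" "\<not> exc_coord e dvd G"
  shows "f \<in> exc_ring (loc XY)"
proof -
  have "n = 0" if "exc_coord e ^ n dvd G" for n
    using that assms(3) dvd_trans[of "exc_coord e" "exc_coord e ^ n" G] by (cases n) (auto simp: dvd_mult2)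
  then have "\<forall>n. exc_coord e ^ n dvd G \<longrightarrow> exc_coord e ^ n dvd F" by (metis one_dvd power_0)
  moreover have "G \<noteq> 0" using assms(3) by auto
  ultimately show ?thesis unfolding exc_ring_chart_iff[OF assms(1), of f e \<gamma>] using assms(2) by blast
qed

lemma not_exc_coord_dvd: "bcoeff G 0 0 \<noteq> 0 \<Longrightarrow> \<not> exc_coord e dvd G" for G :: "'a::idom poly poly"
  using px_power_dvd_iff[of 1 G] py_power_dvd_iff[of 1 G] by (auto simp: exc_coord_def)

lemma loc_chart_next_exc_ring:
  fixes XY :: "'a::field ratfun \<times> 'a ratfun"
  assumes "indep2 XY"
  shows "loc (chart_next e \<gamma> XY) \<subseteq> exc_ring (loc XY)"
proof
  fix f assume "f \<in> loc (chart_next e \<gamma> XY)"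
  then obtain F G where "f = ev2p F (chart_next e \<gamma> XY) / ev2p G (chart_next e \<gamma> XY)" "bcoeff G 0 0 \<noteq> 0"
    unfolding loc_iff by blast
  then show "f \<in> exc_ring (loc XY)" using exc_ringI[OF assms] not_exc_coord_dvd by blast
qed

text \<open>In successive charts of this kind the second coordinate \<open>w\<close> persists, and
  the points follow the smooth arc on which the first coordinate is a polynomial in \<open>w\<close>
  with coefficients \<open>c\<close>.\<close>

lemma gen_params_False_chain:
  assumes ind: "indep2 XY" and e: "\<And>l. i \<le> l \<Longrightarrow> l < i + d \<Longrightarrow> \<not> e l"
  shows "snd (gen_params XY e c (i + d)) = snd (gen_params XY e c i) \<and>
    fst (gen_params XY e c (i + d)) * snd (gen_params XY e c i) ^ d =
      fst (gen_params XY e c i) - (\<Sum>l<d. cnst (c (i + l + 2)) * snd (gen_params XY e c i) ^ Suc l)"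
  using e
proof (induction d)
  case 0
  show ?case by simp
next
  case (Suc d)
  let ?P = "gen_params XY e c" and ?w = "snd (gen_params XY e c i)"
  have w: "?w \<noteq> 0" using indep_coords_nonzero[OF indep_gen_params[OF ind]] by simp
  have IH: "snd (?P (i + d)) = ?w"
    "fst (?P (i + d)) * ?w ^ d = fst (?P i) - (\<Sum>l<d. cnst (c (i + l + 2)) * ?w ^ Suc l)"
    using Suc.IH Suc.prems by simp_all
  have n: "?P (i + Suc d) = chart_next False (c (i + d + 2)) (?P (i + d))" using Suc.prems[of "i + d"] by simp
  have 1: "snd (?P (i + Suc d)) = ?w" unfolding n using IH(1) by (simp add: chart_next_def)
  have "fst (?P (i + Suc d)) * ?w ^ Suc d =
      (fst (?P (i + d)) / ?w - cnst (c (i + d + 2))) * (?w * ?w ^ d)"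
    unfolding n chart_next_def using IH(1) by simp
  also have "\<dots> = fst (?P (i + d)) * ?w ^ d - cnst (c (i + d + 2)) * ?w ^ Suc d"
    using w by (simp add: field_simps)
  finally show ?case using IH(2) 1 by simp
qed

lemma ordge_mono: "m \<le> n \<Longrightarrow> ordge n F \<Longrightarrow> ordge m F"
  by (simp add: ordge_def)

lemma exact_order_exists:
  assumes "G \<noteq> 0" shows "\<exists>N. ordge N G \<and> \<not> ordge (Suc N) G"
proof -
  obtain i j where "bcoeff G i j \<noteq> 0" using assms bipoly_eqI[of G 0] by (auto simp: bcoeff_def)
  then have ex: "\<exists>N. \<not> ordge (Suc N) G" by (intro exI[of _ "i + j"]) (auto simp: ordge_def)
  define N where "N = (LEAST N. \<not> ordge (Suc N) G)"
  have "\<not> ordge (Suc N) G" unfolding N_def using ex by (rule LeastI_ex)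
  moreover have "ordge N G"
  proof (cases N)
    case (Suc k)
    then show ?thesis using not_less_Least[of k "\<lambda>N. \<not> ordge (Suc N) G"] by (auto simp: N_def[symmetric])
  qed (simp add: ordge_def)
  ultimately show ?thesis by blast
qed

lemma bcoeff_py_power: "bcoeff ((py :: 'a::comm_ring_1 poly poly) ^ n) i j = (if i = 0 \<and> j = n then 1 else 0)"
proof -
  have "(py :: 'a poly poly) ^ n = cst 1 * px ^ 0 * py ^ n" by (simp only: power_0 mult_1_right one_pCons[symmetric] mult_1_left)
  also have "\<dots> = monom (monom 1 0) n" by (rule bmonom_eq)
  finally show ?thesis by (simp only: bcoeff_monom)
qed

text \<open>The last first coordinate is \<open>(X - T(w)) / w^d\<close>. Its numerator has order
  exactly 1 at the point with index \<open>i\<close>, its denominator order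
  \<open>d \<ge> 2\<close>, so it has a pole along the exceptional curve of that point.\<close>

lemma not_proximate_False_chain:
  fixes XY :: "'a::field ratfun \<times> 'a ratfun"
  assumes ind: "indep2 XY" and d: "d \<ge> 2" and e: "\<And>l. i \<le> l \<Longrightarrow> l < i + d \<Longrightarrow> \<not> e l"
  shows "\<not> loc (gen_params XY e c (i + d)) \<subseteq> exc_ring (loc (gen_params XY e c i))"
proof
  let ?P = "gen_params XY e c"
  assume "loc (?P (i + d)) \<subseteq> exc_ring (loc (?P i))"
  then have "fst (?P (i + d)) \<in> exc_ring (loc (?P i))" using loc_coords(1) by blast
  then obtain F G where F: "fst (?P (i + d)) = ev2p F (?P i) / ev2p G (?P i)" "G \<noteq> 0"
    "\<And>n. ordge n G \<Longrightarrow> ordge n F" unfolding exc_ring_iff[OF indep_gen_params[OF ind]] by blast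
  define T :: "'a poly poly" where "T = (\<Sum>l<d. cst (c (i + l + 2)) * py ^ Suc l)"
  note indP = indep_gen_params[OF ind, of e c i]
  have w: "snd (?P i) \<noteq> 0" "ev2p G (?P i) \<noteq> 0" using indep_coords_nonzero[OF indP] F(2) indP by (auto simp: indep_nonzero)
  have "fst (?P (i + d)) * snd (?P i) ^ d = ev2p (px - T) (?P i)"
    unfolding T_def using conjunct2[OF gen_params_False_chain[OF ind e]] by (simp only: ev2_hom ev2_gens)
  then have "ev2p (F * py ^ d) (?P i) = ev2p (G * (px - T)) (?P i)"
    unfolding F(1) ev2_hom ev2_gens using w by (simp add: field_simps)
  then have eq: "F * py ^ d = G * (px - T)" using indep_eq_iff[OF indP] by blast
  obtain N where N: "ordge N G" "\<not> ordge (Suc N) G" using exact_order_exists[OF F(2)] by blast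
  have "ordge 1 (py :: 'a poly poly)" using bcoeff_py_power[of 1, where ?'a = 'a] by (simp add: ordge_def)
  then have "ordge (N + d) (F * py ^ d)" by (intro ordge_mult F(3) N ordge_power)
  then have "ordge (Suc (N + 1)) (G * (px - T))" unfolding eq by (rule ordge_mono[rotated]) (use d in simp)
  moreover have "\<not> ordge (Suc 1) (px - T)"
  proof -
    have "bcoeff T 1 0 = 0" unfolding T_def bcoeff_sum bcoeff_cst_mult bcoeff_py_power by simp
    then have "bcoeff (px - T) 1 0 = 1" by (simp add: bcoeff_def)
    then show ?thesis unfolding ordge_def by (metis One_nat_def add.right_neutral lessI zero_neq_one)
  qed
  ultimately show False using ordge_mult_exact[OF N(2), of 1 "px - T"] by blast
qed

text \<open>While the parameters \<open>c\<close> vanish, the points stay on the strict transform of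
  the first exceptional curve, whose local equation is \<open>px\<close> in each of the
  charts.\<close>

lemma exc_ring_chain:
  fixes XY :: "'a::field ratfun \<times> 'a ratfun"
  assumes ind: "indep2 XY" and e: "e 0" "\<And>l. l \<ge> 1 \<Longrightarrow> \<not> e l"
  shows "(\<And>l. 1 \<le> l \<Longrightarrow> l < Suc j \<Longrightarrow> c (l + 2) = 0) \<Longrightarrow>
    f = ev2p F (gen_params XY e c (Suc j)) / ev2p G (gen_params XY e c (Suc j)) \<Longrightarrow>
    \<not> px dvd G \<Longrightarrow> f \<in> exc_ring (loc XY)"
proof (induction j arbitrary: F G)
  case 0
  have P: "gen_params XY e c (Suc 0) = chart_next True (c 2) XY" using e(1) by (simp add: numeral_2_eq_2)
  show ?case using exc_ringI[OF ind, of f F True "c 2" G] 0(2,3) unfolding P exc_coord_def by simp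
next
  case (Suc j)
  let ?P = "gen_params XY e c"
  note indP = indep_gen_params[OF ind, of e c]
  have n: "?P (Suc (Suc j)) = chart_next False 0 (?P (Suc j))"
    using e(2)[of "Suc j"] Suc.prems(1)[of "Suc j"] by simp
  obtain L1 where L1: "\<And>L. L \<ge> L1 \<Longrightarrow> \<exists>F'. chart_sub False 0 F' = exc_coord False ^ L * F" using chart_sub_lift by blast
  obtain L2 where L2: "\<And>L. L \<ge> L2 \<Longrightarrow> \<exists>F'. chart_sub False 0 F' = exc_coord False ^ L * G" using chart_sub_lift by blast
  define L where "L = L1 + L2"
  obtain F' where F': "chart_sub False 0 F' = exc_coord False ^ L * F" using L1[of L] by (auto simp: L_def)
  obtain G' where G': "chart_sub False 0 G' = exc_coord False ^ L * G" using L2[of L] by (auto simp: L_def)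
  have Enz: "ev2p (exc_coord False) (?P (Suc (Suc j))) \<noteq> 0"
    using indep_coords_nonzero[OF indP[of "Suc (Suc j)"]] by (simp add: exc_coord_def ev2_gens)
  have "ev2p F' (?P (Suc j)) = ev2p (exc_coord False) (?P (Suc (Suc j))) ^ L * ev2p F (?P (Suc (Suc j)))"
    "ev2p G' (?P (Suc j)) = ev2p (exc_coord False) (?P (Suc (Suc j))) ^ L * ev2p G (?P (Suc (Suc j)))"
    unfolding n ev2_chart_sub'[OF indP, of False 0, symmetric] F' G' by (simp_all only: ev2_hom)
  then have "f = ev2p F' (?P (Suc j)) / ev2p G' (?P (Suc j))" using Suc.prems(2) Enz by simp
  moreover have "\<not> px dvd G'"
  proof
    assume "px dvd G'"
    then obtain H where H: "G' = px * H" by (elim dvdE)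
    have "chart_sub False 0 px = px * (py :: 'a poly poly)"
      by (simp add: chart_sub_def bsub_gens)
    then have "chart_sub False 0 G' = px * (py * chart_sub False 0 H)"
      unfolding H by (simp only: is_homD[OF is_hom_chart_sub] mult.assoc)
    then have "px dvd py ^ L * G" using G' by (metis dvd_triv_left exc_coord_def)
    moreover have "\<not> px dvd (py ^ L :: 'a poly poly)"
      by (rule not_px_dvd[of _ L]) (simp add: bcoeff_py_power)
    ultimately show False using Suc.prems(3) px_dvd_mult_iff by blast
  qed
  ultimately show ?case using Suc.IH[of F' G'] Suc.prems(1) by simp
qed

text \<open>With \<open>u\<close> the equation of the first exceptional curve, the first nonzero
  parameter gives \<open>u = v^\<sigma>\<close> times a unit at the later point. So
  \<open>v^\<sigma> / u\<close> is regular there, although it has a pole along that curve.\<close>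

lemma not_proximate_first:
  fixes XY :: "'a::field ratfun \<times> 'a ratfun"
  assumes ind: "indep2 XY" and e: "e 0" "\<And>l. l \<ge> 1 \<Longrightarrow> \<not> e l" and \<sigma>: "\<sigma> \<ge> 1" "\<sigma> \<le> d"
    and c: "\<And>l. 1 \<le> l \<Longrightarrow> l < \<sigma> \<Longrightarrow> c (l + 2) = 0" "c (\<sigma> + 2) \<noteq> 0"
  shows "\<not> loc (gen_params XY e c (Suc d)) \<subseteq> exc_ring (loc XY)"
proof
  let ?P = "gen_params XY e c"
  assume sub: "loc (?P (Suc d)) \<subseteq> exc_ring (loc XY)"
  define u where "u = fst (?P 1)"
  define v where "v = snd (?P 1)"
  note indP = indep_gen_params[OF ind, of e c]
  have uv: "u \<noteq> 0" "v \<noteq> 0" using indep_coords_nonzero[OF indP[of 1]] by (auto simp: u_def v_def)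
  have chain: "snd (?P (Suc d)) = v" "fst (?P (Suc d)) * v ^ d = u - (\<Sum>l<d. cnst (c (l + 3)) * v ^ Suc l)"
    using gen_params_False_chain[OF ind, of 1 d e c] e(2) by (simp_all add: u_def v_def add.commute numeral_3_eq_3)
  \<comment> \<open>\<open>u / v^\<sigma>\<close> in the coordinates of the later point; the term
    \<open>l = \<sigma> - 1\<close> gives the constant \<open>c (\<sigma> + 2)\<close>.\<close>
  define G :: "'a poly poly" where
    "G = px * py ^ (d - \<sigma>) + (\<Sum>l=\<sigma>-1..<d. cst (c (l + 3)) * py ^ (Suc l - \<sigma>))"
  have "ev2p G (?P (Suc d)) * v ^ \<sigma> = u"
  proof -
    have "ev2p G (?P (Suc d)) * v ^ \<sigma> = fst (?P (Suc d)) * (v ^ (d - \<sigma>) * v ^ \<sigma>) +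
        (\<Sum>l=\<sigma>-1..<d. cnst (c (l + 3)) * (v ^ (Suc l - \<sigma>) * v ^ \<sigma>))"
      unfolding G_def by (simp only: ev2_hom ev2_gens chain(1) distrib_right sum_distrib_right mult.assoc)
    also have "(\<Sum>l=\<sigma>-1..<d. cnst (c (l + 3)) * (v ^ (Suc l - \<sigma>) * v ^ \<sigma>)) =
        (\<Sum>l=\<sigma>-1..<d. cnst (c (l + 3)) * v ^ Suc l)"
    proof (rule sum.cong)
      fix l assume "l \<in> {\<sigma> - 1..<d}"
      then have "Suc l - \<sigma> + \<sigma> = Suc l" by auto
      then show "cnst (c (l + 3)) * (v ^ (Suc l - \<sigma>) * v ^ \<sigma>) = cnst (c (l + 3)) * v ^ Suc l"
        by (simp only: power_add[symmetric])
    qed simp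
    also have "\<dots> = (\<Sum>l<d. cnst (c (l + 3)) * v ^ Suc l)"
    proof (rule sum.mono_neutral_left)
      show "\<forall>l\<in>{..<d} - {\<sigma> - 1..<d}. cnst (c (l + 3)) * v ^ Suc l = 0"
      proof
        fix l assume "l \<in> {..<d} - {\<sigma> - 1..<d}"
        then have "c (Suc l + 2) = 0" by (intro c(1)) auto
        then show "cnst (c (l + 3)) * v ^ Suc l = 0" by (simp add: is_homD[OF is_hom_cnst] numeral_3_eq_3)
      qed
    qed auto
    also have "v ^ (d - \<sigma>) * v ^ \<sigma> = v ^ d" using \<sigma>(2) by (simp add: power_add[symmetric])
    finally show ?thesis using chain(2) by simp
  qed
  moreover have "bcoeff G 0 0 \<noteq> 0"
  proof -
    have "bcoeff (\<Sum>l=\<sigma>-1..<d. cst (c (l + 3)) * py ^ (Suc l - \<sigma>)) 0 0 =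
        (\<Sum>l=\<sigma>-1..<d. if l = \<sigma> - 1 then c (\<sigma> + 2) else 0)"
      unfolding bcoeff_sum bcoeff_cst_mult bcoeff_py_power
      by (rule sum.cong) (use \<sigma> in \<open>auto simp: numeral_3_eq_3 numeral_2_eq_2\<close>)
    also have "\<dots> = c (\<sigma> + 2)" using \<sigma> by simp
    finally show ?thesis unfolding G_def bcoeff_simps bcoeff_0_0_mult using c(2) by (simp add: bcoeff_def)
  qed
  ultimately have "v ^ \<sigma> / u \<in> loc (?P (Suc d))"
    using locI[of G 1 "?P (Suc d)"] uv by (auto simp: ev2_hom field_simps)
  then have "v ^ \<sigma> / u \<in> exc_ring (loc XY)" using sub by blast
  moreover have P: "?P 1 = chart_next True (c 2) XY" using e(1) by (simp add: numeral_2_eq_2)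
  ultimately obtain F H where F: "v ^ \<sigma> / u = ev2p F (?P 1) / ev2p H (?P 1)" "H \<noteq> 0"
    "\<And>n. px ^ n dvd H \<Longrightarrow> px ^ n dvd F"
    unfolding exc_ring_chart_iff[OF ind, of _ True "c 2"] P exc_coord_def if_True by blast
  have "ev2p H (?P 1) \<noteq> 0" using F(2) indP[of 1] by (simp add: indep_nonzero)
  then have "ev2p (px * F) (?P 1) = ev2p (H * py ^ \<sigma>) (?P 1)"
    unfolding ev2_hom ev2_gens using F(1) uv by (simp add: u_def v_def field_simps)
  then have eq: "px * F = H * py ^ \<sigma>" using indep_eq_iff[OF indP] by blast
  have "px ^ n dvd H" for n
  proof (induction n)
    case (Suc n)
    have "px ^ Suc n dvd H * py ^ \<sigma>" unfolding eq[symmetric] power_Suc using F(3)[OF Suc] by (intro mult_dvd_mono dvd_refl)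
    moreover have "\<not> px dvd (py ^ \<sigma> :: 'a poly poly)"
      by (rule not_px_dvd[of _ \<sigma>]) (simp add: bcoeff_py_power)
    ultimately show ?case by (rule px_power_dvd_multD)
  qed simp
  then have "bcoeff H i j = 0" for i j using px_power_dvd_iff[of "Suc i" H] lessI by blast
  then have "H = 0" by (intro bipoly_eqI) simp
  with F(2) show False by simp
qed

section \<open>Proximity in clusters given by charts\<close>

lemma gen_cluster_in_clusters:
  assumes "r \<ge> 1" "loc XY \<in> plane"
  shows "gen_cluster r XY e c \<in> clusters r"
proof -
  have "loc (gen_params XY e c (Suc i)) \<in> exc_points (loc (gen_params XY e c i))" for i
  proof -
    obtain X Y where P: "gen_params XY e c i = (X, Y)" by fastforce
    show ?thesis unfolding exc_points_def gen_params.simps P chart_next_def by (cases "e i") auto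
  qed
  then show ?thesis using assms by (simp add: clusters_def gen_cluster_def)
qed

lemma proximate_gen_cluster:
  "j < r \<Longrightarrow> i < j \<Longrightarrow> proximate (gen_cluster r XY e c) j i \<longleftrightarrow>
    loc (gen_params XY e c j) \<subseteq> exc_ring (loc (gen_params XY e c i))"
  by (simp add: proximate_def gen_cluster_def)

text \<open>After the first blow-up the cluster follows an arc whose contact order with the first
  exceptional curve is \<open>max s 2 - 1\<close>. Exactly the points with index less than
  \<open>max s 2\<close> other than the origin lie on that curve.\<close>

lemma gen_cluster_in_U_clusters:
  fixes XY :: "'a::field ratfun \<times> 'a ratfun"
  assumes ind: "indep2 XY" and r: "r \<ge> 1" "s \<le> r" and p: "loc XY \<in> plane" and s: "s \<ge> 1"
    and c: "\<And>l. 1 \<le> l \<Longrightarrow> l < max s 2 - 1 \<Longrightarrow> c (l + 2) = 0" "c (max s 2 - 1 + 2) \<noteq> 0"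
  shows "gen_cluster r XY (\<lambda>i. i = 0) c \<in> U_clusters (loc XY) r s"
proof -
  let ?e = "\<lambda>i::nat. i = 0" let ?P = "gen_params XY ?e c"
  note indP = indep_gen_params[OF ind]
  have "proximate (gen_cluster r XY ?e c) j i \<longleftrightarrow> j = Suc i \<or> (i = 0 \<and> j < s)" if j: "j < r" "i < j" for i j
    unfolding proximate_gen_cluster[OF j]
  proof (cases "j = Suc i")
    case True
    have "loc (?P (Suc i)) \<subseteq> exc_ring (loc (?P i))"
      unfolding gen_params.simps by (rule loc_chart_next_exc_ring[OF indP])
    then show "loc (?P j) \<subseteq> exc_ring (loc (?P i)) \<longleftrightarrow> j = Suc i \<or> (i = 0 \<and> j < s)" using True by simp
  next
    case False
    define d where "d = j - i"
    have d: "j = i + d" "d \<ge> 2" using j(2) False by (auto simp: d_def)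
    show "loc (?P j) \<subseteq> exc_ring (loc (?P i)) \<longleftrightarrow> j = Suc i \<or> (i = 0 \<and> j < s)"
    proof (cases "i = 0")
      case False
      have "\<not> loc (?P (i + d)) \<subseteq> exc_ring (loc (?P i))"
        by (rule not_proximate_False_chain[OF ind d(2)]) (use False in simp)
      then show ?thesis using False d by simp
    next
      case i0: True
      show ?thesis
      proof (cases "j < s")
        case True
        obtain j' where j': "j = Suc j'" using j by (cases j) auto
        have "loc (?P j) \<subseteq> exc_ring (loc XY)"
        proof
          fix f assume "f \<in> loc (?P j)"
          then obtain F G where F: "f = ev2p F (?P (Suc j')) / ev2p G (?P (Suc j'))" "bcoeff G 0 0 \<noteq> 0"
            unfolding j' loc_iff by blast
          show "f \<in> exc_ring (loc XY)"
          proof (rule exc_ring_chain[OF ind _ _ _ F(1) not_px_dvd[OF F(2)]])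
            show "c (l + 2) = 0" if "1 \<le> l" "l < Suc j'" for l
              by (rule c(1)) (use that True j' in linarith)+
          qed simp_all
        qed
        then show ?thesis using i0 True by simp
      next
        case False
        have "\<not> loc (?P (Suc (j - 1))) \<subseteq> exc_ring (loc XY)"
          by (rule not_proximate_first[OF ind, where \<sigma> = "max s 2 - 1"]) (use c False d i0 in auto)
        then show ?thesis using i0 False d by simp
      qed
    qed
  qed
  moreover have "gen_cluster r XY ?e c ! 0 = loc XY" using r by (simp add: gen_cluster_def)
  ultimately show ?thesis using gen_cluster_in_clusters[OF r(1) p] r by (simp add: U_clusters_def)
qed

lemma satellite_free_gen_cluster:
  fixes XY :: "'a::field ratfun \<times> 'a ratfun"
  assumes ind: "indep2 XY"
  shows "satellite_free (gen_cluster r XY (\<lambda>_. False) c)"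
proof -
  have "j = Suc i" if "proximate (gen_cluster r XY (\<lambda>_. False) c) j i" for i j
  proof (rule ccontr)
    assume n: "j \<noteq> Suc i"
    have j: "i < j" "j < r" using that by (auto simp: proximate_def gen_cluster_def)
    then have d: "j = i + (j - i)" "j - i \<ge> 2" using n by auto
    have "\<not> loc (gen_params XY (\<lambda>_. False) c (i + (j - i))) \<subseteq> exc_ring (loc (gen_params XY (\<lambda>_. False) c i))"
      by (rule not_proximate_False_chain[OF ind d(2)]) simp
    then show False using that proximate_gen_cluster[OF j(2,1), of XY "\<lambda>_. False" c] d(1) by simp
  qed
  then show ?thesis unfolding satellite_free_def satellite_def by blast
qed

section \<open>Clusters on an arc\<close>

definition dX :: "'a::idom poly poly \<Rightarrow> 'a poly poly" where
  "dX F = map_poly pderiv F"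

lemma coeff_dX: "coeff (dX F) j = pderiv (coeff F j)"
  by (simp add: dX_def coeff_map_poly)

lemma dX_add: "dX (F + G) = dX F + dX G"
  by (rule poly_eqI) (simp add: coeff_dX pderiv_add)

lemma dX_sum: "dX (sum f S) = (\<Sum>x\<in>S. dX (f x))"
  by (induction S rule: infinite_finite_induct) (simp_all add: dX_add, simp_all add: dX_def)

lemma dX_mult: "dX (F * G) = F * dX G + dX F * G"
proof (rule poly_eqI)
  have sum: "pderiv (sum f S) = (\<Sum>x\<in>S. pderiv (f x))" for f :: "nat \<Rightarrow> 'a poly" and S
    by (induction S rule: infinite_finite_induct) (simp_all add: pderiv_add)
  show "coeff (dX (F * G)) n = coeff (F * dX G + dX F * G) n" for n
    by (simp add: coeff_dX coeff_mult sum pderiv_mult sum.distrib mult.commute[of "pderiv _"])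
qed

lemma dX_gens: "dX (cst a) = 0" "dX px = 1" "dX py = 0"
  by (simp_all add: dX_def map_poly_pCons pderiv_pCons one_pCons)

lemma dX_power: "dX (F ^ n) = of_nat n * F ^ (n - 1) * dX F"
proof (induction n)
  case 0
  show ?case using dX_gens(1)[of "1 :: 'a"] by (simp add: one_pCons)
next
  case (Suc n)
  then show ?case by (cases n) (simp_all add: dX_mult algebra_simps)
qed

lemma dX_bsub:
  assumes "dX B = 0" shows "dX (bsub F A B) = bsub (dX F) A B * dX A"
proof (induction F rule: bipoly_induct)
  case (mult F G)
  then show ?case by (simp only: is_homD[OF is_hom_bsub] dX_mult) (simp add: algebra_simps)
next
  case (add F G)
  then show ?case by (simp only: is_homD[OF is_hom_bsub] dX_add) (simp add: algebra_simps)
qed (simp_all only: dX_gens bsub_gens is_homD[OF is_hom_bsub] mult_1_left mult_zero_left assms)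

text \<open>Restriction to the parametrised curve with coordinates \<open>\<alpha>\<close> and
  \<open>\<beta>\<close>.\<close>

definition pev :: "'a::comm_ring_1 poly poly \<Rightarrow> 'a poly \<Rightarrow> 'a poly \<Rightarrow> 'a poly" where
  "pev F \<alpha> \<beta> = bev (\<lambda>a. [:a:]) F \<alpha> \<beta>"

lemma is_hom_const: "is_hom (\<lambda>a::'a::comm_ring_1. [:a:])"
  by (simp add: is_hom_def one_pCons)

lemmas pev_hom = is_homD[OF is_hom_bev[OF is_hom_const], folded pev_def]
lemmas pev_gens = bev_gens[OF is_hom_const, folded pev_def]
lemmas pev_bsub = bev_bsub[OF is_hom_const, folded pev_def]

lemma is_hom_pcompose: "is_hom (\<lambda>p::'a::comm_ring_1 poly. pcompose p q)"
  by (simp add: is_hom_def pcompose_add pcompose_mult one_pCons)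

lemma pcompose_pev: "pcompose (pev F \<alpha> \<beta>) q = pev F (pcompose \<alpha> q) (pcompose \<beta> q)"
  unfolding pev_def
  by (rule bipoly_hom_eqI[OF is_hom_comp[OF is_hom_pcompose is_hom_bev[OF is_hom_const]] is_hom_bev[OF is_hom_const]])
    (simp_all add: bev_gens[OF is_hom_const])

text \<open>If \<open>\<alpha>\<close> parametrises the transformed arc, the arc below is
  \<open>w (\<alpha> + \<gamma>)\<close>. A point of multiplicity \<open>\<mu>\<close> contributes
  \<open>\<mu>\<close> to the order of the restriction, but only \<open>\<mu> - 1\<close> to that of
  the derivative, as the chain rule produces one factor \<open>y\<close>.\<close>

lemma virt_False_arc:
  fixes F :: "'a::idom poly poly" and \<gamma> :: 'a
  assumes "ordge \<mu> F"
  defines "F' \<equiv> virt False \<gamma> \<mu> F" and "w \<equiv> [:0, 1:]"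
  shows "pev F (w * (\<alpha> + [:\<gamma>:])) w = w ^ \<mu> * pev F' \<alpha> w"
    and "\<mu> \<ge> 1 \<Longrightarrow> pev (dX F) (w * (\<alpha> + [:\<gamma>:])) w = w ^ (\<mu> - 1) * pev (dX F') \<alpha> w"
proof -
  have sub: "bsub F (py * (px + cst \<gamma>)) py = py ^ \<mu> * F'"
    using chart_sub_eq_virt[OF assms(1), of False \<gamma>] unfolding F'_def chart_sub_def exc_coord_def if_False .
  have arc: "pev (bsub G (py * (px + cst \<gamma>)) py) \<alpha> w = pev G (w * (\<alpha> + [:\<gamma>:])) w" for G
    unfolding pev_bsub by (simp only: pev_hom pev_gens)
  show "pev F (w * (\<alpha> + [:\<gamma>:])) w = w ^ \<mu> * pev F' \<alpha> w"
    unfolding arc[symmetric] sub by (simp only: pev_hom pev_gens)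
  assume \<mu>: "\<mu> \<ge> 1"
  have "dX (bsub F (py * (px + cst \<gamma>)) py) = bsub (dX F) (py * (px + cst \<gamma>)) py * dX (py * (px + cst \<gamma>))"
    by (rule dX_bsub[OF dX_gens(3)])
  moreover have "dX (py * (px + cst \<gamma>)) = (py :: 'a poly poly)"
    by (simp only: dX_mult dX_add dX_gens) simp
  moreover have "dX (py ^ \<mu> * F') = py * (py ^ (\<mu> - 1) * dX F')"
  proof -
    obtain k where "\<mu> = Suc k" using \<mu> by (cases \<mu>) auto
    then show ?thesis by (simp only: dX_mult dX_power dX_gens diff_Suc_1 power_Suc mult_zero_left mult_zero_right add_0_right mult.assoc)
  qed
  ultimately have "py * bsub (dX F) (py * (px + cst \<gamma>)) py = py * (py ^ (\<mu> - 1) * dX F')"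
    by (simp only: sub mult.commute)
  then have "bsub (dX F) (py * (px + cst \<gamma>)) py = py ^ (\<mu> - 1) * dX F'"
    using mult_left_cancel[of "py :: 'a poly poly"] by simp
  then show "pev (dX F) (w * (\<alpha> + [:\<gamma>:])) w = w ^ (\<mu> - 1) * pev (dX F') \<alpha> w"
    unfolding arc[symmetric] by (simp only: pev_hom pev_gens)
qed

lemma passes_arc:
  fixes F :: "'a::idom poly poly"
  assumes "passes r (\<lambda>_. False) c \<mu> F"
    and \<alpha>: "\<And>i. \<alpha> i = [:0, 1:] * (\<alpha> (Suc i) + [:c (i + 2):])"
  shows "i \<le> r \<Longrightarrow> pev F (\<alpha> 0) [:0, 1:] =
      [:0, 1:] ^ (\<Sum>l<i. \<mu> l) * pev (vstage (\<lambda>_. False) c \<mu> F i) (\<alpha> i) [:0, 1:]"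
    and "i \<le> r \<Longrightarrow> \<forall>l<i. \<mu> l \<ge> 1 \<Longrightarrow> pev (dX F) (\<alpha> 0) [:0, 1:] =
      [:0, 1:] ^ (\<Sum>l<i. \<mu> l - 1) * pev (dX (vstage (\<lambda>_. False) c \<mu> F i)) (\<alpha> i) [:0, 1:]"
proof -
  define w :: "'a poly" where "w = [:0, 1:]"
  let ?F = "vstage (\<lambda>_. False) c \<mu> F"
  have o: "i < r \<Longrightarrow> ordge (\<mu> i) (?F i)" for i using assms(1) by (simp add: passes_def)
  have \<alpha>': "\<alpha> i = w * (\<alpha> (Suc i) + [:c (i + 2):])" for i unfolding w_def by (rule \<alpha>)
  have "i \<le> r \<Longrightarrow> pev F (\<alpha> 0) w = w ^ (\<Sum>l<i. \<mu> l) * pev (?F i) (\<alpha> i) w"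
  proof (induction i)
    case (Suc i)
    have "pev (?F i) (\<alpha> i) w = w ^ \<mu> i * pev (?F (Suc i)) (\<alpha> (Suc i)) w"
      unfolding \<alpha>'[of i] vstage.simps w_def by (rule virt_False_arc(1)[OF o]) (use Suc in simp)
    with Suc show ?case by (simp add: power_add mult.assoc)
  qed simp
  then show "i \<le> r \<Longrightarrow> pev F (\<alpha> 0) [:0, 1:] = [:0, 1:] ^ (\<Sum>l<i. \<mu> l) * pev (?F i) (\<alpha> i) [:0, 1:]"
    by (simp only: w_def)
  have "i \<le> r \<Longrightarrow> \<forall>l<i. \<mu> l \<ge> 1 \<Longrightarrow>
      pev (dX F) (\<alpha> 0) w = w ^ (\<Sum>l<i. \<mu> l - 1) * pev (dX (?F i)) (\<alpha> i) w"
  proof (induction i)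
    case (Suc i)
    have "pev (dX (?F i)) (\<alpha> i) w = w ^ (\<mu> i - 1) * pev (dX (?F (Suc i))) (\<alpha> (Suc i)) w"
      unfolding \<alpha>'[of i] vstage.simps w_def by (rule virt_False_arc(2)[OF o]) (use Suc in simp_all)
    moreover have "pev (dX F) (\<alpha> 0) w = w ^ (\<Sum>l<i. \<mu> l - 1) * pev (dX (?F i)) (\<alpha> i) w" using Suc by simp
    ultimately show ?case by (simp only: sum.lessThan_Suc power_add mult.assoc)
  qed simp
  then show "i \<le> r \<Longrightarrow> \<forall>l<i. \<mu> l \<ge> 1 \<Longrightarrow> pev (dX F) (\<alpha> 0) [:0, 1:] =
      [:0, 1:] ^ (\<Sum>l<i. \<mu> l - 1) * pev (dX (?F i)) (\<alpha> i) [:0, 1:]"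
    by (simp only: w_def)
qed

lemma sum_two_one:
  fixes \<mu> :: "nat \<Rightarrow> nat"
  assumes "\<And>l. l < i \<Longrightarrow> \<mu> l = 2" "\<And>l. i \<le> l \<Longrightarrow> l < i + j \<Longrightarrow> \<mu> l = 1"
  shows "(\<Sum>l<i + j. \<mu> l) = 2 * i + j" "(\<Sum>l<i + j. \<mu> l - 1) = i"
proof -
  have *: "(\<Sum>l<i + j. f (\<mu> l)) = f 2 * i + f 1 * j" for f :: "nat \<Rightarrow> nat"
  proof -
    have "{..<i + j} = {..<i} \<union> {i..<i + j}" by auto
    moreover have "{..<i} \<inter> {i..<i + j} = {}" by auto
    ultimately have "(\<Sum>l<i + j. f (\<mu> l)) = (\<Sum>l<i. f (\<mu> l)) + (\<Sum>l=i..<i + j. f (\<mu> l))"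
      by (simp only: sum.union_disjoint finite_lessThan finite_atLeastLessThan)
    moreover have "(\<Sum>l<i. f (\<mu> l)) = (\<Sum>l<i. f 2)" using assms(1) by (intro sum.cong) auto
    moreover have "(\<Sum>l=i..<i + j. f (\<mu> l)) = (\<Sum>l=i..<i + j. f 1)" using assms(2) by (intro sum.cong) auto
    ultimately show ?thesis by (simp add: mult.commute)
  qed
  show "(\<Sum>l<i + j. \<mu> l) = 2 * i + j" "(\<Sum>l<i + j. \<mu> l - 1) = i"
    using *[of "\<lambda>x. x"] *[of "\<lambda>x. x - 1"] by simp_all
qed

lemma pcompose_shift_dvd:
  fixes G :: "'a::idom poly"
  assumes "[:0, 1:] ^ n dvd pcompose G [:v, 1:]" shows "[:- v, 1:] ^ n dvd G"
proof -
  obtain H where H: "pcompose G [:v, 1:] = [:0, 1:] ^ n * H" using assms by (elim dvdE)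
  have "G = pcompose (pcompose G [:v, 1:]) [:- v, 1:]"
    by (simp add: pcompose_assoc[symmetric] pcompose_pCons pcompose_idR)
  also have "\<dots> = [:- v, 1:] ^ n * pcompose H [:- v, 1:]"
    unfolding H by (simp add: is_homD[OF is_hom_pcompose] pcompose_pCons)
  finally show ?thesis by (metis dvd_triv_left)
qed

text \<open>A double point on the arc counts twice for the function and once for its derivative, a
  simple point once and not at all.\<close>

lemma passes_arc_dvd:
  fixes G :: "'a::idom poly poly" and \<phi> :: "'a poly"
  assumes pass: "passes r (\<lambda>_. False) c \<mu> (bsub G (px + cst (poly \<phi> v)) (py + cst v))"
    and c: "\<And>l. c (l + 2) = coeff (pcompose \<phi> [:v, 1:]) (Suc l)"
    and \<mu>: "\<And>l. l < i \<Longrightarrow> \<mu> l = 2" "\<And>l. i \<le> l \<Longrightarrow> l < i + j \<Longrightarrow> \<mu> l = 1" and r: "i + j \<le> r"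
  shows "[:- v, 1:] ^ (2 * i + j) dvd pev G \<phi> [:0, 1:]" "[:- v, 1:] ^ i dvd pev (dX G) \<phi> [:0, 1:]"
proof -
  define \<psi> where "\<psi> = pcompose \<phi> [:v, 1:]"
  \<comment> \<open>The arc in the coordinates of the \<open>l\<close>-th point: the tail of the
    Taylor expansion of \<open>\<phi>\<close> at \<open>v\<close>, shifted so as to pass through the
    origin.\<close>
  define \<alpha> where "\<alpha> l = pCons 0 (poly_shift (Suc l) \<psi>)" for l
  have shift: "poly_shift n \<psi> = pCons (coeff \<psi> n) (poly_shift (Suc n) \<psi>)" for n
    by (rule poly_eqI) (simp add: coeff_poly_shift coeff_pCons split: nat.split)
  have \<alpha>: "\<alpha> l = [:0, 1:] * (\<alpha> (Suc l) + [:c (l + 2):])" for l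
    unfolding \<alpha>_def c \<psi>_def[symmetric] shift[of "Suc l"] by simp
  have \<alpha>0: "\<alpha> 0 + [:poly \<phi> v:] = \<psi>"
  proof -
    have "poly_shift 0 \<psi> = \<psi>" by (rule poly_eqI) (simp add: coeff_poly_shift)
    moreover have "coeff \<psi> 0 = poly \<phi> v" by (simp add: \<psi>_def poly_0_coeff_0[symmetric] poly_pcompose)
    ultimately show ?thesis using shift[of 0] by (simp add: \<alpha>_def)
  qed
  let ?H = "bsub G (px + cst (poly \<phi> v)) (py + cst v)"
  have ev: "pev (bsub F (px + cst (poly \<phi> v)) (py + cst v)) (\<alpha> 0) [:0, 1:] = pcompose (pev F \<phi> [:0, 1:]) [:v, 1:]" for F
    unfolding pev_bsub pcompose_pev
    by (simp only: pev_hom pev_gens \<alpha>0) (simp add: \<psi>_def pcompose_pCons)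
  have dH: "dX ?H = bsub (dX G) (px + cst (poly \<phi> v)) (py + cst v)"
  proof -
    have "dX (py + cst v) = 0" "dX (px + cst (poly \<phi> v)) = 1" by (simp_all only: dX_add dX_gens add_0_right)
    then show ?thesis using dX_bsub[of "py + cst v"] by (simp only: mult_1_right)
  qed
  have m1: "\<forall>l<i + j. \<mu> l \<ge> 1"
  proof (intro allI impI)
    fix l assume "l < i + j" then show "\<mu> l \<ge> 1" using \<mu>[of l] by (cases "l < i") auto
  qed
  have s: "(\<Sum>l<i + j. \<mu> l) = 2 * i + j" "(\<Sum>l<i + j. \<mu> l - 1) = i"
    using sum_two_one[of i \<mu> j] \<mu> by blast+
  have "[:0, 1:] ^ (2 * i + j) dvd pcompose (pev G \<phi> [:0, 1:]) [:v, 1:]"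
    unfolding ev[symmetric] passes_arc(1)[OF pass \<alpha> r] s(1) by (rule dvd_triv_left)
  then show "[:- v, 1:] ^ (2 * i + j) dvd pev G \<phi> [:0, 1:]" by (rule pcompose_shift_dvd)
  have "[:0, 1:] ^ i dvd pcompose (pev (dX G) \<phi> [:0, 1:]) [:v, 1:]"
    unfolding ev[symmetric] dH[symmetric] passes_arc(2)[OF pass \<alpha> r m1] s(2) by (rule dvd_triv_left)
  then show "[:- v, 1:] ^ i dvd pev (dX G) \<phi> [:0, 1:]" by (rule pcompose_shift_dvd)
qed

lemma linear_power_dvd_cancel:
  fixes p q :: "'a::field poly"
  assumes "[:- v, 1:] ^ n dvd p * q" "poly p v \<noteq> 0" shows "[:- v, 1:] ^ n dvd q"
proof (cases "q = 0")
  case False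
  have p: "p \<noteq> 0" using assms(2) by auto
  have "order v (p * q) = order v q" using False p assms(2) by (simp add: order_mult order_0I)
  then show ?thesis using assms(1) False p by (simp add: order_divides)
qed simp

lemma prod_linear_powers_dvd:
  fixes q :: "'a::field poly"
  assumes "finite S" "inj_on v S" "\<And>k. k \<in> S \<Longrightarrow> [:- v k, 1:] ^ n k dvd q"
  shows "(\<Prod>k\<in>S. [:- v k, 1:] ^ n k) dvd q"
  using assms
proof (induction S arbitrary: q rule: finite_induct)
  case (insert k S)
  obtain q' where q: "q = [:- v k, 1:] ^ n k * q'" using insert.prems(2)[of k] by (auto elim: dvdE)
  have "(\<Prod>k\<in>S. [:- v k, 1:] ^ n k) dvd q'"
  proof (rule insert.IH)
    show "inj_on v S" using insert.prems(1) by simp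
    fix l assume l: "l \<in> S"
    then have "v l \<noteq> v k" using insert.prems(1) insert.hyps(2) by (auto simp: inj_on_def)
    then have "poly ([:- v k, 1:] ^ n k) (v l) \<noteq> 0" by simp
    moreover have "[:- v l, 1:] ^ n l dvd [:- v k, 1:] ^ n k * q'" unfolding q[symmetric]
      using insert.prems(2) l by simp
    ultimately show "[:- v l, 1:] ^ n l dvd q'" by (rule linear_power_dvd_cancel[rotated])
  qed
  then show ?case unfolding q prod.insert[OF insert.hyps] by (rule mult_dvd_mono[OF dvd_refl])
qed simp

abbreviation total_degree_le :: "nat \<Rightarrow> 'a::zero poly poly \<Rightarrow> bool" where
  "total_degree_le n F \<equiv> \<forall>i j. bcoeff F i j \<noteq> 0 \<longrightarrow> i + j \<le> n"

lemma total_degree_le_mult: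
  fixes F G :: "'a::comm_ring_1 poly poly"
  assumes "total_degree_le n F" "total_degree_le n' G" shows "total_degree_le (n + n') (F * G)"
proof (intro allI impI)
  fix a b assume "bcoeff (F * G) a b \<noteq> 0"
  then obtain j where "j \<le> b" "(\<Sum>i\<le>a. bcoeff F i j * bcoeff G (a - i) (b - j)) \<noteq> 0"
    unfolding bcoeff_mult by (meson atMost_iff sum.not_neutral_contains_not_neutral)
  then obtain i where i: "i \<le> a" "bcoeff F i j * bcoeff G (a - i) (b - j) \<noteq> 0"
    by (meson atMost_iff sum.not_neutral_contains_not_neutral)
  have "bcoeff F i j \<noteq> 0" "bcoeff G (a - i) (b - j) \<noteq> 0" using i(2) by auto
  then have "i + j \<le> n" "a - i + (b - j) \<le> n'" using assms by blast+
  then show "a + b \<le> n + n'" using i(1) \<open>j \<le> b\<close> by linarith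
qed

lemma total_degree_le_power:
  fixes F :: "'a::comm_ring_1 poly poly"
  assumes "total_degree_le 1 F" shows "total_degree_le n (F ^ n)"
proof (induction n)
  case 0
  show ?case using bcoeff_cst[of "1 :: 'a"] by (simp add: one_pCons split: if_splits)
next
  case (Suc n)
  show ?case using total_degree_le_mult[OF assms Suc] by (simp only: power_Suc plus_1_eq_Suc)
qed

lemma total_degree_le_sum: "(\<And>x. x \<in> S \<Longrightarrow> total_degree_le n (f x)) \<Longrightarrow> total_degree_le n (sum f S)"
  for f :: "'b \<Rightarrow> 'a::comm_ring_1 poly poly"
  unfolding bcoeff_sum by (meson sum.not_neutral_contains_not_neutral)

lemma total_degree_le_bsub_form:
  fixes A B :: "'a::comm_ring_1 poly poly"
  assumes "total_degree_le 1 A" "total_degree_le 1 B"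
  shows "total_degree_le n (bsub (form t n a) A B)"
proof -
  have "total_degree_le n (bsub (cst (a s) * fmon t n s) A B)" if s: "s \<in> tri n" for s
  proof -
    have *: "total_degree_le n (cst (a s) * (A ^ x * B ^ y))" if "x + y \<le> n" for x y
    proof -
      have deg: "total_degree_le (x + y) (A ^ x * B ^ y)"
        by (rule total_degree_le_mult[OF total_degree_le_power[OF assms(1)] total_degree_le_power[OF assms(2)]])
      show ?thesis
      proof (intro allI impI)
        fix b d assume "bcoeff (cst (a s) * (A ^ x * B ^ y)) b d \<noteq> 0"
        then have "bcoeff (A ^ x * B ^ y) b d \<noteq> 0" unfolding bcoeff_cst_mult by (metis mult_zero_right)
        from deg[rule_format, OF this] \<open>x + y \<le> n\<close> show "b + d \<le> n" by (rule order_trans)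
      qed
    qed
    have "fst s + snd s \<le> n" using s by (auto simp: tri_def)
    define x where "x = (if t = 0 then fst s else n - fst s - snd s)"
    define y where "y = (if t = 0 \<or> t = 1 then snd s else fst s)"
    have xy: "x + y \<le> n" "fmon t n s = (px ^ x * py ^ y :: 'a poly poly)"
      using \<open>fst s + snd s \<le> n\<close> unfolding x_def y_def fmon_def by (simp, simp only: split: if_split) simp
    show ?thesis unfolding xy(2) is_homD[OF is_hom_bsub] bsub_gens by (rule *[OF xy(1)])
  qed
  then show ?thesis unfolding form_def is_homD(6)[OF is_hom_bsub] by (rule total_degree_le_sum)
qed

lemma total_degree_le_coord_shift:
  "total_degree_le 1 (px + cst a :: 'a::comm_ring_1 poly poly)" "total_degree_le 1 (py + cst a :: 'a poly poly)"
  by (auto simp: bcoeff_def coeff_pCons split: nat.splits if_splits)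

lemma pev_map_const: "pev (map_poly (\<lambda>a. [:a:]) q) \<phi> [:0, 1:] = q" for q :: "'a::comm_ring_1 poly"
proof (induction q)
  case 0
  show ?case using pev_hom(1)[of \<phi> "[:0, 1:]"] by simp
next
  case (pCons a q)
  have "map_poly (\<lambda>a. [:a:]) (pCons a q) = cst a + py * map_poly (\<lambda>a. [:a:]) q"
    by (simp add: map_poly_pCons)
  then have "pev (map_poly (\<lambda>a. [:a:]) (pCons a q)) \<phi> [:0, 1:] = [:a:] + [:0, 1:] * q"
    by (simp only: pev_hom pev_gens pCons.IH)
  then show ?case by simp
qed

text \<open>A monomial \<open>x^a y^b\<close> of \<open>L\<close> contributes
  \<open>u^(a+b-m) v^b\<close>. From \<open>b \<le> a + b\<close> one gets
  \<open>deg g_e \<le> m + e\<close>, and from the degree of \<open>L\<close> that there are no rows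
  beyond \<open>D\<close>.\<close>

lemma virt_rows:
  fixes L :: "'a::field poly poly" and \<phi> :: "'a poly"
  assumes deg: "total_degree_le (m + D) L"
  defines "F \<equiv> virt True 0 m L"
  defines "g \<equiv> \<lambda>e. map_poly (\<lambda>p. coeff p e) F"
  shows "degree (g e) \<le> m + e"
    and "pev F \<phi> [:0, 1:] = arc_val D \<phi> g" and "pev (dX F) \<phi> [:0, 1:] = arc_deriv D \<phi> g"
    and "\<forall>e\<le>D. g e = 0 \<Longrightarrow> F = 0"
proof -
  let ?emb = "map_poly (\<lambda>a::'a. [:a:])"
  have F: "bcoeff F e b = (if b \<le> e + m then bcoeff L (e + m - b) b else 0)" for e b
  proof -
    have "chart_sub True 0 L = bsub L px (px * py)" by (simp add: chart_sub_def)
    then show ?thesis by (simp only: F_def bcoeff_virt if_True bcoeff_blow)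
  qed
  have g: "coeff (g e) b = bcoeff F e b" for e b by (simp add: g_def coeff_map_poly bcoeff_def)
  have g0: "coeff (g e) b = 0" if "e > D" for e b
  proof (rule ccontr)
    assume n: "coeff (g e) b \<noteq> 0"
    then have "b \<le> e + m" "bcoeff L (e + m - b) b \<noteq> 0" unfolding g F by (auto split: if_splits)
    then show False using deg[rule_format, of "e + m - b" b] that by simp
  qed
  show "degree (g e) \<le> m + e" by (rule degree_le) (simp add: g F)
  have emb: "bcoeff (?emb q) a b = (if a = 0 then coeff q b else 0)" for q a b
    by (simp add: bcoeff_def coeff_map_poly coeff_pCons split: nat.split)
  have sum: "F = (\<Sum>e\<le>D. px ^ e * ?emb (g e))"
  proof (rule bipoly_eqI)
    fix a b
    have "bcoeff (\<Sum>e\<le>D. px ^ e * ?emb (g e)) a b = (\<Sum>e\<le>D. if e = a then coeff (g a) b else 0)"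
      unfolding bcoeff_sum bcoeff_px_power_mult emb by (rule sum.cong) auto
    also have "\<dots> = bcoeff F a b" using g0[of a b] g[of a b] by simp
    finally show "bcoeff F a b = bcoeff (\<Sum>e\<le>D. px ^ e * ?emb (g e)) a b" by simp
  qed
  show "pev F \<phi> [:0, 1:] = arc_val D \<phi> g"
    unfolding arg_cong[OF sum, of "\<lambda>F. pev F \<phi> [:0, 1:]"] arc_val_def
    by (simp only: pev_hom pev_gens pev_map_const)
  have "dX (?emb q) = 0" for q by (rule poly_eqI) (simp add: coeff_dX coeff_map_poly pderiv_pCons)
  then have "dX F = (\<Sum>e\<le>D. of_nat e * px ^ (e - 1) * ?emb (g e))"
    unfolding arg_cong[OF sum, of dX] dX_sum dX_mult dX_power dX_gens
    by (simp only: mult_zero_right add_0_left mult_1_right)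
  moreover have "pev (of_nat e) \<phi> [:0, 1:] = of_nat e" for e
    by (induction e) (simp_all add: pev_hom)
  ultimately show "pev (dX F) \<phi> [:0, 1:] = arc_deriv D \<phi> g"
    unfolding arc_deriv_def by (simp only: pev_hom pev_gens pev_map_const)
  show "F = 0" if "\<forall>e\<le>D. g e = 0" using sum that by simp
qed

lemma vstage_Suc_shift:
  "vstage e c \<mu> F (Suc i) = vstage (\<lambda>l. e (Suc l)) (\<lambda>l. c (Suc l)) (\<lambda>l. \<mu> (Suc l)) (virt (e 0) (c 2) (\<mu> 0) F) i"
  by (induction i) (simp_all add: numeral_2_eq_2)

lemma passes_Suc:
  assumes "passes (Suc r) e c \<mu> F"
  shows "ordge (\<mu> 0) F"
    and "passes r (\<lambda>l. e (Suc l)) (\<lambda>l. c (Suc l)) (\<lambda>l. \<mu> (Suc l)) (virt (e 0) (c 2) (\<mu> 0) F)"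
  using assms unfolding passes_def by (force, metis Suc_less_eq vstage_Suc_shift)

text \<open>
  In the coordinates \<open>u = x, v = y/x\<close> all the clusters lie on the arc \<open>u = \<phi>(v)\<close>. If \<open>f\<close> passes through
  the \<open>k\<close>-th cluster, then the restrictions of \<open>f\<close> and of \<open>\<partial>f/\<partial>u\<close> to the arc vanish at \<open>v\<^sub>k\<close> to the orders
  \<open>2 i\<^sub>k + j\<^sub>k\<close> and \<open>i\<^sub>k\<close>.
\<close>

lemma arc_determines:
  fixes L :: "'a::field poly poly" and \<phi> :: "'a poly" and v :: "nat \<Rightarrow> 'a"
    and i j r :: "nat \<Rightarrow> nat" and \<mu> :: "nat \<Rightarrow> nat \<Rightarrow> nat" and c :: "nat \<Rightarrow> nat \<Rightarrow> 'a"
  assumes deg: "total_degree_le (m + D) L" and rho: "\<rho> \<ge> 1"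
    and det: "determined m D \<phi> (\<Prod>k=1..\<rho>. [:- v k, 1:] ^ (2 * i k + j k)) (\<Prod>k=1..\<rho>. [:- v k, 1:] ^ i k) N"
    and v: "v 1 = 0" "inj_on v {1..\<rho>}" "\<And>k. k \<in> {2..\<rho>} \<Longrightarrow> poly \<phi> (v k) \<noteq> 0" and \<phi>: "coeff \<phi> 0 = 0"
    and r: "Suc (i 1 + j 1) \<le> r 1" "\<And>k. k \<in> {2..\<rho>} \<Longrightarrow> i k + j k \<le> r k"
    and c: "c 1 2 = 0" "\<And>l. c 1 (l + 3) = coeff \<phi> (Suc l)"
      "\<And>k l. k \<in> {2..\<rho>} \<Longrightarrow> c k (l + 2) = coeff (pcompose \<phi> [:v k, 1:]) (Suc l)"
    and \<mu>1: "\<mu> 1 0 = m" "\<And>l. l < i 1 \<Longrightarrow> \<mu> 1 (Suc l) = 2" "\<And>l. i 1 \<le> l \<Longrightarrow> l < i 1 + j 1 \<Longrightarrow> \<mu> 1 (Suc l) = 1"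
    and \<mu>: "\<And>k l. k \<in> {2..\<rho>} \<Longrightarrow> l < i k \<Longrightarrow> \<mu> k l = 2"
      "\<And>k l. k \<in> {2..\<rho>} \<Longrightarrow> i k \<le> l \<Longrightarrow> l < i k + j k \<Longrightarrow> \<mu> k l = 1"
    and pass1: "passes (r 1) (\<lambda>i. i = 0) (c 1) (\<mu> 1) L"
    and pass: "\<And>k. k \<in> {2..\<rho>} \<Longrightarrow> passes (r k) (\<lambda>_. False) (c k) (\<mu> k)
       (bsub L (px + cst (poly \<phi> (v k))) ((px + cst (poly \<phi> (v k))) * (py + cst (v k))))"
    and N: "\<And>n. n \<in> N \<Longrightarrow> coeff (pev (virt True 0 m L) \<phi> [:0, 1:]) n = 0"
  shows "L = 0"
proof -
  define F where "F = virt True 0 m L"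
  define g where "g = (\<lambda>e. map_poly (\<lambda>p. coeff p e) F)"
  note rows = virt_rows[OF deg, folded F_def, folded g_def]
  obtain r' where r': "r 1 = Suc r'" using r(1) by (cases "r 1") auto
  have pass': "ordge m L" "passes r' (\<lambda>_. False) (\<lambda>l. c 1 (Suc l)) (\<lambda>l. \<mu> 1 (Suc l)) F"
    using passes_Suc[OF pass1[unfolded r']] unfolding F_def \<mu>1(1) c(1) by simp_all
  have LF: "bsub L px (px * py) = px ^ m * F"
    using chart_sub_eq_virt[OF pass'(1), of True 0] by (simp add: chart_sub_def exc_coord_def F_def)
  have L0: "L = 0" if F0: "F = 0"
  proof (rule bipoly_eqI)
    fix a b
    have "bcoeff (bsub L px (px * py)) (a + b) b = 0" unfolding LF F0 by simp
    then show "bcoeff L a b = bcoeff 0 a b" unfolding bcoeff_blow by simp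
  qed
  have dvd: "[:- v k, 1:] ^ (2 * i k + j k) dvd pev F \<phi> [:0, 1:] \<and> [:- v k, 1:] ^ i k dvd pev (dX F) \<phi> [:0, 1:]"
    if k: "k \<in> {1..\<rho>}" for k
  proof (cases "k = 1")
    case True
    have F': "bsub F (px + cst (poly \<phi> (v k))) (py + cst (v k)) = F"
      using \<phi> v(1) True by (simp add: poly_0_coeff_0 bsub_id)
    have "c 1 (Suc (l + 2)) = coeff (pcompose \<phi> [:v k, 1:]) (Suc l)" for l
      using c(2)[of l] v(1) True by (simp add: numeral_3_eq_3 numeral_2_eq_2)
    from passes_arc_dvd[of r' "\<lambda>l. c 1 (Suc l)" "\<lambda>l. \<mu> 1 (Suc l)" F \<phi> "v k", unfolded F', OF pass'(2) this, of "i 1" "j 1"]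
    show ?thesis using \<mu>1 r(1) r' True by simp
  next
    case False
    with k have k: "k \<in> {2..\<rho>}" by auto
    let ?A = "px + cst (poly \<phi> (v k))" and ?B = "py + cst (v k)"
    \<comment> \<open>At these clusters \<open>f\<close> is expressed by
      \<open>L(u, uv) = u^m F\<close>. The factor \<open>u^m\<close> restricts to
      \<open>\<phi>^m\<close>, which does not vanish at \<open>v k\<close> and can be
      cancelled.\<close>
    have G: "bsub L ?A (?A * ?B) = bsub (px ^ m * F) ?A ?B"
      unfolding LF[symmetric] by (simp only: bsub_bsub is_homD[OF is_hom_bsub] bsub_gens)
    note d = passes_arc_dvd[OF pass[OF k, unfolded G] c(3)[OF k] \<mu>(1)[OF k] \<mu>(2)[OF k] r(2)[OF k]]
    have nz: "poly (\<phi> ^ m) (v k) \<noteq> 0" using v(3)[OF k] by simp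
    have 1: "[:- v k, 1:] ^ (2 * i k + j k) dvd pev F \<phi> [:0, 1:]"
      using d(1) nz unfolding pev_hom pev_gens by (rule linear_power_dvd_cancel)
    have "pev (dX (px ^ m * F)) \<phi> [:0, 1:] =
        \<phi> ^ m * pev (dX F) \<phi> [:0, 1:] + pev (dX (px ^ m)) \<phi> [:0, 1:] * pev F \<phi> [:0, 1:]"
      by (simp only: dX_mult pev_hom pev_gens)
    \<comment> \<open>The second term of the product rule already vanishes to the order
      \<open>2 * i k + j k\<close>.\<close>
    moreover have "[:- v k, 1:] ^ i k dvd pev (dX (px ^ m)) \<phi> [:0, 1:] * pev F \<phi> [:0, 1:]"
    proof (rule dvd_mult)
      have "[:- v k, 1:] ^ i k dvd [:- v k, 1:] ^ (2 * i k + j k)" by (rule le_imp_power_dvd) simp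
      then show "[:- v k, 1:] ^ i k dvd pev F \<phi> [:0, 1:]" using 1 by (rule dvd_trans)
    qed
    ultimately have "[:- v k, 1:] ^ i k dvd \<phi> ^ m * pev (dX F) \<phi> [:0, 1:]"
      using d(2) by (simp only: dvd_add_left_iff)
    with 1 linear_power_dvd_cancel[OF _ nz] show ?thesis by blast
  qed
  have "\<forall>e\<le>D. g e = 0"
  proof (rule det[unfolded determined_def, THEN spec, THEN mp])
    show "(\<forall>e\<le>D. degree (g e) \<le> m + e) \<and> (\<Prod>k=1..\<rho>. [:- v k, 1:] ^ (2 * i k + j k)) dvd arc_val D \<phi> g \<and>
       (\<Prod>k=1..\<rho>. [:- v k, 1:] ^ i k) dvd arc_deriv D \<phi> g \<and> (\<forall>n\<in>N. coeff (arc_val D \<phi> g) n = 0)"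
      unfolding rows(2,3)[symmetric]
    proof (intro conjI allI impI ballI)
      show "degree (g e) \<le> m + e" for e unfolding g_def by (rule rows(1))
      show "(\<Prod>k=1..\<rho>. [:- v k, 1:] ^ (2 * i k + j k)) dvd pev F \<phi> [:0, 1:]"
        by (rule prod_linear_powers_dvd) (use v(2) dvd in auto)
      show "(\<Prod>k=1..\<rho>. [:- v k, 1:] ^ i k) dvd pev (dX F) \<phi> [:0, 1:]"
        by (rule prod_linear_powers_dvd) (use v(2) dvd in auto)
      show "coeff (pev F \<phi> [:0, 1:]) n = 0" if "n \<in> N" for n using N[OF that] by (simp add: F_def)
    qed
  qed
  then show ?thesis unfolding g_def by (intro L0 rows(4))
qed

section \<open>The tuple of clusters on the arc\<close>

lemma loc_translate_inj:
  fixes X Y :: "'a::field ratfun"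
  assumes ind: "indep X Y" and eq: "loc (X - cnst \<alpha>, Y - cnst \<beta>) = loc (X - cnst \<alpha>', Y - cnst \<beta>')"
  shows "\<alpha> = \<alpha>' \<and> \<beta> = \<beta>'"
proof -
  let ?XY = "(X - cnst \<alpha>, Y - cnst \<beta>)"
  have i: "indep2 ?XY" "indep2 (X - cnst \<alpha>', Y - cnst \<beta>')" using indep_translate[OF ind] by simp_all
  have eqI: "a = a'" if "f - cnst a \<in> maxid (loc ?XY)" "f - cnst a' \<in> maxid (loc ?XY)" for f a a'
  proof (rule ccontr)
    assume "a \<noteq> a'"
    have "(f - cnst a) + (f - cnst a') * cnst (- 1) \<in> maxid (loc ?XY)"
      by (intro maxid_add[OF i(1)] maxid_mult[OF i(1)] that loc_cnst)
    moreover have "(f - cnst a) + (f - cnst a') * cnst (- 1) = cnst (a' - a)"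
      by (simp add: is_homD[OF is_hom_cnst])
    ultimately show False using cnst_not_maxid[of "a' - a" ?XY] \<open>a \<noteq> a'\<close> by simp
  qed
  show ?thesis using maxid_coords[OF i(1)] maxid_coords[OF i(2), folded eq] eqI[of X \<alpha> \<alpha>'] eqI[of Y \<beta> \<beta>'] by simp
qed

text \<open>Off the exceptional curve the blow-up is a local isomorphism. So a point given in the
  coordinates \<open>u, v\<close> with \<open>U \<noteq> 0\<close> is a point of the plane.\<close>

lemma loc_blow_translate:
  fixes x y :: "'a::field ratfun"
  assumes ind: "indep x y" and U: "U \<noteq> 0"
  shows "loc (x - cnst U, y / x - cnst V) = loc (x - cnst U, y - cnst (U * V))"
proof
  have x: "x \<noteq> 0" using indep_coords_nonzero[OF ind] by simp
  have "indep x (y / x)" using indep_chart_next[OF ind, of True 0] by (simp add: chart_next_def is_homD[OF is_hom_cnst])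
  then have i: "indep2 (x - cnst U, y / x - cnst V)" using indep_translate by simp
  have j: "indep2 (x - cnst U, y - cnst (U * V))" using indep_translate[OF ind] by simp
  have "ev2p (px * py + cst U * py + cst V * px) (x - cnst U, y / x - cnst V) \<in> maxid (loc (x - cnst U, y / x - cnst V))"
    by (rule maxid_ev2[OF i]) (simp add: bcoeff_def)
  moreover have "ev2p (px * py + cst U * py + cst V * px) (x - cnst U, y / x - cnst V) = y - cnst (U * V)"
    using x by (simp only: ev2_hom ev2_gens fst_conv snd_conv) (simp add: is_homD[OF is_hom_cnst] algebra_simps)
  ultimately show "loc (x - cnst U, y - cnst (U * V)) \<subseteq> loc (x - cnst U, y / x - cnst V)"
    using loc_subset[OF i] maxid_coords(1)[OF i] by simp
  have "ev2p (py - cst V * px) (x - cnst U, y - cnst (U * V)) / ev2p (px + cst U) (x - cnst U, y - cnst (U * V)) =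
      y / x - cnst V"
    using x by (simp only: ev2_hom ev2_gens fst_conv snd_conv) (simp add: is_homD[OF is_hom_cnst] field_simps)
  moreover have "bcoeff (px + cst U) 0 0 \<noteq> 0" "bcoeff (py - cst V * px) 0 0 = 0" using U by (simp_all add: bcoeff_def)
  ultimately have "y / x - cnst V \<in> maxid (loc (x - cnst U, y - cnst (U * V)))"
    unfolding maxid_iff[OF j] by metis
  then show "loc (x - cnst U, y / x - cnst V) \<subseteq> loc (x - cnst U, y - cnst (U * V))"
    using loc_subset[OF j] maxid_coords(1)[OF j] by simp
qed

definition mult_at :: "nat \<Rightarrow> (nat \<Rightarrow> nat) \<Rightarrow> (nat \<Rightarrow> nat) \<Rightarrow> nat \<Rightarrow> nat \<Rightarrow> nat" where
  "mult_at m i j k l = (if l < length (mults m i j k) then nat (mults m i j k ! l) else 0)"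

lemma pad_mults_nth:
  assumes "l < r" shows "pad r (mults m i j k) ! l = int (mult_at m i j k l)"
proof (cases "l < length (mults m i j k)")
  case True
  have "\<forall>x\<in>set (mults m i j k). x \<ge> 0" by (auto simp: mults_def)
  then have "mults m i j k ! l \<ge> 0" using nth_mem[OF True] by blast
  then show ?thesis using True by (simp add: pad_def nth_append mult_at_def)
qed (use assms in \<open>simp add: pad_def nth_append mult_at_def\<close>)

lemma mult_at_1:
  "mult_at m i j 1 0 = m" "l < i 1 \<Longrightarrow> mult_at m i j 1 (Suc l) = 2"
  "i 1 \<le> l \<Longrightarrow> l < i 1 + j 1 \<Longrightarrow> mult_at m i j 1 (Suc l) = 1"
  by (simp_all add: mult_at_def mults_def nth_append)

lemma mult_at_other:
  assumes "k \<noteq> 1"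
  shows "l < i k \<Longrightarrow> mult_at m i j k l = 2" "i k \<le> l \<Longrightarrow> l < i k + j k \<Longrightarrow> mult_at m i j k l = 1"
  using assms by (simp_all add: mult_at_def mults_def nth_append)

theorem cluster_tuple_on_arc:
  fixes \<phi> :: "'a::field_char_0 poly" and v :: "nat \<Rightarrow> 'a" and i j r :: "nat \<Rightarrow> nat" and p :: "'a point" and m :: nat
  defines "M \<equiv> \<lambda>k. pad (r k) (mults m i j k)"
  assumes rho: "\<rho> \<ge> 1" and s: "s \<ge> 1" and p: "p \<in> plane" and rs: "r 1 \<ge> s"
    and len: "\<And>k. k \<in> {1..\<rho>} \<Longrightarrow> r k \<ge> 1 \<and> r k \<ge> length (mults m i j k)"
    and \<phi>: "has_ord \<phi> (max s 2 - 1)"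
    and v: "v 1 = 0" "inj_on v {1..\<rho>}" "\<And>k. k \<in> {2..\<rho>} \<Longrightarrow> poly \<phi> (v k) \<noteq> 0"
  shows "\<exists>K\<in>cluster_tuples p s \<rho> r. poly_coord_tuple \<rho> r K \<and>
    (\<forall>D N\<^sub>0 \<kappa>. determined m D \<phi> (\<Prod>k=1..\<rho>. [:- v k, 1:] ^ (2 * i k + j k)) (\<Prod>k=1..\<rho>. [:- v k, 1:] ^ i k)
        {N\<^sub>0..<N\<^sub>0 + \<kappa>} \<longrightarrow>
      rank_cond ((\<lambda>k. K k ! 0) ` {1..\<rho>}) (union_scheme {1..\<rho>} (\<lambda>k. cluster_scheme (K k) (M k))) (m + D) \<kappa>)"
proof -
  obtain t0 a b where t0: "t0 < 3" and pl: "p = loc (fst (aff t0) - cnst a, snd (aff t0) - cnst b)"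
    using p unfolding plane_def by blast
  define x where "x = fst (aff t0) - cnst a"
  define y where "y = snd (aff t0) - cnst b"
  have indxy: "indep x y" unfolding x_def y_def by (rule indep_translate[OF indep_aff])
  have x0: "x \<noteq> 0" using indep_coords_nonzero[OF indxy] by simp
  have induv: "indep x (y / x)" using indep_chart_next[OF indxy, of True 0] by (simp add: chart_next_def is_homD[OF is_hom_cnst])
  define U where "U k = poly \<phi> (v k)" for k
  have \<phi>0: "coeff \<phi> 0 = 0" using \<phi> s by (simp add: has_ord_def)
  have U1: "U 1 = 0" using v(1) \<phi>0 by (simp add: U_def poly_0_coeff_0)
  define XY where "XY k = (if k = 1 then (x, y) else (x - cnst (U k), y / x - cnst (v k)))" for k :: nat
  define A where "A k = (if k = 1 then px + cst a else px + cst (U k) + cst a)" for k :: nat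
  define B where "B k = (if k = 1 then py + cst b else (px + cst (U k)) * (py + cst (v k)) + cst b)" for k :: nat
  define e where "e k l \<longleftrightarrow> k = 1 \<and> l = 0" for k l :: nat
  \<comment> \<open>For the first cluster the exceptional blow-up in direction 0 takes up one
    parameter, so the coefficients of \<open>\<phi>\<close> start with
    \<open>coeff \<phi> 0 = 0\<close> at index 2. The other clusters start on the arc, and the
    Taylor coefficients at \<open>v k\<close> start with the linear one.\<close>
  define c where "c k l = (if k = 1 then coeff \<phi> (l - 2) else coeff (pcompose \<phi> [:v k, 1:]) (l - 1))" for k l :: nat
  define K where "K = (\<lambda>k\<in>{1..\<rho>}. gen_cluster (r k) (XY k) (e k) (c k))"
  have e1: "e 1 = (\<lambda>i. i = 0)" and ek: "k \<noteq> 1 \<Longrightarrow> e k = (\<lambda>_. False)" for k by (auto simp: e_def fun_eq_iff)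
  have ind: "indep2 (XY k)" for k using indxy indep_translate[OF induv] by (simp add: XY_def)
  have origin: "loc (XY k) = loc (x - cnst (U k), y - cnst (U k * v k))" if "k \<in> {1..\<rho>}" for k
  proof (cases "k = 1")
    case True
    then show ?thesis using U1 by (simp add: XY_def is_homD[OF is_hom_cnst])
  next
    case False
    then show ?thesis using loc_blow_translate[OF indxy v(3)[of k], of "v k"] that by (simp add: XY_def U_def)
  qed
  have plane: "loc (XY k) \<in> plane" if "k \<in> {1..\<rho>}" for k
  proof -
    have "loc (XY k) = loc (fst (aff t0) - cnst (a + U k), snd (aff t0) - cnst (b + U k * v k))"
      unfolding origin[OF that] by (simp add: x_def y_def is_homD[OF is_hom_cnst] diff_diff_eq)
    then show ?thesis using t0 unfolding plane_def by blast
  qed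
  have Kk: "K k = gen_cluster (r k) (XY k) (e k) (c k)" if "k \<in> {1..\<rho>}" for k using that by (simp add: K_def)
  have K0: "K k ! 0 = loc (XY k)" if "k \<in> {1..\<rho>}" for k
    using len[OF that] unfolding Kk[OF that] by (simp add: gen_cluster_def)
  have coords: "coords_at t0 (A k) (B k) (XY k)" if "k \<in> {1..\<rho>}" for k
  proof -
    have "fst (aff t0) = ev2p (A k) (XY k)" "snd (aff t0) = ev2p (B k) (XY k)"
      unfolding A_def B_def XY_def using x0
      by (simp_all only: ev2_hom ev2_gens fst_conv snd_conv split: if_split) (simp_all add: x_def y_def)
    then show ?thesis using t0 ind by (simp add: coords_at_def prod_eq_iff)
  qed
  have Kt: "K \<in> cluster_tuples p s \<rho> r"
    unfolding cluster_tuples_def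
  proof (intro CollectI conjI ballI)
    show "K \<in> (\<Pi>\<^sub>E k\<in>{1..\<rho>}. clusters (r k))"
      unfolding K_def by (rule restrict_PiE_iff[THEN iffD2]) (use len plane in \<open>auto intro!: gen_cluster_in_clusters\<close>)
    have one: "1 \<in> {1..\<rho>}" using rho by simp
    have K1: "K 1 = gen_cluster (r 1) (XY 1) (\<lambda>i. i = 0) (c 1)" unfolding Kk[OF one] e1 ..
    have p1: "p = loc (XY 1)" by (simp add: XY_def pl x_def y_def)
    show "K 1 \<in> U_clusters p (r 1) s" unfolding K1 p1
    proof (rule gen_cluster_in_U_clusters[OF ind _ rs plane[OF one] s])
      show "r 1 \<ge> 1" using len[OF one] by simp
      show "c 1 (l + 2) = 0" if "l < max s 2 - 1" for l using \<phi> that by (simp add: c_def has_ord_def)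
      show "c 1 (max s 2 - 1 + 2) \<noteq> 0" using \<phi> by (simp add: c_def has_ord_def)
    qed
    show "satellite_free (K k)" if "k \<in> {2..\<rho>}" for k
      using satellite_free_gen_cluster[OF ind[of k]] that Kk[of k] by (simp add: ek)
    show "inj_on (\<lambda>k. K k ! 0) {1..\<rho>}"
    proof (rule inj_onI)
      fix k k' assume k: "k \<in> {1..\<rho>}" "k' \<in> {1..\<rho>}" and eq: "K k ! 0 = K k' ! 0"
      have UV: "U k = U k'" "U k * v k = U k' * v k'"
        using loc_translate_inj[OF indxy eq[unfolded K0[OF k(1)] K0[OF k(2)] origin[OF k(1)] origin[OF k(2)]]] by auto
      have "U k \<noteq> 0" if "k \<in> {1..\<rho>}" "k \<noteq> 1" for k using v(3)[of k] that by (simp add: U_def)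
      then consider "k = 1" "k' = 1" | "U k \<noteq> 0" using UV(1) U1 k by metis
      then show "k = k'"
      proof cases
        case 2
        then have "v k = v k'" using UV by (metis mult_left_cancel)
        then show ?thesis using inj_onD[OF v(2)] k by blast
      qed simp
    qed
  qed
  have pc: "poly_coord_tuple \<rho> r K"
    unfolding poly_coord_tuple_def
    by (rule exI[of _ "\<lambda>_. t0"], rule exI[of _ A], rule exI[of _ B], rule exI[of _ XY], rule exI[of _ e], rule exI[of _ c])
      (intro ballI conjI coords Kk)
  define \<mu> where "\<mu> = mult_at m i j"
  interpret cluster_data \<rho> r "\<lambda>_. t0" A B XY e c \<mu> M K
    by (rule cluster_dataI[OF rho _ Kt]) (use len coords Kk in \<open>auto simp: M_def \<mu>_def pad_mults_nth\<close>)
  have "rank_condition (m + D) \<kappa>"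
    if det: "determined m D \<phi> (\<Prod>k=1..\<rho>. [:- v k, 1:] ^ (2 * i k + j k)) (\<Prod>k=1..\<rho>. [:- v k, 1:] ^ i k)
        {N\<^sub>0..<N\<^sub>0 + \<kappa>}" for D N\<^sub>0 \<kappa>
    unfolding rank_cond_def
  proof (intro exI allI impI)
    \<comment> \<open>The auxiliary linear forms are the coefficients of
      \<open>v^(N\<^sub>0 + q)\<close> in the restriction of \<open>f / u^m\<close> to the
      arc.\<close>
    let ?l = "\<lambda>q z. coeff (pev (virt True 0 m (bsub (fmon t0 (m + D) z) (px + cst a) (py + cst b))) \<phi> [:0, 1:]) (N\<^sub>0 + q)"
    fix f assume f: "(\<forall>q\<in>(\<lambda>k. K k ! 0) ` {1..\<rho>}. gsec (m + D) f \<in> kernel_at (int (m + D)) Z q) \<and>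
      (\<forall>q<\<kappa>. (\<Sum>z\<in>tri (m + D). ?l q z * f z) = 0)"
    define L where "L = loc_poly 1 (m + D) f"
    have L: "L = bsub (form t0 (m + D) f) (px + cst a) (py + cst b)" by (simp add: L_def loc_poly_def A_def B_def)
    have pass: "passes_at k (loc_poly k (m + D) f)" if "k \<in> {1..\<rho>}" for k
      using f gsec_kernel_iff[OF that] that by blast
    have "L = 0"
    proof (rule arc_determines[where i = i and j = j and r = r and \<mu> = \<mu> and c = c, OF _ rho det v \<phi>0])
      show "total_degree_le (m + D) L"
        unfolding L by (rule total_degree_le_bsub_form) (rule total_degree_le_coord_shift)+
      have "length (mults m i j 1) = Suc (i 1 + j 1)" by (simp add: mults_def)
      with len[of 1] rho show "Suc (i 1 + j 1) \<le> r 1" by simp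
      show "i k + j k \<le> r k" if "k \<in> {2..\<rho>}" for k using len[of k] that by (simp add: mults_def)
      show "c 1 2 = 0" using \<phi>0 by (simp add: c_def)
      show "c 1 (l + 3) = coeff \<phi> (Suc l)" for l by (simp add: c_def numeral_3_eq_3 numeral_2_eq_2)
      show "c k (l + 2) = coeff (pcompose \<phi> [:v k, 1:]) (Suc l)" if "k \<in> {2..\<rho>}" for k l
        using that by (simp add: c_def)
      show "\<mu> 1 0 = m" "\<And>l. l < i 1 \<Longrightarrow> \<mu> 1 (Suc l) = 2"
        "\<And>l. i 1 \<le> l \<Longrightarrow> l < i 1 + j 1 \<Longrightarrow> \<mu> 1 (Suc l) = 1" unfolding \<mu>_def by (fact mult_at_1)+
      show "\<mu> k l = 2" if "k \<in> {2..\<rho>}" "l < i k" for k l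
        unfolding \<mu>_def by (rule mult_at_other) (use that in auto)
      show "\<mu> k l = 1" if "k \<in> {2..\<rho>}" "i k \<le> l" "l < i k + j k" for k l
        unfolding \<mu>_def by (rule mult_at_other) (use that in auto)
      show "passes (r 1) (\<lambda>i. i = 0) (c 1) (\<mu> 1) L" using pass[of 1] rho unfolding L_def e1 by simp
      show "passes (r k) (\<lambda>_. False) (c k) (\<mu> k)
          (bsub L (px + cst (poly \<phi> (v k))) ((px + cst (poly \<phi> (v k))) * (py + cst (v k))))" if k: "k \<in> {2..\<rho>}" for k
      proof -
        have "loc_poly k (m + D) f = bsub L (px + cst (U k)) ((px + cst (U k)) * (py + cst (v k)))"
          unfolding L loc_poly_def using k by (simp only: bsub_bsub is_homD[OF is_hom_bsub] bsub_gens) (simp add: A_def B_def)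
        then show ?thesis using pass[of k] k ek[of k] by (simp add: U_def)
      qed
      show "coeff (pev (virt True 0 m L) \<phi> [:0, 1:]) n = 0" if n: "n \<in> {N\<^sub>0..<N\<^sub>0 + \<kappa>}" for n
      proof -
        have virt: "virt True 0 m F = vstage (\<lambda>_. True) (\<lambda>_. 0) (\<lambda>_. m) F (Suc 0)" for F :: "'a poly poly" by simp
        have "virt True 0 m L =
            (\<Sum>z\<in>tri (m + D). cst (f z) * virt True 0 m (bsub (fmon t0 (m + D) z) (px + cst a) (py + cst b)))"
          unfolding L form_def is_homD[OF is_hom_bsub] bsub_gens virt vstage_sum vstage_cst_mult ..
        then have "coeff (pev (virt True 0 m L) \<phi> [:0, 1:]) n = (\<Sum>z\<in>tri (m + D). ?l (n - N\<^sub>0) z * f z)"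
          using n by (simp only: pev_hom pev_gens coeff_sum) (simp add: mult.commute)
        also have "\<dots> = 0" by (rule conjunct2[OF f, rule_format]) (use n in auto)
        finally show ?thesis .
      qed
    qed
    then have "gsec (m + D) f / hcoord t0 powi int (m + D) = 0"
      using gsec_loc[of 1 "m + D" f] rho by (simp add: L_def ev2_hom)
    then have "gsec (m + D) f = 0" by simp
    then show "\<forall>z\<in>tri (m + D). f z = 0" by (simp add: gsec_eq_0_iff)
  qed
  then show ?thesis using Kt pc unfolding Z_def by blast
qed

section \<open>Maximal rank\<close>

lemma sum_mult_at:
  fixes f :: "nat \<Rightarrow> nat"
  assumes "f 0 = 0" "length (mults m i j k) \<le> r"
  shows "(\<Sum>l<r. f (mult_at m i j k l)) = (if k = 1 then f m else 0) + f 2 * i k + f 1 * j k"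
proof -
  let ?xs = "mults m i j k"
  have "(\<Sum>l<r. f (mult_at m i j k l)) = (\<Sum>l<length ?xs. f (mult_at m i j k l))"
    by (rule sum.mono_neutral_right) (use assms in \<open>auto simp: mult_at_def\<close>)
  also have "\<dots> = (\<Sum>l<length ?xs. map (\<lambda>x. f (nat x)) ?xs ! l)"
    by (rule sum.cong) (auto simp: mult_at_def)
  also have "\<dots> = sum_list (map (\<lambda>x. f (nat x)) ?xs)"
    by (simp add: sum_list_sum_nth atLeast0LessThan)
  also have "\<dots> = (if k = 1 then f m else 0) + f 2 * i k + f 1 * j k"
    by (simp add: mults_def sum_list_replicate mult.commute)
  finally show ?thesis .
qed

lemma sum_sum_mult_at:
  fixes f :: "nat \<Rightarrow> nat" and r :: "nat \<Rightarrow> nat"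
  assumes "f 0 = 0" "\<And>k. k \<in> {1..\<rho>} \<Longrightarrow> length (mults m i j k) \<le> r k" "\<rho> \<ge> 1"
  shows "(\<Sum>k=1..\<rho>. \<Sum>l<r k. f (mult_at m i j k l)) = f m + f 2 * (\<Sum>k=1..\<rho>. i k) + f 1 * (\<Sum>k=1..\<rho>. j k)"
proof -
  have "(\<Sum>k=1..\<rho>. \<Sum>l<r k. f (mult_at m i j k l)) =
      (\<Sum>k=1..\<rho>. (if k = 1 then f m else 0) + f 2 * i k + f 1 * j k)"
    by (rule sum.cong[OF refl], rule sum_mult_at) (use assms in auto)
  also have "\<dots> = (\<Sum>k=1..\<rho>. if k = 1 then f m else 0) + f 2 * (\<Sum>k=1..\<rho>. i k) + f 1 * (\<Sum>k=1..\<rho>. j k)"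
    by (simp only: sum.distrib sum_distrib_left)
  also have "(\<Sum>k=1..\<rho>. if k = 1 then f m else 0) = f m" using assms(3) by simp
  finally show ?thesis .
qed

text \<open>An \<open>m\<close>-fold point imposes \<open>m (m + 1) / 2\<close> conditions on the
  forms of degree \<open>m + D\<close>; the rest is \<open>bidim m D\<close>.\<close>

lemma card_tri_bidim: "2 * card (tri (m + D)) = m * (m + 1) + 2 * bidim m D"
proof -
  have "2 * bidim m D = (D + 1) * (2 * m + D + 2)"
    by (induction D) (simp_all add: bidim_def)
  then show ?thesis unfolding card_tri by (simp add: algebra_simps)
qed

text \<open>Turns \<open>\<kappa>\<close> additional orders of vanishing into
  \<open>\<kappa>\<close> separate linear conditions, the shape in which \<open>rank_cond\<close>
  admits them.\<close>

lemma determined_det0: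
  assumes "det0 m D \<phi> (a + \<kappa>) b" shows "determined m D \<phi> (monom 1 a) (monom 1 b) {a..<a + \<kappa>}"
  unfolding determined_def
proof (intro allI impI)
  fix g e assume g: "(\<forall>e\<le>D. degree (g e) \<le> m + e) \<and> monom 1 a dvd arc_val D \<phi> g \<and>
    monom 1 b dvd arc_deriv D \<phi> g \<and> (\<forall>n\<in>{a..<a + \<kappa>}. coeff (arc_val D \<phi> g) n = 0)" and e: "e \<le> D"
  have "monom 1 (a + \<kappa>) dvd arc_val D \<phi> g"
    unfolding monom_1_dvd_iff'
  proof (intro allI impI)
    fix n assume "n < a + \<kappa>"
    then show "coeff (arc_val D \<phi> g) n = 0"
      using g[THEN conjunct2, THEN conjunct1, unfolded monom_1_dvd_iff'] g[THEN conjunct2, THEN conjunct2, THEN conjunct2]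
      by (cases "n < a") auto
  qed
  then show "g e = 0"
    using assms[unfolded determined_def, THEN spec, of g] g e by blast
qed

text \<open>
  In the exceptional cases all the multiplicities are even, and by a dimension count there is a curve
  of degree \<open>(m + 2)/2\<close> with half the multiplicities. Counted twice, it is an unexpected curve.
\<close>

lemma even_mult_at:
  assumes "even m" "\<And>k. k \<in> {1..\<rho>} \<Longrightarrow> j k = 0" "k \<in> {1..\<rho>}"
  shows "mult_at m i j k = (\<lambda>l. 2 * (mult_at m i j k l div 2))"
proof
  fix l
  have "even x \<and> x \<ge> 0" if "x \<in> set (mults m i j k)" for x
    using that assms by (auto simp: mults_def split: if_splits)
  then have "even (nat (mults m i j k ! l))" if "l < length (mults m i j k)"
    using \<open>\<And>x. x \<in> set (mults m i j k) \<Longrightarrow> even x \<and> x \<ge> 0\<close>[OF nth_mem[OF that]] by (simp add: even_nat_iff)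
  then have "even (mult_at m i j k l)" by (simp add: mult_at_def)
  then show "mult_at m i j k l = 2 * (mult_at m i j k l div 2)" by simp
qed

theorem theorem4p8:
  fixes \<rho> s m :: nat and i j r :: "nat \<Rightarrow> nat"
    and p :: "'a::{alg_closed_field, field_char_0} point"
  assumes "\<rho> \<ge> 1" and "s \<ge> 1"
    and "p \<in> plane"
    and "m \<ge> min (s + (\<Sum>k=1..\<rho>. i k)) (2 * s)"
    and "r 1 \<ge> s"
    and "\<And>k. k \<in> {1..\<rho>} \<Longrightarrow> r k \<ge> 1 \<and> r k \<ge> length (mults m i j k)"
    and "3 * (\<Sum>k=1..\<rho>. i k) + (\<Sum>k=1..\<rho>. j k) \<ge> 2 * m + 3"
    and "4 * int (\<Sum>k=1..\<rho>. j k) \<ge> int m ^ 2 - 4 * int m - 6"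
  shows "\<exists>W. zariski_open_in \<rho> r (cluster_tuples p s \<rho> r) W \<and> W \<noteq> {} \<and>
    (\<forall>K\<in>W. max_rank (union_scheme {1..\<rho>} (\<lambda>k. cluster_scheme (K k) (pad (r k) (mults m i j k))))
       \<longleftrightarrow> \<not> (m = 2 \<and> (\<Sum>k=1..\<rho>. i k) = 4 \<and> (\<forall>k\<in>{1..\<rho>}. j k = 0)) \<and>
           \<not> (m = 4 \<and> (\<Sum>k=1..\<rho>. i k) = 6 \<and> (\<forall>k\<in>{1..\<rho>}. j k = 0)))"
proof -
  define I where "I = (\<Sum>k=1..\<rho>. i k)"
  define J where "J = (\<Sum>k=1..\<rho>. j k)"
  define M where "M k = pad (r k) (mults m i j k)" for k
  define \<mu> where "\<mu> = mult_at m i j"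
  define rk where "rk K n \<kappa> = rank_cond ((\<lambda>k. K k ! 0) ` {1..\<rho>})
    (union_scheme {1..\<rho>} (\<lambda>k. cluster_scheme (K k) (M k))) n \<kappa>" for K :: "nat \<Rightarrow> 'a point list" and n \<kappa> :: nat
  define W where "W n \<kappa> n' \<kappa>' = {K \<in> cluster_tuples p s \<rho> r. poly_coord_tuple \<rho> r K \<and> rk K n \<kappa> \<and> rk K n' \<kappa>'}" for n \<kappa> n' \<kappa>'
  note rho = assms(1) and s = assms(2) and pl = assms(3) and rs = assms(5) and len = assms(6)
  note m = assms(4)[folded I_def] and N = assms(7)[folded I_def J_def] and J = assms(8)[folded J_def]
  have Mnth: "M k ! l = int (\<mu> k l)" if "l < r k" for k l
    unfolding M_def \<mu>_def by (rule pad_mults_nth[OF that])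
  have open_W: "zariski_open_in \<rho> r (cluster_tuples p s \<rho> r) (W n \<kappa> n' \<kappa>')" for n \<kappa> n' \<kappa>'
    unfolding W_def rk_def by (rule zariski_open_rank[OF rho]) (use len Mnth in auto)
  have nonempty: "W (m + D1) \<kappa>1 (m + D2) \<kappa>2 \<noteq> {}"
    if ord: "has_ord \<phi>1 (max s 2 - 1)" "has_ord \<phi>2 (max s 2 - 1)"
      and det: "determined m D1 \<phi>1 (monom 1 (2 * I + J)) (monom 1 I) {N1..<N1 + \<kappa>1}"
        "determined m D2 \<phi>2 (monom 1 (2 * I + J)) (monom 1 I) {N2..<N2 + \<kappa>2}"
    for \<phi>1 \<phi>2 :: "'a poly" and D1 D2 \<kappa>1 \<kappa>2 N1 N2
  proof -
    from arc_family[OF ord det[unfolded I_def J_def]] obtain \<phi> :: "'a poly" and v where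
      v: "has_ord \<phi> (max s 2 - 1)" "v 1 = 0" "inj_on v {1..\<rho>}" "\<forall>k\<in>{2..\<rho>}. poly \<phi> (v k) \<noteq> 0"
      and d: "\<forall>(D, N)\<in>{(D1, {N1..<N1 + \<kappa>1}), (D2, {N2..<N2 + \<kappa>2})}.
        determined m D \<phi> (\<Prod>k=1..\<rho>. [:- v k, 1:] ^ (2 * i k + j k)) (\<Prod>k=1..\<rho>. [:- v k, 1:] ^ i k) N"
      by blast
    from cluster_tuple_on_arc[OF rho s pl rs len v(1,2,3) v(4)[rule_format]] obtain K where
      K: "K \<in> cluster_tuples p s \<rho> r" "poly_coord_tuple \<rho> r K" and
      det: "\<And>D N \<kappa>. determined m D \<phi> (\<Prod>k=1..\<rho>. [:- v k, 1:] ^ (2 * i k + j k)) (\<Prod>k=1..\<rho>. [:- v k, 1:] ^ i k)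
        {N..<N + \<kappa>} \<Longrightarrow> rk K (m + D) \<kappa>" unfolding rk_def M_def by blast
    from d have "rk K (m + D1) \<kappa>1" "rk K (m + D2) \<kappa>2" by (auto intro!: det)
    then show ?thesis using K unfolding W_def by blast
  qed
  have card: "2 * card (cluster_conds \<rho> r \<mu>) = m * (m + 1) + 2 * (3 * I + J)" if "cluster_data \<rho> r t A B XY e c \<mu> M K"
    for t A B XY e c and K :: "nat \<Rightarrow> 'a point list"
  proof -
    interpret cluster_data \<rho> r t A B XY e c \<mu> M K by fact
    have "2 * card conds = m * (m + 1) + 2 * (2 + 1) * I + 1 * (1 + 1) * J"
      unfolding card_conds unfolding \<mu>_def I_def J_def
      by (rule sum_sum_mult_at[of "\<lambda>x. x * (x + 1)"]) (use len rho in auto)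
    then show ?thesis by simp
  qed
  \<comment> \<open>The exception as it arises in the arc construction; the quadratic bound with
    \<open>J = 0\<close> then leaves \<open>m = 2\<close> and \<open>m = 4\<close>.\<close>
  define ex where "ex \<longleftrightarrow> even m \<and> I = m + 2 \<and> J = 0"
  have "m \<ge> 1" using m s by auto
  have ex: "ex \<longleftrightarrow> (m = 2 \<and> I = 4 \<and> (\<forall>k\<in>{1..\<rho>}. j k = 0)) \<or> (m = 4 \<and> I = 6 \<and> (\<forall>k\<in>{1..\<rho>}. j k = 0))"
  proof -
    have J0: "J = 0 \<longleftrightarrow> (\<forall>k\<in>{1..\<rho>}. j k = 0)" by (simp add: J_def)
    have "m = 2 \<or> m = 4" if "even m" "J = 0"
    proof -
      have "int m * (int m - 4) \<le> 6" using J that(2) by (simp add: power2_eq_square algebra_simps)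
      moreover have "6 * 2 \<le> int m * (int m - 4)" if "m \<ge> 6" by (rule mult_mono) (use that in auto)
      ultimately have "m < 6" by linarith
      then show ?thesis using \<open>m \<ge> 1\<close> \<open>even m\<close> by (auto elim!: evenE)
    qed
    then show ?thesis unfolding ex_def J0[symmetric] by auto
  qed
  have arcs: "\<exists>\<phi>::'a poly. has_ord \<phi> (max s 2 - 1) \<and>
      determined m (Suc D) \<phi> (monom 1 (2 * I + J)) (monom 1 I) {2 * I + J..<2 * I + J + (bidim m (Suc D) - (3 * I + J))}"
    if "\<not> (D = 1 \<and> ex)" "D \<ge> 1" "3 * I + J \<le> bidim m (Suc D)" for D
  proof -
    have "2 * I + (bidim m (Suc D) - 3 * I) = 2 * I + J + (bidim m (Suc D) - (3 * I + J))" using that(3) by simp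
    then show ?thesis using arc_surj[OF s m N J that(1)[unfolded ex_def] that(2,3), where ?'a = 'a] determined_det0 by metis
  qed
  show ?thesis
  proof (cases ex)
    case False
    have "\<exists>D\<ge>2. 3 * I + J \<le> bidim m D"
    proof (intro exI conjI)
      show "3 * I + J \<le> bidim m (3 * I + J + 2)" using card_tri_bidim[of m "3 * I + J + 2"] unfolding card_tri by (simp add: algebra_simps)
    qed simp
    \<comment> \<open>\<open>m + D1\<close> is the first degree, from \<open>m + 2\<close> on, with
      at least as many forms as conditions: surjectivity starts there, injectivity ends one degree
      below.\<close>
    then obtain D1 where "D1 \<ge> 2 \<and> 3 * I + J \<le> bidim m D1" and least: "\<And>D. D < D1 \<Longrightarrow> \<not> (D \<ge> 2 \<and> 3 * I + J \<le> bidim m D)"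
      using exists_least_iff[of "\<lambda>D. D \<ge> 2 \<and> 3 * I + J \<le> bidim m D"] by blast
    then obtain D where D: "D1 = Suc (Suc D)" "3 * I + J \<le> bidim m (Suc (Suc D))"
      by (metis add_2_eq_Suc le_Suc_ex)
    \<comment> \<open>For \<open>D = 0\<close> minimality says nothing, and
      \<open>3I + J \<ge> 2m + 3 = bidim m 1\<close> is used instead.\<close>
    have inj: "bidim m (Suc D) \<le> 3 * I + J"
    proof (cases D)
      case 0
      then show ?thesis using N by (simp add: bidim_def)
    next
      case (Suc D')
      then show ?thesis using least[of "Suc D"] D(1) by simp
    qed
    define \<kappa> where "\<kappa> = bidim m (Suc (Suc D)) - (3 * I + J)"
    obtain \<phi>1 :: "'a poly" where 1: "has_ord \<phi>1 (max s 2 - 1)" "det0 m (Suc D) \<phi>1 (2 * I + J) I"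
      using arc_inj[OF s m N J _ inj] False unfolding ex_def by blast
    obtain \<phi>2 :: "'a poly" where 2: "has_ord \<phi>2 (max s 2 - 1)"
      "determined m (Suc (Suc D)) \<phi>2 (monom 1 (2 * I + J)) (monom 1 I) {2 * I + J..<2 * I + J + \<kappa>}"
      using arcs[of "Suc D"] False D(2) unfolding \<kappa>_def by auto
    have "max_rank (union_scheme {1..\<rho>} (\<lambda>k. cluster_scheme (K k) (M k)))"
      if KW: "K \<in> W (m + Suc D) 0 (m + Suc (Suc D)) \<kappa>" for K
    proof -
      from KW obtain t A B XY e c where coords: "\<And>k. k \<in> {1..\<rho>} \<Longrightarrow>
        coords_at (t k) (A k) (B k) (XY k) \<and> K k = gen_cluster (r k) (XY k) (e k) (c k)"
        unfolding W_def poly_coord_tuple_def by blast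
      have data: "cluster_data \<rho> r t A B XY e c \<mu> M K"
        by (rule cluster_dataI[OF rho]) (use len Mnth coords KW in \<open>auto simp: W_def\<close>)
      then interpret cluster_data \<rho> r t A B XY e c \<mu> M K .
      have "\<kappa> + card conds \<le> card (tri (Suc (m + Suc D)))"
        using card[OF data] card_tri_bidim[of m "Suc (Suc D)"] D(2) by (simp add: \<kappa>_def)
      moreover have "rank_condition (m + Suc D) 0" "rank_condition (Suc (m + Suc D)) \<kappa>"
        using KW unfolding W_def rk_def Z_def by simp_all
      ultimately show ?thesis using max_rank_if unfolding Z_def by blast
    qed
    moreover have "W (m + Suc D) 0 (m + Suc (Suc D)) \<kappa> \<noteq> {}"
      by (rule nonempty[OF 1(1) 2(1) _ 2(2), where ?N1.0 = 0]) (use 1(2) in simp)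
    ultimately show ?thesis using open_W False unfolding ex unfolding M_def I_def by blast
  next
    case True
    then have ev: "even m" and IJ: "I = m + 2" "J = 0" by (auto simp: ex_def)
    have b: "bidim m 3 = 4 * m + 10" "bidim m 2 = 3 * m + 6" 
      using card_tri_bidim[of m 3] card_tri_bidim[of m 2] unfolding card_tri by (simp_all add: algebra_simps)
    have Suc2: "Suc 2 = (3::nat)" by simp
    \<comment> \<open>The expected dimension in degree \<open>m + 3\<close>. There the rank is as
      expected even in the exceptional cases, which proves the conditions independent.\<close>
    define \<kappa> where "\<kappa> = m + 4"
    have "\<kappa> = bidim m 3 - (3 * I + J)" by (simp add: b IJ \<kappa>_def)
    then obtain \<phi> :: "'a poly" where \<phi>: "has_ord \<phi> (max s 2 - 1)"
      "determined m 3 \<phi> (monom 1 (2 * I + J)) (monom 1 I) {2 * I + J..<2 * I + J + \<kappa>}"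
      using arcs[of 2, unfolded Suc2] b IJ by auto
    have "\<not> max_rank (union_scheme {1..\<rho>} (\<lambda>k. cluster_scheme (K k) (M k)))"
      if KW: "K \<in> W (m + 3) \<kappa> (m + 3) \<kappa>" for K
    proof -
      from KW obtain t A B XY e c where coords: "\<And>k. k \<in> {1..\<rho>} \<Longrightarrow>
        coords_at (t k) (A k) (B k) (XY k) \<and> K k = gen_cluster (r k) (XY k) (e k) (c k)"
        unfolding W_def poly_coord_tuple_def by blast
      define \<nu> where "\<nu> k l = \<mu> k l div 2" for k l
      have data: "cluster_data \<rho> r t A B XY e c \<mu> M K"
        by (rule cluster_dataI[OF rho]) (use len Mnth coords KW in \<open>auto simp: W_def\<close>)
      \<comment> \<open>The same clusters and coordinates with half the multiplicities.\<close>
      interpret half: cluster_data \<rho> r t A B XY e c \<nu> "\<lambda>k. map (\<lambda>l. int (\<nu> k l)) [0..<r k]" K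
        by (rule cluster_dataI[OF rho]) (use len coords KW in \<open>auto simp: W_def\<close>)
      interpret cluster_data \<rho> r t A B XY e c \<mu> M K by (rule data)
      obtain h where h: "m = 2 * h" using ev by (elim evenE)
      have "2 * card half.conds = h * (h + 1) + 2 * I"
      proof -
        have "2 * card half.conds = m div 2 * (m div 2 + 1) + 2 div 2 * (2 div 2 + 1) * I + 1 div 2 * (1 div 2 + 1) * J"
          unfolding half.card_conds unfolding \<nu>_def \<mu>_def I_def J_def
          by (rule sum_sum_mult_at[of "\<lambda>x. x div 2 * (x div 2 + 1)"]) (use len rho in auto)
        then show ?thesis by (simp add: h)
      qed
      moreover have "h = 1 \<or> h = 2" using True h unfolding ex by auto
      \<comment> \<open>There is one form more than conditions:
        \<open>h (h + 1) / 2 + 2h + 2\<close> against \<open>(h + 2) (h + 3) / 2\<close>.\<close>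
      ultimately have "card half.conds < card (tri (h + 1))"
        using card_tri[of "h + 1"] IJ h by auto
      from half.nonzero_form_exists[OF this] obtain a where
        a: "\<exists>z\<in>tri (h + 1). a z \<noteq> 0" "\<And>k. k \<in> {1..\<rho>} \<Longrightarrow> half.passes_at k (loc_poly k (h + 1) a)" by blast
      have "\<mu> k = (\<lambda>l. 2 * \<nu> k l)" if "k \<in> {1..\<rho>}" for k
        unfolding \<nu>_def \<mu>_def by (rule even_mult_at[OF ev _ that]) (use IJ(2) in \<open>auto simp: J_def\<close>)
      from square_of_section[OF a(2,1) this] obtain a' where
        a': "\<exists>z\<in>tri (2 * (h + 1)). a' z \<noteq> 0" "\<And>k. k \<in> {1..\<rho>} \<Longrightarrow> passes_at k (loc_poly k (2 * (h + 1)) a')" by blast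
      have "rank_condition (m + 3) \<kappa>" using KW unfolding W_def rk_def Z_def by simp
      \<comment> \<open>In degree \<open>m + 2\<close> the numbers of conditions and of forms agree,
        so a nonzero form through \<open>Z\<close> excludes both injectivity and
        surjectivity.\<close>
      moreover have "\<kappa> + card conds \<le> card (tri (m + 3))" "card (tri (2 * (h + 1))) \<le> card conds"
        using card[OF data] card_tri_bidim[of m 3] card_tri_bidim[of m 2] h unfolding b by (simp_all add: IJ \<kappa>_def)
      ultimately have "\<not> max_rank_in_degree (int (2 * (h + 1))) Z"
        using not_max_rank_in_degree[OF _ _ _ a'] by blast
      then show ?thesis unfolding max_rank_def Z_def by blast
    qed
    moreover have "W (m + 3) \<kappa> (m + 3) \<kappa> \<noteq> {}"
      by (rule nonempty[OF \<phi>(1) \<phi>(1) \<phi>(2) \<phi>(2)])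
    ultimately show ?thesis using open_W True unfolding ex unfolding M_def I_def by blast
  qed
qed

end
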